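(* Let $(P,M,T)$ be any $(m+2)$-angulation of a surface $P$ with non-empty boundary ($m\ge1$), and let $\Lambda=kQ_T/I_T$ be the corresponding algebra. Let $(\tilde P,\tilde M,\tilde T)$ be the $(m+2)$-angulation obtained from $(P,M,T)$ by removing all boundary bridges (equal to $(P,M,T)$ if $(P,M,T)$ is non-degenerate). Then the AG-invariant of $\Lambda$ is $$\mathrm{AG}(\Lambda)=t\,(0,m+2)^*+\sum_i (a_i,b_i)^*,$$ where $t$ is the number of internal $(m+2)$-gons in $(P,M,T)$, $i$ indexes the boundary components of $\tilde P$, and $$a_i=\#\tilde M_T^i,\qquad b_i=\sum_{\mathfrak b\in\tilde{\mathfrak B}_i}\bigl(m-w(\mathfrak b)\bigr).$$
   Context: $k$ is an algebraically closed field. Paths are composed left to right: $\alpha\beta$ means first $\alpha$, then $\beta$, with $t(\alpha)=s(\beta)$. **$(m+2)$-angulations of surfaces.** $P$ is an unpunctured Riemann surface with non-empty boundary, with any number of boundary components; $M$ is a set of points in the boundary with at least one point in each component; $T$ is a collection of arcs contained in the interior of $P$ with endpoints in $M$. $(P,M,T)$ is an $(m+2)$-angulation if $T$ subdivides the interior of $P$ into $(m+2)$-gons. An $(m+2)$-gon is internal if all its sides belong to $T$. **Quiver.** The vertices of $Q_T$ are the elements of $T$. There is an arrow $x\to y$ for each $(m+2)$-gon $\triangle$ and each corner of $\triangle$ at which two sides $\tau_x,\tau_y\in T$ of $\triangle$ meet, with $\tau_y$ following $\tau_x$ in the counter-clockwise walk around the boundary of $\triangle$. The ideal $I_T$ is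 generated by the paths $\alpha\beta$ of length 2 such that $\alpha,\beta$ come from two neighbouring corners of the same $(m+2)$-gon. **Boundary data.** $M_T$ is the set of $p\in M$ incident to $T$. $\mathfrak B$ is the set of pieces $\mathfrak b$ of the boundary demarcated by $M_T$: the endpoints of $\mathfrak b$ are in $M_T$ and $\mathfrak b$ contains no other points of $M_T$. $w(\mathfrak b)=\#((M\cap\mathfrak b)\setminus M_T)$. $(P,M,T)$ is non-degenerate if each $(m+2)$-gon contains at most one element of $\mathfrak B$, and degenerate otherwise. For $(a,b)\in\mathbb N^2$, $(a,b)^*\colon\mathbb N^2\to\mathbb N$ has value $1$ at $(a,b)$ and $0$ elsewhere. **Boundary bridges** (this construction is made for $m>1$). Let $\triangle$ be an $(m+2)$-gon bounded by $\mathfrak b_1,\dots,\mathfrak b_s\in\mathfrak B$ with $s>1$, and let $\mathfrak t_1,\dots,\mathfrak t_r$ be the boundary segments of $\triangle$ composed of arcs of $T$, each $\mathfrak t_i$ being incident at its two ends to elements of $\mathfrak B$ bounding $\triangle$. For each $i$, let $\delta_i',\delta_i''$ be curves on these two elements of $\mathfrak B$ starting at the endpoints of $\mathfrak t_i$, with other endpoints $v_i',v_i''\notin M$, short enough that no point of $M$ other than the endpoints of $\mathfrak t_i$ lies on them. Let $\mathfrak t_i'$ be the arc (up to homotopy) in the interior of $P$, inside $\triangle$, connecting $v_i'$ and $v_i''$; then $\mathfrak t_i,\delta_i',\delta_i'',\mathfrak t_i'$ bound a polygon $\triangle_i'$ (with $v_i',v_i''$ among its vertices). Add marked points to $\mathfrak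 t_i'$ so that $\triangle_i'$ is an $(m+2)$-gon (zero or more points need to be added, since $m>1$). The complement in $\triangle$ of the $\triangle_i'$ is the boundary bridge in $\triangle$; it includes the pieces of the $\mathfrak b_j$ not in the $\delta_i',\delta_i''$ but not the arcs $\mathfrak t_i'$. For degenerate $(P,M,T)$, $(\tilde P,\tilde M,\tilde T)$ is the $(m+2)$-angulation constructed by removing all boundary bridges from $(P,M,T)$ (so $\tilde P$ may be disconnected, the arcs are unchanged, $\tilde T=T$, and $\tilde M$ consists of the remaining points of $M$ and the new marked points); for non-degenerate $(P,M,T)$, $(\tilde P,\tilde M,\tilde T)=(P,M,T)$. $\tilde M_T$, $\tilde{\mathfrak B}$ and the weights $w(\mathfrak b)$ for $\mathfrak b\in\tilde{\mathfrak B}$ are defined for $(\tilde P,\tilde M,\tilde T)$ as $M_T$, $\mathfrak B$, $w$ are for $(P,M,T)$; $\tilde M_T^i$ and $\tilde{\mathfrak B}_i$ are the parts of $\tilde M_T$ and $\tilde{\mathfrak B}$ in the $i$th boundary component of $\tilde P$. **Threads** of a gentle algebra $\Lambda=kQ/I$. A permitted path is a path not in $I$; a non-trivial permitted thread is a permitted path $H$ of positive length such that for no arrow $\beta$ is $\beta H$ or $H\beta$ a permitted path. A forbidden path is a path $\alpha_1\cdots\alpha_n$ with pairwise distinct arrows and $\alpha_i\alpha_{i+1}\in I$ for all $i<n$; a non-trivial forbidden thread is a forbidden path $F$ of positive length such that for no arrow $\beta$ is $\beta F$ or $F\beta$ a forbidden path (oriented cycles in which every two cyclically consecutive arrows form a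 relation are not counted as forbidden threads). Let $x\in Q_0$ have at most one incoming and at most one outgoing arrow. The constant path $e_x$ is a trivial permitted thread $h_x$ if, whenever arrows $\beta,\gamma$ with $t(\beta)=x=s(\gamma)$ exist, $\beta\gamma\notin I$; it is a trivial forbidden thread $p_x$ if, whenever such arrows exist, $\beta\gamma\in I$. **Sign functions.** Fix a choice of functions $\sigma,\varepsilon\colon Q_1\to\{-1,1\}$ such that: (1) distinct arrows with the same source have opposite $\sigma$; (2) distinct arrows with the same target have opposite $\varepsilon$; (3) if $s(\beta)=t(\alpha)$ and $\alpha\beta\notin I$ then $\sigma(\beta)=-\varepsilon(\alpha)$. For a path, $\sigma(\alpha_1\cdots\alpha_n)=\sigma(\alpha_1)$ and $\varepsilon(\alpha_1\cdots\alpha_n)=\varepsilon(\alpha_n)$. For trivial threads: $\sigma(h_x)=-\varepsilon(h_x)=-\sigma(\alpha)$ if $s(\alpha)=x$, or $\sigma(h_x)=-\varepsilon(h_x)=\varepsilon(\beta)$ if $t(\beta)=x$; $\sigma(p_y)=\varepsilon(p_y)=-\sigma(\gamma)$ if $s(\gamma)=y$, or $\sigma(p_y)=\varepsilon(p_y)=-\varepsilon(\delta)$ if $t(\delta)=y$. **AG-invariant.** (1) Start with a permitted thread $H_0$. To $H_i$ associate $F_i$, the forbidden thread ending at $t(H_i)$ with $\varepsilon(F_i)=-\varepsilon(H_i)$; to $F_i$ associate $H_{i+1}$, the permitted thread starting at $s(F_i)$ with $\sigma(H_{i+1})=-\sigma(F_i)$. Stop when $H_n=H_0$ for some natural number $n\ge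 1$, and record the pair $(n,q)$ with $q=\sum_{i=1}^{n}\ell(F_i)$ (where $F_n=F_0$), $\ell$ denoting length. (2) Repeat until all permitted threads have occurred. (3) For each oriented cycle in which each pair of consecutive arrows forms a relation, record $(0,n)$, $n$ the length of the cycle. $\mathrm{AG}(\Lambda)\colon\mathbb N^2\to\mathbb N$ sends $(n,q)$ to the number of times the pair $(n,q)$ is recorded.
   Formalization: T must be non-empty (an arc in each component of P); an isolated vertex has two h_x and two p_x (both signs); if y has arrows in and out, σ(p_y)=-σ(γ), ε(p_y)=-ε(δ); αβ is a relation only if β's corner follows α's counter-clockwise. *)

theory Defs
  imports
    "HOL-Analysis.Analysis"
    "HOL-Computational_Algebra.Polynomial"
    "Graph_Theory.Arc_Walk"
begin

section \<open>Surfaces with boundary\<close>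

definition surface_boundary :: "'p topology \<Rightarrow> 'p set" where
  "surface_boundary P = {x \<in> topspace P.
     \<not> (\<exists>U V. openin P U \<and> x \<in> U \<and> open (V :: complex set) \<and>
              subtopology P U homeomorphic_space top_of_set V)}"

text \<open>Compact surfaces with boundary. They need not be connected. The orientation is carried by
  the polygons of an angulation, see below.\<close>
definition surface_with_boundary :: "'p topology \<Rightarrow> bool" where
  "surface_with_boundary P \<longleftrightarrow> compact_space P \<and> Hausdorff_space P \<and>
     (\<forall>x \<in> topspace P. \<exists>U V. openin P U \<and> x \<in> U \<and>
        openin (top_of_set {z :: complex. 0 \<le> Im z}) V \<and>
        subtopology P U homeomorphic_space top_of_set V)"

definition boundary_components :: "'p topology \<Rightarrow> 'p set set" where
  "boundary_components P = connected_components_of (subtopology P (surface_boundary P))"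

definition boundary_segments :: "'p topology \<Rightarrow> 'p set \<Rightarrow> 'p set set" where
  "boundary_segments P M = connected_components_of (subtopology P (surface_boundary P - M))"


section \<open>Angulations\<close>

text \<open>The standard \<open>n\<close>-gon is the regular one in the plane. Its corners and sides are numbered
  counter-clockwise, and the numbering is \<open>n\<close>-periodic: side \<open>k\<close> runs from corner \<open>k\<close> to
  corner \<open>k + 1\<close>.\<close>
definition corner :: "nat \<Rightarrow> nat \<Rightarrow> complex" where
  "corner n k = cis (2 * pi * real k / real n)"

definition ngon :: "nat \<Rightarrow> complex set" where
  "ngon n = convex hull (corner n ` {..<n})"

definition side :: "nat \<Rightarrow> nat \<Rightarrow> complex set" where
  "side n k = closed_segment (corner n k) (corner n (Suc k))"

definition open_side :: "nat \<Rightarrow> nat \<Rightarrow> complex set" where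
  "open_side n k = open_segment (corner n k) (corner n (Suc k))"

definition side_point :: "nat \<Rightarrow> nat \<Rightarrow> real \<Rightarrow> complex" where
  "side_point n k = linepath (corner n k) (corner n (Suc k))"

text \<open>Arcs are regarded as subsets of the surface; both ends of an arc may coincide.\<close>
definition is_surface_arc :: "'p topology \<Rightarrow> 'p set \<Rightarrow> 'p set \<Rightarrow> bool" where
  "is_surface_arc P M \<tau> \<longleftrightarrow> (\<exists>g. pathin P g \<and> g ` {0..1} = \<tau> \<and> inj_on g {0<..<1} \<and>
     g ` {0<..<1} \<subseteq> topspace P - surface_boundary P \<and> g 0 \<in> M \<and> g 1 \<in> M)"

text \<open>Two sides \<open>k\<close> of \<open>f\<close> and \<open>l\<close> of \<open>g\<close> with the same image traverse it in opposite
  directions.\<close>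
definition opposite_sides ::
  "nat \<Rightarrow> ('f \<Rightarrow> complex \<Rightarrow> 'p) \<Rightarrow> 'f \<Rightarrow> nat \<Rightarrow> 'f \<Rightarrow> nat \<Rightarrow> bool" where
  "opposite_sides n \<phi> f k g l \<longleftrightarrow>
     (\<exists>h :: real \<Rightarrow> real. continuous_on {0..1} h \<and> h ` {0..1} = {0..1} \<and>
        (\<forall>s \<in> {0..1}. \<forall>t \<in> {0..1}. s < t \<longrightarrow> h t < h s) \<and>
        (\<forall>s \<in> {0..1}. \<phi> f (side_point n k s) = \<phi> g (side_point n l (h s))))"

text \<open>\<open>(P, M, T)\<close> is an \<open>n\<close>-angulation (\<open>n = m + 2\<close>): the elements of \<open>F\<close> name the \<open>n\<close>-gons
  into which \<open>T\<close> subdivides the surface, and \<open>\<phi> f\<close> maps the standard \<open>n\<close>-gon onto the \<open>n\<close>-gon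
  named by \<open>f\<close>. Only sides and corners may be identified by \<open>\<phi> f\<close>. Each arc is a side on
  two sides, each boundary segment is a side once. The last condition says that the maps \<open>\<phi> f\<close>
  all preserve one orientation of the surface: this is the orientation with respect to which
  ``counter-clockwise'' is understood.\<close>
definition angulation ::
  "nat \<Rightarrow> 'p topology \<Rightarrow> 'p set \<Rightarrow> 'p set set \<Rightarrow> 'f set \<Rightarrow> ('f \<Rightarrow> complex \<Rightarrow> 'p) \<Rightarrow> bool" where
  "angulation n P M T F \<phi> \<longleftrightarrow>
     surface_with_boundary P \<and> surface_boundary P \<noteq> {} \<and>
     finite M \<and> M \<subseteq> surface_boundary P \<and> (\<forall>C \<in> boundary_components P. C \<inter> M \<noteq> {}) \<and>
     (\<forall>\<tau> \<in> T. is_surface_arc P M \<tau>) \<and>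
     (\<forall>\<tau> \<in> T. \<forall>\<tau>' \<in> T. \<tau> \<noteq> \<tau>' \<longrightarrow> \<tau> \<inter> \<tau>' \<subseteq> M) \<and>
     finite F \<and>
     (\<forall>f \<in> F. continuous_map (top_of_set (ngon n)) P (\<phi> f) \<and> inj_on (\<phi> f) (interior (ngon n))) \<and>
     bij_betw (\<lambda>f. \<phi> f ` interior (ngon n)) F
       (connected_components_of (subtopology P (topspace P - surface_boundary P - \<Union>T))) \<and>
     (\<forall>f \<in> F. \<forall>k < n. \<phi> f (corner n k) \<in> M \<and>
        \<phi> f ` open_side n k \<inter> M = {} \<and> inj_on (\<phi> f) (open_side n k) \<and>
        (\<phi> f ` side n k \<in> T \<or> \<phi> f ` open_side n k \<in> boundary_segments P M)) \<and>
     (\<forall>\<tau> \<in> T. card {(f, k). f \<in> F \<and> k < n \<and> \<phi> f ` side n k = \<tau>} = 2) \<and>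
     (\<forall>\<beta> \<in> boundary_segments P M.
        card {(f, k). f \<in> F \<and> k < n \<and> \<phi> f ` open_side n k = \<beta>} = 1) \<and>
     (\<forall>f \<in> F. \<forall>g \<in> F. \<forall>k < n. \<forall>l < n.
        (f, k) \<noteq> (g, l) \<and> \<phi> f ` side n k \<in> T \<and> \<phi> f ` side n k = \<phi> g ` side n l \<longrightarrow>
        opposite_sides n \<phi> f k g l)"

definition internal_polygons ::
  "nat \<Rightarrow> 'p set set \<Rightarrow> 'f set \<Rightarrow> ('f \<Rightarrow> complex \<Rightarrow> 'p) \<Rightarrow> 'f set" where
  "internal_polygons n T F \<phi> = {f \<in> F. \<forall>k < n. \<phi> f ` side n k \<in> T}"


section \<open>Boundary data\<close>

definition marked_on_arcs :: "'p set \<Rightarrow> 'p set set \<Rightarrow> 'p set" where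
  "marked_on_arcs M T = M \<inter> \<Union>T"

text \<open>The pieces are closed, so they contain their end points. A piece with coinciding end points
  is a whole boundary component.\<close>
definition boundary_pieces :: "'p topology \<Rightarrow> 'p set \<Rightarrow> 'p set set \<Rightarrow> 'p set set" where
  "boundary_pieces P M T = (\<lambda>C. P closure_of C) `
     connected_components_of (subtopology P (surface_boundary P - marked_on_arcs M T))"

definition weight :: "'p set \<Rightarrow> 'p set set \<Rightarrow> 'p set \<Rightarrow> nat" where
  "weight M T \<bb> = card ((M \<inter> \<bb>) - marked_on_arcs M T)"

text \<open>The angulation is non-degenerate if there are no degenerate polygons; removing the boundary
  bridges as defined below then changes nothing.\<close>
definition degenerate_polygons ::
  "nat \<Rightarrow> 'p topology \<Rightarrow> 'p set \<Rightarrow> 'p set set \<Rightarrow> 'f set \<Rightarrow> ('f \<Rightarrow> complex \<Rightarrow> 'p) \<Rightarrow> 'f set" where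
  "degenerate_polygons n P M T F \<phi> =
     {f \<in> F. card {\<bb> \<in> boundary_pieces P M T. \<bb> \<subseteq> \<phi> f ` ngon n} > 1}"


section \<open>Removal of boundary bridges\<close>

text \<open>The sides \<open>k, \<dots>, k + r - 1\<close> of \<open>f\<close> form one of the segments of the boundary of the polygon
  that consist of arcs and are flanked by the boundary of the surface at both ends.\<close>
definition arc_run ::
  "nat \<Rightarrow> 'p set set \<Rightarrow> ('f \<Rightarrow> complex \<Rightarrow> 'p) \<Rightarrow> 'f \<Rightarrow> nat \<Rightarrow> nat \<Rightarrow> bool" where
  "arc_run n T \<phi> f k r \<longleftrightarrow> k < n \<and> 0 < r \<and> r < n \<and>
     (\<forall>i \<in> {k..<k + r}. \<phi> f ` side n i \<in> T) \<and>
     \<phi> f ` side n (k + n - 1) \<notin> T \<and> \<phi> f ` side n (k + r) \<notin> T"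

text \<open>The two new points attached to such a segment are the points with parameter \<open>hi\<close> on the side
  preceding it and with parameter \<open>lo\<close> on the side following it. The new arc joining them is
  drawn as a chord of the standard polygon.\<close>
definition cut_before :: "nat \<Rightarrow> ('f \<Rightarrow> nat \<Rightarrow> real) \<Rightarrow> 'f \<Rightarrow> nat \<Rightarrow> complex" where
  "cut_before n hi f k = side_point n (k + n - 1) (hi f ((k + n - 1) mod n))"

definition cut_after :: "nat \<Rightarrow> ('f \<Rightarrow> nat \<Rightarrow> real) \<Rightarrow> 'f \<Rightarrow> nat \<Rightarrow> nat \<Rightarrow> complex" where
  "cut_after n lo f k r = side_point n (k + r) (lo f ((k + r) mod n))"

definition cut_polygon ::
  "nat \<Rightarrow> ('f \<Rightarrow> nat \<Rightarrow> real) \<Rightarrow> ('f \<Rightarrow> nat \<Rightarrow> real) \<Rightarrow> 'f \<Rightarrow> nat \<Rightarrow> nat \<Rightarrow> complex set" where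
  "cut_polygon n lo hi f k r =
     convex hull (corner n ` {k..k + r} \<union> {cut_before n hi f k, cut_after n lo f k r})"

text \<open>Admissible choices: \<open>lo < hi\<close> keeps the two curves on a common side disjoint; \<open>N f k\<close> is the
  set of marked points added to the chord, and the polygon that is cut off, which has the \<open>r\<close>
  arcs, the two short boundary curves and the parts of the chord as its sides, becomes an
  \<open>n\<close>-gon.\<close>
definition bridge_cuts ::
  "nat \<Rightarrow> 'p topology \<Rightarrow> 'p set \<Rightarrow> 'p set set \<Rightarrow> 'f set \<Rightarrow> ('f \<Rightarrow> complex \<Rightarrow> 'p) \<Rightarrow>
   ('f \<Rightarrow> nat \<Rightarrow> real) \<Rightarrow> ('f \<Rightarrow> nat \<Rightarrow> real) \<Rightarrow> ('f \<Rightarrow> nat \<Rightarrow> complex set) \<Rightarrow> bool" where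
  "bridge_cuts n P M T F \<phi> lo hi N \<longleftrightarrow> (\<forall>f \<in> degenerate_polygons n P M T F \<phi>.
     (\<forall>k < n. 0 < lo f k \<and> lo f k < hi f k \<and> hi f k < 1) \<and>
     (\<forall>k r. arc_run n T \<phi> f k r \<longrightarrow>
        finite (N f k) \<and> N f k \<subseteq> open_segment (cut_before n hi f k) (cut_after n lo f k r) \<and>
        r + 2 + (card (N f k) + 1) = n))"

definition bridge ::
  "nat \<Rightarrow> 'p set set \<Rightarrow> ('f \<Rightarrow> complex \<Rightarrow> 'p) \<Rightarrow> ('f \<Rightarrow> nat \<Rightarrow> real) \<Rightarrow> ('f \<Rightarrow> nat \<Rightarrow> real) \<Rightarrow>
   'f \<Rightarrow> 'p set" where
  "bridge n T \<phi> lo hi f =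
     \<phi> f ` (ngon n - \<Union>{cut_polygon n lo hi f k r | k r. arc_run n T \<phi> f k r})"

definition cut_surface ::
  "nat \<Rightarrow> 'p topology \<Rightarrow> 'p set \<Rightarrow> 'p set set \<Rightarrow> 'f set \<Rightarrow> ('f \<Rightarrow> complex \<Rightarrow> 'p) \<Rightarrow>
   ('f \<Rightarrow> nat \<Rightarrow> real) \<Rightarrow> ('f \<Rightarrow> nat \<Rightarrow> real) \<Rightarrow> 'p topology" where
  "cut_surface n P M T F \<phi> lo hi = subtopology P
     (topspace P - (\<Union>f \<in> degenerate_polygons n P M T F \<phi>. bridge n T \<phi> lo hi f))"

definition cut_marked ::
  "nat \<Rightarrow> 'p topology \<Rightarrow> 'p set \<Rightarrow> 'p set set \<Rightarrow> 'f set \<Rightarrow> ('f \<Rightarrow> complex \<Rightarrow> 'p) \<Rightarrow>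
   ('f \<Rightarrow> nat \<Rightarrow> real) \<Rightarrow> ('f \<Rightarrow> nat \<Rightarrow> real) \<Rightarrow> ('f \<Rightarrow> nat \<Rightarrow> complex set) \<Rightarrow> 'p set" where
  "cut_marked n P M T F \<phi> lo hi N =
     (M \<inter> topspace (cut_surface n P M T F \<phi> lo hi)) \<union>
     (\<Union>f \<in> degenerate_polygons n P M T F \<phi>.
        \<phi> f ` \<Union>{N f k \<union> {cut_before n hi f k, cut_after n lo f k r} | k r. arc_run n T \<phi> f k r})"


section \<open>Path algebras\<close>

text \<open>A path is given by its source and its list of arrows, composed from left to right. Elements of
  the path algebra are finitely supported functions on paths.\<close>
type_synonym ('v, 'a) qpath = "'v \<times> 'a list"

definition qpaths :: "('v, 'a) pre_digraph \<Rightarrow> ('v, 'a) qpath set" where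
  "qpaths Q = {(u, p). \<exists>v. pre_digraph.awalk Q u p v}"

definition path_algebra :: "('v, 'a) pre_digraph \<Rightarrow> (('v, 'a) qpath \<Rightarrow> 'k::field) set" where
  "path_algebra Q = {x. finite {p. x p \<noteq> 0} \<and> {p. x p \<noteq> 0} \<subseteq> qpaths Q}"

definition path_mult :: "('v, 'a) pre_digraph \<Rightarrow> (('v, 'a) qpath \<Rightarrow> 'k::field) \<Rightarrow>
    (('v, 'a) qpath \<Rightarrow> 'k) \<Rightarrow> ('v, 'a) qpath \<Rightarrow> 'k" where
  "path_mult Q x y = (\<lambda>(u, p). if (u, p) \<in> qpaths Q
     then \<Sum>i \<le> length p. x (u, take i p) * y (pre_digraph.awlast Q u (take i p), drop i p)
     else 0)"

definition path_elem :: "('v, 'a) qpath \<Rightarrow> ('v, 'a) qpath \<Rightarrow> 'k::field" where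
  "path_elem p = (\<lambda>q. if q = p then 1 else 0)"

definition two_sided_ideal ::
  "('v, 'a) pre_digraph \<Rightarrow> (('v, 'a) qpath \<Rightarrow> 'k::field) set \<Rightarrow> bool" where
  "two_sided_ideal Q J \<longleftrightarrow> J \<subseteq> path_algebra Q \<and> (\<lambda>_. 0) \<in> J \<and>
     (\<forall>x \<in> J. \<forall>y \<in> J. (\<lambda>p. x p + y p) \<in> J) \<and>
     (\<forall>a \<in> path_algebra Q. \<forall>x \<in> J. path_mult Q a x \<in> J \<and> path_mult Q x a \<in> J)"

definition generated_ideal :: "('v, 'a) pre_digraph \<Rightarrow>
    (('v, 'a) qpath \<Rightarrow> 'k::field) set \<Rightarrow> (('v, 'a) qpath \<Rightarrow> 'k) set" where
  "generated_ideal Q R = \<Inter>{J. two_sided_ideal Q J \<and> R \<subseteq> J}"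


section \<open>The quiver with relations of an angulation\<close>

text \<open>The arrow \<open>(f, k)\<close> sits at the corner of \<open>f\<close> between the sides \<open>k\<close> and \<open>k + 1\<close>.\<close>
definition angulation_quiver :: "nat \<Rightarrow> 'p set set \<Rightarrow> 'f set \<Rightarrow> ('f \<Rightarrow> complex \<Rightarrow> 'p) \<Rightarrow>
    ('p set, 'f \<times> nat) pre_digraph" where
  "angulation_quiver n T F \<phi> =
     \<lparr> verts = T,
       arcs = {(f, k). f \<in> F \<and> k < n \<and> \<phi> f ` side n k \<in> T \<and> \<phi> f ` side n (Suc k) \<in> T},
       tail = (\<lambda>(f, k). \<phi> f ` side n k),
       head = (\<lambda>(f, k). \<phi> f ` side n (Suc k)) \<rparr>"

text \<open>The corner of the second arrow of a generator directly follows that of the first one, so that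
  the two arrows meet in the side lying between the two corners. (If two sides of a
  polygon are glued, the arrows at two neighbouring corners may also compose in the opposite
  order, around a marked point; such a composition is not a relation.)\<close>
definition angulation_ideal :: "nat \<Rightarrow> 'p set set \<Rightarrow> 'f set \<Rightarrow> ('f \<Rightarrow> complex \<Rightarrow> 'p) \<Rightarrow>
    (('p set, 'f \<times> nat) qpath \<Rightarrow> 'k::field) set" where
  "angulation_ideal n T F \<phi> = (let Q = angulation_quiver n T F \<phi> in
     generated_ideal Q {path_elem (tail Q \<alpha>, [\<alpha>, \<beta>]) | \<alpha> \<beta>. \<alpha> \<in> arcs Q \<and> \<beta> \<in> arcs Q \<and>
       (\<exists>f k. \<alpha> = (f, k) \<and> \<beta> = (f, Suc k mod n))})"


section \<open>Threads and the AG-invariant\<close>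

definition in_relation :: "('v, 'a) pre_digraph \<Rightarrow> (('v, 'a) qpath \<Rightarrow> 'k::field) set \<Rightarrow>
    'a \<Rightarrow> 'a \<Rightarrow> bool" where
  "in_relation Q I \<alpha> \<beta> \<longleftrightarrow> \<alpha> \<in> arcs Q \<and> \<beta> \<in> arcs Q \<and> head Q \<alpha> = tail Q \<beta> \<and>
     path_elem (tail Q \<alpha>, [\<alpha>, \<beta>]) \<in> I"

text \<open>Permitted and forbidden paths of positive length.\<close>
definition permitted_path :: "('v, 'a) pre_digraph \<Rightarrow> (('v, 'a) qpath \<Rightarrow> 'k::field) set \<Rightarrow>
    'a list \<Rightarrow> bool" where
  "permitted_path Q I p \<longleftrightarrow> p \<noteq> [] \<and> (tail Q (hd p), p) \<in> qpaths Q \<and>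
     path_elem (tail Q (hd p), p) \<notin> I"

definition forbidden_path :: "('v, 'a) pre_digraph \<Rightarrow> (('v, 'a) qpath \<Rightarrow> 'k::field) set \<Rightarrow>
    'a list \<Rightarrow> bool" where
  "forbidden_path Q I p \<longleftrightarrow> p \<noteq> [] \<and> set p \<subseteq> arcs Q \<and> distinct p \<and>
     successively (in_relation Q I) p"

definition relation_cycle :: "('v, 'a) pre_digraph \<Rightarrow> (('v, 'a) qpath \<Rightarrow> 'k::field) set \<Rightarrow>
    'a list \<Rightarrow> bool" where
  "relation_cycle Q I c \<longleftrightarrow> forbidden_path Q I c \<and> in_relation Q I (last c) (hd c)"

text \<open>A trivial thread at \<open>x\<close> is stored together with a sign. The defining equations determine the
  sign unless \<open>x\<close> is isolated. At an isolated vertex both signs are allowed, so there are two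
  trivial permitted and two trivial forbidden threads; this way each vertex lies on exactly two
  permitted threads (and the quiver with one vertex and no arrow has the single pair (2, 0)).\<close>
datatype ('v, 'a) thread = Nontrivial "'a list" | Trivial 'v int

fun thread_start :: "('v, 'a) pre_digraph \<Rightarrow> ('v, 'a) thread \<Rightarrow> 'v" where
  "thread_start Q (Nontrivial p) = tail Q (hd p)"
| "thread_start Q (Trivial x s) = x"

fun thread_end :: "('v, 'a) pre_digraph \<Rightarrow> ('v, 'a) thread \<Rightarrow> 'v" where
  "thread_end Q (Nontrivial p) = head Q (last p)"
| "thread_end Q (Trivial x s) = x"

fun thread_length :: "('v, 'a) thread \<Rightarrow> nat" where
  "thread_length (Nontrivial p) = length p"
| "thread_length (Trivial x s) = 0"

definition sign_functions :: "('v, 'a) pre_digraph \<Rightarrow> (('v, 'a) qpath \<Rightarrow> 'k::field) set \<Rightarrow>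
    ('a \<Rightarrow> int) \<Rightarrow> ('a \<Rightarrow> int) \<Rightarrow> bool" where
  "sign_functions Q I \<sigma> \<epsilon> \<longleftrightarrow>
     (\<forall>\<alpha> \<in> arcs Q. \<sigma> \<alpha> \<in> {-1, 1} \<and> \<epsilon> \<alpha> \<in> {-1, 1}) \<and>
     (\<forall>\<alpha> \<in> arcs Q. \<forall>\<beta> \<in> arcs Q. \<alpha> \<noteq> \<beta> \<and> tail Q \<alpha> = tail Q \<beta> \<longrightarrow> \<sigma> \<alpha> = - \<sigma> \<beta>) \<and>
     (\<forall>\<alpha> \<in> arcs Q. \<forall>\<beta> \<in> arcs Q. \<alpha> \<noteq> \<beta> \<and> head Q \<alpha> = head Q \<beta> \<longrightarrow> \<epsilon> \<alpha> = - \<epsilon> \<beta>) \<and>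
     (\<forall>\<alpha> \<in> arcs Q. \<forall>\<beta> \<in> arcs Q.
        tail Q \<beta> = head Q \<alpha> \<and> path_elem (tail Q \<alpha>, [\<alpha>, \<beta>]) \<notin> I \<longrightarrow> \<sigma> \<beta> = - \<epsilon> \<alpha>)"

definition thread_vertex :: "('v, 'a) pre_digraph \<Rightarrow> 'v \<Rightarrow> bool" where
  "thread_vertex Q x \<longleftrightarrow> x \<in> verts Q \<and> card (in_arcs Q x) \<le> 1 \<and> card (out_arcs Q x) \<le> 1"

text \<open>The sign stored in a trivial permitted thread \<open>h\<close> is \<open>\<sigma>(h)\<close>.\<close>
definition permitted_threads :: "('v, 'a) pre_digraph \<Rightarrow> (('v, 'a) qpath \<Rightarrow> 'k::field) set \<Rightarrow>
    ('a \<Rightarrow> int) \<Rightarrow> ('a \<Rightarrow> int) \<Rightarrow> ('v, 'a) thread set" where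
  "permitted_threads Q I \<sigma> \<epsilon> =
     {Nontrivial p | p. permitted_path Q I p \<and>
        (\<forall>\<beta> \<in> arcs Q. \<not> permitted_path Q I (\<beta> # p) \<and> \<not> permitted_path Q I (p @ [\<beta>]))} \<union>
     {Trivial x s | x s. thread_vertex Q x \<and>
        (\<forall>\<beta> \<in> in_arcs Q x. \<forall>\<gamma> \<in> out_arcs Q x. \<not> in_relation Q I \<beta> \<gamma>) \<and>
        s \<in> {-1, 1} \<and> (\<forall>\<alpha> \<in> out_arcs Q x. s = - \<sigma> \<alpha>) \<and> (\<forall>\<beta> \<in> in_arcs Q x. s = \<epsilon> \<beta>)}"

fun permitted_sigma :: "('a \<Rightarrow> int) \<Rightarrow> ('v, 'a) thread \<Rightarrow> int" where
  "permitted_sigma \<sigma> (Nontrivial p) = \<sigma> (hd p)"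
| "permitted_sigma \<sigma> (Trivial x s) = s"

fun permitted_epsilon :: "('a \<Rightarrow> int) \<Rightarrow> ('v, 'a) thread \<Rightarrow> int" where
  "permitted_epsilon \<epsilon> (Nontrivial p) = \<epsilon> (last p)"
| "permitted_epsilon \<epsilon> (Trivial x s) = - s"

text \<open>The sign stored in a trivial forbidden thread \<open>p\<close> is \<open>\<sigma>(p)\<close>. When \<open>y\<close> has both an incoming
  arrow \<open>\<delta>\<close> and an outgoing arrow \<open>\<gamma>\<close> (and then \<open>\<delta>\<gamma>\<close> is a relation), the conditions on sign
  functions do not relate \<open>\<sigma>(\<gamma>)\<close> and \<open>\<epsilon>(\<delta>)\<close>, so the two formulas for \<open>\<sigma>(p) = \<epsilon>(p)\<close> need not
  agree. We take \<open>\<sigma>(p) = -\<sigma>(\<gamma>)\<close> and \<open>\<epsilon>(p) = -\<epsilon>(\<delta>)\<close> then, which agrees with both formulas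
  whenever they are consistent; in all other cases \<open>\<sigma>(p) = \<epsilon>(p)\<close>.\<close>
definition forbidden_threads :: "('v, 'a) pre_digraph \<Rightarrow> (('v, 'a) qpath \<Rightarrow> 'k::field) set \<Rightarrow>
    ('a \<Rightarrow> int) \<Rightarrow> ('a \<Rightarrow> int) \<Rightarrow> ('v, 'a) thread set" where
  "forbidden_threads Q I \<sigma> \<epsilon> =
     {Nontrivial p | p. forbidden_path Q I p \<and> \<not> relation_cycle Q I p \<and>
        (\<forall>\<beta> \<in> arcs Q. \<not> forbidden_path Q I (\<beta> # p) \<and> \<not> forbidden_path Q I (p @ [\<beta>]))} \<union>
     {Trivial y s | y s. thread_vertex Q y \<and>
        (\<forall>\<delta> \<in> in_arcs Q y. \<forall>\<gamma> \<in> out_arcs Q y. in_relation Q I \<delta> \<gamma>) \<and>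
        s \<in> {-1, 1} \<and> (\<forall>\<gamma> \<in> out_arcs Q y. s = - \<sigma> \<gamma>) \<and>
        (out_arcs Q y = {} \<longrightarrow> (\<forall>\<delta> \<in> in_arcs Q y. s = - \<epsilon> \<delta>))}"

fun forbidden_sigma :: "('a \<Rightarrow> int) \<Rightarrow> ('v, 'a) thread \<Rightarrow> int" where
  "forbidden_sigma \<sigma> (Nontrivial p) = \<sigma> (hd p)"
| "forbidden_sigma \<sigma> (Trivial y s) = s"

fun forbidden_epsilon :: "('v, 'a) pre_digraph \<Rightarrow> ('a \<Rightarrow> int) \<Rightarrow> ('v, 'a) thread \<Rightarrow> int" where
  "forbidden_epsilon Q \<epsilon> (Nontrivial p) = \<epsilon> (last p)"
| "forbidden_epsilon Q \<epsilon> (Trivial y s) =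
     (if in_arcs Q y = {} then s else - \<epsilon> (THE \<delta>. \<delta> \<in> in_arcs Q y))"

text \<open>One step of the algorithm: from \<open>H\<^sub>i\<close> to \<open>F\<^sub>i\<close>, and from \<open>H\<^sub>i\<close> to \<open>H\<^sub>i\<^sub>+\<^sub>1\<close>.\<close>
definition AG_forbidden :: "('v, 'a) pre_digraph \<Rightarrow> (('v, 'a) qpath \<Rightarrow> 'k::field) set \<Rightarrow>
    ('a \<Rightarrow> int) \<Rightarrow> ('a \<Rightarrow> int) \<Rightarrow> ('v, 'a) thread \<Rightarrow> ('v, 'a) thread" where
  "AG_forbidden Q I \<sigma> \<epsilon> H = (THE F. F \<in> forbidden_threads Q I \<sigma> \<epsilon> \<and>
     thread_end Q F = thread_end Q H \<and> forbidden_epsilon Q \<epsilon> F = - permitted_epsilon \<epsilon> H)"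

definition AG_step :: "('v, 'a) pre_digraph \<Rightarrow> (('v, 'a) qpath \<Rightarrow> 'k::field) set \<Rightarrow>
    ('a \<Rightarrow> int) \<Rightarrow> ('a \<Rightarrow> int) \<Rightarrow> ('v, 'a) thread \<Rightarrow> ('v, 'a) thread" where
  "AG_step Q I \<sigma> \<epsilon> H = (let F = AG_forbidden Q I \<sigma> \<epsilon> H in
     THE H'. H' \<in> permitted_threads Q I \<sigma> \<epsilon> \<and>
       thread_start Q H' = thread_start Q F \<and> permitted_sigma \<sigma> H' = - forbidden_sigma \<sigma> F)"

definition AG_period :: "('v, 'a) pre_digraph \<Rightarrow> (('v, 'a) qpath \<Rightarrow> 'k::field) set \<Rightarrow>
    ('a \<Rightarrow> int) \<Rightarrow> ('a \<Rightarrow> int) \<Rightarrow> ('v, 'a) thread \<Rightarrow> nat" where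
  "AG_period Q I \<sigma> \<epsilon> H = (LEAST n. 1 \<le> n \<and> (AG_step Q I \<sigma> \<epsilon> ^^ n) H = H)"

definition AG_length :: "('v, 'a) pre_digraph \<Rightarrow> (('v, 'a) qpath \<Rightarrow> 'k::field) set \<Rightarrow>
    ('a \<Rightarrow> int) \<Rightarrow> ('a \<Rightarrow> int) \<Rightarrow> ('v, 'a) thread \<Rightarrow> nat" where
  "AG_length Q I \<sigma> \<epsilon> H = (\<Sum>i = 1..AG_period Q I \<sigma> \<epsilon> H.
     thread_length (AG_forbidden Q I \<sigma> \<epsilon> ((AG_step Q I \<sigma> \<epsilon> ^^ i) H)))"

text \<open>A run of the algorithm records one pair for each set \<open>{H\<^sub>0, H\<^sub>1, \<dots>}\<close> of permitted threads that
  occur together. Oriented cycles are counted up to rotation.\<close>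
definition AG_invariant :: "('v, 'a) pre_digraph \<Rightarrow> (('v, 'a) qpath \<Rightarrow> 'k::field) set \<Rightarrow>
    ('a \<Rightarrow> int) \<Rightarrow> ('a \<Rightarrow> int) \<Rightarrow> nat \<times> nat \<Rightarrow> nat" where
  "AG_invariant Q I \<sigma> \<epsilon> = (\<lambda>(n, q).
     card {range (\<lambda>i. (AG_step Q I \<sigma> \<epsilon> ^^ i) H) | H. H \<in> permitted_threads Q I \<sigma> \<epsilon> \<and>
       AG_period Q I \<sigma> \<epsilon> H = n \<and> AG_length Q I \<sigma> \<epsilon> H = q} +
     (if n = 0 then card {range (\<lambda>i. rotate i c) | c. relation_cycle Q I c \<and> length c = q} else 0))"

text \<open>The function \<open>(a, b)\<^sup>*\<close>. The second entry is an integer because it is used with a sum of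
  differences.\<close>
definition pair_indicator :: "nat \<Rightarrow> int \<Rightarrow> nat \<times> nat \<Rightarrow> nat" where
  "pair_indicator a b = (\<lambda>(n, q). if n = a \<and> int q = b then 1 else 0)"

end

theory Submission
  imports Defs
begin

text \<open>
  The arrows of the quiver are the corners at which two arcs meet, and a composition of two of them is
  a relation if and only if they sit at neighbouring corners of one polygon. So the forbidden threads
  are the maximal runs of consecutive arcs on the boundaries of the polygons, a run of \<open>l\<close> arcs giving a
  thread of length \<open>l - 1\<close>, the permitted threads are the fans of arcs around the marked
  points in \<open>M\<^sub>T\<close>, and the cycles with full relations are the internal polygons. Each polygon at a
  marked point contributes one sector and the sectors form a single fan between two boundary
  segments; hence both kinds of threads are in bijection with the runs of arcs, and one step of
  the algorithm leads from a run, around the fan at its starting point, to the run that ends at the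
  last arc of this fan.

  After removal of the bridges every polygon that is not internal carries exactly one run, say of \<open>l\<close> arcs,
  and its remaining sides form one piece \<open>\<bb>\<close> with \<open>m - w(\<bb>) = l - 1\<close>. Thus the algorithm follows the
  boundary from piece to piece, and its orbits are the boundary components.
\<close>

section \<open>Partial injections and permutations of finite sets\<close>

text \<open>An arc has two sides. The functions \<open>\<sigma>\<close> and
  \<open>\<epsilon>\<close> are extended from arrows to sides in such a way that passing to the
  other side changes the sign. An arc together with a sign is then one of its sides, so that each
  choice made by the algorithm is the choice of a side, and trivial and nontrivial threads behave
  alike in every step.

  That the corners at a marked point form one fan is not part of the definition of an angulation. It
  comes from the topology: a boundary point has small neighbourhoods that stay connected when the
  point is removed, while two families of corners not linked by gluing would disconnect them.

  The boundary of the surface after the cuts is defined by charts. Off the arcs it is found by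
  invariance of domain, since the polygons embed there; near the arcs nothing is removed, and the
  comparison is with \<open>P\<close>. The same computation with nothing removed yields the pieces
  of \<open>P\<close>, on which degeneracy depends.\<close>

locale partial_injection =
  fixes D A :: "'d set" and f :: "'d \<Rightarrow> 'd"
  assumes finite_D: "finite D" and A_subset: "A \<subseteq> D"
    and f_into: "f ` A \<subseteq> D" and inj_f: "inj_on f A"
begin

text \<open>The orbits of a partial injection of a finite set are chains and cycles.
  \<open>starts\<close> collects the heads of the chains; an element of \<open>D\<close> outside
  \<open>A\<close> without preimage is a chain of length 0.\<close>

definition starts :: "'d set" where "starts = D - f ` A"
definition len :: "'d \<Rightarrow> nat" where "len x = (LEAST j. (f ^^ j) x \<notin> A)"
definition stop :: "'d \<Rightarrow> 'd" where "stop x = (f ^^ len x) x"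

lemma funpow_cancel:
  assumes "\<And>k. k < i \<Longrightarrow> (f ^^ k) x \<in> A" "\<And>k. k < i \<Longrightarrow> (f ^^ k) y \<in> A"
    and "(f ^^ i) x = (f ^^ i) y"
  shows "x = y"
  using assms
proof (induction i)
  case (Suc i)
  have "(f ^^ i) x = (f ^^ i) y"
    using Suc.prems inj_f by (auto simp: inj_on_def)
  then show ?case using Suc by auto
qed simp

text \<open>Cancelling the common number of steps reduces to comparing \<open>x\<close> with an
  iterate of \<open>y\<close>. A proper iterate lies in the image of \<open>f\<close>, which a head
  avoids.\<close>

lemma starts_eq:
  assumes x: "x \<in> starts" and y: "y \<in> starts"
    and "\<And>k. k < i \<Longrightarrow> (f ^^ k) x \<in> A" "\<And>k. k < j \<Longrightarrow> (f ^^ k) y \<in> A"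
    and "(f ^^ i) x = (f ^^ j) y"
  shows "x = y \<and> i = j"
proof -
  have *: "x = y \<and> i = j" if "x \<in> starts"
    "\<And>k. k < i \<Longrightarrow> (f ^^ k) x \<in> A" "\<And>k. k < j \<Longrightarrow> (f ^^ k) y \<in> A"
    "(f ^^ i) x = (f ^^ j) y" "i \<le> j" for x y i j
  proof -
    define z where "z = (f ^^ (j - i)) y"
    have z: "(f ^^ k) z = (f ^^ (k + (j - i))) y" for k by (simp add: z_def funpow_add)
    have "x = z"
      by (rule funpow_cancel[of i]) (use that z in auto)
    moreover have "j - i = 0"
    proof (rule ccontr)
      assume "j - i \<noteq> 0"
      then obtain d where d: "j - i = Suc d" by (cases "j - i") auto
      then have "z = f ((f ^^ d) y)" by (simp add: z_def)
      moreover have "(f ^^ d) y \<in> A" using d by (intro that(3)) simp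
      ultimately show False using \<open>x = z\<close> that(1) by (auto simp: starts_def)
    qed
    ultimately show ?thesis using that z_def by auto
  qed
  show ?thesis
  proof (cases "i \<le> j")
    case True then show ?thesis using * assms by blast
  next
    case False then show ?thesis using *[of y j i x] assms by auto
  qed
qed

lemma exits: assumes "x \<in> starts" shows "\<exists>j. (f ^^ j) x \<notin> A"
proof (rule ccontr)
  assume "\<not> ?thesis"
  then have A: "\<And>j. (f ^^ j) x \<in> A" by auto
  have "finite (range (\<lambda>j. (f ^^ j) x))"
    using A A_subset finite_D by (auto intro: finite_subset)
  then have "\<not> inj (\<lambda>j. (f ^^ j) x)" using finite_imageD by blast
  then show False using starts_eq[OF assms assms] A by (auto simp: inj_on_def)
qed

lemma len_stop: assumes "x \<in> starts"
  shows "stop x \<in> D - A" and "\<And>j. j < len x \<Longrightarrow> (f ^^ j) x \<in> A"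
proof -
  have 1: "(f ^^ len x) x \<notin> A" unfolding len_def using exits[OF assms] by (rule LeastI_ex)
  show 2: "(f ^^ j) x \<in> A" if "j < len x" for j using that not_less_Least[of j] by (auto simp: len_def)
  have "(f ^^ len x) x \<in> D"
  proof (cases "len x")
    case 0 then show ?thesis using assms by (simp add: starts_def)
  next
    case (Suc k) then show ?thesis using 2[of k] f_into by auto
  qed
  with 1 show "stop x \<in> D - A" by (simp add: stop_def)
qed

lemma len_eqI: assumes "(f ^^ r) x \<notin> A" "\<And>j. j < r \<Longrightarrow> (f ^^ j) x \<in> A" shows "len x = r"
  unfolding len_def using assms by (intro Least_equality) (auto simp: not_less[symmetric])

text \<open>Injectivity is \<open>starts_eq\<close> read at the far ends. Surjectivity is a count:
  since \<open>f\<close> is injective on \<open>A\<close>, both sets have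
  \<open>card D - card A\<close> elements.\<close>

lemma bij_stop: "bij_betw stop starts (D - A)"
proof -
  have inj: "inj_on stop starts"
    using len_stop(2) by (auto simp: inj_on_def stop_def dest!: starts_eq[rotated -1])
  have "stop ` starts \<subseteq> D - A" using len_stop(1) by auto
  moreover have "card starts = card (D - A)"
    using card_Diff_subset[of "f ` A" D] card_Diff_subset[of A D] f_into A_subset finite_D
      card_image[OF inj_f] finite_subset[OF A_subset finite_D] by (auto simp: starts_def)
  ultimately have "stop ` starts = D - A"
    using card_image[OF inj] finite_D by (intro card_subset_eq) auto
  with inj show ?thesis by (simp add: bij_betw_def)
qed

lemma len_pos: "x \<in> A \<Longrightarrow> x \<in> starts \<Longrightarrow> 0 < len x"
  using len_stop(1)[of x] by (cases "len x") (auto simp: stop_def)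

end

text \<open>The number \<open>p\<close> has the same form as in \<open>AG_period\<close>, so it
  measures the orbits of the algorithm. A repetition cancels to a return to \<open>s\<close>, and
  minimality of \<open>p\<close> makes the first \<open>p\<close> iterates distinct.\<close>

lemma permutation_orbit:
  fixes S :: "'a set"
  assumes fin: "finite S" and bij: "bij_betw f S S" and s: "s \<in> S"
  defines "p \<equiv> (LEAST k. 1 \<le> k \<and> (f ^^ k) s = s)"
  shows "1 \<le> p" and "(f ^^ p) s = s"
    and "bij_betw (\<lambda>i. (f ^^ i) s) {..<p} (range (\<lambda>i. (f ^^ i) s))"
proof -
  interpret partial_injection S S f
    using bij fin by unfold_locales (auto simp: bij_betw_def)
  have in_S: "(f ^^ i) x \<in> S" if "x \<in> S" for i x
    using that bij by (induction i) (auto simp: bij_betw_def)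
  have canc: "(f ^^ (j - i)) s = s" if "(f ^^ i) s = (f ^^ j) s" "i \<le> j" for i j
  proof -
    have "(f ^^ i) ((f ^^ (j - i)) s) = (f ^^ j) s" using that(2)
      by (metis comp_apply funpow_add le_add_diff_inverse)
    then show ?thesis using in_S s that(1) funpow_cancel[of i "(f ^^ (j - i)) s" s] by auto
  qed
  have "finite (range (\<lambda>j. (f ^^ j) s))"
    using in_S[OF s] fin by (auto intro: finite_subset)
  then have "\<not> inj (\<lambda>j. (f ^^ j) s)" using finite_imageD by blast
  then obtain i j where "i < j" "(f ^^ i) s = (f ^^ j) s"
    by (auto simp: inj_on_def) (metis nat_neq_iff)
  then have "\<exists>k. 1 \<le> k \<and> (f ^^ k) s = s" using canc[of i j] by (intro exI[of _ "j - i"]) auto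
  then have p: "1 \<le> p \<and> (f ^^ p) s = s" unfolding p_def by (rule LeastI_ex)
  then show "1 \<le> p" and per: "(f ^^ p) s = s" by auto
  have "inj_on (\<lambda>i. (f ^^ i) s) {..<p}"
  proof -
    have "i = j" if "i \<le> j" "j < p" "(f ^^ i) s = (f ^^ j) s" for i j
    proof (rule ccontr)
      assume "i \<noteq> j"
      then have "1 \<le> j - i" "j - i < p" using that by auto
      then show False using canc[of i j] that not_less_Least[of "j - i" "\<lambda>k. 1 \<le> k \<and> (f ^^ k) s = s"]
        unfolding p_def[symmetric] by auto
    qed
    then show ?thesis by (auto simp: inj_on_def) (metis nat_le_linear)
  qed
  moreover have "(f ^^ i) s \<in> (\<lambda>i. (f ^^ i) s) ` {..<p}" for i
    using funpow_mod_eq[OF per, of i] p by (intro image_eqI[of _ _ "i mod p"]) auto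
  then have "range (\<lambda>i. (f ^^ i) s) = (\<lambda>i. (f ^^ i) s) ` {..<p}" by auto
  ultimately show "bij_betw (\<lambda>i. (f ^^ i) s) {..<p} (range (\<lambda>i. (f ^^ i) s))"
    by (simp add: bij_betw_def)
qed

section \<open>Polygons glued along sides\<close>

text \<open>A dart is a polygon together with one of its sides, and also stands for the corner at which
  that side starts. The darts in \<open>A\<close> are the sides glued in pairs by \<open>opp\<close>; turning
  counter-clockwise around a marked point takes the corner \<open>d\<close> to the corner \<open>rot d\<close>. The last
  two assumptions say that the corners at a marked point form a single fan that does not close
  up.\<close>
locale dart_complex =
  fixes D A :: "'d set" and nxt prv opp :: "'d \<Rightarrow> 'd" and E :: "'d \<Rightarrow> 'v" and pt :: "'d \<Rightarrow> 'p"
    and n :: nat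
  assumes finite_darts: "finite D" and arcs_subset: "A \<subseteq> D"
    and nxt_in: "d \<in> D \<Longrightarrow> nxt d \<in> D" and prv_in: "d \<in> D \<Longrightarrow> prv d \<in> D"
    and prv_nxt: "d \<in> D \<Longrightarrow> prv (nxt d) = d" and nxt_prv: "d \<in> D \<Longrightarrow> nxt (prv d) = d"
    and nxt_period: "d \<in> D \<Longrightarrow> (nxt ^^ n) d = d"
    and nxt_no_period: "d \<in> D \<Longrightarrow> 0 < i \<Longrightarrow> i < n \<Longrightarrow> (nxt ^^ i) d \<noteq> d"
    and n_ge: "2 \<le> n"
    and opp_in: "d \<in> A \<Longrightarrow> opp d \<in> A" and opp_opp: "d \<in> A \<Longrightarrow> opp (opp d) = d"
    and opp_neq: "d \<in> A \<Longrightarrow> opp d \<noteq> d"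
    and E_eq: "d \<in> A \<Longrightarrow> d' \<in> A \<Longrightarrow> E d = E d' \<longleftrightarrow> d' = d \<or> d' = opp d"
    and pt_rot: "d \<in> A \<Longrightarrow> pt (nxt (opp d)) = pt d"
    and fan_connected: "G \<subseteq> {d \<in> D. pt d = p} \<Longrightarrow> G \<noteq> {} \<Longrightarrow>
      (\<And>d. d \<in> A \<Longrightarrow> pt d = p \<Longrightarrow> d \<in> G \<longleftrightarrow> nxt (opp d) \<in> G) \<Longrightarrow> G = {d \<in> D. pt d = p}"
    and fan_boundary: "d \<in> D \<Longrightarrow> \<exists>d' \<in> D. pt d' = pt d \<and> (d' \<notin> A \<or> prv d' \<notin> A)"
begin

definition rot :: "'d \<Rightarrow> 'd" where "rot d = nxt (opp d)"

lemma inD: "d \<in> A \<Longrightarrow> d \<in> D" using arcs_subset by auto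

lemma funpow_nxt_in: "d \<in> D \<Longrightarrow> (nxt ^^ i) d \<in> D"
  by (induction i) (auto intro: nxt_in)

lemma nxt_eq: "d \<in> D \<Longrightarrow> d' \<in> D \<Longrightarrow> nxt d = nxt d' \<longleftrightarrow> d = d'"
  by (metis prv_nxt)

lemma opp_eq: "d \<in> A \<Longrightarrow> d' \<in> A \<Longrightarrow> opp d = opp d' \<longleftrightarrow> d = d'"
  by (metis opp_opp)

lemma finite_A: "finite A" using finite_darts arcs_subset finite_subset by blast

lemma E_opp: "d \<in> A \<Longrightarrow> E (opp d) = E d"
  using E_eq[of d "opp d"] opp_in by auto

text \<open>The chains of \<open>rot\<close> are the fans of corners, those of \<open>nxt\<close>
  below are the runs of arcs. Both have the same heads, the darts whose preceding side is not an
  arc; this is why runs and fans can be indexed by one set.\<close>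

sublocale R: partial_injection D A rot
proof
  show "inj_on rot A" unfolding inj_on_def rot_def
    by (metis inD opp_eq opp_in nxt_eq)
qed (use inD in \<open>auto simp: finite_darts rot_def intro: nxt_in opp_in\<close>)

sublocale N: partial_injection D A nxt
proof
  show "inj_on nxt A" unfolding inj_on_def by (metis inD nxt_eq)
qed (use inD in \<open>auto simp: finite_darts intro: nxt_in\<close>)

lemma image_rot: "d \<in> D \<Longrightarrow> d \<in> rot ` A \<longleftrightarrow> prv d \<in> A"
  unfolding rot_def image_iff by (metis inD nxt_prv opp_in opp_opp prv_nxt)

lemma image_nxt: "d \<in> D \<Longrightarrow> d \<in> nxt ` A \<longleftrightarrow> prv d \<in> A"
  unfolding image_iff by (metis inD nxt_prv prv_nxt)

lemma N_starts: "N.starts = {d \<in> D. prv d \<notin> A}"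
  unfolding N.starts_def using image_nxt by auto

lemma R_starts: "R.starts = {d \<in> D. prv d \<notin> A}"
  unfolding R.starts_def using image_rot by auto

text \<open>The first arcs of the runs of arcs on the boundaries of the polygons. Each of them is also
  the first arc of the fan at its starting point.\<close>
definition S :: "'d set" where "S = {d \<in> A. prv d \<notin> A}"

section \<open>Runs of arcs and the successor of a run\<close>

definition run_end :: "'d \<Rightarrow> 'd" where "run_end s = prv (N.stop s)"

text \<open>The fan of a run start \<open>s\<close> stops at a corner whose side is not an arc but
  whose preceding side is one. That preceding side is the last arc of exactly one run, which is
  found by inverting \<open>N.stop\<close>.\<close>

definition next_run :: "'d \<Rightarrow> 'd" where
  "next_run s = inv_into {d \<in> D. prv d \<notin> A} N.stop (R.stop s)"

lemma S_starts: "s \<in> S \<Longrightarrow> s \<in> N.starts" "s \<in> S \<Longrightarrow> s \<in> R.starts"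
  "s \<in> S \<Longrightarrow> s \<in> A" "s \<in> S \<Longrightarrow> prv s \<notin> A" "s \<in> S \<Longrightarrow> s \<in> D"
  using inD by (auto simp: S_def N_starts R_starts)

lemma finite_S: "finite S" using finite_A by (simp add: S_def)

lemma N_len_pos: "s \<in> S \<Longrightarrow> 0 < N.len s" using S_starts N.len_pos by auto
lemma R_len_pos: "s \<in> S \<Longrightarrow> 0 < R.len s" using S_starts R.len_pos by auto

lemma run_end: assumes s: "s \<in> S"
  shows "run_end s = (nxt ^^ (N.len s - 1)) s" "run_end s \<in> A" "nxt (run_end s) = N.stop s"
    "nxt (run_end s) \<notin> A"
proof -
  obtain k where k: "N.len s = Suc k" using N_len_pos[OF s] by (cases "N.len s") auto
  then have "(nxt ^^ k) s \<in> A" using N.len_stop(2)[of s k] S_starts[OF s] by auto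
  then show "run_end s = (nxt ^^ (N.len s - 1)) s" "run_end s \<in> A" "nxt (run_end s) = N.stop s"
     using k by (auto simp: run_end_def N.stop_def prv_nxt inD)
  then show "nxt (run_end s) \<notin> A" using N.len_stop(1)[of s] S_starts[OF s] by auto
qed

lemma bij_run_end: "bij_betw run_end S {d \<in> A. nxt d \<notin> A}"
proof (rule bij_betw_imageI)
  show inj: "inj_on run_end S"
  proof
    fix s t assume st: "s \<in> S" "t \<in> S" "run_end s = run_end t"
    then have "N.stop s = N.stop t" using run_end(3) by metis
    then show "s = t" using N.bij_stop st S_starts by (auto simp: bij_betw_def inj_on_def)
  qed
  show "run_end ` S = {d \<in> A. nxt d \<notin> A}"
  proof (intro equalityI subsetI)
    fix d assume d: "d \<in> {d \<in> A. nxt d \<notin> A}"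
    then have "nxt d \<in> D - A" by (auto intro: nxt_in inD)
    then obtain s where s: "s \<in> N.starts" "nxt d = N.stop s"
      using N.bij_stop by (auto simp: bij_betw_def)
    \<comment> \<open>A head outside \<open>A\<close> is a chain of length 0 and would equal
      \<open>nxt d\<close>. The side before a head is not an arc, whereas the side before
      \<open>nxt d\<close> is \<open>d\<close>.\<close>
    have "s \<in> A"
    proof (rule ccontr)
      assume "s \<notin> A"
      then have "N.len s = 0" by (intro N.len_eqI) auto
      then have "nxt d = s" using s by (simp add: N.stop_def)
      then show False using s d by (auto simp: N_starts prv_nxt inD)
    qed
    then have "s \<in> S" using s by (auto simp: S_def N_starts)
    moreover have "run_end s = d" using s d prv_nxt[of d] inD by (simp add: run_end_def)
    ultimately show "d \<in> run_end ` S" by auto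
  qed (use run_end in auto)
qed

lemma R_stop: assumes "s \<in> S"
  shows "R.stop s \<notin> A" "R.stop s \<in> D" "prv (R.stop s) \<in> A"
    "prv (R.stop s) = opp ((rot ^^ (R.len s - 1)) s)"
proof -
  show "R.stop s \<notin> A" and D: "R.stop s \<in> D" using R.len_stop(1)[of s] S_starts[OF assms] by auto
  obtain k where k: "R.len s = Suc k" using R_len_pos[OF assms] by (cases "R.len s") auto
  then have 1: "(rot ^^ k) s \<in> A" using R.len_stop(2)[of s k] S_starts[OF assms] by auto
  have "R.stop s = rot ((rot ^^ k) s)" using k by (simp add: R.stop_def)
  then show "prv (R.stop s) = opp ((rot ^^ (R.len s - 1)) s)" using k 1
    by (auto simp: rot_def prv_nxt inD opp_in)
  then show "prv (R.stop s) \<in> A" using 1 k by (auto intro: opp_in)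
qed

lemma next_run: assumes s: "s \<in> S"
  shows "next_run s \<in> S" "nxt (run_end (next_run s)) = R.stop s"
proof -
  have "nxt (prv (R.stop s)) = R.stop s" using R_stop(2)[OF s] nxt_prv by blast
  then have "prv (R.stop s) \<in> {d \<in> A. nxt d \<notin> A}" using R_stop(1,3)[OF s] by auto
  then have "prv (R.stop s) \<in> run_end ` S" using bij_run_end by (simp add: bij_betw_def)
  then obtain t where t: "t \<in> S" "run_end t = prv (R.stop s)" by auto
  then have "N.stop t = R.stop s" using run_end(3)[OF t(1)] R_stop(2)[OF s] nxt_prv by simp
  moreover have "inj_on N.stop {d \<in> D. prv d \<notin> A}"
    using N.bij_stop by (simp add: bij_betw_def N_starts)
  ultimately have "next_run s = t" using S_starts[OF t(1)] unfolding next_run_def N_starts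
    by (metis (mono_tags, lifting) inv_into_f_f)
  then show "next_run s \<in> S" "nxt (run_end (next_run s)) = R.stop s"
    using t(1) \<open>N.stop t = R.stop s\<close> run_end(3)[OF t(1)] by simp_all
qed

text \<open>\<open>next_run s\<close> determines \<open>R.stop s\<close>, and \<open>R.stop\<close>
  is injective; on a finite set this suffices.\<close>

lemma bij_next_run: "bij_betw next_run S S"
proof -
  have "inj_on next_run S"
  proof
    fix s t assume st: "s \<in> S" "t \<in> S" "next_run s = next_run t"
    then have "R.stop s = R.stop t" using next_run(2) by metis
    then show "s = t" using R.bij_stop st S_starts by (auto simp: bij_betw_def inj_on_def)
  qed
  then show ?thesis using next_run(1) finite_S endo_inj_surj[of S next_run] by (auto simp: bij_betw_def)
qed

section \<open>Fans around a marked point\<close>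

lemma pt_funpow_rot: "s \<in> R.starts \<Longrightarrow> j \<le> R.len s \<Longrightarrow> pt ((rot ^^ j) s) = pt s"
  by (induction j) (use R.len_stop(2) pt_rot in \<open>auto simp: rot_def\<close>)

text \<open>The chain from \<open>s\<close> is closed under \<open>rot\<close> in both directions:
  nothing leads into its head, and its last corner \<open>R.stop s\<close> does not belong to an
  arc. Then \<open>fan_connected\<close> makes it the whole set.\<close>

lemma fan_eq:
  assumes s: "s \<in> R.starts"
  shows "{d \<in> D. pt d = pt s} = (\<lambda>j. (rot ^^ j) s) ` {..R.len s}" (is "_ = ?G")
proof -
  have sD: "s \<in> D" "prv s \<notin> A" using s by (auto simp: R_starts)
  have in_A: "(rot ^^ j) s \<in> A" if "j < R.len s" for j using R.len_stop(2)[OF s that] .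
  have G: "?G \<subseteq> {d \<in> D. pt d = pt s}"
  proof -
    have "(rot ^^ j) s \<in> D" if "j \<le> R.len s" for j
      using that in_A[of j] inD R.len_stop(1)[OF s] by (cases "j = R.len s") (auto simp: R.stop_def)
    then show ?thesis using pt_funpow_rot[OF s] by auto
  qed
  have "?G = {d \<in> D. pt d = pt s}"
  proof (rule fan_connected[OF G])
    fix d assume d: "d \<in> A" "pt d = pt s"
    show "d \<in> ?G \<longleftrightarrow> nxt (opp d) \<in> ?G"
    proof
      assume "d \<in> ?G"
      then obtain j where j: "j \<le> R.len s" "d = (rot ^^ j) s" by auto
      have "j \<noteq> R.len s" using R.len_stop(1)[OF s] d j by (auto simp: R.stop_def)
      then show "nxt (opp d) \<in> ?G" using j by (intro image_eqI[of _ _ "Suc j"]) (auto simp: rot_def)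
    next
      assume "nxt (opp d) \<in> ?G"
      then obtain j where j: "j \<le> R.len s" "rot d = (rot ^^ j) s" by (auto simp: rot_def)
      have "rot d \<in> rot ` A" using d by auto
      then have "j \<noteq> 0" using j sD image_rot[of s] by (cases j) auto
      then obtain k where k: "j = Suc k" by (cases j) auto
      then have "d = (rot ^^ k) s" using j d in_A[of k] R.inj_f by (auto simp: inj_on_def)
      then show "d \<in> ?G" using j k by auto
    qed
  qed auto
  then show ?thesis by simp
qed

text \<open>Either the corner given by \<open>fan_boundary\<close> is already a head, or its
  preceding side is an arc and its own side is not. In the second case it is the end of a chain
  whose head lies at the same point.\<close>

lemma fan_start: assumes d: "d \<in> D" shows "\<exists>s \<in> R.starts. pt s = pt d"
proof -
  obtain d' where d': "d' \<in> D" "pt d' = pt d" "d' \<notin> A \<or> prv d' \<notin> A" using fan_boundary[OF d] by auto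
  show ?thesis
  proof (cases "prv d' \<in> A")
    case True
    then have "d' \<in> D - A" using d' by auto
    then obtain s where "s \<in> R.starts" "d' = R.stop s" using R.bij_stop by (auto simp: bij_betw_def)
    then show ?thesis using pt_funpow_rot[of s "R.len s"] d' by (auto simp: R.stop_def)
  qed (use d' R_starts in auto)
qed

lemma starts_pt_inj: assumes "s \<in> R.starts" "t \<in> R.starts" "pt s = pt t" shows "s = t"
proof -
  have "t \<in> (\<lambda>j. (rot ^^ j) s) ` {..R.len s}" using fan_eq[OF assms(1)] assms by (auto simp: R_starts)
  then obtain j where "j \<le> R.len s" "(rot ^^ j) s = (rot ^^ 0) t" by auto
  then show ?thesis
    using R.starts_eq[OF assms(1,2), of j 0] R.len_stop(2)[OF assms(1)] by auto
qed

text \<open>A corner between two non-arcs is a chain of length 0 and therefore its whole fan: a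
  marked point off the arcs is a corner of one polygon, once.\<close>

lemma trivial_fan:
  assumes "d \<in> D" "d \<notin> A" "prv d \<notin> A" "d' \<in> D" "pt d' = pt d" shows "d' = d"
proof -
  have d: "d \<in> R.starts" using assms by (simp add: R_starts)
  have "R.len d = 0" using assms by (intro R.len_eqI) auto
  then show ?thesis using fan_eq[OF d] assms by auto
qed

lemma inj_pt_S: "inj_on pt S"
  using starts_pt_inj S_starts by (auto simp: inj_on_def)

text \<open>For an angulation this becomes the set of marked points on arcs. If the head of a fan
  were not an arc, the fan would be a single corner between two non-arcs.\<close>

lemma pt_S: "pt ` S = pt ` {d \<in> D. d \<in> A \<or> prv d \<in> A}"
proof (intro equalityI subsetI)
  fix p assume "p \<in> pt ` {d \<in> D. d \<in> A \<or> prv d \<in> A}"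
  then obtain d where d: "d \<in> D" "d \<in> A \<or> prv d \<in> A" "p = pt d" by auto
  obtain s where s: "s \<in> R.starts" "pt s = p" using fan_start[OF d(1)] d by auto
  have "s \<in> A"
  proof (rule ccontr)
    assume "s \<notin> A"
    then have "d = s" using trivial_fan[of s d] s d by (auto simp: R_starts)
    then show False using \<open>s \<notin> A\<close> d s by (auto simp: R_starts)
  qed
  then show "p \<in> pt ` S" using s by (auto simp: S_def R_starts)
qed (use inD in \<open>auto simp: S_def\<close>)

lemma pt_next_run: "s \<in> S \<Longrightarrow> pt (nxt (run_end (next_run s))) = pt s"
  using next_run(2) pt_funpow_rot[of s "R.len s"] S_starts by (auto simp: R.stop_def)

lemma fan_position: assumes "d \<in> D" obtains s j where "s \<in> R.starts" "j \<le> R.len s" "d = (rot ^^ j) s"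
proof -
  obtain s where "s \<in> R.starts" "pt s = pt d" using fan_start[OF assms] by auto
  moreover from this have "d \<in> (\<lambda>j. (rot ^^ j) s) ` {..R.len s}" using fan_eq[of s] assms by auto
  ultimately show thesis using that by auto
qed

section \<open>Gaps: maximal sequences of non-arcs on a polygon\<close>

sublocale G: partial_injection D "D - A" nxt
proof
  show "inj_on nxt (D - A)" unfolding inj_on_def by (metis DiffD1 nxt_eq)
qed (use nxt_in finite_darts in auto)

lemma G_starts: "G.starts = {d \<in> D. prv d \<in> A}"
proof -
  have "d \<in> nxt ` (D - A) \<longleftrightarrow> prv d \<notin> A" if d: "d \<in> D" for d
  proof
    assume "prv d \<notin> A"
    then have "nxt (prv d) \<in> nxt ` (D - A)" using prv_in d by simp
    then show "d \<in> nxt ` (D - A)" using nxt_prv[OF d] by simp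
  qed (auto simp: prv_nxt)
  then show ?thesis unfolding G.starts_def by auto
qed

lemma nxt_run_end: assumes "s \<in> S" shows "nxt (run_end s) \<in> G.starts" "nxt (run_end s) \<in> D - A"
  using run_end(2,4)[OF assms] inD nxt_in prv_nxt by (auto simp: G_starts)

definition gap :: "'d \<Rightarrow> nat" where "gap s = G.len (nxt (run_end s))"

lemma gap: assumes s: "s \<in> S"
  shows "0 < gap s" "i < gap s \<Longrightarrow> (nxt ^^ i) (nxt (run_end s)) \<in> D - A"
    "(nxt ^^ gap s) (nxt (run_end s)) \<in> S"
proof -
  note g = G.len_stop[OF nxt_run_end(1)[OF s]]
  show in_gap: "i < gap s \<Longrightarrow> (nxt ^^ i) (nxt (run_end s)) \<in> D - A" for i using g(2) by (simp add: gap_def)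
  show pos: "0 < gap s" unfolding gap_def by (rule G.len_pos[OF nxt_run_end(2)[OF s] nxt_run_end(1)[OF s]])
  then obtain q where q: "gap s = Suc q" by (cases "gap s") auto
  have "prv ((nxt ^^ gap s) (nxt (run_end s))) = (nxt ^^ q) (nxt (run_end s))"
    using in_gap[of q] q prv_nxt by simp
  then show "(nxt ^^ gap s) (nxt (run_end s)) \<in> S" using in_gap[of q] q g(1) by (auto simp: S_def gap_def G.stop_def)
qed

text \<open>Induction along the polygon. A non-arc after an arc opens the gap of the run that ends
  there, and going on inside a gap stays in it until the next run begins. The arc \<open>a\<close>
  matters as a starting point, because gaps are indexed by runs.\<close>

lemma gap_cover:
  assumes a: "a \<in> A"
  shows "(nxt ^^ t) a \<in> A \<or> (\<exists>s \<in> S. \<exists>i < gap s. (nxt ^^ t) a = (nxt ^^ i) (nxt (run_end s)))"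
proof (induction t)
  case (Suc t)
  show ?case
  proof (cases "(nxt ^^ Suc t) a \<in> A")
    case False
    from Suc show ?thesis
    proof
      assume "(nxt ^^ t) a \<in> A"
      then have "(nxt ^^ t) a \<in> run_end ` S" using False bij_run_end by (simp add: bij_betw_def)
      then obtain s where s: "s \<in> S" "(nxt ^^ t) a = run_end s" by auto
      then have "(nxt ^^ Suc t) a = (nxt ^^ 0) (nxt (run_end s))" by simp
      then show ?thesis using s gap(1) by blast
    next
      assume "\<exists>s \<in> S. \<exists>i < gap s. (nxt ^^ t) a = (nxt ^^ i) (nxt (run_end s))"
      then obtain s i where s: "s \<in> S" "i < gap s" "(nxt ^^ t) a = (nxt ^^ i) (nxt (run_end s))" by auto
      then have e: "(nxt ^^ Suc t) a = (nxt ^^ Suc i) (nxt (run_end s))" by simp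
      then have "Suc i \<noteq> gap s" using False e gap(3)[OF s(1)] S_starts(3) by metis
      then have "Suc i < gap s" using s(2) by simp
      then show ?thesis using s(1) e by blast
    qed
  qed simp
qed (use a in simp)

lemma gap_unique:
  assumes "s \<in> S" "t \<in> S" "i < gap s" "j < gap t" "(nxt ^^ i) (nxt (run_end s)) = (nxt ^^ j) (nxt (run_end t))"
  shows "s = t \<and> i = j"
proof -
  have "nxt (run_end s) = nxt (run_end t) \<and> i = j"
    using assms gap(2) by (intro G.starts_eq nxt_run_end) auto
  then have "run_end s = run_end t" "i = j" using nxt_eq run_end(2) assms inD by auto
  then show ?thesis using bij_run_end assms by (auto simp: bij_betw_def inj_on_def)
qed

section \<open>Orbits of the successor map\<close>

definition run_orbit :: "'d \<Rightarrow> 'd set" where "run_orbit s = range (\<lambda>i. (next_run ^^ i) s)"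

lemma funpow_next_run: "s \<in> S \<Longrightarrow> (next_run ^^ i) s \<in> S"
  by (induction i) (auto intro: next_run(1))

lemma run_orbit_subset: "s \<in> S \<Longrightarrow> run_orbit s \<subseteq> S"
  by (auto simp: run_orbit_def funpow_next_run)

lemma run_orbit_self: "s \<in> run_orbit s"
  unfolding run_orbit_def by (rule range_eqI[of _ _ 0]) simp

lemma run_orbit_step: assumes "s \<in> S" "t \<in> run_orbit s" shows "run_orbit t = run_orbit s"
proof -
  obtain i where t: "t = (next_run ^^ i) s" using assms(2) by (auto simp: run_orbit_def)
  note orb = permutation_orbit[OF finite_S bij_next_run assms(1)]
  obtain p where p: "1 \<le> p" "(next_run ^^ p) s = s" using orb(1,2) by blast
  have per: "(next_run ^^ (p * m)) s = s" for m
    by (induction m) (simp_all add: funpow_add p)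
  have "(next_run ^^ j) s \<in> run_orbit t" for j
  proof -
    \<comment> \<open>Adding the multiple \<open>p * i\<close> of the period makes it possible to
      step forward from the \<open>i\<close>-th iterate \<open>t\<close> to the \<open>j\<close>-th
      one even if \<open>j < i\<close>.\<close>
    have "i \<le> p * i + j" using p(1) by (simp add: trans_le_add1)
    then have "(next_run ^^ (p * i + j - i)) t = (next_run ^^ (p * i + j)) s"
      unfolding t by (metis comp_apply funpow_add le_add_diff_inverse2)
    also have "\<dots> = (next_run ^^ j) s" using per by (metis add.commute comp_apply funpow_add)
    finally show ?thesis unfolding run_orbit_def by (metis rangeI)
  qed
  moreover have "(next_run ^^ j) t \<in> run_orbit s" for j
    unfolding t run_orbit_def by (metis comp_apply funpow_add rangeI)
  ultimately show ?thesis unfolding run_orbit_def[of s] run_orbit_def[of t] by (auto simp: run_orbit_def)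
qed

end

section \<open>Threads of a gluing of polygons\<close>

lemma (in pre_digraph) cas_successively:
  "p \<noteq> [] \<Longrightarrow> (\<exists>v. cas u p v) \<longleftrightarrow> tail G (hd p) = u \<and> successively (\<lambda>\<alpha> \<beta>. head G \<alpha> = tail G \<beta>) p"
proof (induction p arbitrary: u)
  case (Cons a p) then show ?case by (cases p) (auto simp: eq_commute)
qed simp

lemma successively_funpow:
  assumes "successively (\<lambda>\<alpha> \<beta>. \<beta> = g \<alpha>) p" "i < length p" shows "p ! i = (g ^^ i) (hd p)"
  using assms(2)
proof (induction i)
  case 0 then show ?case by (simp add: hd_conv_nth)
next
  case (Suc i) then show ?case using assms(1) by (auto simp: successively_conv_nth)
qed

text \<open>An arrow is named by the dart of its source side. The assumption
  \<open>path_in_ideal\<close>, that a path lies in the ideal exactly if two successive arrows sit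
  at neighbouring corners, separates the combinatorics of threads from the path algebra.\<close>

locale dart_quiver = dart_complex +
  fixes Q :: "('b, 'a) pre_digraph" and I :: "(('b, 'a) qpath \<Rightarrow> 'k::field) set"
    and \<sigma> \<epsilon> :: "'a \<Rightarrow> int"
  assumes Q: "Q = \<lparr>verts = E ` A, arcs = {d \<in> A. nxt d \<in> A}, tail = E, head = (\<lambda>d. E (nxt d))\<rparr>"
    and path_in_ideal: "(u, p) \<in> qpaths Q \<Longrightarrow>
      path_elem (u, p) \<in> I \<longleftrightarrow> \<not> successively (\<lambda>\<alpha> \<beta>. \<beta> \<noteq> nxt \<alpha>) p"
    and signs: "sign_functions Q I \<sigma> \<epsilon>"
begin

lemma Q_simps: "verts Q = E ` A" "arcs Q = {d \<in> A. nxt d \<in> A}" "tail Q = E" "head Q = (\<lambda>d. E (nxt d))"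
  by (auto simp: Q)

lemma qpaths_iff: assumes "p \<noteq> []"
  shows "(u, p) \<in> qpaths Q \<longleftrightarrow> E (hd p) = u \<and> set p \<subseteq> arcs Q \<and> successively (\<lambda>\<alpha> \<beta>. E (nxt \<alpha>) = E \<beta>) p"
proof -
  have "hd p \<in> set p" using assms by simp
  then show ?thesis using pre_digraph.cas_successively[OF assms, of Q u]
    by (auto simp: qpaths_def pre_digraph.awalk_def Q_simps)
qed

lemma in_relation_iff: "in_relation Q I \<alpha> \<beta> \<longleftrightarrow> \<alpha> \<in> arcs Q \<and> \<beta> \<in> arcs Q \<and> \<beta> = nxt \<alpha>"
  using path_in_ideal[of "E \<alpha>" "[\<alpha>, \<beta>]"]
  by (auto simp: in_relation_def qpaths_iff Q_simps)

text \<open>When \<open>\<alpha>\<close> ends at the arc where \<open>\<beta>\<close> starts,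
  \<open>\<beta>\<close> is one of the two sides of this arc. The side \<open>nxt \<alpha>\<close>
  gives a relation, so a permitted path must cross to \<open>opp (nxt \<alpha>)\<close> and turns
  around a marked point.\<close>

lemma permitted_path_iff:
  "permitted_path Q I p \<longleftrightarrow> p \<noteq> [] \<and> set p \<subseteq> arcs Q \<and> successively (\<lambda>\<alpha> \<beta>. \<beta> = opp (nxt \<alpha>)) p"
proof (cases "p \<noteq> [] \<and> set p \<subseteq> arcs Q")
  case True
  then have arr: "p ! i \<in> A" "nxt (p ! i) \<in> A" if "i < length p" for i
    using nth_mem[OF that] by (auto simp: Q_simps subset_iff)
  have "(E (nxt (p ! i)) = E (p ! Suc i) \<and> p ! Suc i \<noteq> nxt (p ! i)) \<longleftrightarrow> p ! Suc i = opp (nxt (p ! i))"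
    if "Suc i < length p" for i
    using E_eq[of "nxt (p ! i)" "p ! Suc i"] arr[of i] arr[of "Suc i"]
      opp_neq[of "nxt (p ! i)"] that by auto
  then have "successively (\<lambda>\<alpha> \<beta>. E (nxt \<alpha>) = E \<beta>) p \<and> successively (\<lambda>\<alpha> \<beta>. \<beta> \<noteq> nxt \<alpha>) p \<longleftrightarrow>
      successively (\<lambda>\<alpha> \<beta>. \<beta> = opp (nxt \<alpha>)) p"
    unfolding successively_conv_nth by blast
  then show ?thesis using True path_in_ideal[of "E (hd p)" p] qpaths_iff[of p "E (hd p)"]
    by (auto simp: permitted_path_def Q_simps)
qed (auto simp: permitted_path_def qpaths_iff)

lemma forbidden_path_iff:
  "forbidden_path Q I p \<longleftrightarrow> p \<noteq> [] \<and> set p \<subseteq> arcs Q \<and> distinct p \<and> successively (\<lambda>\<alpha> \<beta>. \<beta> = nxt \<alpha>) p"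
proof -
  have "successively (in_relation Q I) p \<longleftrightarrow> successively (\<lambda>\<alpha> \<beta>. \<beta> = nxt \<alpha>) p" if "set p \<subseteq> arcs Q"
    using that by (intro successively_cong) (auto simp: in_relation_iff)
  then show ?thesis by (auto simp: forbidden_path_def)
qed

text \<open>With the arcs of the fan numbered from 0, the arrow for \<open>j\<close> leads from arc
  \<open>j - 1\<close> to arc \<open>j\<close>: its dart \<open>prv ((rot ^^ j) s)\<close> is the
  other side of arc \<open>j - 1\<close>. So a fan of \<open>l\<close> arcs has \<open>l - 1\<close>
  arrows.\<close>

definition fan_arrows :: "'a \<Rightarrow> 'a list" where
  "fan_arrows s = map (\<lambda>j. prv ((rot ^^ j) s)) [1..<R.len s]"

definition run_arrows :: "'a \<Rightarrow> 'a list" where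
  "run_arrows s = map (\<lambda>j. (nxt ^^ j) s) [0..<N.len s - 1]"

lemma prv_funpow_rot: assumes "s \<in> R.starts" "j < R.len s"
  shows "prv ((rot ^^ Suc j) s) = opp ((rot ^^ j) s)"
  using assms R.len_stop(2)[OF assms] by (simp add: rot_def prv_nxt inD opp_in)

text \<open>An arrow in front would satisfy \<open>nxt \<beta> = s\<close>, but the side before
  \<open>s\<close> is not an arc. An arrow behind would have \<open>R.stop s\<close> as target side,
  which is not an arc either.\<close>

lemma permitted_fan:
  assumes s: "s \<in> S" and len: "1 < R.len s"
  shows "permitted_path Q I (fan_arrows s)"
    "\<beta> \<in> arcs Q \<Longrightarrow> \<not> permitted_path Q I (\<beta> # fan_arrows s)"
    "\<beta> \<in> arcs Q \<Longrightarrow> \<not> permitted_path Q I (fan_arrows s @ [\<beta>])"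
proof -
  note st = S_starts[OF s]
  have A: "(rot ^^ j) s \<in> A" if "j < R.len s" for j using R.len_stop(2)[OF st(2) that] .
  have nxt_prv_rot: "nxt (prv ((rot ^^ j) s)) = (rot ^^ j) s" if "j < R.len s" for j
    using A[OF that] nxt_prv inD by auto
  have pA: "prv ((rot ^^ j) s) \<in> A" if "1 \<le> j" "j \<le> R.len s" for j
    using that prv_funpow_rot[OF st(2), of "j - 1"] A[of "j - 1"] opp_in by auto
  show "permitted_path Q I (fan_arrows s)"
    unfolding permitted_path_iff
  proof (intro conjI)
    show "fan_arrows s \<noteq> []" using len by (simp add: fan_arrows_def)
    show "set (fan_arrows s) \<subseteq> arcs Q" using pA A nxt_prv_rot by (auto simp: fan_arrows_def Q_simps)
    have "prv ((rot ^^ Suc j) s) = opp (nxt (prv ((rot ^^ j) s)))" if "j < R.len s" for j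
      by (simp only: prv_funpow_rot[OF st(2) that] nxt_prv_rot[OF that])
    then show "successively (\<lambda>\<alpha> \<beta>. \<beta> = opp (nxt \<alpha>)) (fan_arrows s)"
      by (auto simp: fan_arrows_def successively_conv_nth simp del: funpow.simps)
  qed
  have hd: "hd (fan_arrows s) = opp s"
    using len prv_funpow_rot[OF st(2), of 0] by (simp add: fan_arrows_def hd_map)
  have last: "last (fan_arrows s) = prv ((rot ^^ (R.len s - 1)) s)"
    using len by (simp add: fan_arrows_def last_map)
  have ne: "fan_arrows s \<noteq> []" using len by (simp add: fan_arrows_def)
  show "\<not> permitted_path Q I (\<beta> # fan_arrows s)" if "\<beta> \<in> arcs Q"
  proof
    assume "permitted_path Q I (\<beta> # fan_arrows s)"
    then have "opp s = opp (nxt \<beta>)" using ne hd by (simp add: permitted_path_iff successively_Cons)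
    then have "nxt \<beta> = s" using that st opp_eq by (auto simp: Q_simps)
    then show False using that st prv_nxt inD by (auto simp: Q_simps)
  qed
  show "\<not> permitted_path Q I (fan_arrows s @ [\<beta>])" if "\<beta> \<in> arcs Q"
  proof
    assume "permitted_path Q I (fan_arrows s @ [\<beta>])"
    then have "\<beta> = opp (nxt (prv ((rot ^^ (R.len s - 1)) s)))"
      using ne last by (simp add: permitted_path_iff successively_append_iff)
    then have "nxt \<beta> = rot ((rot ^^ (R.len s - 1)) s)" using nxt_prv_rot[of "R.len s - 1"] len by (simp add: rot_def)
    also have "\<dots> = R.stop s" using len unfolding R.stop_def
      by (metis One_nat_def Suc_pred funpow.simps(2) less_trans o_apply zero_less_one)
    finally show False using R.len_stop(1)[OF st(2)] that by (auto simp: Q_simps)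
  qed
qed

text \<open>The target side of the first arrow has a position \<open>j\<close> in its fan.
  Maximality to the left forces \<open>j = 1\<close>, the arrows then follow the fan, and maximality
  to the right makes them exhaust it.\<close>

lemma permitted_maximal:
  assumes p: "permitted_path Q I p"
    and max: "\<forall>\<beta> \<in> arcs Q. \<not> permitted_path Q I (\<beta> # p) \<and> \<not> permitted_path Q I (p @ [\<beta>])"
  obtains s where "s \<in> S" "1 < R.len s" "p = fan_arrows s"
proof -
  from p have ne: "p \<noteq> []" and arr: "set p \<subseteq> arcs Q" and
    succ: "successively (\<lambda>\<alpha> \<beta>. \<beta> = opp (nxt \<alpha>)) p" by (auto simp: permitted_path_iff)
  have hdp: "hd p \<in> A" "nxt (hd p) \<in> A" "hd p \<in> D" using ne arr inD by (auto simp: Q_simps subset_iff)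
  obtain s j where s: "s \<in> R.starts" and j: "j \<le> R.len s" "nxt (hd p) = (rot ^^ j) s"
    using fan_position[of "nxt (hd p)"] hdp inD by metis
  have A: "(rot ^^ i) s \<in> A" if "i < R.len s" for i using R.len_stop(2)[OF s that] .
  have j_less: "j < R.len s" using j hdp R.len_stop(1)[OF s] by (cases "j = R.len s") (auto simp: R.stop_def)
  have j0: "j \<noteq> 0" using j hdp s prv_nxt[of "hd p"] by (cases j) (auto simp: R_starts)
  have s_S: "s \<in> S" using A[of 0] j_less j0 s by (auto simp: S_def R_starts)
  have j1: "j = 1"
  proof (rule ccontr)
    assume "j \<noteq> 1"
    then obtain k where k: "j = Suc (Suc k)" using j0 by (metis One_nat_def not0_implies_Suc)
    define c where "c = (rot ^^ Suc k) s"
    have "c \<in> A" "prv c \<in> A"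
      using A[of "Suc k"] prv_funpow_rot[OF s, of k] A[of k] j_less k opp_in
      by (auto simp: c_def simp del: funpow.simps)
    then have c: "c \<in> A" "prv c \<in> A" "nxt (prv c) = c" using nxt_prv inD by auto
    have "nxt (hd p) = nxt (opp c)" using j k by (simp add: c_def rot_def)
    then have "hd p = opp (nxt (prv c))" using c hdp nxt_eq inD opp_in by auto
    then have "permitted_path Q I (prv c # p)" using p c ne
      by (auto simp: permitted_path_iff successively_Cons Q_simps)
    then show False using max c by (auto simp: Q_simps)
  qed
  have pnth: "Suc i < R.len s \<and> p ! i = prv ((rot ^^ Suc i) s)" if "i < length p" for i
    using that
  proof (induction i)
    case 0
    have "p ! 0 = prv (nxt (hd p))" using ne hdp prv_nxt by (simp add: hd_conv_nth)
    then show ?case using j j1 j_less by simp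
  next
    case (Suc i)
    then have IH: "Suc i < R.len s" "p ! i = prv ((rot ^^ Suc i) s)" by auto
    have "p ! Suc i = opp (nxt (p ! i))" using succ Suc.prems by (simp add: successively_conv_nth)
    then have opp: "p ! Suc i = opp ((rot ^^ Suc i) s)" using IH A[of "Suc i"] nxt_prv inD by auto
    also have "\<dots> = prv ((rot ^^ Suc (Suc i)) s)" using prv_funpow_rot[OF s, of "Suc i"] IH by simp
    finally have eq: "p ! Suc i = prv ((rot ^^ Suc (Suc i)) s)" .
    have "nxt (p ! Suc i) = (rot ^^ Suc (Suc i)) s" using A[OF IH(1)] opp_in inD opp by (simp add: rot_def)
    moreover have "nxt (p ! Suc i) \<in> A" using arr nth_mem[OF Suc.prems] by (auto simp: Q_simps)
    ultimately have "Suc (Suc i) \<noteq> R.len s"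
      using R.len_stop(1)[OF s] by (auto simp: R.stop_def simp del: funpow.simps)
    then show ?case using eq IH by auto
  qed
  have "Suc (length p) = R.len s"
  proof (rule ccontr)
    assume "Suc (length p) \<noteq> R.len s"
    moreover have "Suc (length p - 1) < R.len s" using pnth[of "length p - 1"] ne by auto
    ultimately have l: "Suc (length p) < R.len s" using ne by (cases p) auto
    define b where "b = prv ((rot ^^ Suc (length p)) s)"
    have lp: "0 < length p" using ne by simp
    have "last p = prv ((rot ^^ length p) s)" using pnth[of "length p - 1"] ne lp by (simp add: last_conv_nth)
    then have "b = opp (nxt (last p))" using prv_funpow_rot[OF s, of "length p"] l A[of "length p"] nxt_prv inD
      by (auto simp: b_def)
    moreover have "b \<in> arcs Q"
      using A[of "Suc (length p)"] l prv_funpow_rot[OF s, of "length p"] A[of "length p"] opp_in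
        nxt_prv[of "(rot ^^ Suc (length p)) s"] inD by (auto simp: b_def Q_simps simp del: funpow.simps)
    ultimately have "permitted_path Q I (p @ [b])" "b \<in> arcs Q" using p ne
      by (auto simp: permitted_path_iff successively_append_iff)
    then show False using max by auto
  qed
  then have "p = fan_arrows s" using pnth by (intro nth_equalityI) (auto simp: fan_arrows_def simp del: funpow.simps)
  moreover have "1 < R.len s" using \<open>Suc (length p) = R.len s\<close> ne by (cases p) auto
  ultimately show thesis using that s_S by blast
qed

text \<open>The arcs of a run are distinct as members of one chain. The sides before and after the
  run are not arcs, which excludes extensions as well as closing up to a cycle.\<close>

lemma forbidden_run:
  assumes s: "s \<in> S" and len: "1 < N.len s"
  shows "forbidden_path Q I (run_arrows s)" "\<not> relation_cycle Q I (run_arrows s)"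
    "\<beta> \<in> arcs Q \<Longrightarrow> \<not> forbidden_path Q I (\<beta> # run_arrows s)"
    "\<beta> \<in> arcs Q \<Longrightarrow> \<not> forbidden_path Q I (run_arrows s @ [\<beta>])"
proof -
  note st = S_starts[OF s]
  have A: "(nxt ^^ j) s \<in> A" if "j < N.len s" for j using N.len_stop(2)[OF st(1) that] .
  have ne: "run_arrows s \<noteq> []" using len by (simp add: run_arrows_def)
  have hd: "hd (run_arrows s) = s" using len by (simp add: run_arrows_def hd_map)
  have last: "nxt (last (run_arrows s)) = run_end s"
  proof -
    have "last (run_arrows s) = (nxt ^^ (N.len s - 2)) s" using len by (simp add: run_arrows_def last_map numeral_2_eq_2)
    moreover have "N.len s - 1 = Suc (N.len s - 2)" using len by simp
    ultimately show ?thesis using run_end(1)[OF s] by simp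
  qed
  show fp: "forbidden_path Q I (run_arrows s)"
    unfolding forbidden_path_iff
  proof (intro conjI ne)
    show "set (run_arrows s) \<subseteq> arcs Q" using A[of "Suc _"] A by (auto simp: run_arrows_def Q_simps)
    have "i = j" if "i < N.len s" "j < N.len s" "(nxt ^^ i) s = (nxt ^^ j) s" for i j
      using N.starts_eq[OF st(1) st(1), of i j] that A by auto
    then show "distinct (run_arrows s)" by (auto simp: run_arrows_def distinct_map inj_on_def)
    show "successively (\<lambda>\<alpha> \<beta>. \<beta> = nxt \<alpha>) (run_arrows s)"
      by (auto simp: run_arrows_def successively_conv_nth)
  qed
  have no: "s \<noteq> nxt \<beta>" if "\<beta> \<in> arcs Q" for \<beta> using that st prv_nxt inD by (auto simp: Q_simps)
  show "\<not> relation_cycle Q I (run_arrows s)"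
    using no[of "last (run_arrows s)"] hd by (auto simp: relation_cycle_def in_relation_iff)
  show "\<not> forbidden_path Q I (\<beta> # run_arrows s)" if "\<beta> \<in> arcs Q"
    using no[OF that] ne hd by (simp add: forbidden_path_iff successively_Cons)
  show "\<not> forbidden_path Q I (run_arrows s @ [\<beta>])" if "\<beta> \<in> arcs Q"
    using that ne last run_end[OF s] by (auto simp: forbidden_path_iff successively_append_iff Q_simps)
qed

text \<open>The path follows \<open>nxt\<close> along one polygon. If the side before its first
  arrow were an arc, it would be an arrow that can be put in front, unless it already occurs in the
  path; distinctness then makes it the last one, and the path closes up to a relation cycle.\<close>

lemma forbidden_maximal:
  assumes p: "forbidden_path Q I p" and cyc: "\<not> relation_cycle Q I p"
    and max: "\<forall>\<beta> \<in> arcs Q. \<not> forbidden_path Q I (\<beta> # p) \<and> \<not> forbidden_path Q I (p @ [\<beta>])"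
  obtains s where "s \<in> S" "1 < N.len s" "p = run_arrows s"
proof -
  from p have ne: "p \<noteq> []" and arr: "set p \<subseteq> arcs Q" and dist: "distinct p" and
    succ: "successively (\<lambda>\<alpha> \<beta>. \<beta> = nxt \<alpha>) p" by (auto simp: forbidden_path_iff)
  define s where "s = hd p"
  have pnth: "p ! i = (nxt ^^ i) s" if "i < length p" for i
    using successively_funpow[OF succ that] by (simp add: s_def)
  have s_set: "s \<in> set p" using ne by (simp add: s_def)
  then have sA: "s \<in> A" "s \<in> D" using arr inD by (auto simp: Q_simps)
  have sn: "s = p ! 0" using ne by (simp add: s_def hd_conv_nth)
  have "prv s \<notin> A"
  proof
    assume pA: "prv s \<in> A"
    then have arc: "prv s \<in> arcs Q" using sA nxt_prv by (auto simp: Q_simps)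
    have "prv s \<in> set p"
    proof (rule ccontr)
      assume "prv s \<notin> set p"
      then have "forbidden_path Q I (prv s # p)" using p ne arc nxt_prv[OF sA(2)]
        by (auto simp: forbidden_path_iff successively_Cons s_def)
      then show False using max arc by auto
    qed
    then obtain i where i: "i < length p" "prv s = p ! i" by (auto simp: in_set_conv_nth)
    have ns: "nxt (p ! i) = s" using i nxt_prv sA by metis
    show False
    proof (cases "Suc i < length p")
      case True
      then have "p ! Suc i = p ! 0" using ns sn succ by (simp add: successively_conv_nth)
      then show False using nth_eq_iff_index_eq[OF dist True, of 0] ne by simp
    next
      case False
      then have "length p = Suc i" using i by simp
      then have "last p = p ! i" using ne by (simp add: last_conv_nth)
      then have "relation_cycle Q I p" using p ns s_set arr arc i
        by (auto simp: relation_cycle_def in_relation_iff s_def)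
      then show False using cyc by simp
    qed
  qed
  then have s: "s \<in> S" using sA by (simp add: S_def)
  note st = S_starts[OF s]
  have pA: "(nxt ^^ i) s \<in> A" if "i \<le> length p" for i
  proof (cases i)
    case 0 then show ?thesis using sA by simp
  next
    case (Suc k)
    then have "p ! k \<in> set p" using that by auto
    then have "nxt (p ! k) \<in> A" using arr by (auto simp: Q_simps)
    then show ?thesis using pnth[of k] Suc that by simp
  qed
  have "length p < N.len s"
    using pA[of "N.len s"] N.len_stop(1)[OF st(1)] by (auto simp: N.stop_def not_less[symmetric])
  moreover have "\<not> Suc (length p) < N.len s"
  proof
    assume l: "Suc (length p) < N.len s"
    define b where "b = (nxt ^^ length p) s"
    have "b \<in> arcs Q" using N.len_stop(2)[OF st(1), of "Suc (length p)"] N.len_stop(2)[OF st(1), of "length p"] l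
      by (auto simp: b_def Q_simps)
    moreover have "b \<notin> set p"
    proof
      assume "b \<in> set p"
      then obtain i where "i < length p" "(nxt ^^ length p) s = (nxt ^^ i) s"
        using pnth by (auto simp: in_set_conv_nth b_def)
      then show False using N.starts_eq[OF st(1) st(1), of "length p" i] pA by auto
    qed
    moreover have "b = nxt (last p)"
    proof -
      obtain k where "length p = Suc k" using ne by (cases p) auto
      then show ?thesis using pnth[of k] ne by (simp add: b_def last_conv_nth)
    qed
    ultimately have "forbidden_path Q I (p @ [b])" "b \<in> arcs Q" using p ne
      by (auto simp: forbidden_path_iff successively_append_iff)
    then show False using max by auto
  qed
  ultimately have "Suc (length p) = N.len s" by simp
  then have "p = run_arrows s" using pnth by (intro nth_equalityI) (auto simp: run_arrows_def)
  moreover have "1 < N.len s" using \<open>Suc (length p) = N.len s\<close> ne by (cases p) auto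
  ultimately show thesis using that s by blast
qed

end

section \<open>Signs on the two sides of an arc\<close>

context dart_quiver
begin

text \<open>The sign functions are extended from arrows to sides: \<open>out_sign d\<close> stands for the value of
  \<open>\<sigma>\<close> at the (possibly missing) arrow that starts at the side \<open>d\<close>, and \<open>in_sign d\<close> for the value
  of \<open>\<epsilon>\<close> at the one that ends there. Only if both of them exist for one of the two sides of an arc
  and neither for the other one can the two signs differ.\<close>
definition out_sign :: "'a \<Rightarrow> int" where
  "out_sign d = (if nxt d \<in> A then \<sigma> d else if nxt (opp d) \<in> A then - \<sigma> (opp d)
     else if prv d \<in> A then \<epsilon> (prv d) else if prv (opp d) \<in> A then - \<epsilon> (prv (opp d))
     else if d = (SOME d'. d' \<in> A \<and> E d' = E d) then 1 else -1)"

definition in_sign :: "'a \<Rightarrow> int" where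
  "in_sign d = (if prv d \<in> A then \<epsilon> (prv d) else if prv (opp d) \<in> A then - \<epsilon> (prv (opp d))
     else out_sign d)"

lemma arrow_iff: "d \<in> A \<Longrightarrow> d \<in> arcs Q \<longleftrightarrow> nxt d \<in> A"
  "d \<in> A \<Longrightarrow> prv d \<in> arcs Q \<longleftrightarrow> prv d \<in> A"
  using nxt_prv inD by (auto simp: Q_simps)

lemma prv_eq: "d \<in> D \<Longrightarrow> d' \<in> D \<Longrightarrow> prv d = prv d' \<longleftrightarrow> d = d'"
  by (metis nxt_prv)

text \<open>This and the next two lemmas are the three sign conditions at one arc, read off its
  sides: two arrows starting there, two arrows ending there, and an arrow entering at one side
  followed by one leaving from the other, which is not a relation.\<close>

lemma sigma_opp: assumes "d \<in> A" "nxt d \<in> A" "nxt (opp d) \<in> A" shows "\<sigma> (opp d) = - \<sigma> d"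
proof -
  have "opp d \<in> arcs Q" "d \<in> arcs Q" "tail Q (opp d) = tail Q d"
    using assms arrow_iff opp_in E_opp by (auto simp: Q_simps)
  then show ?thesis using signs opp_neq[OF assms(1)] unfolding sign_functions_def by blast
qed

lemma epsilon_opp: assumes "d \<in> A" "prv d \<in> A" "prv (opp d) \<in> A" shows "\<epsilon> (prv (opp d)) = - \<epsilon> (prv d)"
proof -
  have "prv (opp d) \<in> arcs Q" "prv d \<in> arcs Q" using assms arrow_iff opp_in by auto
  moreover have "head Q (prv (opp d)) = head Q (prv d)"
    using assms nxt_prv opp_in inD E_opp by (auto simp: Q_simps)
  moreover have "prv (opp d) \<noteq> prv d" using prv_eq opp_neq assms inD opp_in by auto
  ultimately show ?thesis using signs unfolding sign_functions_def by blast
qed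

lemma sigma_epsilon: assumes "d \<in> A" "prv d \<in> A" "nxt (opp d) \<in> A" shows "\<sigma> (opp d) = - \<epsilon> (prv d)"
proof -
  have *: "prv d \<in> arcs Q" "opp d \<in> arcs Q" using assms arrow_iff opp_in by auto
  have "\<not> in_relation Q I (prv d) (opp d)" using assms opp_neq nxt_prv inD by (auto simp: in_relation_iff)
  moreover have "tail Q (opp d) = head Q (prv d)" using assms nxt_prv inD E_opp by (auto simp: Q_simps)
  ultimately show ?thesis using signs * unfolding sign_functions_def in_relation_def by auto
qed

lemma sign_values: assumes "d \<in> A"
  shows "out_sign d \<in> {-1, 1}" "in_sign d \<in> {-1, 1}"
proof -
  have *: "\<alpha> \<in> arcs Q \<Longrightarrow> (\<sigma> \<alpha> = -1 \<or> \<sigma> \<alpha> = 1) \<and> (\<epsilon> \<alpha> = -1 \<or> \<epsilon> \<alpha> = 1)" for \<alpha>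
    using signs unfolding sign_functions_def by auto
  show 1: "out_sign d \<in> {-1, 1}"
    using *[of d] *[of "opp d"] *[of "prv d"] *[of "prv (opp d)"] arrow_iff[OF assms]
      arrow_iff[OF opp_in[OF assms]] by (auto simp: out_sign_def)
  then show "in_sign d \<in> {-1, 1}"
    using *[of "prv d"] *[of "prv (opp d)"] arrow_iff[OF assms]
      arrow_iff[OF opp_in[OF assms]] by (auto simp: in_sign_def)
qed

text \<open>Serves the isolated vertices: no arrow fixes a sign there, and the last case of
  \<open>out_sign\<close> tells the two sides apart by an arbitrary choice.\<close>

lemma choice_opp: assumes "d \<in> A"
  shows "(opp d = (SOME d'. d' \<in> A \<and> E d' = E (opp d))) \<longleftrightarrow> d \<noteq> (SOME d'. d' \<in> A \<and> E d' = E d)"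
proof -
  have "(SOME d'. d' \<in> A \<and> E d' = E d) \<in> A \<and> E (SOME d'. d' \<in> A \<and> E d' = E d) = E d"
    by (rule someI[of _ d]) (use assms in auto)
  then show ?thesis using E_eq[OF assms] E_opp[OF assms] opp_neq[OF assms] by metis
qed

lemma out_sign_opp: assumes "d \<in> A" shows "out_sign (opp d) = - out_sign d"
  using sigma_opp[OF assms] epsilon_opp[OF assms] choice_opp[OF assms] opp_opp[OF assms]
  by (simp add: out_sign_def)

lemma in_sign_opp: assumes "d \<in> A" shows "in_sign (opp d) = - in_sign d"
  using epsilon_opp[OF assms] out_sign_opp[OF assms] opp_opp[OF assms] by (simp add: in_sign_def)

lemma out_sign_arrow: "nxt d \<in> A \<Longrightarrow> out_sign d = \<sigma> d"
  by (simp add: out_sign_def)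

lemma in_sign_arrow: "prv d \<in> A \<Longrightarrow> in_sign d = \<epsilon> (prv d)"
  by (simp add: in_sign_def)

text \<open>If an arrow enters at the other side and one leaves from \<open>d\<close>, the third
  sign condition links the two values. The case excluded by the last assumption is that of a
  relation passing along the other side, where they may differ.\<close>

lemma in_out_sign:
  assumes d: "d \<in> A" "prv d \<notin> A" and "nxt (opp d) \<notin> A \<or> prv (opp d) \<notin> A"
  shows "in_sign d = out_sign d"
  using assms sigma_epsilon[of "opp d"] opp_in opp_opp by (auto simp: in_sign_def out_sign_def)

text \<open>The two sides of an arc carry opposite signs. This and its analogue for
  \<open>in_sign\<close> are the uniqueness behind the choices in the algorithm, where a vertex and
  a sign have to determine a thread.\<close>

lemma E_out_sign_inj: assumes "d \<in> A" "d' \<in> A" "E d = E d'" "out_sign d = out_sign d'" shows "d = d'"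
  using assms E_eq[of d d'] out_sign_opp[of d] sign_values[of d] by auto

lemma E_in_sign_inj: assumes "d \<in> A" "d' \<in> A" "E d = E d'" "in_sign d = in_sign d'" shows "d = d'"
  using assms E_eq[of d d'] in_sign_opp[of d] sign_values[of d] by auto

section \<open>The threads of the quiver and the algorithm\<close>

lemma in_arcs_E: "d \<in> A \<Longrightarrow> in_arcs Q (E d) = {e \<in> {prv d, prv (opp d)}. e \<in> A}"
proof (intro equalityI subsetI)
  fix e assume d: "d \<in> A" and e: "e \<in> in_arcs Q (E d)"
  then have "e \<in> A" "nxt e \<in> A" "E (nxt e) = E d" by (auto simp: in_arcs_def Q_simps)
  then show "e \<in> {e \<in> {prv d, prv (opp d)}. e \<in> A}" using d E_eq[of d "nxt e"] prv_nxt[of e] inD by auto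
next
  fix e assume d: "d \<in> A" and e: "e \<in> {e \<in> {prv d, prv (opp d)}. e \<in> A}"
  then show "e \<in> in_arcs Q (E d)"
    using nxt_prv[of d] nxt_prv[of "opp d"] opp_in[OF d] inD E_opp[OF d] by (auto simp: in_arcs_def Q_simps)
qed

lemma out_arcs_E: "d \<in> A \<Longrightarrow> out_arcs Q (E d) = {e \<in> {d, opp d}. nxt e \<in> A}"
  using E_eq[of d, THEN iffD1, OF _ _ sym] opp_in E_opp by (auto simp: out_arcs_def Q_simps)

text \<open>A nontrivial permitted thread starts with the arrow at \<open>opp s\<close>, of sign
  \<open>- out_sign s\<close>, and the sign stored in a trivial one is chosen to agree. A nontrivial
  forbidden thread starts with \<open>s\<close> itself, hence the sign without a minus in
  \<open>forbidden_thread\<close>.\<close>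

definition permitted_thread :: "'a \<Rightarrow> ('b, 'a) thread" where
  "permitted_thread s = (if R.len s = 1 then Trivial (E s) (- out_sign s) else Nontrivial (fan_arrows s))"

definition forbidden_thread :: "'a \<Rightarrow> ('b, 'a) thread" where
  "forbidden_thread s = (if N.len s = 1 then Trivial (E s) (out_sign s) else Nontrivial (run_arrows s))"

lemma R_len_1: assumes "s \<in> S" shows "R.len s = 1 \<longleftrightarrow> nxt (opp s) \<notin> A"
proof
  assume "R.len s = 1"
  then show "nxt (opp s) \<notin> A" using R_stop(1)[OF assms] by (simp add: R.stop_def rot_def)
next
  assume "nxt (opp s) \<notin> A"
  then show "R.len s = 1" using S_starts[OF assms] by (intro R.len_eqI) (auto simp: rot_def)
qed

lemma N_len_1: assumes "s \<in> S" shows "N.len s = 1 \<longleftrightarrow> nxt s \<notin> A"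
proof
  assume "N.len s = 1"
  then show "nxt s \<notin> A" using run_end(3,4)[OF assms] by (simp add: N.stop_def)
next
  assume "nxt s \<notin> A"
  then show "N.len s = 1" using S_starts[OF assms] by (intro N.len_eqI) auto
qed

text \<open>Four arrows are possible at an arc, one entering and one leaving at each side. The
  conditions on a trivial permitted thread leave at most the one leaving from a side
  \<open>s\<close> and the one entering at \<open>opp s\<close>, so the fan of \<open>s\<close> has
  a single arc. If no arrow is left, both sides qualify and the stored sign selects one of
  them.\<close>

lemma trivial_permitted:
  "Trivial x v \<in> permitted_threads Q I \<sigma> \<epsilon> \<longleftrightarrow> (\<exists>s \<in> S. R.len s = 1 \<and> x = E s \<and> v = - out_sign s)"
  (is "?L \<longleftrightarrow> ?R")
proof
  assume L: ?L
  then have x: "x \<in> verts Q" "card (in_arcs Q x) \<le> 1" "card (out_arcs Q x) \<le> 1"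
    "\<And>\<beta> \<gamma>. \<beta> \<in> in_arcs Q x \<Longrightarrow> \<gamma> \<in> out_arcs Q x \<Longrightarrow> \<not> in_relation Q I \<beta> \<gamma>"
    and v: "v = -1 \<or> v = 1" "\<And>\<alpha>. \<alpha> \<in> out_arcs Q x \<Longrightarrow> v = - \<sigma> \<alpha>" "\<And>\<beta>. \<beta> \<in> in_arcs Q x \<Longrightarrow> v = \<epsilon> \<beta>"
    by (auto simp: permitted_threads_def thread_vertex_def)
  obtain d where d: "d \<in> A" "x = E d" using x by (auto simp: Q_simps)
  have od: "opp d \<in> A" "opp (opp d) = d" "E (opp d) = E d" using d opp_in opp_opp E_opp by auto
  note arcs = in_arcs_E[OF d(1)] out_arcs_E[OF d(1)]
  have two: "a = b" if "a \<in> X" "b \<in> X" "card X \<le> 1" "finite X" for a b and X :: "'a set"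
    using that by (metis card_le_Suc0_iff_eq One_nat_def)
  have 1: "\<not> (prv d \<in> A \<and> prv (opp d) \<in> A)"
    using two[of "prv d" "in_arcs Q x" "prv (opp d)"] x(2) d(2) arcs(1) prv_eq[of d "opp d"] inD d(1) od opp_neq[OF d(1)] by auto
  have 2: "\<not> (nxt d \<in> A \<and> nxt (opp d) \<in> A)"
    using two[of "d" "out_arcs Q x" "opp d"] x(3) d(2) arcs(2) opp_neq[OF d(1)] by auto
  have 3: "\<not> (prv d \<in> A \<and> nxt d \<in> A)"
    if "d \<in> A" "x = E d" for d
    using x(4)[of "prv d" d] that in_arcs_E[OF that(1)] out_arcs_E[OF that(1)] arrow_iff[OF that(1)] nxt_prv[of d] inD
    by (auto simp: in_relation_iff)
  have good: "v = - out_sign d'"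
    if d': "d' \<in> A" "x = E d'" "prv d' \<notin> A" "nxt (opp d') \<notin> A" "nxt d' \<in> A \<or> prv (opp d') \<in> A" for d'
  proof (cases "nxt d' \<in> A")
    case True
    then show ?thesis using v(2)[of d'] out_arcs_E[OF d'(1)] d'(2) out_sign_arrow by auto
  next
    case False
    then have "prv (opp d') \<in> A" using d' by auto
    then have "v = in_sign (opp d')" using v(3)[of "prv (opp d')"] in_arcs_E[OF d'(1)] d'(2) in_sign_arrow by auto
    then show ?thesis using in_sign_opp[OF d'(1)] in_out_sign d' by auto
  qed
  have fin: ?R if "d' \<in> A" "x = E d'" "prv d' \<notin> A" "nxt (opp d') \<notin> A" "v = - out_sign d'" for d'
    using that by (intro bexI[of _ d']) (simp_all add: R_len_1 S_def del: One_nat_def)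
  consider "prv d \<in> A \<or> nxt (opp d) \<in> A" | "nxt d \<in> A \<or> prv (opp d) \<in> A"
    | "prv d \<notin> A" "nxt (opp d) \<notin> A" "nxt d \<notin> A" "prv (opp d) \<notin> A" by blast
  then show ?R
  proof cases
    case 1
    then have "prv (opp d) \<notin> A" "nxt d \<notin> A" using \<open>\<not> (prv d \<in> A \<and> prv (opp d) \<in> A)\<close> 2 3[of d] 3[of "opp d"] d od by auto
    then show ?R using fin[of "opp d"] good[of "opp d"] 1 d od by auto
  next
    case 2
    then have "prv d \<notin> A" "nxt (opp d) \<notin> A" using \<open>\<not> (nxt d \<in> A \<and> nxt (opp d) \<in> A)\<close> 1 3[of d] 3[of "opp d"] d od by auto
    then show ?R using fin[of "d"] good[of "d"] 2 d od by auto
  next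
    case 3
    show ?R
    proof (cases "v = - out_sign d")
      case True then show ?thesis using fin[of d] 3 d by auto
    next
      case False
      then have "v = - out_sign (opp d)" using v(1) sign_values(1)[OF d(1)] out_sign_opp[OF d(1)] by auto
      then show ?thesis using fin[of "opp d"] 3 d od by auto
    qed
  qed
next
  assume ?R
  then obtain d where d: "d \<in> S" "R.len d = 1" "x = E d" "v = - out_sign d" by auto
  have dA: "d \<in> A" "prv d \<notin> A" "nxt (opp d) \<notin> A" "opp d \<in> A" using d R_len_1 S_starts opp_in by auto
  have i: "in_arcs Q x = {e \<in> {prv (opp d)}. e \<in> A}" and o: "out_arcs Q x = {e \<in> {d}. nxt e \<in> A}"
    using in_arcs_E[of d] out_arcs_E[of d] d dA by auto
  have "card {e \<in> {a}. P e} \<le> 1" for a :: 'a and P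
    using card_mono[of "{a}" "{e \<in> {a}. P e}"] by auto
  then have "thread_vertex Q x" unfolding thread_vertex_def i o using d dA by (auto simp: Q_simps)
  moreover have "\<not> in_relation Q I (prv (opp d)) d" using nxt_prv[of "opp d"] dA inD opp_neq[of d]
    by (auto simp: in_relation_iff)
  moreover have "v \<in> {-1, 1}" using d sign_values(1)[OF dA(1)] by auto
  moreover have "v = \<epsilon> (prv (opp d))" if "prv (opp d) \<in> A"
    using in_sign_arrow[OF that] in_sign_opp[OF dA(1)] in_out_sign[of d] dA d by simp
  moreover have "v = - \<sigma> d" if "nxt d \<in> A" using out_sign_arrow[OF that] d by simp
  ultimately show ?L unfolding permitted_threads_def using i o by auto
qed

text \<open>Dually to \<open>trivial_permitted\<close>, the arrows that remain enter and leave at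
  the same side \<open>opp s\<close> of the arc, so the other side \<open>s\<close> is a run of one
  arc. For an isolated vertex the stored sign again selects the side.\<close>

lemma trivial_forbidden:
  "Trivial x v \<in> forbidden_threads Q I \<sigma> \<epsilon> \<longleftrightarrow> (\<exists>s \<in> S. N.len s = 1 \<and> x = E s \<and> v = out_sign s)"
  (is "?L \<longleftrightarrow> ?R")
proof
  assume L: ?L
  then have x: "x \<in> verts Q" "card (in_arcs Q x) \<le> 1" "card (out_arcs Q x) \<le> 1"
    "\<And>\<beta> \<gamma>. \<beta> \<in> in_arcs Q x \<Longrightarrow> \<gamma> \<in> out_arcs Q x \<Longrightarrow> in_relation Q I \<beta> \<gamma>"
    and v: "v = -1 \<or> v = 1" "\<And>\<alpha>. \<alpha> \<in> out_arcs Q x \<Longrightarrow> v = - \<sigma> \<alpha>"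
      "\<And>\<beta>. out_arcs Q x = {} \<Longrightarrow> \<beta> \<in> in_arcs Q x \<Longrightarrow> v = - \<epsilon> \<beta>"
    by (auto simp: forbidden_threads_def thread_vertex_def)
  obtain d where d: "d \<in> A" "x = E d" using x by (auto simp: Q_simps)
  have od: "opp d \<in> A" "opp (opp d) = d" "E (opp d) = E d" using d opp_in opp_opp E_opp by auto
  note arcs = in_arcs_E[OF d(1)] out_arcs_E[OF d(1)]
  have two: "a = b" if "a \<in> X" "b \<in> X" "card X \<le> 1" "finite X" for a b and X :: "'a set"
    using that by (metis card_le_Suc0_iff_eq One_nat_def)
  have 1: "\<not> (prv d \<in> A \<and> prv (opp d) \<in> A)"
    using two[of "prv d" "in_arcs Q x" "prv (opp d)"] x(2) d(2) arcs(1) prv_eq[of d "opp d"] inD d(1) od opp_neq[OF d(1)] by auto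
  have 2: "\<not> (nxt d \<in> A \<and> nxt (opp d) \<in> A)"
    using two[of "d" "out_arcs Q x" "opp d"] x(3) d(2) arcs(2) opp_neq[OF d(1)] by auto
  have 3: "\<not> (prv d \<in> A \<and> nxt (opp d) \<in> A)" if "d \<in> A" "x = E d" for d
    using x(4)[of "prv d" "opp d"] that in_arcs_E[OF that(1)] out_arcs_E[OF that(1)]
      nxt_prv[of d] inD opp_neq[OF that(1)] by (auto simp: in_relation_iff)
  have good: "v = out_sign d'"
    if d': "d' \<in> A" "x = E d'" "prv d' \<notin> A" "nxt d' \<notin> A" "nxt (opp d') \<in> A \<or> prv (opp d') \<in> A" for d'
  proof (cases "nxt (opp d') \<in> A")
    case True
    then show ?thesis using v(2)[of "opp d'"] out_arcs_E[OF d'(1)] d'(2) out_sign_arrow[of "opp d'"]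
      out_sign_opp[OF d'(1)] by auto
  next
    case False
    then have "prv (opp d') \<in> A" using d' by auto
    moreover have "out_arcs Q x = {}" using False d' out_arcs_E[OF d'(1)] by auto
    ultimately have "v = - in_sign (opp d')"
      using v(3)[of "prv (opp d')"] in_arcs_E[OF d'(1)] d'(2) in_sign_arrow by auto
    then show ?thesis using in_sign_opp[OF d'(1)] in_out_sign d' False by auto
  qed
  have fin: ?R if "d' \<in> A" "x = E d'" "prv d' \<notin> A" "nxt d' \<notin> A" "v = out_sign d'" for d'
    using that by (intro bexI[of _ d']) (simp_all add: N_len_1 S_def del: One_nat_def)
  consider "prv d \<in> A \<or> nxt d \<in> A" | "nxt (opp d) \<in> A \<or> prv (opp d) \<in> A"
    | "prv d \<notin> A" "nxt (opp d) \<notin> A" "nxt d \<notin> A" "prv (opp d) \<notin> A" by blast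
  then show ?R
  proof cases
    case 1
    then have "prv (opp d) \<notin> A" "nxt (opp d) \<notin> A" using \<open>\<not> (prv d \<in> A \<and> prv (opp d) \<in> A)\<close> 2 3[of d] 3[of "opp d"] d od by auto
    then show ?R using fin[of "opp d"] good[of "opp d"] 1 d od by auto
  next
    case 2
    then have "prv d \<notin> A" "nxt d \<notin> A" using \<open>\<not> (nxt d \<in> A \<and> nxt (opp d) \<in> A)\<close> 1 3[of d] 3[of "opp d"] d od by auto
    then show ?R using fin[of "d"] good[of "d"] 2 d od by auto
  next
    case 3
    show ?R
    proof (cases "v = out_sign d")
      case True then show ?thesis using fin[of d] 3 d by auto
    next
      case False
      then have "v = out_sign (opp d)" using v(1) sign_values(1)[OF d(1)] out_sign_opp[OF d(1)] by auto
      then show ?thesis using fin[of "opp d"] 3 d od by auto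
    qed
  qed
next
  assume ?R
  then obtain d where d: "d \<in> S" "N.len d = 1" "x = E d" "v = out_sign d" by auto
  have dA: "d \<in> A" "prv d \<notin> A" "nxt d \<notin> A" "opp d \<in> A" using d N_len_1 S_starts opp_in by auto
  have i: "in_arcs Q x = {e \<in> {prv (opp d)}. e \<in> A}" and o: "out_arcs Q x = {e \<in> {opp d}. nxt e \<in> A}"
    using in_arcs_E[of d] out_arcs_E[of d] d dA by auto
  have "card {e \<in> {a}. P e} \<le> 1" for a :: 'a and P
    using card_mono[of "{a}" "{e \<in> {a}. P e}"] by auto
  then have "thread_vertex Q x" unfolding thread_vertex_def i o using d dA by (auto simp: Q_simps)
  moreover have "in_relation Q I (prv (opp d)) (opp d)" if "prv (opp d) \<in> A" "nxt (opp d) \<in> A"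
    using that nxt_prv[of "opp d"] dA inD by (auto simp: in_relation_iff Q_simps)
  moreover have "v \<in> {-1, 1}" using d sign_values(1)[OF dA(1)] by auto
  moreover have "v = - \<epsilon> (prv (opp d))" if "prv (opp d) \<in> A" "nxt (opp d) \<notin> A"
    using in_sign_arrow[OF that(1)] in_sign_opp[OF dA(1)] in_out_sign[of d] dA d that by simp
  moreover have "v = - \<sigma> (opp d)" if "nxt (opp d) \<in> A"
    using out_sign_arrow[OF that] out_sign_opp[OF dA(1)] d by simp
  ultimately show ?L unfolding forbidden_threads_def using i o by auto
qed

lemma permitted_threads_eq: "permitted_threads Q I \<sigma> \<epsilon> = permitted_thread ` S"
proof (intro equalityI subsetI)
  fix H assume H: "H \<in> permitted_threads Q I \<sigma> \<epsilon>"
  show "H \<in> permitted_thread ` S"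
  proof (cases H)
    case (Nontrivial p)
    then obtain s where "s \<in> S" "1 < R.len s" "p = fan_arrows s"
      using H permitted_maximal[of p] by (auto simp: permitted_threads_def)
    then show ?thesis using Nontrivial by (intro image_eqI[of _ _ s]) (auto simp: permitted_thread_def)
  next
    case (Trivial x v)
    then show ?thesis using H trivial_permitted[of x v] by (auto simp: permitted_thread_def)
  qed
next
  fix H assume "H \<in> permitted_thread ` S"
  then obtain s where s: "s \<in> S" "H = permitted_thread s" by auto
  show "H \<in> permitted_threads Q I \<sigma> \<epsilon>"
  proof (cases "R.len s = 1")
    case True
    then show ?thesis using s trivial_permitted by (auto simp: permitted_thread_def)
  next
    case False
    then have "1 < R.len s" using R_len_pos[OF s(1)] by simp
    then show ?thesis using s False permitted_fan[OF s(1)] by (auto simp: permitted_threads_def permitted_thread_def)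
  qed
qed

lemma forbidden_threads_eq: "forbidden_threads Q I \<sigma> \<epsilon> = forbidden_thread ` S"
proof (intro equalityI subsetI)
  fix F assume F: "F \<in> forbidden_threads Q I \<sigma> \<epsilon>"
  show "F \<in> forbidden_thread ` S"
  proof (cases F)
    case (Nontrivial p)
    then obtain s where "s \<in> S" "1 < N.len s" "p = run_arrows s"
      using F forbidden_maximal[of p] by (auto simp: forbidden_threads_def)
    then show ?thesis using Nontrivial by (intro image_eqI[of _ _ s]) (auto simp: forbidden_thread_def)
  next
    case (Trivial x v)
    then show ?thesis using F trivial_forbidden[of x v] by (auto simp: forbidden_thread_def)
  qed
next
  fix F assume "F \<in> forbidden_thread ` S"
  then obtain s where s: "s \<in> S" "F = forbidden_thread s" by auto
  show "F \<in> forbidden_threads Q I \<sigma> \<epsilon>"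
  proof (cases "N.len s = 1")
    case True
    then show ?thesis using s trivial_forbidden by (auto simp: forbidden_thread_def)
  next
    case False
    then have "1 < N.len s" using N_len_pos[OF s(1)] by simp
    then show ?thesis using s False forbidden_run[OF s(1)] by (auto simp: forbidden_threads_def forbidden_thread_def)
  qed
qed

lemma permitted_thread_start: assumes s: "s \<in> S"
  shows "thread_start Q (permitted_thread s) = E s" "permitted_sigma \<sigma> (permitted_thread s) = - out_sign s"
proof -
  note st = S_starts[OF s]
  have "hd (fan_arrows s) = opp s" "nxt (opp s) \<in> A" if "R.len s \<noteq> 1"
  proof -
    have l: "1 < R.len s" using that R_len_pos[OF s] by simp
    then show "hd (fan_arrows s) = opp s"
      using prv_funpow_rot[OF st(2), of 0] by (simp add: fan_arrows_def hd_map)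
    show "nxt (opp s) \<in> A" using that R_len_1[OF s] by simp
  qed
  then show "thread_start Q (permitted_thread s) = E s" "permitted_sigma \<sigma> (permitted_thread s) = - out_sign s"
    using E_opp[OF st(3)] out_sign_opp[OF st(3)] out_sign_arrow[of "opp s"]
    by (auto simp: permitted_thread_def Q_simps)
qed

lemma permitted_thread_end: assumes s: "s \<in> S"
  shows "thread_end Q (permitted_thread s) = E (run_end (next_run s))"
    "permitted_epsilon \<epsilon> (permitted_thread s) = - in_sign (run_end (next_run s))"
proof -
  note st = S_starts[OF s]
  define c where "c = (rot ^^ (R.len s - 1)) s"
  have c: "c \<in> A" using R.len_stop(2)[OF st(2), of "R.len s - 1"] R_len_pos[OF s] by (auto simp: c_def)
  \<comment> \<open>The last arc of the fan is \<open>c\<close>, and its other side is the last arc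
    of the next run.\<close>
  have l: "run_end (next_run s) = opp c"
    using R_stop(4)[OF s] next_run[OF s] prv_nxt run_end(2) inD by (metis c_def)
  have "last (fan_arrows s) = prv c" "prv c \<in> A" if "R.len s \<noteq> 1"
  proof -
    have l: "1 < R.len s" using that R_len_pos[OF s] by simp
    then show "last (fan_arrows s) = prv c" by (simp add: fan_arrows_def last_map c_def)
    have "R.len s - 1 = Suc (R.len s - 2)" using l by simp
    then have "prv c = opp ((rot ^^ (R.len s - 2)) s)" unfolding c_def
      using prv_funpow_rot[OF st(2), of "R.len s - 2"] l by simp
    then show "prv c \<in> A" using R.len_stop(2)[OF st(2), of "R.len s - 2"] l opp_in by auto
  qed
  then show "thread_end Q (permitted_thread s) = E (run_end (next_run s))"
    using E_opp[OF c] nxt_prv[of c] inD c l by (auto simp: permitted_thread_def Q_simps c_def)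
  show "permitted_epsilon \<epsilon> (permitted_thread s) = - in_sign (run_end (next_run s))"
  proof (cases "R.len s = 1")
    case True
    then have "c = s" "nxt (opp s) \<notin> A" using R_len_1[OF s] by (auto simp: c_def)
    then show ?thesis using True l in_sign_opp[OF st(3)] in_out_sign[of s] st by (simp add: permitted_thread_def)
  next
    case False
    then show ?thesis using \<open>R.len s \<noteq> 1 \<Longrightarrow> last (fan_arrows s) = prv c\<close> \<open>R.len s \<noteq> 1 \<Longrightarrow> prv c \<in> A\<close>
      in_sign_arrow[of c] in_sign_opp[OF c] l by (simp add: permitted_thread_def)
  qed
qed

text \<open>For a trivial thread \<open>forbidden_epsilon\<close> reads the incoming arrow if there
  is one, which is the value of \<open>in_sign\<close>. Without an incoming arrow it reads the
  stored sign, and \<open>in_out_sign\<close> makes the two signs agree.\<close>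

lemma forbidden_thread_props: assumes s: "s \<in> S"
  shows "thread_start Q (forbidden_thread s) = E s" "forbidden_sigma \<sigma> (forbidden_thread s) = out_sign s"
    "thread_end Q (forbidden_thread s) = E (run_end s)"
    "forbidden_epsilon Q \<epsilon> (forbidden_thread s) = in_sign (run_end s)"
    "thread_length (forbidden_thread s) = N.len s - 1"
proof -
  note st = S_starts[OF s]
  have nontriv: "hd (run_arrows s) = s" "nxt s \<in> A" "last (run_arrows s) = prv (run_end s)" "prv (run_end s) \<in> A"
    if "N.len s \<noteq> 1"
  proof -
    have l: "1 < N.len s" using that N_len_pos[OF s] by simp
    then show "hd (run_arrows s) = s" by (simp add: run_arrows_def hd_map)
    show "nxt s \<in> A" using that N_len_1[OF s] by simp
    have "N.len s - 1 = Suc (N.len s - 2)" using l by simp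
    then have e: "run_end s = nxt ((nxt ^^ (N.len s - 2)) s)" using run_end(1)[OF s] by simp
    have A: "(nxt ^^ (N.len s - 2)) s \<in> A" using N.len_stop(2)[OF st(1), of "N.len s - 2"] l by auto
    then show "prv (run_end s) \<in> A" using e prv_nxt inD by simp
    show "last (run_arrows s) = prv (run_end s)" using l e A prv_nxt inD
      by (simp add: run_arrows_def last_map numeral_2_eq_2)
  qed
  have triv: "run_end s = s" if "N.len s = 1" using run_end(1)[OF s] that by simp
  show "thread_start Q (forbidden_thread s) = E s" "forbidden_sigma \<sigma> (forbidden_thread s) = out_sign s"
    using nontriv out_sign_arrow[of s] by (auto simp: forbidden_thread_def Q_simps)
  show "thread_end Q (forbidden_thread s) = E (run_end s)"
    using nontriv triv nxt_prv[of "run_end s"] run_end(2)[OF s] inD by (auto simp: forbidden_thread_def Q_simps)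
  show "thread_length (forbidden_thread s) = N.len s - 1"
    by (auto simp: forbidden_thread_def run_arrows_def)
  show "forbidden_epsilon Q \<epsilon> (forbidden_thread s) = in_sign (run_end s)"
  proof (cases "N.len s = 1")
    case False
    then show ?thesis using nontriv in_sign_arrow by (simp add: forbidden_thread_def)
  next
    case True
    have i: "in_arcs Q (E s) = {e \<in> {prv (opp s)}. e \<in> A}" using in_arcs_E[OF st(3)] st(4) by auto
    show ?thesis
    proof (cases "prv (opp s) \<in> A")
      case T: True
      then have "in_arcs Q (E s) = {prv (opp s)}" using i by auto
      then show ?thesis using True triv in_sign_arrow[OF T] in_sign_opp[OF st(3)] by (simp add: forbidden_thread_def)
    next
      case F: False
      then have "in_arcs Q (E s) = {}" using i by auto
      then show ?thesis using True triv in_out_sign[of s] st F by (simp add: forbidden_thread_def)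
    qed
  qed
qed

text \<open>The fan of \<open>s\<close> and the run \<open>next_run s\<close> end at the same arc.
  This arc and the value of \<open>in_sign\<close> determine a side, which is the last arc of one
  run.\<close>

lemma AG_forbidden_eq: assumes s: "s \<in> S"
  shows "AG_forbidden Q I \<sigma> \<epsilon> (permitted_thread s) = forbidden_thread (next_run s)"
  unfolding AG_forbidden_def forbidden_threads_eq permitted_thread_end[OF s]
proof (rule the_equality)
  show "forbidden_thread (next_run s) \<in> forbidden_thread ` S \<and>
    thread_end Q (forbidden_thread (next_run s)) = E (run_end (next_run s)) \<and>
    forbidden_epsilon Q \<epsilon> (forbidden_thread (next_run s)) = - (- in_sign (run_end (next_run s)))"
    using next_run(1)[OF s] forbidden_thread_props by auto
next
  fix F assume F: "F \<in> forbidden_thread ` S \<and> thread_end Q F = E (run_end (next_run s)) \<and>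
    forbidden_epsilon Q \<epsilon> F = - (- in_sign (run_end (next_run s)))"
  then obtain t where t: "t \<in> S" "F = forbidden_thread t" by auto
  then have "run_end t = run_end (next_run s)"
    using F forbidden_thread_props[OF t(1)] E_in_sign_inj run_end(2) next_run(1)[OF s] by auto
  then show "F = forbidden_thread (next_run s)"
    using bij_run_end t next_run(1)[OF s] by (auto simp: bij_betw_def inj_on_def)
qed

lemma AG_step_eq: assumes s: "s \<in> S"
  shows "AG_step Q I \<sigma> \<epsilon> (permitted_thread s) = permitted_thread (next_run s)"
  unfolding AG_step_def Let_def AG_forbidden_eq[OF s] permitted_threads_eq
    forbidden_thread_props[OF next_run(1)[OF s]]
proof (rule the_equality)
  show "permitted_thread (next_run s) \<in> permitted_thread ` S \<and>
    thread_start Q (permitted_thread (next_run s)) = E (next_run s) \<and>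
    permitted_sigma \<sigma> (permitted_thread (next_run s)) = - out_sign (next_run s)"
    using next_run(1)[OF s] permitted_thread_start by auto
next
  fix H assume H: "H \<in> permitted_thread ` S \<and> thread_start Q H = E (next_run s) \<and>
    permitted_sigma \<sigma> H = - out_sign (next_run s)"
  then obtain t where t: "t \<in> S" "H = permitted_thread t" by auto
  then have "t = next_run s"
    using H permitted_thread_start[OF t(1)] E_out_sign_inj[of t "next_run s"] S_starts(3) next_run(1)[OF s] by auto
  then show "H = permitted_thread (next_run s)" using t by simp
qed

lemma inj_permitted_thread: "inj_on permitted_thread S"
proof
  fix s t assume st: "s \<in> S" "t \<in> S" "permitted_thread s = permitted_thread t"
  then have "E s = E t" "out_sign s = out_sign t"
    using permitted_thread_start[OF st(1)] permitted_thread_start[OF st(2)] by auto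
  then show "s = t" using E_out_sign_inj S_starts(3) st by auto
qed

lemma AG_step_funpow: "s \<in> S \<Longrightarrow>
    (AG_step Q I \<sigma> \<epsilon> ^^ i) (permitted_thread s) = permitted_thread ((next_run ^^ i) s)"
  by (induction i) (use AG_step_eq funpow_next_run in auto)

lemma AG_pair: assumes s: "s \<in> S"
  shows "AG_period Q I \<sigma> \<epsilon> (permitted_thread s) = card (run_orbit s)"
    "AG_length Q I \<sigma> \<epsilon> (permitted_thread s) = (\<Sum>x\<in>run_orbit s. N.len x - 1)"
proof -
  define per where "per = (LEAST k. 1 \<le> k \<and> (next_run ^^ k) s = s)"
  note orb = permutation_orbit[OF finite_S bij_next_run s, folded per_def run_orbit_def]
  have "permitted_thread ((next_run ^^ k) s) = permitted_thread s \<longleftrightarrow> (next_run ^^ k) s = s" for k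
    using inj_permitted_thread funpow_next_run s by (auto simp: inj_on_def)
  then have period: "AG_period Q I \<sigma> \<epsilon> (permitted_thread s) = per"
    unfolding AG_period_def per_def AG_step_funpow[OF s] by simp
  also have "per = card (run_orbit s)" using bij_betw_same_card[OF orb(3)] by simp
  finally show "AG_period Q I \<sigma> \<epsilon> (permitted_thread s) = card (run_orbit s)" .
  define g where "g i = N.len ((next_run ^^ i) s) - 1" for i
  \<comment> \<open>The algorithm adds the lengths for the indices 1 to \<open>per\<close>, and the
    forbidden thread of index \<open>i\<close> belongs to the run of index \<open>i + 1\<close>. As
    \<open>g\<close> has period \<open>per\<close>, this shift by two does not change the
    sum.\<close>
  have "g per = g 0" "g (Suc per) = g (Suc 0)" using orb(2) by (auto simp: g_def)
  then have 1: "(\<Sum>i<per. g (Suc i)) = (\<Sum>i<per. g i)" "(\<Sum>i<per. g (Suc (Suc i))) = (\<Sum>i<per. g (Suc i))"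
    using sum.lessThan_Suc_shift[of g per] sum.lessThan_Suc_shift[of "\<lambda>i. g (Suc i)" per] by auto
  have "AG_length Q I \<sigma> \<epsilon> (permitted_thread s) = (\<Sum>i = 1..per. g (Suc i))"
    unfolding AG_length_def period AG_step_funpow[OF s] g_def
    by (intro sum.cong refl)
      (use AG_forbidden_eq funpow_next_run[OF s] next_run(1) forbidden_thread_props(5) in auto)
  also have "\<dots> = (\<Sum>i<per. g (Suc (Suc i)))"
    by (rule sum.reindex_bij_witness[of _ Suc "\<lambda>i. i - 1"]) auto
  also have "\<dots> = (\<Sum>i<per. g i)" using 1 by simp
  also have "\<dots> = (\<Sum>x\<in>run_orbit s. N.len x - 1)"
    unfolding g_def by (rule sum.reindex_bij_betw[OF orb(3)])
  finally show "AG_length Q I \<sigma> \<epsilon> (permitted_thread s) = (\<Sum>x\<in>run_orbit s. N.len x - 1)" .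
qed

text \<open>Permitted threads correspond injectively to runs, so the sets of threads that occur
  together are the images of the orbits of runs.\<close>

lemma card_AG_threads:
  "card {range (\<lambda>i. (AG_step Q I \<sigma> \<epsilon> ^^ i) H) | H. H \<in> permitted_threads Q I \<sigma> \<epsilon> \<and>
     AG_period Q I \<sigma> \<epsilon> H = a \<and> AG_length Q I \<sigma> \<epsilon> H = b} =
   card {C \<in> run_orbit ` S. card C = a \<and> (\<Sum>x\<in>C. N.len x - 1) = b}" (is "card ?X = card ?Y")
proof -
  have r: "range (\<lambda>i. (AG_step Q I \<sigma> \<epsilon> ^^ i) (permitted_thread s)) = permitted_thread ` run_orbit s"
    if "s \<in> S" for s unfolding run_orbit_def AG_step_funpow[OF that] by auto
  have "?X = (`) permitted_thread ` ?Y"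
  proof (intro equalityI subsetI)
    fix X assume "X \<in> (`) permitted_thread ` ?Y"
    then obtain s where s: "s \<in> S" "X = permitted_thread ` run_orbit s" "card (run_orbit s) = a"
      "(\<Sum>x\<in>run_orbit s. N.len x - 1) = b" by auto
    then show "X \<in> ?X" using r[OF s(1)] AG_pair[OF s(1)] permitted_threads_eq
      by (intro CollectI exI[of _ "permitted_thread s"]) auto
  qed (auto simp: permitted_threads_eq AG_pair r simp del: One_nat_def)
  moreover have "inj_on ((`) permitted_thread) ?Y"
    by (rule inj_on_subset[OF inj_on_image_Pow[OF inj_permitted_thread]])
      (auto simp: run_orbit_def funpow_next_run)
  ultimately show ?thesis by (simp add: card_image)
qed

end

section \<open>Monomial ideals of path algebras\<close>

lemma sum_nonzero_term:
  fixes f :: "nat \<Rightarrow> 'k::field"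
  assumes "(\<Sum>i\<le>n. f i) \<noteq> 0" shows "\<exists>i\<le>n. f i \<noteq> 0"
  using assms by (metis (mono_tags, lifting) atMost_iff sum.neutral)

context wf_digraph
begin

text \<open>Of all splittings of a path, the one after \<open>length p\<close> arrows is the only
  candidate for a nonzero term.\<close>

lemma path_mult_elem:
  assumes "(u, p @ q) \<in> qpaths G"
  shows "path_mult G (path_elem (u, p)) (path_elem (awlast u p, q)) =
    (path_elem (u, p @ q) :: ('a, 'b) qpath \<Rightarrow> 'k::field)"
proof
  fix x :: "('a, 'b) qpath"
  obtain v r where x: "x = (v, r)" by (cases x)
  let ?f = "\<lambda>i. (path_elem (u, p) (v, take i r) :: 'k) * path_elem (awlast u p, q) (awlast v (take i r), drop i r)"
  show "path_mult G (path_elem (u, p)) (path_elem (awlast u p, q)) x = (path_elem (u, p @ q) x :: 'k)"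
  proof (cases "x = (u, p @ q)")
    case True
    have "(\<Sum>i\<le>length r. ?f i) = (\<Sum>i\<le>length r. if i = length p then 1 else 0)"
    proof (intro sum.cong refl)
      fix i assume i: "i \<in> {..length r}"
      show "?f i = (if i = length p then 1 else 0)"
      proof (cases "i = length p")
        case False
        then have "length (take i r) \<noteq> length p" using i by simp
        then have "take i r \<noteq> p" by auto
        then show ?thesis using False by (simp add: path_elem_def)
      qed (use True x in \<open>simp add: path_elem_def\<close>)
    qed
    then show ?thesis using True x assms by (simp add: path_mult_def path_elem_def)
  next
    case False
    have "?f i = 0" for i using False x by (auto simp: path_elem_def)
    then have "(\<Sum>i\<le>length r. ?f i) = 0" by (intro sum.neutral) auto
    moreover have "path_elem (u, p @ q) x = (0 :: 'k)" using False by (simp add: path_elem_def)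
    ultimately show ?thesis unfolding path_mult_def x by simp
  qed
qed

lemma path_elem_in_algebra: "(u, p) \<in> qpaths G \<Longrightarrow> path_elem (u, p) \<in> path_algebra G"
  by (auto simp: path_algebra_def path_elem_def)

text \<open>A property inherited by all longer paths defines an ideal by a condition on supports.
  This bounds a generated ideal from above: a path without a relation cannot lie in it.\<close>

lemma two_sided_ideal_paths:
  assumes "\<And>p q r. B q \<Longrightarrow> B (p @ q @ r)"
  shows "two_sided_ideal G {x \<in> path_algebra G. \<forall>u p. x (u, p) \<noteq> (0::'k::field) \<longrightarrow> B p}" (is "two_sided_ideal G ?J")
proof -
  have trm: "\<exists>i. x (u, take i p) \<noteq> 0 \<and> y (awlast u (take i p), drop i p) \<noteq> 0 \<and> (u, p) \<in> qpaths G"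
    if "path_mult G x y (u, p) \<noteq> (0::'k)" for x y u p
    using that sum_nonzero_term[of "\<lambda>i. x (u, take i p) * y (awlast u (take i p), drop i p)" "length p"]
    by (auto simp: path_mult_def split: if_splits)
  \<comment> \<open>A path in the support of a product is the concatenation of paths from the two
    supports.\<close>
  have fin: "finite {p. path_mult G x y p \<noteq> (0::'k)}" if "x \<in> path_algebra G" "y \<in> path_algebra G" for x y
  proof (rule finite_subset)
    show "{p. path_mult G x y p \<noteq> 0} \<subseteq>
      (\<lambda>((u, p), (v, q)). (u, p @ q)) ` ({p. x p \<noteq> 0} \<times> {p. y p \<noteq> 0})"
    proof
      fix z assume "z \<in> {p. path_mult G x y p \<noteq> 0}"
      then obtain u p where z: "z = (u, p)" "path_mult G x y (u, p) \<noteq> 0" by (cases z) auto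
      obtain i where "x (u, take i p) \<noteq> 0" "y (awlast u (take i p), drop i p) \<noteq> 0" using trm[OF z(2)] by auto
      then show "z \<in> (\<lambda>((u, p), (v, q)). (u, p @ q)) ` ({p. x p \<noteq> 0} \<times> {p. y p \<noteq> 0})"
        using z by (intro image_eqI[of _ _ "((u, take i p), (awlast u (take i p), drop i p))"]) auto
    qed
  qed (use that in \<open>auto simp: path_algebra_def\<close>)
  have mult: "path_mult G x y \<in> path_algebra G"
    if "x \<in> path_algebra G" "y \<in> path_algebra G" for x y :: "('a, 'b) qpath \<Rightarrow> 'k"
    using fin[OF that] trm[of x y] by (auto simp: path_algebra_def)
  have add: "(\<lambda>p. x p + y p) \<in> ?J" if "x \<in> ?J" "y \<in> ?J" for x y
  proof -
    have sub: "{p. x p + y p \<noteq> 0} \<subseteq> {p. x p \<noteq> 0} \<union> {p. y p \<noteq> 0}" by auto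
    moreover have "finite ({p. x p \<noteq> 0} \<union> {p. y p \<noteq> 0})" using that by (auto simp: path_algebra_def)
    ultimately have "(\<lambda>p. x p + y p) \<in> path_algebra G"
      using that finite_subset[OF sub] unfolding path_algebra_def by blast
    moreover have "B p" if "x (u, p) + y (u, p) \<noteq> 0" for u p
      using that \<open>x \<in> ?J\<close> \<open>y \<in> ?J\<close> by (cases "x (u, p) = 0") auto
    ultimately show ?thesis by auto
  qed
  have mult2: "path_mult G a x \<in> ?J \<and> path_mult G x a \<in> ?J" if a: "a \<in> path_algebra G" and x: "x \<in> ?J" for a x
  proof -
    have "B p" if nz: "path_mult G a x (u, p) \<noteq> 0" for u p
    proof -
      obtain i where "x (awlast u (take i p), drop i p) \<noteq> 0" using trm[OF nz] by auto
      then have "B (drop i p)" using x by auto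
      from assms[OF this, of "take i p" "[]"] show ?thesis by simp
    qed
    moreover have "B p" if nz: "path_mult G x a (u, p) \<noteq> 0" for u p
    proof -
      obtain i where "x (u, take i p) \<noteq> 0" using trm[OF nz] by auto
      then have "B (take i p)" using x by auto
      from assms[OF this, of "[]" "drop i p"] show ?thesis by simp
    qed
    ultimately show ?thesis using mult a x by auto
  qed
  show ?thesis unfolding two_sided_ideal_def
  proof (intro conjI ballI)
    show "?J \<subseteq> path_algebra G" by (rule subsetI, drule CollectD, erule conjunct1)
    show "(\<lambda>_. 0) \<in> ?J" by (simp add: path_algebra_def)
    show "(\<lambda>p. x p + y p) \<in> ?J" if "x \<in> ?J" "y \<in> ?J" for x y using that by (rule add)
    show "path_mult G a x \<in> ?J" "path_mult G x a \<in> ?J" if "a \<in> path_algebra G" "x \<in> ?J" for a x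
      by (rule mult2[OF that, THEN conjunct1], rule mult2[OF that, THEN conjunct2])
  qed
qed

text \<open>A path containing a relation is the product of a generator with two paths. Conversely,
  the elements supported on such paths form an ideal that contains the generators.\<close>

lemma path_elem_in_generated_ideal:
  fixes r :: "'b \<Rightarrow> 'b \<Rightarrow> bool"
  assumes r: "\<And>\<alpha> \<beta>. \<alpha> \<in> arcs G \<Longrightarrow> \<beta> \<in> arcs G \<Longrightarrow> r \<alpha> \<beta> \<Longrightarrow> head G \<alpha> = tail G \<beta>"
    and p: "(u, p) \<in> qpaths G"
  defines "R \<equiv> {path_elem (tail G \<alpha>, [\<alpha>, \<beta>]) | \<alpha> \<beta>. \<alpha> \<in> arcs G \<and> \<beta> \<in> arcs G \<and> r \<alpha> \<beta>}"
  shows "(path_elem (u, p) :: _ \<Rightarrow> 'k::field) \<in> generated_ideal G R \<longleftrightarrow> \<not> successively (\<lambda>\<alpha> \<beta>. \<not> r \<alpha> \<beta>) p"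
proof
  assume "\<not> successively (\<lambda>\<alpha> \<beta>. \<not> r \<alpha> \<beta>) p"
  then obtain i where i: "Suc i < length p" "r (p ! i) (p ! Suc i)" by (auto simp: successively_conv_nth)
  define xs ys where "xs = take i p" and "ys = drop (Suc (Suc i)) p"
  have split: "p = xs @ [p ! i, p ! Suc i] @ ys"
    using i by (simp add: xs_def ys_def Cons_nth_drop_Suc)
  obtain v where v: "awalk u p v" using p by (auto simp: qpaths_def)
  then have arcs: "p ! i \<in> arcs G" "p ! Suc i \<in> arcs G" using i by (auto simp: awalk_def)
  have aw: "awalk u xs (awlast u xs)" "awalk (awlast u xs) ([p ! i, p ! Suc i] @ ys) v"
    using v split awalk_append_iff by metis+
  then have tail: "awlast u xs = tail G (p ! i)" by (auto simp: awalk_def)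
  have last: "awlast u (xs @ [p ! i, p ! Suc i]) = head G (p ! Suc i)" by (simp add: awalk_verts_conv)
  have aw': "awalk u (xs @ [p ! i, p ! Suc i]) (head G (p ! Suc i))"
    "awalk (head G (p ! Suc i)) ys v"
    using v split awalk_append_iff[of u "xs @ [p ! i, p ! Suc i]" ys v] last by simp_all
  have q1: "(u, xs @ [p ! i, p ! Suc i]) \<in> qpaths G" using aw' by (auto simp: qpaths_def)
  show "path_elem (u, p) \<in> generated_ideal G R"
    unfolding generated_ideal_def
  proof
    fix J :: "(('a, 'b) qpath \<Rightarrow> 'k) set" assume "J \<in> {J. two_sided_ideal G J \<and> R \<subseteq> J}"
    then have J: "two_sided_ideal G J" "R \<subseteq> J" by auto
    have gen: "path_elem (tail G (p ! i), [p ! i, p ! Suc i]) \<in> J"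
      using arcs i J(2) by (auto simp: R_def)
    have a1: "(path_elem (u, xs) :: _ \<Rightarrow> 'k) \<in> path_algebra G"
      using aw by (intro path_elem_in_algebra) (auto simp: qpaths_def)
    have a2: "(path_elem (head G (p ! Suc i), ys) :: _ \<Rightarrow> 'k) \<in> path_algebra G"
      using aw' by (intro path_elem_in_algebra) (auto simp: qpaths_def)
    have "path_mult G (path_elem (u, xs)) (path_elem (tail G (p ! i), [p ! i, p ! Suc i])) \<in> J"
      using J(1) a1 gen by (auto simp: two_sided_ideal_def)
    then have "path_elem (u, xs @ [p ! i, p ! Suc i]) \<in> J"
      using path_mult_elem[OF q1, where 'k = 'k] tail by simp
    then have "path_mult G (path_elem (u, xs @ [p ! i, p ! Suc i])) (path_elem (head G (p ! Suc i), ys)) \<in> J"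
      using J(1) a2 by (auto simp: two_sided_ideal_def)
    then show "path_elem (u, p) \<in> J"
      using path_mult_elem[of u "xs @ [p ! i, p ! Suc i]" ys, where 'k = 'k] last split p by simp
  qed
next
  assume elem: "(path_elem (u, p) :: _ \<Rightarrow> 'k) \<in> generated_ideal G R"
  define B where "B p \<longleftrightarrow> \<not> successively (\<lambda>\<alpha> \<beta>. \<not> r \<alpha> \<beta>) p" for p
  let ?J = "{x \<in> path_algebra G. \<forall>u p. x (u, p) \<noteq> (0::'k) \<longrightarrow> B p}"
  have "two_sided_ideal G ?J"
    by (rule two_sided_ideal_paths) (auto simp: B_def successively_append_iff)
  moreover have "R \<subseteq> ?J"
  proof
    fix x assume "x \<in> R"
    then obtain \<alpha> \<beta> where x: "x = path_elem (tail G \<alpha>, [\<alpha>, \<beta>])" "\<alpha> \<in> arcs G" "\<beta> \<in> arcs G" "r \<alpha> \<beta>"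
      by (auto simp: R_def)
    then have "(tail G \<alpha>, [\<alpha>, \<beta>]) \<in> qpaths G"
      using r[of \<alpha> \<beta>] by (auto simp: qpaths_def awalk_def)
    then show "x \<in> ?J" using x path_elem_in_algebra by (auto simp: B_def path_elem_def[abs_def] split: if_splits)
  qed
  ultimately have "(path_elem (u, p) :: _ \<Rightarrow> 'k) \<in> ?J" using elem by (auto simp: generated_ideal_def)
  then show "\<not> successively (\<lambda>\<alpha> \<beta>. \<not> r \<alpha> \<beta>) p" by (auto simp: path_elem_def B_def)
qed

end

section \<open>Regular polygons\<close>

lemma nat_mod_neq: fixes a b n :: nat
  assumes "a < b" "b < a + n" shows "a mod n \<noteq> b mod n"
proof
  assume "a mod n = b mod n"
  then have "n dvd b - a" using mod_eq_dvd_iff_nat[of a b n] assms by auto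
  then show False using assms by (auto dest: dvd_imp_le)
qed

text \<open>The offset \<open>x\<close> is 0 for the corners and 1/2 for the midpoint directions of
  the sides.\<close>

lemma cis_mod: assumes "0 < n" shows "cis (2 * pi * (real (k mod n) + x) / real n) = cis (2 * pi * (real k + x) / real n)"
proof -
  have "real k = real (k div n) * real n + real (k mod n)"
    by (metis div_mult_mod_eq of_nat_add of_nat_mult)
  then have "2 * pi * (real k + x) / real n = 2 * pi * (real (k mod n) + x) / real n + 2 * pi * real (k div n)"
    using assms by (simp add: field_simps)
  moreover have "cis (2 * pi * real (k div n)) = 1" using cis_multiple_2pi[of "real (k div n)"] by simp
  ultimately show ?thesis by (simp add: cis_mult[symmetric])
qed

lemma corner_mod: "0 < n \<Longrightarrow> corner n (k mod n) = corner n k"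
  using cis_mod[of n k 0] by (simp add: corner_def)

lemma corner_Suc_mod: "0 < n \<Longrightarrow> corner n (Suc (k mod n)) = corner n (Suc k)"
  by (metis corner_mod mod_Suc_eq)

lemma side_mod: "0 < n \<Longrightarrow> side n (k mod n) = side n k"
  "0 < n \<Longrightarrow> open_side n (k mod n) = open_side n k"
  "0 < n \<Longrightarrow> side_point n (k mod n) = side_point n k"
  by (simp_all add: side_def open_side_def side_point_def corner_mod corner_Suc_mod)

text \<open>The outward unit normal, pointing from the centre to the midpoint of the side. The inner
  product with it equals the \<open>apothem\<close>, the radius of the inscribed circle, along the
  side.\<close>

definition side_normal :: "nat \<Rightarrow> nat \<Rightarrow> complex" where
  "side_normal n k = cis (2 * pi * (real k + 1 / 2) / real n)"

definition apothem :: "nat \<Rightarrow> real" where "apothem n = cos (pi / real n)"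

lemma side_normal_mod: "0 < n \<Longrightarrow> side_normal n (k mod n) = side_normal n k"
  using cis_mod[of n k "1/2"] by (simp add: side_normal_def)

lemma inner_cis: "cis a \<bullet> cis b = cos (a - b)"
  by (simp add: inner_complex_def cos_diff)

lemma corner_inner_eq: assumes "0 < n"
  shows "corner n k \<bullet> side_normal n k = apothem n" "corner n (Suc k) \<bullet> side_normal n k = apothem n"
proof -
  have "2 * pi * real k / real n - 2 * pi * (real k + 1 / 2) / real n = - (pi / real n)"
    "2 * pi * real (Suc k) / real n - 2 * pi * (real k + 1 / 2) / real n = pi / real n"
    using assms by (simp_all add: field_simps)
  then show "corner n k \<bullet> side_normal n k = apothem n" "corner n (Suc k) \<bullet> side_normal n k = apothem n"
    by (simp_all add: corner_def side_normal_def inner_cis apothem_def)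
qed

text \<open>A corner and a normal enclose an odd multiple of \<open>pi / real n\<close>, and the
  cosine is largest for the two corners at angle \<open>pi / real n\<close>. Angles beyond
  \<open>pi\<close> are reflected.\<close>

lemma cos_odd_less:
  assumes "3 \<le> n" "1 < a" "a < 2 * real n - 1"
  shows "cos (pi * a / real n) < cos (pi / real n)"
proof (cases "a \<le> real n")
  case True
  show ?thesis
    by (rule cos_monotone_0_pi) (use True assms in \<open>auto simp: field_simps\<close>)
next
  case False
  have "cos (pi * a / real n) = cos (2 * pi - pi * a / real n)" by (simp add: cos_diff)
  also have "2 * pi - pi * a / real n = pi * (2 * real n - a) / real n" using assms by (simp add: field_simps)
  also have "cos (pi * (2 * real n - a) / real n) < cos (pi / real n)"
  proof (rule cos_monotone_0_pi)
    have "pi * 1 < pi * (2 * real n - a)" using assms by (intro mult_strict_left_mono) auto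
    then show "pi / real n < pi * (2 * real n - a) / real n" using assms by (intro divide_strict_right_mono) auto
  qed (use False assms in \<open>auto simp: field_simps\<close>)
  finally show ?thesis .
qed

context
  fixes n :: nat assumes n: "3 \<le> n"
begin

lemma apothem_pos: "0 < apothem n"
proof -
  have "pi / real n < pi / 2" using n by (simp add: field_simps)
  then show ?thesis unfolding apothem_def using n by (intro cos_gt_zero_pi) (auto intro: less_trans[of _ 0])
qed

lemma corner_inner_less:
  assumes "j < n" "k < n" "j \<noteq> k" "j \<noteq> Suc k mod n"
  shows "corner n j \<bullet> side_normal n k < apothem n"
proof -
  define a where "a = \<bar>2 * real j - 2 * real k - 1\<bar>"
  have "2 * pi * real j / real n - 2 * pi * (real k + 1 / 2) / real n = pi * (2 * real j - 2 * real k - 1) / real n"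
    using n by (simp add: field_simps)
  moreover have "\<bar>pi * (2 * real j - 2 * real k - 1) / real n\<bar> = pi * a / real n"
    by (simp add: a_def abs_mult)
  ultimately have "corner n j \<bullet> side_normal n k = cos (pi * a / real n)"
    unfolding corner_def side_normal_def inner_cis by (metis cos_abs_real)
  moreover have "1 < a \<and> a < 2 * real n - 1"
  proof (cases "k < j")
    case True
    then have "j \<noteq> Suc k" using assms by (auto simp: mod_if split: if_splits)
    then have "Suc (Suc k) \<le> j" using True by simp
    then have "real k + 2 \<le> real j" "real j < real n" using assms(1) by linarith+
    then show ?thesis by (simp add: a_def)
  next
    case False
    then have "Suc j \<le> k" using assms by simp
    moreover have "k \<noteq> n - 1 \<or> j \<noteq> 0" using assms n by (auto simp: mod_if)
    then have "k - j < n - 1" using assms by auto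
    ultimately have "real j + 1 \<le> real k" "real k - real j < real n - 1" using assms by (auto simp: of_nat_diff)
    then show ?thesis by (simp add: a_def)
  qed
  ultimately show ?thesis using cos_odd_less[OF n] by (simp add: apothem_def)
qed

lemma corner_inner_le: "corner n j \<bullet> side_normal n k \<le> apothem n"
proof -
  have "corner n (j mod n) \<bullet> side_normal n (k mod n) \<le> apothem n"
    using corner_inner_less[of "j mod n" "k mod n"] corner_inner_eq[of n "k mod n"] n
    by (cases "j mod n = k mod n"; cases "j mod n = Suc (k mod n) mod n") (auto simp: corner_mod corner_Suc_mod mod_Suc_eq)
  then show ?thesis using n by (simp add: corner_mod side_normal_mod)
qed

lemma corner_inner_eq_iff: assumes "j < n" "k < n"
  shows "corner n j \<bullet> side_normal n k = apothem n \<longleftrightarrow> j = k \<or> j = Suc k mod n"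
  using corner_inner_less[OF assms] corner_inner_eq[of n k] n corner_mod[of n "Suc k"] by fastforce

lemma corner_inj: assumes "j < n" "k < n" "corner n j = corner n k" shows "j = k"
proof (rule ccontr)
  assume "j \<noteq> k"
  have 1: "j = Suc k mod n" using corner_inner_eq_iff[of j k] corner_inner_eq[of n k] assms n \<open>j \<noteq> k\<close> by auto
  have 2: "k = Suc j mod n" using corner_inner_eq_iff[of k j] corner_inner_eq[of n j] assms n \<open>j \<noteq> k\<close> by auto
  have "k = Suc (Suc k) mod n" using 1 2 by (metis mod_Suc_eq)
  then show False using nat_mod_neq[of k "Suc (Suc k)" n] n assms by simp
qed

lemma corner_neq: assumes "i < j" "j < i + n" shows "corner n i \<noteq> corner n j"
  using corner_inj[of "i mod n" "j mod n"] nat_mod_neq[OF assms] n by (auto simp: corner_mod)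

lemma corner_neq_Suc: "corner n k \<noteq> corner n (Suc k)"
proof
  assume "corner n k = corner n (Suc k)"
  then have "k mod n = Suc k mod n" using corner_inj[of "k mod n" "Suc k mod n"] n by (simp add: corner_mod)
  then show False using nat_mod_neq[of k "Suc k" n] n by simp
qed

lemma corner_in_ngon: "corner n k \<in> ngon n"
  using n by (auto simp: ngon_def corner_mod[symmetric, of n k] intro!: hull_inc)

lemma convex_ngon: "convex (ngon n)" and compact_ngon: "compact (ngon n)"
  by (auto simp: ngon_def intro: finite_imp_compact_convex_hull)

text \<open>The corners are the \<open>n\<close>-th roots of unity, whose mean is 0.\<close>

lemma zero_in_ngon: "0 \<in> ngon n"
proof -
  have "(\<Sum>k<n. corner n k) = 0"
  proof -
    have c: "corner n k = cis (2 * pi / real n) ^ k" for k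
    proof -
      have "2 * pi * real k / real n = real k * (2 * pi / real n)" by simp
      then show ?thesis by (metis corner_def Complex.DeMoivre)
    qed
    have "cis (2 * pi / real n) \<noteq> 1" using corner_neq_Suc[of 0] by (simp add: corner_def)
    then have "(\<Sum>k<n. corner n k) = (cis (2 * pi / real n) ^ n - 1) / (cis (2 * pi / real n) - 1)"
      unfolding c by (simp add: geometric_sum)
    also have "cis (2 * pi / real n) ^ n = 1" using n by (simp add: Complex.DeMoivre)
    finally show ?thesis by simp
  qed
  moreover have "(\<Sum>k<n. (1 / real n) *\<^sub>R corner n k) \<in> ngon n"
    using n corner_in_ngon convex_ngon by (intro convex_sum) auto
  ultimately show ?thesis by (simp flip: scaleR_sum_right)
qed

text \<open>A point satisfying all inequalities lies in the angle between two consecutive corners,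
  where it is a combination of them with coefficients \<open>a\<close> and \<open>b\<close> that are
  not negative. The inequality of this side gives \<open>a + b \<le> 1\<close>, and the remaining
  weight goes to the centre.\<close>

lemma ngon_halfplanes: "ngon n = {z. \<forall>k<n. z \<bullet> side_normal n k \<le> apothem n}" (is "_ = ?H")
proof
  have "convex (\<Inter>k<n. {z. side_normal n k \<bullet> z \<le> apothem n})"
    by (intro convex_INT convex_halfspace_le)
  moreover have "(\<Inter>k<n. {z. side_normal n k \<bullet> z \<le> apothem n}) = ?H" by (auto simp: inner_commute)
  ultimately have "convex ?H" by simp
  then show "ngon n \<subseteq> ?H" unfolding ngon_def
    by (intro hull_minimal) (auto simp: corner_inner_le)
next
  show "?H \<subseteq> ngon n"
  proof
    fix z assume z: "z \<in> ?H"
    show "z \<in> ngon n"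
    proof (cases "z = 0")
      case True then show ?thesis using zero_in_ngon by simp
    next
      case False
      define t where "t = Arg2pi z"
      have t: "0 \<le> t" "t < 2 * pi" "z = of_real (cmod z) * cis t"
        using Arg2pi_ge_0[of z] Arg2pi_lt_2pi[of z] Arg2pi_eq[of z] by (simp_all add: t_def cis_conv_exp)
      define k where "k = nat \<lfloor>t * real n / (2 * pi)\<rfloor>"
      define s where "s = t - 2 * pi * real k / real n"
      have "0 \<le> t * real n / (2 * pi)" using t by simp
      then have k: "real k \<le> t * real n / (2 * pi)" "t * real n / (2 * pi) < real k + 1"
        unfolding k_def by linarith+
      have "2 * pi * real k / real n \<le> t" "t < 2 * pi * (real k + 1) / real n" using k n by (simp_all add: field_simps)
      then have s: "0 \<le> s" "s < 2 * pi / real n"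
        by (simp_all add: s_def add_divide_distrib distrib_left)
      have "t * real n / (2 * pi) < real n" using t n by (simp add: field_simps)
      then have kn: "k < n" using k by linarith
      define w where "w = 2 * pi / real n"
      have w: "0 < w" "w < pi" using n by (auto simp: w_def field_simps)
      then have sw: "0 < sin w" by (simp add: sin_gt_zero)
      \<comment> \<open>The coefficients of \<open>z\<close> with respect to the corners
        \<open>k\<close> and \<open>k + 1\<close>, by the law of sines: \<open>s\<close> is the
        angle from corner \<open>k\<close> to \<open>z\<close>, and \<open>w\<close> the angle
        between the corners.\<close>
      define a b where "a = cmod z * sin (w - s) / sin w" and "b = cmod z * sin s / sin w"
      have ab: "0 \<le> a" "0 \<le> b" using s w sw by (auto simp: a_def b_def w_def[symmetric] intro!: mult_nonneg_nonneg divide_nonneg_pos sin_ge_zero)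
      have "sin w *\<^sub>R cis t = sin (w - s) *\<^sub>R corner n k + sin s *\<^sub>R corner n (Suc k)"
      proof -
        have "corner n k = cis (t - s)" by (simp add: s_def corner_def)
        moreover have "corner n (Suc k) = cis (t - s + w)"
          by (simp add: s_def w_def corner_def add_divide_distrib algebra_simps)
        moreover have "sin w * cos t = sin (w - s) * cos (t - s) + sin s * cos (t - s + w)"
          "sin w * sin t = sin (w - s) * sin (t - s) + sin s * sin (t - s + w)"
        proof -
          have e: "sin w * cos (u + s) = sin (w - s) * cos u + sin s * cos (u + w)"
            "sin w * sin (u + s) = sin (w - s) * sin u + sin s * sin (u + w)" for u
            by (simp_all add: cos_add sin_add sin_diff algebra_simps)
          show "sin w * cos t = sin (w - s) * cos (t - s) + sin s * cos (t - s + w)"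
            "sin w * sin t = sin (w - s) * sin (t - s) + sin s * sin (t - s + w)"
            using e[of "t - s"] by simp_all
        qed
        ultimately show ?thesis by (simp add: complex_eq_iff)
      qed
      then have "z = a *\<^sub>R corner n k + b *\<^sub>R corner n (Suc k)"
      proof -
        have "z = (cmod z / sin w) *\<^sub>R (sin w *\<^sub>R cis t)" using t(3) sw by (simp add: scaleR_conv_of_real)
        also have "\<dots> = a *\<^sub>R corner n k + b *\<^sub>R corner n (Suc k)"
          unfolding \<open>sin w *\<^sub>R cis t = _\<close> by (simp add: a_def b_def scaleR_add_right)
        finally show ?thesis .
      qed
      moreover from this have "(a + b) * apothem n = z \<bullet> side_normal n k"
        using corner_inner_eq[of n k] n by (simp add: inner_add_left algebra_simps)
      then have "(a + b) * apothem n \<le> 1 * apothem n" using z kn by simp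
      then have "a + b \<le> 1" using apothem_pos by simp
      moreover have "a + b \<noteq> 0" using calculation(1) ab False by (auto simp: add_nonneg_eq_0_iff)
      ultimately have "z = (1 - (a + b)) *\<^sub>R 0 + (a + b) *\<^sub>R ((a / (a + b)) *\<^sub>R corner n k + (b / (a + b)) *\<^sub>R corner n (Suc k))"
        by (simp add: scaleR_add_right)
      moreover have "(a / (a + b)) *\<^sub>R corner n k + (b / (a + b)) *\<^sub>R corner n (Suc k) \<in> ngon n"
        using ab \<open>a + b \<noteq> 0\<close> corner_in_ngon by (intro convexD[OF convex_ngon]) (auto simp: add_divide_distrib[symmetric])
      ultimately show ?thesis
        using convexD[OF convex_ngon zero_in_ngon, of _ "1 - (a + b)" "a + b"] ab \<open>a + b \<le> 1\<close> by auto
    qed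
  qed
qed

lemma interior_ngon: "interior (ngon n) = {z. \<forall>k<n. z \<bullet> side_normal n k < apothem n}" (is "_ = ?H")
proof
  show "interior (ngon n) \<subseteq> ?H"
  proof safe
    fix z k assume z: "z \<in> interior (ngon n)" and k: "k < n"
    have "ngon n \<subseteq> {z. side_normal n k \<bullet> z \<le> apothem n}" using k by (auto simp: ngon_halfplanes inner_commute)
    then have "interior (ngon n) \<subseteq> interior {z. side_normal n k \<bullet> z \<le> apothem n}" by (rule interior_mono)
    moreover have "side_normal n k \<noteq> 0" by (simp add: side_normal_def)
    ultimately have "z \<in> {z. side_normal n k \<bullet> z < apothem n}" using z by (auto simp: interior_halfspace_le)
    then show "z \<bullet> side_normal n k < apothem n" by (simp add: inner_commute)
  qed
  have "open (\<Inter>k<n. {z. side_normal n k \<bullet> z < apothem n})"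
    by (intro open_INT) (auto intro: open_halfspace_lt)
  moreover have "(\<Inter>k<n. {z. side_normal n k \<bullet> z < apothem n}) = ?H" by (auto simp: inner_commute)
  ultimately have "open ?H" by simp
  then show "?H \<subseteq> interior (ngon n)" by (intro interior_maximal) (auto simp: ngon_halfplanes less_imp_le)
qed

text \<open>The supporting line cuts out a face, and a face of a convex hull is the hull of some of
  the corners. The two ends of the side are the corners on this line.\<close>

lemma side_eq: assumes k: "k < n" shows "side n k = {z \<in> ngon n. z \<bullet> side_normal n k = apothem n}"
proof
  have "side n k \<subseteq> ngon n"
    unfolding side_def by (intro closed_segment_subset corner_in_ngon convex_ngon)
  moreover have "z \<bullet> side_normal n k = apothem n" if z: "z \<in> side n k" for z
  proof -
    obtain u where "z = (1 - u) *\<^sub>R corner n k + u *\<^sub>R corner n (Suc k)" using z by (auto simp: side_def in_segment)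
    then have "z \<bullet> side_normal n k = (1 - u) * apothem n + u * apothem n"
      using corner_inner_eq[of n k] n by (simp add: inner_add_left)
    then show ?thesis by (simp add: algebra_simps)
  qed
  ultimately show "side n k \<subseteq> {z \<in> ngon n. z \<bullet> side_normal n k = apothem n}" by auto
next
  let ?F = "ngon n \<inter> {z. side_normal n k \<bullet> z = apothem n}"
  have "?F face_of ngon n"
    by (rule face_of_Int_supporting_hyperplane_le[OF convex_ngon]) (use k in \<open>auto simp: ngon_halfplanes inner_commute\<close>)
  then obtain X where X: "X \<subseteq> corner n ` {..<n}" "?F = convex hull X"
    using face_of_convex_hull_subset[of "corner n ` {..<n}" ?F] by (auto simp: ngon_def finite_imp_compact)
  have "X \<subseteq> {corner n k, corner n (Suc k)}"
  proof
    fix x assume "x \<in> X"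
    then have "x \<in> ?F" using X(2) hull_inc[of x X] by simp
    moreover obtain j where j: "j < n" "x = corner n j" using X(1) \<open>x \<in> X\<close> by auto
    ultimately have "j = k \<or> j = Suc k mod n" using corner_inner_eq_iff[OF j(1) k] by (auto simp: inner_commute)
    then show "x \<in> {corner n k, corner n (Suc k)}" using j n by (auto simp: corner_mod)
  qed
  then have "?F \<subseteq> side n k" unfolding X(2) side_def segment_convex_hull by (rule hull_mono)
  then show "{z \<in> ngon n. z \<bullet> side_normal n k = apothem n} \<subseteq> side n k" by (auto simp: inner_commute)
qed

lemma side_subset: "side n k \<subseteq> ngon n"
  unfolding side_def by (intro closed_segment_subset corner_in_ngon convex_ngon)

lemma ngon_frontier: "ngon n - interior (ngon n) = (\<Union>k<n. side n k)"
proof (intro equalityI subsetI)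
  fix z assume z: "z \<in> ngon n - interior (ngon n)"
  then obtain k where k: "k < n" "\<not> z \<bullet> side_normal n k < apothem n" by (auto simp: interior_ngon)
  moreover have "z \<bullet> side_normal n k \<le> apothem n" using z k(1) by (simp add: ngon_halfplanes)
  ultimately have "z \<in> side n k" using z by (simp add: side_eq)
  then show "z \<in> (\<Union>k<n. side n k)" using k(1) by blast
next
  fix z assume "z \<in> (\<Union>k<n. side n k)"
  then obtain k where k: "k < n" "z \<in> ngon n" "z \<bullet> side_normal n k = apothem n" by (auto simp: side_eq)
  then show "z \<in> ngon n - interior (ngon n)" by (auto simp: interior_ngon intro!: exI[of _ k])
qed

lemma side_split: "side n k = insert (corner n k) (insert (corner n (Suc k)) (open_side n k))"
  by (auto simp: side_def open_side_def open_segment_def)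

lemma corner_in_side: "corner n k \<in> side n k" "corner n (Suc k) \<in> side n k"
  by (auto simp: side_def)

lemma open_side_subset: "open_side n k \<subseteq> side n k"
  by (auto simp: side_split)

text \<open>As \<open>n\<close> is at least 3, the ends of another side do not both lie on the line
  of side \<open>k\<close>, so a proper convex combination of them lies strictly inside.\<close>

lemma open_side_inner_less: assumes "z \<in> open_side n j" "j < n" "k < n" "j \<noteq> k"
  shows "z \<bullet> side_normal n k < apothem n"
proof -
  obtain t where t: "0 < t" "t < 1" "z = (1 - t) *\<^sub>R corner n j + t *\<^sub>R corner n (Suc j)"
    using assms(1) corner_neq_Suc by (auto simp: open_side_def in_segment)
  define p q where "p = corner n j \<bullet> side_normal n k" and "q = corner n (Suc j) \<bullet> side_normal n k"
  have pq: "p \<le> apothem n" "q \<le> apothem n" by (auto simp: p_def q_def corner_inner_le)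
  have "p < apothem n \<or> q < apothem n"
  proof (rule ccontr)
    assume "\<not> ?thesis"
    then have "corner n j \<bullet> side_normal n k = apothem n" "corner n (Suc j mod n) \<bullet> side_normal n k = apothem n"
      using pq n by (auto simp: p_def q_def corner_mod)
    then have j: "j = Suc k mod n" "Suc j mod n = k \<or> Suc j mod n = Suc k mod n"
      using corner_inner_eq_iff[of j k] corner_inner_eq_iff[of "Suc j mod n" k] assms n by auto
    then have "Suc (Suc k) mod n = k \<or> Suc (Suc k) mod n = Suc k mod n" by (metis mod_Suc_eq)
    then show False using nat_mod_neq[of k "Suc (Suc k)" n] nat_mod_neq[of "Suc k" "Suc (Suc k)" n] n assms by auto
  qed
  then have "(1 - t) * p + t * q < (1 - t) * apothem n + t * apothem n"
    using t pq mult_left_mono[of p "apothem n" "1 - t"] mult_left_mono[of q "apothem n" t]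
      mult_strict_left_mono[of p "apothem n" "1 - t"] mult_strict_left_mono[of q "apothem n" t] by linarith
  moreover have "z \<bullet> side_normal n k = (1 - t) * p + t * q" by (simp add: t(3) p_def q_def inner_add_left)
  ultimately show ?thesis by (simp add: algebra_simps)
qed

lemma open_side_disjoint: assumes "j < n" "k < n" "j \<noteq> k" shows "open_side n j \<inter> side n k = {}"
  using open_side_inner_less[OF _ assms] side_eq[OF assms(2)] by fastforce

lemma corner_notin_open_side: "corner n j \<notin> open_side n k"
proof
  assume a: "corner n j \<in> open_side n k"
  then have "corner n (j mod n) \<in> open_side n (k mod n)" using n by (simp add: corner_mod side_mod)
  moreover have "corner n (j mod n) \<in> side n (j mod n)" by (rule corner_in_side)
  ultimately have "j mod n = k mod n" using open_side_disjoint[of "k mod n" "j mod n"] n by fastforce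
  then have "corner n j = corner n k" using n by (metis corner_mod gr_zeroI not_numeral_le_zero)
  then show False using a by (simp add: open_side_def open_segment_def)
qed

lemma corner_side_iff: assumes "j < n" "k < n" shows "corner n j \<in> side n k \<longleftrightarrow> j = k \<or> j = Suc k mod n"
  using corner_in_ngon corner_inner_eq_iff[OF assms] by (simp add: side_eq[OF assms(2)])

lemma side_point_image: "side_point n k ` {0..1} = side n k" "side_point n k ` {0<..<1} = open_side n k"
proof -
  show "side_point n k ` {0..1} = side n k" by (simp add: side_point_def side_def linepath_image_01)
  show "side_point n k ` {0<..<1} = open_side n k"
    using corner_neq_Suc[of k] by (simp add: side_point_def open_side_def open_segment_image_interval linepath_def)
qed

lemma side_point_ends: "side_point n k 0 = corner n k" "side_point n k 1 = corner n (Suc k)"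
  by (auto simp: side_point_def linepath_def)

lemma side_point_inj: "side_point n k s = side_point n k t \<longleftrightarrow> s = t"
proof
  assume "side_point n k s = side_point n k t"
  then have "(s - t) *\<^sub>R (corner n (Suc k) - corner n k) = 0"
    by (simp add: side_point_def linepath_def algebra_simps)
  then show "s = t" using corner_neq_Suc[of k] by simp
qed simp

lemma interior_ngon_nonempty: "0 \<in> interior (ngon n)"
  using apothem_pos by (simp add: interior_ngon)

lemma ngon_cases:
  assumes "z \<in> ngon n"
  obtains "z \<in> interior (ngon n)" | k where "k < n" "z \<in> open_side n k" | k where "k < n" "z = corner n k"
proof -
  consider "z \<in> interior (ngon n)" | k where "k < n" "z \<in> side n k"
    using assms ngon_frontier by blast
  then show thesis
  proof cases
    case (2 k)
    then consider "z = corner n k" | "z = corner n (Suc k mod n)" | "z \<in> open_side n k"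
      using n by (auto simp: side_split corner_mod)
    then show thesis using that(2)[of k] that(3)[of k] that(3)[of "Suc k mod n"] 2 n by cases auto
  qed (use that in auto)
qed

lemma open_side_boundary: "k < n \<Longrightarrow> side n k \<inter> interior (ngon n) = {}"
  using ngon_frontier by auto

end

subsection \<open>Cutting a regular polygon along a chord\<close>

text \<open>Positive to the left of the directed line from \<open>v\<close> to \<open>w\<close> and
  zero on it: \<open>\<i> * (w - v)\<close> is a left normal.\<close>

definition chord_side :: "complex \<Rightarrow> complex \<Rightarrow> complex \<Rightarrow> real" where
  "chord_side v w z = (\<i> * (w - v)) \<bullet> (z - v)"

lemma chord_side_ends: "chord_side v w v = 0" "chord_side v w w = 0"
  by (simp_all add: chord_side_def inner_complex_def algebra_simps)

lemma chord_side_convex: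
  "chord_side v w ((1 - t) *\<^sub>R x + t *\<^sub>R y) = (1 - t) * chord_side v w x + t * chord_side v w y"
  by (simp add: chord_side_def inner_complex_def algebra_simps)

lemma chord_side_zero: assumes "chord_side v w z = 0" "v \<noteq> w" obtains t where "z = (1 - t) *\<^sub>R v + t *\<^sub>R w"
proof -
  define c where "c = (z - v) / (w - v)"
  have z: "z - v = c * (w - v)" using assms by (simp add: c_def)
  have "(\<i> * d) \<bullet> (c * d) = (cmod d)\<^sup>2 * Im c" for d
    unfolding cmod_power2 inner_complex_def by (simp add: algebra_simps power2_eq_square)
  then have "Im c = 0" using assms unfolding chord_side_def z by simp
  then have "c = of_real (Re c)" by (simp add: complex_eq_iff)
  then have "z - v = Re c *\<^sub>R (w - v)" using z by (metis scaleR_conv_of_real)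
  then have "z = (1 - Re c) *\<^sub>R v + Re c *\<^sub>R w" by (simp add: algebra_simps)
  then show thesis by (rule that)
qed

lemma mod_window:
  fixes i k n :: nat assumes "i < n" obtains j where "k \<le> j" "j < k + n" "j mod n = i"
proof -
  have kn: "k mod n < n" using assms by simp
  define j where "j = (if k mod n \<le> i then k + (i - k mod n) else k + (n + i - k mod n))"
  obtain m where m: "k = m * n + k mod n" by (metis div_mult_mod_eq)
  then have "j = (if k mod n \<le> i then i + m * n else i + Suc m * n)" using kn by (auto simp: j_def)
  then have "j mod n = i mod n" by (metis mod_mult_self1)
  moreover have "k \<le> j" "j < k + n" using assms kn by (auto simp: j_def)
  ultimately show thesis using that assms by simp
qed

text \<open>The linear form decreases along the segment and takes the value \<open>b\<close> at
  \<open>w\<close>, so the half-plane keeps the part up to \<open>w\<close>.\<close>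

lemma segment_part:
  fixes x y w z a :: "'a::real_inner"
  assumes w: "w \<in> open_segment x y" and a: "b < a \<bullet> x" "a \<bullet> w = b"
  shows "z \<in> closed_segment x y \<and> b \<le> a \<bullet> z \<longleftrightarrow> z \<in> closed_segment x w"
proof
  obtain u where u: "0 < u" "u < 1" "w = (1 - u) *\<^sub>R x + u *\<^sub>R y" using w by (auto simp: in_segment)
  define d where "d = a \<bullet> x - a \<bullet> y"
  have ud: "u * d = a \<bullet> x - b" using a(2) by (simp add: u(3) d_def inner_add_right algebra_simps)
  then have d: "0 < d" using a(1) u(1) zero_less_mult_pos[of u d] by simp
  show "z \<in> closed_segment x w" if z: "z \<in> closed_segment x y \<and> b \<le> a \<bullet> z"
  proof -
    obtain t where t: "0 \<le> t" "t \<le> 1" "z = (1 - t) *\<^sub>R x + t *\<^sub>R y"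
      using z[THEN conjunct1, unfolded in_segment] by (elim exE conjE)
    have "a \<bullet> z = a \<bullet> x - t * d" by (simp add: t(3) d_def inner_add_right algebra_simps)
    then have "t * d \<le> u * d" using z ud by simp
    then have tu: "t \<le> u" using d by simp
    have line: "(1 - c) *\<^sub>R x + c *\<^sub>R y' = x + c *\<^sub>R (y' - x)" for c and y' :: 'a by (simp add: algebra_simps)
    have "z = (1 - t / u) *\<^sub>R x + (t / u) *\<^sub>R w"
      unfolding t(3) u(3) line using u(1) by simp
    moreover have "0 \<le> t / u" "t / u \<le> 1" using t u tu by auto
    ultimately show ?thesis unfolding in_segment by (intro exI conjI)
  qed
  show "z \<in> closed_segment x y \<and> b \<le> a \<bullet> z" if z: "z \<in> closed_segment x w"
  proof
    show "z \<in> closed_segment x y"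
      using z w subset_closed_segment[of x w x y] by (auto simp: open_segment_def)
    obtain t where t: "0 \<le> t" "t \<le> 1" "z = (1 - t) *\<^sub>R x + t *\<^sub>R w"
      using z[unfolded in_segment] by (elim exE conjE)
    have "a \<bullet> z = b + (1 - t) * (a \<bullet> x - b)" using a(2) by (simp add: t(3) inner_add_right algebra_simps)
    then show "b \<le> a \<bullet> z" using t a(1) by simp
  qed
qed

lemma half_open_segment:
  fixes x y w :: "'a::real_vector"
  assumes w: "w \<in> open_segment x y" shows "closed_segment x w - {x} \<subseteq> open_segment x y"
proof
  have line: "(1 - c) *\<^sub>R x + c *\<^sub>R y' = x + c *\<^sub>R (y' - x)" for c and y' :: 'a by (simp add: algebra_simps)
  fix z assume z: "z \<in> closed_segment x w - {x}"
  obtain t where t: "0 \<le> t" "t \<le> 1" "z = x + t *\<^sub>R (w - x)"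
    using z[THEN DiffD1, unfolded in_segment line] by (elim exE conjE)
  obtain u where u: "x \<noteq> y" "0 < u" "u < 1" "w = x + u *\<^sub>R (y - x)"
    using w[unfolded in_segment line] by (elim exE conjE)
  have "t \<noteq> 0" using z t(3) by auto
  then have "0 < t" using t(1) by simp
  then have "0 < t * u" "t * u < 1" using t(2) u mult_le_less_imp_less[of t 1 u 1] by auto
  moreover have "z = x + (t * u) *\<^sub>R (y - x)" using t(3) u(4) by simp
  ultimately show "z \<in> open_segment x y" unfolding in_segment line using u(1) by (intro conjI exI)
qed

lemma connected_segment_minus_end:
  fixes x y :: "'a::euclidean_space" shows "connected (closed_segment x y - {x})"
proof -
  have "x extreme_point_of closed_segment x y" by (simp add: extreme_point_of_segment)
  then have "convex (closed_segment x y - {x})"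
    using extreme_point_of_stillconvex[OF convex_closed_segment] by blast
  then show ?thesis by (rule convex_connected)
qed

lemma connected_Union_chain:
  assumes "\<And>i. i < q \<Longrightarrow> connected (X i)" "\<And>i. Suc i < q \<Longrightarrow> X i \<inter> X (Suc i) \<noteq> {}"
  shows "connected (\<Union>i<q. X i)"
  using assms
proof (induction q)
  case (Suc q)
  show ?case
  proof (cases q)
    case 0 then show ?thesis using Suc.prems by (simp add: lessThan_Suc)
  next
    case (Suc k)
    have "connected ((\<Union>i<q. X i) \<union> X q)"
      using Suc.IH Suc.prems Suc \<open>q = Suc k\<close> by (intro connected_Un) auto
    then show ?thesis by (simp add: lessThan_Suc Un_commute)
  qed
qed simp

context
  fixes n :: nat assumes n: "3 \<le> n"
begin

context
  fixes p q :: nat and v w :: complex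
  assumes pq: "p < n" "q < n" "p \<noteq> q" and v: "v \<in> open_side n p" and w: "w \<in> open_side n q"
begin

lemma chord_in_ngon: "v \<in> ngon n" "w \<in> ngon n"
  using v w open_side_subset[OF n] side_subset[OF n] by blast+

lemma chord_normal:
  "v \<bullet> side_normal n p = apothem n" "j < n \<Longrightarrow> j \<noteq> p \<Longrightarrow> v \<bullet> side_normal n j < apothem n"
  "w \<bullet> side_normal n q = apothem n" "j < n \<Longrightarrow> j \<noteq> q \<Longrightarrow> w \<bullet> side_normal n j < apothem n"
proof -
  show "v \<bullet> side_normal n p = apothem n" "w \<bullet> side_normal n q = apothem n"
    using v w pq side_eq[OF n] open_side_subset[OF n] by blast+
qed (use v w pq open_side_inner_less[OF n] in auto)

lemma chord_neq: "v \<noteq> w" using chord_normal pq by force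

text \<open>Beyond \<open>v\<close> or \<open>w\<close> the line violates the inequality of the side
  \<open>p\<close> or \<open>q\<close>, because the other end of the chord satisfies it
  strictly.\<close>

lemma chord_line: assumes "z \<in> ngon n" "chord_side v w z = 0" shows "z \<in> closed_segment v w"
proof -
  obtain t where t: "z = (1 - t) *\<^sub>R v + t *\<^sub>R w" using chord_side_zero assms(2) chord_neq by blast
  have *: "z \<bullet> side_normal n j = v \<bullet> side_normal n j + t * (w \<bullet> side_normal n j - v \<bullet> side_normal n j)" for j
    by (simp add: t inner_add_left algebra_simps)
  have "z \<bullet> side_normal n p \<le> apothem n" "z \<bullet> side_normal n q \<le> apothem n"
    using assms(1) pq ngon_halfplanes[OF n] by auto
  then have "t * (w \<bullet> side_normal n p - apothem n) \<le> 0" "(1 - t) * (v \<bullet> side_normal n q - apothem n) \<le> 0"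
    using * chord_normal(1,3) by (simp_all add: algebra_simps)
  then have "0 \<le> t" "0 \<le> 1 - t"
    using chord_normal(4)[of p] chord_normal(2)[of q] pq
    by (auto simp: mult_le_0_iff zero_le_mult_iff)
  then show ?thesis using t by (auto simp: in_segment)
qed

lemma chord_interior: assumes "z \<in> open_segment v w" shows "z \<in> interior (ngon n)"
proof -
  obtain t where t: "0 < t" "t < 1" "z = (1 - t) *\<^sub>R v + t *\<^sub>R w" using assms by (auto simp: in_segment)
  have "z \<bullet> side_normal n j < apothem n" if j: "j < n" for j
  proof -
    define a b where "a = v \<bullet> side_normal n j" and "b = w \<bullet> side_normal n j"
    have "a \<le> apothem n" "b \<le> apothem n" using chord_in_ngon j ngon_halfplanes[OF n] by (auto simp: a_def b_def)
    moreover have "a < apothem n \<or> b < apothem n" using chord_normal(2,4) j pq(3) by (auto simp: a_def b_def)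
    ultimately have "(1 - t) * a + t * b < (1 - t) * apothem n + t * apothem n"
      using t mult_left_mono[of a "apothem n" "1 - t"] mult_left_mono[of b "apothem n" t]
        mult_strict_left_mono[of a "apothem n" "1 - t"] mult_strict_left_mono[of b "apothem n" t] by linarith
    moreover have "z \<bullet> side_normal n j = (1 - t) * a + t * b" by (simp add: t(3) a_def b_def inner_add_left)
    ultimately show ?thesis by (simp add: algebra_simps)
  qed
  then show ?thesis using interior_ngon[OF n] by simp
qed

lemma chord_frontier: assumes "z \<in> side n j" "j < n" "chord_side v w z = 0" shows "z = v \<or> z = w"
proof -
  have "z \<in> closed_segment v w" using chord_line assms side_subset[OF n] by blast
  moreover have "z \<notin> interior (ngon n)" using assms open_side_boundary[OF n] by blast
  ultimately show ?thesis using chord_interior by (auto simp: open_segment_def)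
qed

lemma chord_side_nonzero: assumes "z \<in> side n j" "j < n" "j \<noteq> p" "j \<noteq> q" shows "chord_side v w z \<noteq> 0"
  using chord_frontier[OF assms(1,2)] assms v w open_side_disjoint[OF n] pq by blast

lemma chord_corner: "chord_side v w (corner n j) \<noteq> 0"
proof
  assume "chord_side v w (corner n j) = 0"
  moreover have "corner n j \<in> side n (j mod n)" using corner_in_side(1)[of n j] n side_mod[of n j] by simp
  ultimately have "corner n j = v \<or> corner n j = w" using chord_frontier[of "corner n j" "j mod n"] n by simp
  then show False using v w corner_notin_open_side[OF n] by blast
qed

text \<open>A sign change would give a zero on the side, that is, a point of the chord on the
  frontier of the polygon. Such a point is \<open>v\<close> or \<open>w\<close>, and these lie
  inside other sides.\<close>

lemma chord_same_side:
  assumes "j mod n \<noteq> p" "j mod n \<noteq> q"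
  shows "0 < chord_side v w (corner n j) * chord_side v w (corner n (Suc j))"
proof (rule ccontr)
  define x y where "x = chord_side v w (corner n j)" and "y = chord_side v w (corner n (Suc j))"
  assume "\<not> ?thesis"
  moreover have "x \<noteq> 0" "y \<noteq> 0" by (simp_all add: x_def y_def chord_corner)
  ultimately have xy: "x * y < 0" by (simp add: x_def y_def not_less order_le_less)
  then have ne: "x - y \<noteq> 0" "0 < x / (x - y)" "x / (x - y) < 1"
    by (auto simp: mult_less_0_iff field_simps divide_simps)
  define t where "t = x / (x - y)"
  have "(1 - t) * x + t * y = x - t * (x - y)" by (simp add: algebra_simps)
  also have "\<dots> = 0" using ne by (simp add: t_def)
  finally have "chord_side v w ((1 - t) *\<^sub>R corner n j + t *\<^sub>R corner n (Suc j)) = 0"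
    by (simp add: chord_side_convex x_def y_def)
  moreover have "(1 - t) *\<^sub>R corner n j + t *\<^sub>R corner n (Suc j) \<in> side n j"
    using ne by (auto simp: side_def in_segment t_def[symmetric] intro!: exI[of _ t])
  then have "(1 - t) *\<^sub>R corner n j + t *\<^sub>R corner n (Suc j) \<in> side n (j mod n)" using n by (simp add: side_mod)
  ultimately show False using chord_side_nonzero[of _ "j mod n"] assms n by auto
qed

lemma chord_opposite_side:
  assumes "j mod n = p \<or> j mod n = q"
  shows "chord_side v w (corner n j) * chord_side v w (corner n (Suc j)) < 0"
proof -
  define x y where "x = chord_side v w (corner n j)" and "y = chord_side v w (corner n (Suc j))"
  have xy: "x \<noteq> 0" "y \<noteq> 0" by (simp_all add: x_def y_def chord_corner)
  have "v \<in> open_side n j \<or> w \<in> open_side n j" using assms v w n side_mod(2)[of n j] by auto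
  then obtain u where "u = v \<or> u = w" "u \<in> open_side n j" by auto
  then obtain t where "0 < t" "t < 1" "chord_side v w ((1 - t) *\<^sub>R corner n j + t *\<^sub>R corner n (Suc j)) = 0"
    using chord_side_ends by (auto simp: open_side_def in_segment)
  then have t: "0 < t" "t < 1" "(1 - t) * x = - (t * y)" by (simp_all add: chord_side_convex x_def y_def)
  show ?thesis
  proof (rule ccontr)
    assume "\<not> ?thesis"
    then have "x > 0 \<and> y > 0 \<or> x < 0 \<and> y < 0"
      using xy by (auto simp: x_def[symmetric] y_def[symmetric] not_less zero_le_mult_iff)
    then show False
    proof
      assume "x > 0 \<and> y > 0"
      then have "(1 - t) * x > 0" "t * y > 0" using t(1,2) by auto
      then show False using t by linarith
    next
      assume "x < 0 \<and> y < 0"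
      then have "(1 - t) * x < 0" "t * y < 0" using t(1,2) mult_pos_neg[of "1 - t" x] mult_pos_neg[of t y] by auto
      then show False using t by linarith
    qed
  qed
qed

end

text \<open>The sides \<open>k, \<dots>, k + r - 1\<close> are cut off along a chord from the side before them to the
  side after them.\<close>
context
  fixes k r :: nat and v w :: complex
  assumes r: "0 < r" "r + 2 \<le> n" and v: "v \<in> open_side n (k + n - 1)" and w: "w \<in> open_side n (k + r)"
begin

private abbreviation (input) p where "p \<equiv> (k + n - 1) mod n"
private abbreviation (input) q where "q \<equiv> (k + r) mod n"

lemma cut_sides: "p < n" "q < n" "p \<noteq> q" "v \<in> open_side n p" "w \<in> open_side n q"
proof -
  have "k + r < k + n - 1" "k + n - 1 < k + r + n" using n r by linarith+
  then show "p \<noteq> q" by (metis nat_mod_neq)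
qed (use n v w in \<open>auto simp: side_mod\<close>)

text \<open>Along the polygon the sign of \<open>chord_side\<close> changes precisely on the two
  sides that contain \<open>v\<close> and \<open>w\<close>, so it is constant on the corners
  \<open>k\<close> to \<open>k + r\<close> and opposite on the others.\<close>

lemma cut_halfplane:
  obtains a b where "a \<noteq> 0" "a \<bullet> v = b" "a \<bullet> w = b"
    "\<And>j. k \<le> j \<Longrightarrow> j \<le> k + r \<Longrightarrow> b < a \<bullet> corner n j"
    "\<And>j. k + r < j \<Longrightarrow> j < k + n \<Longrightarrow> a \<bullet> corner n j < b"
    "\<And>z. z \<in> ngon n \<Longrightarrow> a \<bullet> z = b \<Longrightarrow> z \<in> closed_segment v w"
proof -
  note cs = cut_sides
  define f where "f j = chord_side v w (corner n j)" for j
  have same: "0 < f j * f (Suc j)" if "k \<le> j" "j < k + n - 1" "j \<noteq> k + r" for j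
  proof -
    have "j mod n \<noteq> p" using nat_mod_neq[of j "k + n - 1" n] that n by auto
    moreover have "j mod n \<noteq> q"
      using nat_mod_neq[of j "k + r" n] nat_mod_neq[of "k + r" j n] that n r by (cases "j < k + r"; linarith)
    ultimately show ?thesis using chord_same_side[OF cs] by (auto simp: f_def)
  qed
  have opp: "f (k + r) * f (Suc (k + r)) < 0" using chord_opposite_side[OF cs, of "k + r"] by (simp add: f_def)
  have pos: "0 < f k * f (k + i)" if "i \<le> r" for i
    using that
  proof (induction i)
    case 0
    then show ?case using chord_corner[OF cs, of k] by (auto simp: f_def zero_less_mult_iff)
  next
    case (Suc i)
    have "k + i < k + n - 1" "k + i \<noteq> k + r" using Suc.prems r by linarith+
    then show ?case using same[of "k + i"] Suc by (auto simp: zero_less_mult_iff)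
  qed
  have neg: "f k * f (Suc (k + r) + i) < 0" if "Suc (r + i) < n" for i
    using that
  proof (induction i)
    case 0
    then show ?case using opp pos[of r] by (auto simp: zero_less_mult_iff mult_less_0_iff)
  next
    case (Suc i)
    have "Suc (k + r) + i < k + n - 1" using Suc.prems by linarith
    then show ?case using same[of "Suc (k + r) + i"] Suc by (auto simp: zero_less_mult_iff mult_less_0_iff)
  qed
  \<comment> \<open>The factor \<open>f k\<close> orients the normal so that corner \<open>k\<close>
    lies on the positive side.\<close>
  define a where "a = f k *\<^sub>R (\<i> * (w - v))"
  have a: "a \<bullet> z - a \<bullet> v = f k * chord_side v w z" for z
    by (simp add: a_def chord_side_def inner_diff_right right_diff_distrib)
  have fk: "f k \<noteq> 0" using chord_corner[OF cs] by (simp add: f_def)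
  show thesis
  proof (rule that[of a "a \<bullet> v"])
    show "a \<noteq> 0" using fk chord_neq[OF cs] by (simp add: a_def)
    show "a \<bullet> w = a \<bullet> v" using a[of w] by (simp add: chord_side_ends)
    show "a \<bullet> v < a \<bullet> corner n j" if "k \<le> j" "j \<le> k + r" for j
    proof -
      have "j - k \<le> r" "k + (j - k) = j" using that by linarith+
      then show ?thesis using a[of "corner n j"] pos[of "j - k"] by (simp add: f_def)
    qed
    show "a \<bullet> corner n j < a \<bullet> v" if "k + r < j" "j < k + n" for j
    proof -
      have "Suc (r + (j - Suc (k + r))) < n" "Suc (k + r) + (j - Suc (k + r)) = j" using that by linarith+
      then show ?thesis using a[of "corner n j"] neg[of "j - Suc (k + r)"] by (simp add: f_def)
    qed
    show "z \<in> closed_segment v w" if "z \<in> ngon n" "a \<bullet> z = a \<bullet> v" for z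
      using a[of z] that fk chord_line[OF cs] by simp
  qed simp
qed

lemma corner_cases:
  assumes "z \<in> corner n ` {..<n}"
  obtains j where "k \<le> j" "j < k + n" "z = corner n j"
proof -
  obtain i where i: "i < n" "z = corner n i" using assms by auto
  then obtain j where "k \<le> j" "j < k + n" "j mod n = i" using mod_window by blast
  then show thesis using that i corner_mod[of n j] n by auto
qed

text \<open>The set on the right is compact and convex, hence the hull of its extreme points. An
  extreme point off the chord is extreme in the whole polygon, so it is a corner on the positive
  side.\<close>

lemma cut_polygon_eq:
  assumes a: "a \<noteq> 0" "a \<bullet> v = b" "a \<bullet> w = b"
    "\<And>j. k \<le> j \<Longrightarrow> j \<le> k + r \<Longrightarrow> b < a \<bullet> corner n j"
    "\<And>j. k + r < j \<Longrightarrow> j < k + n \<Longrightarrow> a \<bullet> corner n j < b"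
    "\<And>z. z \<in> ngon n \<Longrightarrow> a \<bullet> z = b \<Longrightarrow> z \<in> closed_segment v w"
  shows "convex hull (corner n ` {k..k + r} \<union> {v, w}) = ngon n \<inter> {z. b \<le> a \<bullet> z}" (is "convex hull ?V = ?K")
proof
  have conv: "convex ?K" by (intro convex_Int convex_ngon[OF n] convex_halfspace_ge)
  have vw: "v \<in> ngon n" "w \<in> ngon n" using chord_in_ngon[OF cut_sides] .
  show "convex hull ?V \<subseteq> ?K"
  proof (rule hull_minimal)
    show "?V \<subseteq> ?K" using a(2,3) a(4) vw corner_in_ngon[OF n] by (auto intro: less_imp_le)
  qed (rule conv)
  have comp: "compact ?K" using compact_ngon[OF n] closed_halfspace_ge by (rule compact_Int_closed)
  have "{x. x extreme_point_of ?K} \<subseteq> convex hull ?V"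
  proof safe
    fix x assume x: "x extreme_point_of ?K"
    then have xK: "x \<in> ngon n" "b \<le> a \<bullet> x" by (auto simp: extreme_point_of_def)
    show "x \<in> convex hull ?V"
    proof (cases "a \<bullet> x = b")
      case True
      then have "x \<in> closed_segment v w" using a(6) xK by simp
      then have "x \<in> convex hull {v, w}" by (simp add: segment_convex_hull)
      then show ?thesis using hull_mono[of "{v, w}" ?V] by blast
    next
      case False
      have "x extreme_point_of ngon n"
        unfolding extreme_point_of_def
      proof (intro conjI ballI notI xK)
        fix y z assume yz: "y \<in> ngon n" "z \<in> ngon n" "x \<in> open_segment y z"
        then obtain t where t: "0 < t" "t < 1" "x = (1 - t) *\<^sub>R y + t *\<^sub>R z" "y \<noteq> z" by (auto simp: in_segment)
        \<comment> \<open>If \<open>x\<close> lay inside a segment of the polygon, a short symmetric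
          part of this segment around \<open>x\<close> would stay in the open half-plane, against
          extremality in \<open>?K\<close>.\<close>
        define g where "g u = (1 - u) *\<^sub>R y + u *\<^sub>R z" for u :: real
        have "continuous (at t) (\<lambda>u. a \<bullet> g u)" unfolding g_def by (intro continuous_intros)
        moreover have "b < a \<bullet> g t" using False xK t by (simp add: g_def)
        ultimately have "\<forall>\<^sub>F u in at t. b < a \<bullet> g u"
          by (auto simp: continuous_at intro: order_tendstoD(1))
        then obtain d where d: "d > 0" "\<And>u. u \<noteq> t \<Longrightarrow> dist u t < d \<Longrightarrow> b < a \<bullet> g u"
          by (auto simp: eventually_at)
        define e where "e = min (d / 2) (min t (1 - t) / 2)"
        have e: "0 < e" "e < d" "e < t" "e < 1 - t"
          using d(1) t(1,2) by (simp_all add: e_def min_def)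
        have in_K: "g (t - e) \<in> ?K" "g (t + e) \<in> ?K"
          using d(2)[of "t - e"] d(2)[of "t + e"] e yz t convexD_alt[OF convex_ngon[OF n] yz(1,2)]
          by (auto simp: dist_real_def g_def intro: less_imp_le)
        have g: "g u = y + u *\<^sub>R (z - y)" for u by (simp add: g_def algebra_simps)
        have "g (t - e) \<noteq> g (t + e)" using e t(4) by (simp add: g)
        moreover have "x = midpoint (g (t - e)) (g (t + e))"
          unfolding t(3) g_def midpoint_def by (simp add: complex_eq_iff field_simps)
        ultimately have "x \<in> open_segment (g (t - e)) (g (t + e))" by simp
        then show False using x in_K by (auto simp: extreme_point_of_def)
      qed
      then have "x \<in> corner n ` {..<n}"
        using extreme_point_of_convex_hull unfolding ngon_def by blast
      then obtain j where j: "k \<le> j" "j < k + n" "x = corner n j" using corner_cases by blast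
      then have "j \<le> k + r" using a(5)[of j] xK by (cases "j \<le> k + r") auto
      then show ?thesis using j by (intro hull_inc) auto
    qed
  qed
  then have "convex hull {x. x extreme_point_of ?K} \<subseteq> convex hull ?V" by (intro hull_minimal convex_convex_hull)
  then show "?K \<subseteq> convex hull ?V" using Krein_Milman_Minkowski[OF comp conv] by simp
qed

text \<open>The part of the boundary of the piece cut off that does not consist of the given sides.\<close>
definition cut_boundary :: "complex set" where
  "cut_boundary = closed_segment (corner n (k + r)) w \<union> closed_segment w v \<union> closed_segment v (corner n k)"

private definition K :: "complex set" where
  "K = convex hull (corner n ` {k..k + r} \<union> {v, w})"

lemma sides_window: "(\<Union>j<n. side n j) = (\<Union>j\<in>{k..<k + n}. side n j)"
proof (intro equalityI subsetI)
  fix z assume "z \<in> (\<Union>j<n. side n j)"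
  then obtain i where "i < n" "z \<in> side n i" by auto
  then obtain j where "k \<le> j" "j < k + n" "j mod n = i" using mod_window by blast
  then show "z \<in> (\<Union>j\<in>{k..<k + n}. side n j)" using \<open>z \<in> side n i\<close> side_mod(1)[of n j] n by auto
next
  fix z assume "z \<in> (\<Union>j\<in>{k..<k + n}. side n j)"
  then obtain j where "z \<in> side n j" by auto
  then show "z \<in> (\<Union>j<n. side n j)" using side_mod(1)[of n j] n by (intro UN_I[of "j mod n"]) auto
qed

lemma before_side: "v \<in> open_segment (corner n k) (corner n (k + n - 1))"
  "side n (k + n - 1) = closed_segment (corner n k) (corner n (k + n - 1))"
  "open_side n (k + n - 1) = open_segment (corner n k) (corner n (k + n - 1))"
proof -
  have "corner n (Suc (k + n - 1)) = corner n k"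
    using n corner_mod[of n "k + n"] corner_mod[of n k] by simp
  then show "v \<in> open_segment (corner n k) (corner n (k + n - 1))"
    "side n (k + n - 1) = closed_segment (corner n k) (corner n (k + n - 1))"
    "open_side n (k + n - 1) = open_segment (corner n k) (corner n (k + n - 1))"
    using v open_segment_commute closed_segment_commute unfolding open_side_def side_def by metis+
qed

lemma cut_ends_neq: "corner n k \<noteq> corner n (k + r)"
  using corner_inj[OF n, of "k mod n" "(k + r) mod n"] nat_mod_neq[of k "k + r" n] n r by (auto simp: corner_mod)

lemma cut_interior:
  assumes a: "a \<noteq> 0" "K = ngon n \<inter> {z. b \<le> a \<bullet> z}"
  shows "interior K = interior (ngon n) \<inter> {z. b < a \<bullet> z}"
  unfolding a(2) interior_Int using a(1) interior_halfspace_ge[of a b] by simp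

text \<open>The linear form of \<open>cut_halfplane\<close> decides everything side by side: the
  sides of the run lie strictly above the chord, the two neighbouring sides cross it at
  \<open>v\<close> and \<open>w\<close>, and the remaining ones lie strictly below. The results are
  what the locale of regions will ask for.\<close>

lemma cut_props:
  shows cut_subset: "convex hull (corner n ` {k..k + r} \<union> {v, w}) \<subseteq> ngon n"
    and compact_cut: "compact (convex hull (corner n ` {k..k + r} \<union> {v, w}))"
    and cut_side_subset: "\<And>j. k \<le> j \<Longrightarrow> j < k + r \<Longrightarrow> side n j \<subseteq> convex hull (corner n ` {k..k + r} \<union> {v, w})"
    and cut_side_apart: "\<And>j. k \<le> j \<Longrightarrow> j < k + r \<Longrightarrow>
      side n j \<inter> closure (ngon n - convex hull (corner n ` {k..k + r} \<union> {v, w})) = {}"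
    and cut_frontier: "convex hull (corner n ` {k..k + r} \<union> {v, w}) - interior (convex hull (corner n ` {k..k + r} \<union> {v, w})) =
      (\<Union>j\<in>{k..<k + r}. side n j) \<union> cut_boundary"
    and cut_boundary_open: "cut_boundary - {corner n k, corner n (k + r)} \<subseteq>
      interior (ngon n) \<union> open_side n (k + n - 1) \<union> open_side n (k + r)"
    and connected_cut_boundary: "connected (cut_boundary - {corner n k, corner n (k + r)})"
  unfolding K_def[symmetric]
proof -
  obtain a b where ab: "a \<noteq> 0" "a \<bullet> v = b" "a \<bullet> w = b"
    "\<And>j. k \<le> j \<Longrightarrow> j \<le> k + r \<Longrightarrow> b < a \<bullet> corner n j"
    "\<And>j. k + r < j \<Longrightarrow> j < k + n \<Longrightarrow> a \<bullet> corner n j < b"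
    "\<And>z. z \<in> ngon n \<Longrightarrow> a \<bullet> z = b \<Longrightarrow> z \<in> closed_segment v w"
    using cut_halfplane by metis
  have K: "K = ngon n \<inter> {z. b \<le> a \<bullet> z}" unfolding K_def by (rule cut_polygon_eq[OF ab])
  have int_K: "interior K = interior (ngon n) \<inter> {z. b < a \<bullet> z}" using cut_interior ab(1) K by simp
  have vw: "v \<in> ngon n" "w \<in> ngon n" using chord_in_ngon[OF cut_sides] .
  show "K \<subseteq> ngon n" using K by auto
  show "compact K" unfolding K using compact_ngon[OF n] closed_halfspace_ge by (rule compact_Int_closed)
  have convK: "convex K" by (simp add: K_def)
  have above: "b < a \<bullet> z" if "z \<in> side n j" "k \<le> j" "j < k + r" for z j
  proof -
    have "side n j \<subseteq> {z. b < a \<bullet> z}" unfolding side_def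
      using ab(4)[of j] ab(4)[of "Suc j"] that by (intro closed_segment_subset convex_halfspace_gt) auto
    then show ?thesis using that by auto
  qed
  show in_K: "side n j \<subseteq> K" if "k \<le> j" "j < k + r" for j
    using above[OF _ that] side_subset[OF n, of j] unfolding K by (auto intro: less_imp_le)
  show "side n j \<inter> closure (ngon n - K) = {}" if "k \<le> j" "j < k + r" for j
  proof -
    have "closure (ngon n - K) \<subseteq> {z. a \<bullet> z \<le> b}"
      unfolding K using closed_halfspace_le by (intro closure_minimal) auto
    then show ?thesis using above[OF _ that] by fastforce
  qed
  have after: "z \<in> side n (k + r) \<and> b \<le> a \<bullet> z \<longleftrightarrow> z \<in> closed_segment (corner n (k + r)) w" for z
    using segment_part[of w "corner n (k + r)" "corner n (Suc (k + r))" b a z] w ab(3,4) r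
    by (simp add: side_def open_side_def)
  have before: "z \<in> side n (k + n - 1) \<and> b \<le> a \<bullet> z \<longleftrightarrow> z \<in> closed_segment (corner n k) v" for z
    using segment_part[of v "corner n k" "corner n (k + n - 1)" b a z] before_side ab(2,4) by simp
  have below: "a \<bullet> z < b" if "z \<in> side n j" "k + r < j" "j < k + n - 1" for z j
  proof -
    have "side n j \<subseteq> {z. a \<bullet> z < b}" unfolding side_def
      using ab(5)[of j] ab(5)[of "Suc j"] that by (intro closed_segment_subset convex_halfspace_lt) auto
    then show ?thesis using that by auto
  qed
  show "K - interior K = (\<Union>j\<in>{k..<k + r}. side n j) \<union> cut_boundary"
  proof (intro equalityI subsetI)
    fix z assume z: "z \<in> K - interior K"
    show "z \<in> (\<Union>j\<in>{k..<k + r}. side n j) \<union> cut_boundary"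
    proof (cases "a \<bullet> z = b")
      case True
      then have "z \<in> closed_segment v w" using ab(6) z K by auto
      then show ?thesis by (auto simp: cut_boundary_def closed_segment_commute)
    next
      case False
      then have "z \<in> ngon n - interior (ngon n)" "b \<le> a \<bullet> z" using z int_K K by auto
      then obtain j where j: "k \<le> j" "j < k + n" "z \<in> side n j"
        using ngon_frontier[OF n] sides_window by auto
      consider "j < k + r" | "j = k + r" | "j = k + n - 1" | "k + r < j" "j < k + n - 1" using j r by linarith
      then show ?thesis
        using j \<open>b \<le> a \<bullet> z\<close> after[of z] before[of z] below[of z j]
        by cases (auto simp: cut_boundary_def closed_segment_commute)
    qed
  next
    fix z assume "z \<in> (\<Union>j\<in>{k..<k + r}. side n j) \<union> cut_boundary"
    then consider j where "k \<le> j" "j < k + r" "z \<in> side n j" | "z \<in> closed_segment (corner n (k + r)) w"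
      | "z \<in> closed_segment v w" | "z \<in> closed_segment (corner n k) v"
      by (auto simp: cut_boundary_def closed_segment_commute)
    then show "z \<in> K - interior K"
    proof cases
      case 1
      then have "z \<notin> interior (ngon n)"
        using open_side_boundary[OF n, of "j mod n"] n side_mod(1)[of n j] by auto
      then show ?thesis using in_K 1 int_K by auto
    next
      case 2
      then have *: "z \<in> side n (k + r)" "b \<le> a \<bullet> z" using after by auto
      then have "z \<notin> interior (ngon n)"
        using open_side_boundary[OF n, of "(k + r) mod n"] n side_mod(1)[of n "k + r"] by auto
      then show ?thesis using * side_subset[OF n] int_K K by auto
    next
      case 3
      have "closed_segment v w \<subseteq> ngon n \<inter> {z. a \<bullet> z = b}"
        using vw ab(2,3) by (intro closed_segment_subset convex_Int convex_ngon[OF n] convex_hyperplane) auto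
      then show ?thesis using 3 int_K K by auto
    next
      case 4
      then have *: "z \<in> side n (k + n - 1)" "b \<le> a \<bullet> z" using before by auto
      then have "z \<notin> interior (ngon n)"
        using open_side_boundary[OF n, of "(k + n - 1) mod n"] n side_mod(1)[of n "k + n - 1"] by auto
      then show ?thesis using * side_subset[OF n] int_K K by auto
    qed
  qed
  have seg_w: "closed_segment (corner n (k + r)) w - {corner n (k + r)} \<subseteq> open_side n (k + r)"
    using half_open_segment[of w "corner n (k + r)" "corner n (Suc (k + r))"] w by (simp add: open_side_def)
  have seg_v: "closed_segment v (corner n k) - {corner n k} \<subseteq> open_side n (k + n - 1)"
    using half_open_segment[OF before_side(1)] unfolding before_side(3) by (simp add: closed_segment_commute)
  have seg_vw: "closed_segment w v \<subseteq> interior (ngon n) \<union> open_side n (k + n - 1) \<union> open_side n (k + r)"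
    using chord_interior[OF cut_sides] v w by (auto simp: closed_segment_eq_open open_segment_commute)
  show "cut_boundary - {corner n k, corner n (k + r)} \<subseteq>
      interior (ngon n) \<union> open_side n (k + n - 1) \<union> open_side n (k + r)"
    using seg_w seg_v seg_vw unfolding cut_boundary_def by blast
  have notin: "corner n j \<notin> interior (ngon n) \<union> open_side n i \<union> open_side n i'" for i i' j
    using corner_notin_open_side[OF n] open_side_boundary[OF n, of "j mod n"] corner_in_side(1)[OF n, of "j mod n"]
      n by (auto simp: corner_mod)
  have "cut_boundary - {corner n k, corner n (k + r)} =
    (closed_segment (corner n (k + r)) w - {corner n (k + r)}) \<union> (closed_segment w v \<union> (closed_segment v (corner n k) - {corner n k}))"
    using seg_w seg_v seg_vw notin cut_ends_neq unfolding cut_boundary_def by blast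
  moreover have "connected (closed_segment v (corner n k) - {corner n k})"
    using connected_segment_minus_end[of "corner n k" v] by (simp add: closed_segment_commute)
  moreover have "v \<noteq> corner n k" "w \<noteq> corner n (k + r)" using v w corner_notin_open_side[OF n] by blast+
  ultimately show "connected (cut_boundary - {corner n k, corner n (k + r)})"
    using connected_segment_minus_end[of "corner n (k + r)" w] by (auto intro!: connected_Un)
qed

text \<open>The second piece lies strictly beyond the chord of the first one. The last two
  assumptions handle runs separated by a single side, where both chords end on that side.\<close>

lemma cut_disjoint:
  assumes k': "k + r < k'" "k' + r' < k + n"
    and v': "v' \<in> open_side n (k' - 1)" and w': "w' \<in> open_side n (k' + r')"
    and v'': "k' = Suc (k + r) \<Longrightarrow> v' \<in> open_segment w (corner n k')"
    and w'': "Suc (k' + r') = k + n \<Longrightarrow> w' \<in> open_segment (corner n (k' + r')) v"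
  shows "convex hull (corner n ` {k..k + r} \<union> {v, w}) \<inter> convex hull (corner n ` {k'..k' + r'} \<union> {v', w'}) = {}"
proof -
  obtain a b where ab: "a \<noteq> 0" "a \<bullet> v = b" "a \<bullet> w = b"
    "\<And>j. k \<le> j \<Longrightarrow> j \<le> k + r \<Longrightarrow> b < a \<bullet> corner n j"
    "\<And>j. k + r < j \<Longrightarrow> j < k + n \<Longrightarrow> a \<bullet> corner n j < b"
    "\<And>z. z \<in> ngon n \<Longrightarrow> a \<bullet> z = b \<Longrightarrow> z \<in> closed_segment v w"
    using cut_halfplane by metis
  have 1: "convex hull (corner n ` {k..k + r} \<union> {v, w}) \<subseteq> {z. b \<le> a \<bullet> z}"
    by (rule subset_trans[OF equalityD1[OF cut_polygon_eq[OF ab]] Int_lower2])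
  have seg: "a \<bullet> z < b" if xyz: "z \<in> open_segment x y" "a \<bullet> x \<le> b" "a \<bullet> y \<le> b" "a \<bullet> x < b \<or> a \<bullet> y < b" for x y z
  proof -
    obtain t where t: "0 < t" "t < 1" "z = (1 - t) *\<^sub>R x + t *\<^sub>R y" using xyz(1) by (auto simp: in_segment)
    have "a \<bullet> z = (1 - t) * (a \<bullet> x) + t * (a \<bullet> y)" by (simp add: t(3) inner_add_right)
    also have "\<dots> < (1 - t) * b + t * b"
      using t(1,2) that mult_left_mono[of "a \<bullet> x" b "1 - t"] mult_left_mono[of "a \<bullet> y" b t]
        mult_strict_left_mono[of "a \<bullet> x" b "1 - t"] mult_strict_left_mono[of "a \<bullet> y" b t] by linarith
    finally show ?thesis by (simp add: algebra_simps)
  qed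
  have "a \<bullet> v' < b"
  proof (cases "k' = Suc (k + r)")
    case True
    then show ?thesis using v'' seg[of v' w "corner n k'"] ab(3) ab(5)[of k'] k' by auto
  next
    case False
    then have "k + r < k' - 1" "k' - 1 < k + n" "Suc (k' - 1) = k'" using k' by linarith+
    then show ?thesis using v' seg[of v' "corner n (k' - 1)" "corner n k'"] ab(5)[of "k' - 1"] ab(5)[of k'] k'
      by (simp add: open_side_def)
  qed
  moreover have "a \<bullet> w' < b"
  proof (cases "Suc (k' + r') = k + n")
    case True
    then show ?thesis using w'' seg[of w' "corner n (k' + r')" v] ab(2) ab(5)[of "k' + r'"] k' by auto
  next
    case False
    then show ?thesis using w' seg[of w' "corner n (k' + r')" "corner n (Suc (k' + r'))"]
        ab(5)[of "k' + r'"] ab(5)[of "Suc (k' + r')"] k' by (auto simp: open_side_def)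
  qed
  ultimately have "convex hull (corner n ` {k'..k' + r'} \<union> {v', w'}) \<subseteq> {z. a \<bullet> z < b}"
    using ab(5) k' by (intro hull_minimal convex_halfspace_lt) auto
  with 1 show ?thesis by fastforce
qed

end

text \<open>Each side without these points lies between the open side and its closure. Consecutive
  sides still share a corner, because fewer than \<open>n\<close> sides do not close up.\<close>

lemma connected_sides_minus_ends:
  assumes "q < n"
  shows "connected ((\<Union>j\<in>{e..<e + q}. side n j) - {corner n e, corner n (e + q)})"
proof -
  let ?X = "\<lambda>i. side n (e + i) - {corner n e, corner n (e + q)}"
  have "connected (?X i)" for i
  proof (rule connected_intermediate_closure)
    show "connected (open_side n (e + i))" by (simp add: open_side_def convex_connected)
    show "open_side n (e + i) \<subseteq> ?X i" using corner_notin_open_side[OF n] open_side_subset[OF n] by blast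
    show "?X i \<subseteq> closure (open_side n (e + i))"
      using corner_neq_Suc[OF n, of "e + i"] by (auto simp: open_side_def side_def)
  qed
  moreover have "?X i \<inter> ?X (Suc i) \<noteq> {}" if "Suc i < q" for i
  proof -
    have "corner n (e + Suc i) \<noteq> corner n e" "corner n (e + Suc i) \<noteq> corner n (e + q)"
      using corner_neq[OF n, of e "e + Suc i"] corner_neq[OF n, of "e + Suc i" "e + q"] that assms by auto
    then have "corner n (e + Suc i) \<in> ?X i \<inter> ?X (Suc i)"
      using corner_in_side[OF n] by (simp add: side_def)
    then show ?thesis by blast
  qed
  ultimately have "connected (\<Union>i<q. ?X i)" by (intro connected_Union_chain) auto
  moreover have "(\<Union>i<q. ?X i) = (\<Union>j\<in>{e..<e + q}. side n j) - {corner n e, corner n (e + q)}"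
  proof -
    have "{e..<e + q} = (+) e ` {..<q}"
      using image_add_atLeastLessThan[of e 0 q] by (simp add: lessThan_atLeast0 add.commute)
    then show ?thesis by simp
  qed
  ultimately show ?thesis by simp
qed

end

section \<open>Boundary points of surfaces\<close>

lemma homeomorphic_map_restrict:
  assumes "homeomorphic_map X Y f" "S \<subseteq> topspace X"
  shows "homeomorphic_map (subtopology X S) (subtopology Y (f ` S)) f"
proof (rule homeomorphic_map_subtopologies[OF assms(1)])
  show "f ` (topspace X \<inter> S) = topspace Y \<inter> f ` S"
    using assms homeomorphic_imp_surjective_map[OF assms(1)] by blast
qed

lemma homeomorphic_map_open_image:
  assumes "homeomorphic_map (top_of_set W) (subtopology X S) f" "openin X S" "openin (top_of_set W) U"
  shows "openin X (f ` U)"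
proof -
  have "openin (subtopology X S) (f ` U)"
    using assms(1,3) homeomorphic_imp_open_map open_map_def by blast
  then show ?thesis using assms(2) openin_open_subtopology by blast
qed

text \<open>By invariance of domain.\<close>
lemma chart_boundary_iff:
  fixes W :: "complex set"
  assumes S: "openin X S" and f: "homeomorphic_map (top_of_set W) (subtopology X S) f" and y: "y \<in> W"
  shows "f y \<in> surface_boundary X \<longleftrightarrow> y \<notin> interior W"
proof
  have im: "f ` W = S" using homeomorphic_imp_surjective_map[OF f] openin_subset[OF S] by auto
  show "y \<notin> interior W" if fy: "f y \<in> surface_boundary X"
  proof
    assume yi: "y \<in> interior W"
    have sub: "interior W \<subseteq> W" by (rule interior_subset)
    have ope: "openin X (f ` interior W)"
      by (rule homeomorphic_map_open_image[OF f S open_subset[OF interior_subset open_interior]])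
    have "homeomorphic_map (subtopology (top_of_set W) (interior W)) (subtopology (subtopology X S) (f ` interior W)) f"
      using homeomorphic_map_restrict[OF f, of "interior W"] sub by simp
    then have "homeomorphic_map (top_of_set (interior W)) (subtopology X (f ` interior W)) f"
      using sub image_mono[OF sub, of f] im by (simp add: subtopology_subtopology inf_absorb2)
    then have "subtopology X (f ` interior W) homeomorphic_space top_of_set (interior W)"
      using homeomorphic_map_imp_homeomorphic_space homeomorphic_space_sym by blast
    then show False using fy ope yi by (auto simp: surface_boundary_def)
  qed
  show "f y \<in> surface_boundary X" if nyi: "y \<notin> interior W"
  proof (rule ccontr)
    assume "f y \<notin> surface_boundary X"
    moreover have "f y \<in> topspace X" using im y openin_subset[OF S] by auto
    ultimately obtain U V where U: "openin X U" "f y \<in> U" and V: "open (V :: complex set)"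
      and hom: "subtopology X U homeomorphic_space top_of_set V" by (auto simp: surface_boundary_def)
    then obtain h where h: "homeomorphic_map (top_of_set V) (subtopology X U) h"
      using homeomorphic_space homeomorphic_space_sym by blast
    have hV: "h ` V = U" using homeomorphic_imp_surjective_map[OF h] openin_subset[OF U(1)] by auto
    obtain g where g: "homeomorphic_maps (top_of_set W) (subtopology X S) f g"
      using f homeomorphic_map_maps by blast
    \<comment> \<open>The transition map \<open>g \<circ> h\<close> from the planar chart is
      continuous and injective on the open set \<open>Z\<close>, so its image is open; it lies in
      \<open>W\<close> and contains \<open>y\<close>.\<close>
    define Z where "Z = {z \<in> V. h z \<in> U \<inter> S}"
    have "openin (subtopology X U) (U \<inter> S)"
      using S by (metis Int_commute openin_subtopology)
    then have "openin (top_of_set V) {z \<in> topspace (top_of_set V). h z \<in> U \<inter> S}"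
      by (rule openin_continuous_map_preimage[OF homeomorphic_imp_continuous_map[OF h]])
    then have "openin (top_of_set V) Z" by (simp add: Z_def)
    then have oZ: "open Z" using V openin_open_trans by blast
    have "continuous_map (top_of_set Z) (subtopology X (U \<inter> S)) h"
    proof -
      have "continuous_map (subtopology (top_of_set V) Z) (subtopology X U) h"
        using homeomorphic_imp_continuous_map[OF h] continuous_map_from_subtopology by blast
      then have "continuous_map (top_of_set Z) (subtopology X U) h"
        by (metis (no_types, lifting) Z_def inf.absorb_iff2 mem_Collect_eq subsetI subtopology_subtopology)
      then show ?thesis by (auto simp: continuous_map_in_subtopology Z_def)
    qed
    then have "continuous_map (top_of_set Z) (subtopology X S) h"
      by (auto simp: continuous_map_in_subtopology)
    moreover have "continuous_map (subtopology X S) (top_of_set W) g" using g homeomorphic_maps_def by blast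
    ultimately have "continuous_map (top_of_set Z) (top_of_set W) (g \<circ> h)" by (rule continuous_map_compose)
    then have cont: "continuous_on Z (g \<circ> h)" and gW: "(g \<circ> h) ` Z \<subseteq> W"
      by (auto simp: continuous_map_in_subtopology)
    have gf: "f (g x) = x" if "x \<in> S" for x using g that openin_subset[OF S] by (auto simp: homeomorphic_maps_def)
    have "inj_on h V" using homeomorphic_imp_injective_map[OF h] by simp
    then have "inj_on (g \<circ> h) Z" using gf by (auto simp: inj_on_def Z_def) metis
    then have "open ((g \<circ> h) ` Z)" by (intro invariance_of_domain_gen[OF oZ cont]) simp_all
    moreover have "y \<in> (g \<circ> h) ` Z"
    proof -
      obtain z where z: "z \<in> V" "h z = f y" using hV U(2) by (metis imageE)
      then have "z \<in> Z" using U(2) im y by (auto simp: Z_def)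
      moreover have "g (f y) = y" using g y by (auto simp: homeomorphic_maps_def)
      ultimately show ?thesis using z by (metis comp_apply image_eqI)
    qed
    ultimately show False using nyi gW by (meson interior_maximal subsetD)
  qed
qed

text \<open>A chart around \<open>x\<close> can be restricted to its part inside \<open>S\<close>,
  where the two topologies agree.\<close>

lemma boundary_local:
  assumes S: "openin X S" "S \<subseteq> R" and x: "x \<in> S"
  shows "x \<in> surface_boundary (subtopology X R) \<longleftrightarrow> x \<in> surface_boundary X"
proof -
  have shrink: "\<exists>U' V'. openin Z U' \<and> x \<in> U' \<and> U' \<subseteq> S' \<and> open (V' :: complex set) \<and> subtopology Z U' homeomorphic_space top_of_set V'"
    if U: "openin Z U" "x \<in> U" and V: "open (V :: complex set)" and hom: "subtopology Z U homeomorphic_space top_of_set V"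
      and S': "openin Z S'" "x \<in> S'" for Z :: "'a topology" and U V S'
  proof -
    obtain h where h: "homeomorphic_map (subtopology Z U) (top_of_set V) h"
      using hom homeomorphic_space by blast
    have sub: "U \<inter> S' \<subseteq> topspace (subtopology Z U)" using openin_subset[OF U(1)] by auto
    have ope: "openin (subtopology Z U) (U \<inter> S')" using S' by (metis Int_commute openin_subtopology)
    have "openin (top_of_set V) (h ` (U \<inter> S'))"
      using ope h homeomorphic_imp_open_map open_map_def by blast
    then have oV: "open (h ` (U \<inter> S'))" using V openin_open_trans by blast
    have hV: "h ` (U \<inter> S') \<subseteq> V" using homeomorphic_imp_surjective_map[OF h] sub by auto
    have "homeomorphic_map (subtopology (subtopology Z U) (U \<inter> S')) (subtopology (top_of_set V) (h ` (U \<inter> S'))) h"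
      by (rule homeomorphic_map_restrict[OF h sub])
    then have "homeomorphic_map (subtopology Z (U \<inter> S')) (top_of_set (h ` (U \<inter> S'))) h"
      using hV by (simp add: subtopology_subtopology Int_absorb1)
    then show ?thesis
      using U S' oV openin_Int[OF U(1) S'(1)] homeomorphic_map_imp_homeomorphic_space
      by (intro exI[of _ "U \<inter> S'"] exI[of _ "h ` (U \<inter> S')"]) auto
  qed
  have top: "x \<in> topspace X" "x \<in> topspace (subtopology X R)" using openin_subset[OF S(1)] S x by auto
  have SR: "openin (subtopology X R) S" using S by (metis Int_absorb2 openin_subtopology)
  have "(\<exists>U V. openin X U \<and> x \<in> U \<and> open (V :: complex set) \<and> subtopology X U homeomorphic_space top_of_set V) \<longleftrightarrow>
    (\<exists>U V. openin (subtopology X R) U \<and> x \<in> U \<and> open (V :: complex set) \<and>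
       subtopology (subtopology X R) U homeomorphic_space top_of_set V)" (is "?L \<longleftrightarrow> ?R")
  proof
    assume ?L
    then obtain U V where U: "openin X U" "x \<in> U" "U \<subseteq> S" "open (V :: complex set)"
      "subtopology X U homeomorphic_space top_of_set V" using shrink[OF _ _ _ _ S(1) x] by metis
    moreover have "openin (subtopology X R) U" using U S(2) by (metis Int_absorb2 openin_subtopology subset_trans)
    moreover have "subtopology (subtopology X R) U = subtopology X U"
      using U S(2) by (simp add: subtopology_subtopology Int_absorb1)
    ultimately show ?R by metis
  next
    assume ?R
    then obtain U V where U: "openin (subtopology X R) U" "x \<in> U" "U \<subseteq> S" "open (V :: complex set)"
      "subtopology (subtopology X R) U homeomorphic_space top_of_set V" using shrink[OF _ _ _ _ SR x] by metis
    moreover have "openin X U"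
    proof -
      obtain A where A: "openin X A" "U = A \<inter> R" using U(1) by (auto simp: openin_subtopology)
      then have "U = A \<inter> S" using U(3) S(2) by auto
      then show ?thesis using A S by auto
    qed
    moreover have "subtopology (subtopology X R) U = subtopology X U"
      using U S(2) by (simp add: subtopology_subtopology Int_absorb1)
    ultimately show ?L by metis
  qed
  then show ?thesis using top unfolding surface_boundary_def by blast
qed

abbreviation halfplane :: "complex set" where "halfplane \<equiv> {z. 0 \<le> Im z}"

lemma open_upper: "open {z. 0 < Im z}"
  using open_halfspace_Im_gt[of 0] by simp

lemma interior_halfball:
  assumes "Im v = 0"
  shows "z \<in> ball v \<delta> \<inter> halfplane \<Longrightarrow> z \<notin> interior (ball v \<delta> \<inter> halfplane) \<longleftrightarrow> Im z = 0"
proof -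
  assume z: "z \<in> ball v \<delta> \<inter> halfplane"
  have "interior halfplane = {z. 0 < Im z}"
    using interior_halfspace_ge[of \<i> 0] by (simp add: inner_complex_def)
  then show ?thesis using z by auto
qed

text \<open>The chart puts \<open>p\<close> on the real axis: otherwise it would correspond to an
  interior point of \<open>V\<close>, and \<open>p\<close> would not be on the boundary. So the
  chart restricts to a half disc centred on the axis.\<close>

lemma boundary_chart:
  assumes P: "surface_with_boundary P" and p: "p \<in> surface_boundary P" and U: "openin P U" "p \<in> U"
  obtains v \<delta> h where "Im v = 0" "0 < \<delta>"
    "homeomorphic_map (top_of_set (ball v \<delta> \<inter> halfplane)) (subtopology P (h ` (ball v \<delta> \<inter> halfplane))) h"
    "openin P (h ` (ball v \<delta> \<inter> halfplane))" "h ` (ball v \<delta> \<inter> halfplane) \<subseteq> U" "h v = p"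
proof -
  have "p \<in> topspace P" using p by (auto simp: surface_boundary_def)
  then obtain W V where W: "openin P W" "p \<in> W" and V: "openin (top_of_set halfplane) V"
    and hom: "subtopology P W homeomorphic_space top_of_set V"
    using P unfolding surface_with_boundary_def by auto
  then obtain h where h: "homeomorphic_map (top_of_set V) (subtopology P W) h"
    using homeomorphic_space homeomorphic_space_sym by blast
  have hV: "h ` V = W" using homeomorphic_imp_surjective_map[OF h] openin_subset[OF W(1)] by auto
  then obtain v where v: "v \<in> V" "h v = p" using W(2) by auto
  have "v \<notin> interior V" using chart_boundary_iff[OF W(1) h v(1)] v p by simp
  have VH: "V \<subseteq> halfplane" using openin_subset[OF V] by simp
  have "Im v = 0"
  proof (rule ccontr)
    assume "Im v \<noteq> 0"
    then have "v \<in> {z. 0 < Im z}" using VH v by fastforce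
    moreover have "open (V \<inter> {z. 0 < Im z})"
    proof -
      obtain O' where "open O'" "V = O' \<inter> halfplane" using V by (auto simp: openin_open Int_commute)
      then have "V \<inter> {z. 0 < Im z} = O' \<inter> {z. 0 < Im z}" by auto
      then show ?thesis using \<open>open O'\<close> open_upper by auto
    qed
    ultimately have "v \<in> interior V" using v by (auto intro: interiorI[of "V \<inter> {z. 0 < Im z}"])
    then show False using \<open>v \<notin> interior V\<close> by simp
  qed
  have "openin (top_of_set V) {z \<in> topspace (top_of_set V). h z \<in> W \<inter> U}"
  proof (rule openin_continuous_map_preimage[OF homeomorphic_imp_continuous_map[OF h]])
    show "openin (subtopology P W) (W \<inter> U)" using U by (metis Int_commute openin_subtopology)
  qed
  then have "openin (top_of_set halfplane) {z \<in> V. h z \<in> W \<inter> U}" using V openin_trans by fastforce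
  then obtain \<delta> where \<delta>: "0 < \<delta>" "ball v \<delta> \<inter> halfplane \<subseteq> {z \<in> V. h z \<in> W \<inter> U}"
    using v W U by (auto simp: openin_contains_ball)
  let ?B = "ball v \<delta> \<inter> halfplane"
  have BV: "?B \<subseteq> V" using \<delta> by auto
  have "openin (top_of_set V) ?B" using BV VH
    by (auto simp: openin_open intro!: exI[of _ "ball v \<delta>"])
  then have ope: "openin P (h ` ?B)" by (rule homeomorphic_map_open_image[OF h W(1)])
  have "homeomorphic_map (subtopology (top_of_set V) ?B) (subtopology (subtopology P W) (h ` ?B)) h"
    using homeomorphic_map_restrict[OF h, of ?B] BV by simp
  moreover have "subtopology (top_of_set V) ?B = top_of_set ?B"
    using BV by (simp add: subtopology_subtopology inf.absorb2)
  moreover have "subtopology (subtopology P W) (h ` ?B) = subtopology P (h ` ?B)"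
    using image_mono[OF BV, of h] hV by (simp add: subtopology_subtopology inf.absorb2)
  ultimately have "homeomorphic_map (top_of_set ?B) (subtopology P (h ` ?B)) h" by simp
  then show thesis using that \<open>Im v = 0\<close> \<delta> ope v by auto
qed

context
  fixes P :: "'p topology" and p :: 'p and U :: "'p set"
  assumes P: "surface_with_boundary P" and p: "p \<in> surface_boundary P" and U: "openin P U" "p \<in> U"
begin

text \<open>The open half disc is convex and dense in the half disc, so removing the centre leaves a
  connected set.\<close>

lemma boundary_punctured_nbhd:
  obtains W where "openin P W" "p \<in> W" "W \<subseteq> U" "connectedin P (W - {p})"
proof -
  obtain v \<delta> h where h: "Im v = 0" "0 < \<delta>"
    "homeomorphic_map (top_of_set (ball v \<delta> \<inter> halfplane)) (subtopology P (h ` (ball v \<delta> \<inter> halfplane))) h"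
    "openin P (h ` (ball v \<delta> \<inter> halfplane))" "h ` (ball v \<delta> \<inter> halfplane) \<subseteq> U" "h v = p"
    using boundary_chart[OF P p U] .
  let ?B = "ball v \<delta> \<inter> halfplane"
  have vB: "v \<in> ?B" using h by simp
  have conn: "connected (?B - {v})"
  proof (rule connected_intermediate_closure)
    show "connected (ball v \<delta> \<inter> {z. 0 < Im z})"
      using convex_halfspace_Im_gt[of 0] by (intro convex_connected convex_Int) auto
    show "ball v \<delta> \<inter> {z. 0 < Im z} \<subseteq> ?B - {v}" using h(1) by auto
    show "?B - {v} \<subseteq> closure (ball v \<delta> \<inter> {z. 0 < Im z})"
    proof
      fix z assume z: "z \<in> ?B - {v}"
      have "closure {z. 0 < Im z} = halfplane"
        using closure_halfspace_gt[of \<i> 0] by (simp add: inner_complex_def)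
      then have "z \<in> ball v \<delta> \<inter> closure {z. 0 < Im z}" using z by simp
      then show "z \<in> closure (ball v \<delta> \<inter> {z. 0 < Im z})"
        using open_Int_closure_subset[OF open_ball] by blast
    qed
  qed
  have inj: "inj_on h ?B" using homeomorphic_imp_injective_map[OF h(3)] by simp
  have "continuous_map (top_of_set ?B) P h"
    using homeomorphic_imp_continuous_map[OF h(3)] by (simp add: continuous_map_in_subtopology)
  moreover have "connectedin (top_of_set ?B) (?B - {v})" using conn by (auto simp: connectedin_subtopology)
  ultimately have "connectedin P (h ` (?B - {v}))" by (rule connectedin_continuous_map_image)
  moreover have "h ` (?B - {v}) = h ` ?B - {p}" using inj_on_image_set_diff[OF inj, of ?B "{v}"] vB h(6) by auto
  ultimately show thesis using that[of "h ` ?B"] h vB by auto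
qed

text \<open>The diameter of a half disc consists of infinitely many boundary points.\<close>

lemma boundary_points_nearby: assumes "finite M" shows "\<exists>q \<in> U. q \<in> surface_boundary P \<and> q \<notin> M"
proof -
  obtain v \<delta> h where h: "Im v = 0" "0 < \<delta>"
    "homeomorphic_map (top_of_set (ball v \<delta> \<inter> halfplane)) (subtopology P (h ` (ball v \<delta> \<inter> halfplane))) h"
    "openin P (h ` (ball v \<delta> \<inter> halfplane))" "h ` (ball v \<delta> \<inter> halfplane) \<subseteq> U" "h v = p"
    using boundary_chart[OF P p U] .
  let ?B = "ball v \<delta> \<inter> halfplane"
  have inj: "inj_on h ?B" using homeomorphic_imp_injective_map[OF h(3)] by simp
  let ?L = "(\<lambda>x. v + of_real x) ` {0<..<\<delta>}"
  have L: "?L \<subseteq> ?B" using h(1) by (auto simp: dist_norm)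
  have "infinite {0<..<\<delta>}" using h(2) by simp
  then have "infinite ?L" by (subst finite_image_iff) (auto simp: inj_on_def)
  then have "infinite (h ` ?L)" using finite_imageD[OF _ inj_on_subset[OF inj L]] by blast
  then have "\<not> h ` ?L \<subseteq> M" using finite_subset[OF _ assms] by auto
  then have "\<exists>x \<in> {0<..<\<delta>}. h (v + of_real x) \<notin> M" unfolding image_subset_iff by blast
  then obtain x where x: "x \<in> {0<..<\<delta>}" "h (v + of_real x) \<notin> M" by (rule bexE)
  define z where "z = v + of_real x"
  have z: "z \<in> ?B" "Im z = 0" using x(1) h(1) by (auto simp: z_def dist_norm)
  have "h z \<in> surface_boundary P"
    using chart_boundary_iff[OF h(4,3) z(1)] interior_halfball[OF h(1) z(1)] z(2) by simp
  moreover have "h z \<in> U" using h(5) z(1) by (rule subsetD[OF _ imageI])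
  ultimately show ?thesis using x(2) unfolding z_def by (intro bexI conjI)
qed

lemma interior_points_nearby: "\<exists>q \<in> U. q \<notin> surface_boundary P"
proof -
  obtain v \<delta> h where h: "Im v = 0" "0 < \<delta>"
    "homeomorphic_map (top_of_set (ball v \<delta> \<inter> halfplane)) (subtopology P (h ` (ball v \<delta> \<inter> halfplane))) h"
    "openin P (h ` (ball v \<delta> \<inter> halfplane))" "h ` (ball v \<delta> \<inter> halfplane) \<subseteq> U" "h v = p"
    using boundary_chart[OF P p U] .
  let ?B = "ball v \<delta> \<inter> halfplane"
  define z where "z = v + of_real (\<delta> / 2) * \<i>"
  have z: "z \<in> ?B" "Im z \<noteq> 0" using h(1,2) by (auto simp: z_def dist_norm norm_mult)
  have "h z \<notin> surface_boundary P"
    using chart_boundary_iff[OF h(4,3) z(1)] interior_halfball[OF h(1) z(1)] z(2) by simp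
  then show ?thesis using h(5) z(1) by blast
qed

end

text \<open>Each member is closed, and so is the finite union of the others; hence the members are
  connected and clopen.\<close>

lemma connected_components_finite_partition:
  assumes fin: "finite J" and conn: "\<And>j. j \<in> J \<Longrightarrow> connectedin X (B j)" and ne: "\<And>j. j \<in> J \<Longrightarrow> B j \<noteq> {}"
    and closed: "\<And>j. j \<in> J \<Longrightarrow> closedin (subtopology X Y) (B j)" and Y: "Y = (\<Union>j\<in>J. B j)"
    and disj: "\<And>i j. i \<in> J \<Longrightarrow> j \<in> J \<Longrightarrow> i \<noteq> j \<Longrightarrow> B i \<inter> B j = {}"
  shows "connected_components_of (subtopology X Y) = B ` J"
proof -
  have top: "topspace (subtopology X Y) = Y"
    using closed closedin_subset Y by (metis SUP_least subset_antisym topspace_subtopology_subset inf_le2 topspace_subtopology)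
  have comp: "B j \<in> connected_components_of (subtopology X Y)" if j: "j \<in> J" for j
  proof -
    have cj: "connectedin (subtopology X Y) (B j)" using conn[OF j] Y j by (auto simp: connectedin_subtopology)
    have ope: "openin (subtopology X Y) (B j)"
    proof -
      have "closedin (subtopology X Y) (\<Union>i\<in>J - {j}. B i)"
        using fin closed by (intro closedin_Union) auto
      then have "openin (subtopology X Y) (topspace (subtopology X Y) - (\<Union>i\<in>J - {j}. B i))"
        unfolding closedin_def by blast
      moreover have "topspace (subtopology X Y) - (\<Union>i\<in>J - {j}. B i) = B j"
      proof -
        have "x \<notin> B i" if "x \<in> B j" "i \<in> J - {j}" for x i using disj[of i j] that j by blast
        then have "(\<Union>i\<in>J. B i) - (\<Union>i\<in>J - {j}. B i) = B j" using j by auto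
        then show ?thesis unfolding top unfolding Y .
      qed
      ultimately show ?thesis by simp
    qed
    have "topspace (subtopology X Y) \<noteq> {}" using ne[OF j] Y j unfolding top by blast
    then obtain C where C: "C \<in> connected_components_of (subtopology X Y)" "B j \<subseteq> C"
      using exists_connected_component_of_superset[OF cj] by (metis null_topspace_iff_trivial)
    have "connectedin (subtopology X Y) C" using C(1) connectedin_connected_components_of by blast
    then have "C \<subseteq> B j \<or> disjnt C (B j)" using ope closed[OF j] connectedin_clopen_cases by blast
    then have "C \<subseteq> B j" using C(2) ne[OF j] by (auto simp: disjnt_def)
    then show ?thesis using C by auto
  qed
  moreover have "C \<in> B ` J" if C: "C \<in> connected_components_of (subtopology X Y)" for C
  proof -
    obtain x where x: "x \<in> C" using C nonempty_connected_components_of by blast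
    then have "x \<in> Y" using C connected_components_of_subset top by blast
    then obtain j where j: "j \<in> J" "x \<in> B j" using Y by auto
    then have "\<not> disjnt C (B j)" using x by (auto simp: disjnt_def)
    then have "C = B j" using pairwiseD[OF pairwise_disjoint_connected_components_of C comp[OF j(1)]] by blast
    then show ?thesis using j by auto
  qed
  ultimately show ?thesis by auto
qed

section \<open>The fans of an angulation\<close>

locale angulated =
  fixes n :: nat and P :: "'p topology" and M :: "'p set" and T :: "'p set set"
    and F :: "'f set" and \<phi> :: "'f \<Rightarrow> complex \<Rightarrow> 'p"
  assumes n: "3 \<le> n" and angulation: "angulation n P M T F \<phi>"
begin

definition D :: "('f \<times> nat) set" where "D = F \<times> {..<n}"
definition E :: "'f \<times> nat \<Rightarrow> 'p set" where "E = (\<lambda>(f, k). \<phi> f ` side n k)"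
definition A :: "('f \<times> nat) set" where "A = {d \<in> D. E d \<in> T}"
definition nxt :: "'f \<times> nat \<Rightarrow> 'f \<times> nat" where "nxt = (\<lambda>(f, k). (f, Suc k mod n))"
definition prv :: "'f \<times> nat \<Rightarrow> 'f \<times> nat" where "prv = (\<lambda>(f, k). (f, (k + n - 1) mod n))"
definition pt :: "'f \<times> nat \<Rightarrow> 'p" where "pt = (\<lambda>(f, k). \<phi> f (corner n k))"
definition opp :: "'f \<times> nat \<Rightarrow> 'f \<times> nat" where "opp d = (THE d'. d' \<in> A \<and> d' \<noteq> d \<and> E d' = E d)"

lemma surface: "surface_with_boundary P" and finite_M: "finite M" and M_boundary: "M \<subseteq> surface_boundary P"
  and finite_F: "finite F"
  and arc: "\<And>\<tau>. \<tau> \<in> T \<Longrightarrow> is_surface_arc P M \<tau>"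
  and arcs_inter: "\<And>\<tau> \<tau>'. \<tau> \<in> T \<Longrightarrow> \<tau>' \<in> T \<Longrightarrow> \<tau> \<noteq> \<tau>' \<Longrightarrow> \<tau> \<inter> \<tau>' \<subseteq> M"
  and cont: "\<And>f. f \<in> F \<Longrightarrow> continuous_map (top_of_set (ngon n)) P (\<phi> f)"
  and inj_interior: "\<And>f. f \<in> F \<Longrightarrow> inj_on (\<phi> f) (interior (ngon n))"
  and components: "bij_betw (\<lambda>f. \<phi> f ` interior (ngon n)) F
       (connected_components_of (subtopology P (topspace P - surface_boundary P - \<Union>T)))"
  using angulation by (simp_all add: angulation_def)

lemma corner_M: "f \<in> F \<Longrightarrow> k < n \<Longrightarrow> \<phi> f (corner n k) \<in> M"
  and open_side_M: "f \<in> F \<Longrightarrow> k < n \<Longrightarrow> \<phi> f ` open_side n k \<inter> M = {}"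
  and inj_open_side: "f \<in> F \<Longrightarrow> k < n \<Longrightarrow> inj_on (\<phi> f) (open_side n k)"
  and side_type: "f \<in> F \<Longrightarrow> k < n \<Longrightarrow> \<phi> f ` side n k \<in> T \<or> \<phi> f ` open_side n k \<in> boundary_segments P M"
  and card_arc_sides: "\<tau> \<in> T \<Longrightarrow> card {(f, k). f \<in> F \<and> k < n \<and> \<phi> f ` side n k = \<tau>} = 2"
  and card_boundary_sides: "\<beta> \<in> boundary_segments P M \<Longrightarrow> card {(f, k). f \<in> F \<and> k < n \<and> \<phi> f ` open_side n k = \<beta>} = 1"
  and opposite: "f \<in> F \<Longrightarrow> g \<in> F \<Longrightarrow> k < n \<Longrightarrow> l < n \<Longrightarrow> (f, k) \<noteq> (g, l) \<Longrightarrow> \<phi> f ` side n k \<in> T \<Longrightarrow>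
     \<phi> f ` side n k = \<phi> g ` side n l \<Longrightarrow> opposite_sides n \<phi> f k g l"
  using angulation unfolding angulation_def by blast+

lemma hausdorff: "Hausdorff_space P" using surface by (simp add: surface_with_boundary_def)

lemma boundary_subset: "surface_boundary P \<subseteq> topspace P" by (auto simp: surface_boundary_def)

lemma corner_M': "f \<in> F \<Longrightarrow> \<phi> f (corner n k) \<in> M"
  using corner_M[of f "k mod n"] n by (simp add: corner_mod)

lemma closedin_image: assumes "f \<in> F" "compact C" "C \<subseteq> ngon n" shows "closedin P (\<phi> f ` C)"
proof (rule compactin_imp_closedin[OF hausdorff])
  have "compactin (top_of_set (ngon n)) C" using assms by (simp add: compactin_subtopology)
  then show "compactin P (\<phi> f ` C)" using cont[OF assms(1)] by (rule image_compactin)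
qed

lemma open_preimage: assumes "f \<in> F" "openin P U"
  obtains V where "open V" "{z \<in> ngon n. \<phi> f z \<in> U} = ngon n \<inter> V"
proof -
  have "openin (top_of_set (ngon n)) {z \<in> topspace (top_of_set (ngon n)). \<phi> f z \<in> U}"
    by (rule openin_continuous_map_preimage[OF cont[OF assms(1)] assms(2)])
  then show thesis using that by (auto simp: openin_open)
qed

lemma interior_image: assumes "f \<in> F" "y \<in> interior (ngon n)"
  shows "\<phi> f y \<in> topspace P" "\<phi> f y \<notin> surface_boundary P" "\<phi> f y \<notin> \<Union>T"
proof -
  have "\<phi> f ` interior (ngon n) \<in> connected_components_of (subtopology P (topspace P - surface_boundary P - \<Union>T))"
    using components assms(1) by (auto simp: bij_betw_def)
  then have "\<phi> f ` interior (ngon n) \<subseteq> topspace P - surface_boundary P - \<Union>T"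
    using connected_components_of_subset by fastforce
  then show "\<phi> f y \<in> topspace P" "\<phi> f y \<notin> surface_boundary P" "\<phi> f y \<notin> \<Union>T" using assms(2) by auto
qed

lemma arc_boundary: assumes "\<tau> \<in> T" shows "\<tau> \<subseteq> topspace P" "\<tau> \<inter> surface_boundary P \<subseteq> M"
proof -
  obtain g where g: "pathin P g" "g ` {0..1} = \<tau>" "g ` {0<..<1} \<subseteq> topspace P - surface_boundary P" "g 0 \<in> M" "g 1 \<in> M"
    using arc[OF assms] by (auto simp: is_surface_arc_def)
  show "\<tau> \<subseteq> topspace P" using g(1,2) path_image_subset_topspace by blast
  show "\<tau> \<inter> surface_boundary P \<subseteq> M"
  proof
    fix x assume x: "x \<in> \<tau> \<inter> surface_boundary P"
    then obtain t where t: "0 \<le> t" "t \<le> 1" "x = g t" using g(2) by auto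
    then consider "t = 0" | "t = 1" | "t \<in> {0<..<1}" by fastforce
    then show "x \<in> M"
    proof cases
      case 3 then show ?thesis using g(3) t(3) x by blast
    qed (use g t in auto)
  qed
qed

lemma segment_subset: assumes "C \<in> boundary_segments P M" shows "C \<subseteq> surface_boundary P" "C \<inter> M = {}" "C \<noteq> {}"
proof -
  have "C \<subseteq> topspace (subtopology P (surface_boundary P - M))"
    using assms connected_components_of_subset unfolding boundary_segments_def by blast
  then show "C \<subseteq> surface_boundary P" "C \<inter> M = {}" by auto
  show "C \<noteq> {}" using assms nonempty_connected_components_of unfolding boundary_segments_def by blast
qed

lemma A_D: "A \<subseteq> D" by (auto simp: A_def)

lemma D_iff: "(f, k) \<in> D \<longleftrightarrow> f \<in> F \<and> k < n" by (auto simp: D_def)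

lemma A_iff: "(f, k) \<in> A \<longleftrightarrow> f \<in> F \<and> k < n \<and> \<phi> f ` side n k \<in> T" by (auto simp: A_def D_def E_def)

section \<open>Which points of the polygons are identified\<close>

lemma arc_side: assumes "(f, k) \<in> A" "y \<in> open_side n k"
  shows "\<phi> f y \<in> E (f, k)" "\<phi> f y \<notin> surface_boundary P" "\<phi> f y \<notin> M" "\<phi> f y \<in> \<Union>T"
proof -
  show 1: "\<phi> f y \<in> E (f, k)" using assms open_side_subset[OF n] by (auto simp: E_def)
  show 2: "\<phi> f y \<notin> M" using assms open_side_M[of f k] by (auto simp: A_iff)
  show "\<phi> f y \<notin> surface_boundary P" using 1 2 arc_boundary[of "E (f, k)"] assms by (auto simp: A_def)
  show "\<phi> f y \<in> \<Union>T" using 1 assms by (auto simp: A_def)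
qed

lemma nonarc_side: assumes "(f, k) \<in> D" "(f, k) \<notin> A"
  shows "\<phi> f ` open_side n k \<in> boundary_segments P M"
  using assms side_type[of f k] by (auto simp: A_iff D_iff)

lemma nonarc_side_boundary: assumes "(f, k) \<in> D" "(f, k) \<notin> A" "y \<in> open_side n k"
  shows "\<phi> f y \<in> surface_boundary P" "\<phi> f y \<notin> M" "\<phi> f y \<notin> \<Union>T"
proof -
  show 1: "\<phi> f y \<in> surface_boundary P" "\<phi> f y \<notin> M"
    using segment_subset[OF nonarc_side[OF assms(1,2)]] assms(3) by auto
  then show "\<phi> f y \<notin> \<Union>T" using arc_boundary(2) by blast
qed

text \<open>The images of the open polygons are different components of the complement of arcs and
  boundary, hence disjoint, while the sides are mapped into arcs or boundary.\<close>

lemma interior_inj: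
  assumes f: "f \<in> F" "g \<in> F" and y: "y \<in> interior (ngon n)" and z: "z \<in> ngon n" and eq: "\<phi> f y = \<phi> g z"
  shows "f = g \<and> y = z"
  using z
proof (cases rule: ngon_cases[OF n, consumes 1])
  case 1
  let ?C = "connected_components_of (subtopology P (topspace P - surface_boundary P - \<Union>T))"
  have C: "\<phi> f ` interior (ngon n) \<in> ?C" "\<phi> g ` interior (ngon n) \<in> ?C"
    using components f by (auto simp: bij_betw_def)
  have "\<phi> f y \<in> \<phi> f ` interior (ngon n)" using y by (rule imageI)
  moreover have "\<phi> f y \<in> \<phi> g ` interior (ngon n)" unfolding eq using 1 by (rule imageI)
  ultimately have "\<phi> f ` interior (ngon n) = \<phi> g ` interior (ngon n)"
    using pairwiseD[OF pairwise_disjoint_connected_components_of C] by (meson disjnt_iff)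
  then have "f = g" using components f by (auto simp: bij_betw_def inj_on_def)
  then show ?thesis using inj_interior[OF f(1)] eq y 1 by (auto simp: inj_on_def)
next
  case (2 k)
  then show ?thesis
    using interior_image[OF f(1) y] arc_side(4)[of g k z] nonarc_side_boundary(1)[of g k z] eq f
    by (cases "(g, k) \<in> A") (auto simp: D_iff)
next
  case (3 k)
  then show ?thesis using interior_image[OF f(1) y] corner_M[OF f(2)] M_boundary eq by auto
qed

text \<open>Different arcs meet in \<open>M\<close> only, and a boundary segment is a side just
  once. So an inner point of a side is identified at most with a point inside the other side of the
  same arc.\<close>

lemma open_side_cases: assumes "(f, k) \<in> D" "y \<in> open_side n k" "g \<in> F" "z \<in> ngon n" "\<phi> f y = \<phi> g z"
  obtains l where "l < n" "z \<in> open_side n l" "(g, l) = (f, k)" "y = z"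
  | l where "l < n" "z \<in> open_side n l" "(g, l) \<noteq> (f, k)" "(f, k) \<in> A" "(g, l) \<in> A" "E (f, k) = E (g, l)"
  using assms(4)
proof (cases rule: ngon_cases[OF n, consumes 1])
  case 1
  have "y \<in> ngon n" using assms(2) open_side_subset[OF n] side_subset[OF n] by blast
  then have "f = g \<and> z = y" using interior_inj[of g f z y] assms 1 by (auto simp: D_iff)
  then show thesis using 1 assms(1,2) open_side_subset[OF n] open_side_boundary[OF n, of k] by (auto simp: D_iff)
next
  case (3 l)
  then show thesis using corner_M[OF assms(3), of l] open_side_M[of f k] assms by (auto simp: D_iff)
next
  case (2 l)
  have gl: "(g, l) \<in> D" using 2 assms(3) by (simp add: D_iff)
  have inj: thesis if "(g, l) = (f, k)"
  proof -
    have "y = z" using inj_open_side[of f k] that assms 2 by (auto simp: D_iff inj_on_def)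
    then show thesis using that 2 \<open>\<And>l. l < n \<Longrightarrow> z \<in> open_side n l \<Longrightarrow> (g, l) = (f, k) \<Longrightarrow> y = z \<Longrightarrow> thesis\<close> by blast
  qed
  show thesis
  proof (cases "(f, k) \<in> A")
    case True
    then have "(g, l) \<in> A"
      using arc_side[OF True assms(2)] nonarc_side_boundary[OF gl _ 2(2)] assms(5) by auto
    moreover have "E (f, k) = E (g, l)"
    proof (rule ccontr)
      assume "E (f, k) \<noteq> E (g, l)"
      then have "E (f, k) \<inter> E (g, l) \<subseteq> M" using arcs_inter True \<open>(g, l) \<in> A\<close> by (auto simp: A_def)
      then show False using arc_side(1,3)[OF True assms(2)] arc_side(1)[OF \<open>(g, l) \<in> A\<close> 2(2)] assms(5) by auto
    qed
    ultimately show thesis using inj that(2)[of l] True 2 by auto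
  next
    case False
    then have gA: "(g, l) \<notin> A" using arc_side[of g l z] nonarc_side_boundary[OF assms(1) False assms(2)] assms(5) 2 by auto
    let ?a = "\<phi> f ` open_side n k" and ?b = "\<phi> g ` open_side n l"
    have ab: "?a \<in> boundary_segments P M" "?b \<in> boundary_segments P M"
      using nonarc_side assms(1) False gl gA by auto
    have "?a = ?b"
      using pairwiseD[OF pairwise_disjoint_connected_components_of, of ?a _ ?b] ab assms 2
      unfolding boundary_segments_def disjnt_def by blast
    moreover obtain x where "{(f, k). f \<in> F \<and> k < n \<and> \<phi> f ` open_side n k = ?a} = {x}"
      using card_boundary_sides[OF ab(1)] card_1_singletonE by blast
    moreover have "(f, k) \<in> {(f, k). f \<in> F \<and> k < n \<and> \<phi> f ` open_side n k = ?a}" using assms(1) by (auto simp: D_iff)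
    moreover have "(g, l) \<in> {(f, k). f \<in> F \<and> k < n \<and> \<phi> f ` open_side n k = ?a}" using gl calculation(1) by (auto simp: D_iff)
    ultimately have "(g, l) = (f, k)" by (metis singletonD)
    then show thesis by (rule inj)
  qed
qed

lemma corner_cases': assumes "f \<in> F" "g \<in> F" "z \<in> ngon n" "\<phi> g z = \<phi> f (corner n k)"
  obtains l where "l < n" "z = corner n l"
  using assms(3)
proof (cases rule: ngon_cases[OF n, consumes 1])
  case 1
  then show thesis using interior_image[OF assms(2) 1] corner_M'[OF assms(1)] assms(4) M_boundary by auto
next
  case (2 l)
  then show thesis using open_side_M[OF assms(2) 2(1)] corner_M'[OF assms(1), of k] assms(4) by auto
qed (use that in auto)

lemma M_corner: assumes "g \<in> F" "z \<in> ngon n" "\<phi> g z \<in> M"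
  obtains l where "l < n" "z = corner n l"
  using assms(2)
proof (cases rule: ngon_cases[OF n, consumes 1])
  case 1
  then show thesis using interior_image[OF assms(1) 1] assms(3) M_boundary by auto
next
  case (2 l)
  then show thesis using open_side_M[OF assms(1) 2(1)] assms(3) by auto
qed (use that in auto)

lemma nxt_D: "d \<in> D \<Longrightarrow> nxt d \<in> D" "d \<in> D \<Longrightarrow> prv d \<in> D"
  using n by (auto simp: D_def nxt_def prv_def)

lemma Suc_prv: "k < n \<Longrightarrow> Suc ((k + n - 1) mod n) mod n = k"
  using n by (simp add: mod_Suc_eq)

lemma prv_Suc: assumes "k < n" shows "(Suc k mod n + n - 1) mod n = k"
proof (cases "Suc k = n")
  case False
  then have "Suc k mod n + n - 1 = k + n" using assms by simp
  then show ?thesis using assms by simp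
qed (use assms in auto)

lemma prv_nxt: "d \<in> D \<Longrightarrow> prv (nxt d) = d" and nxt_prv: "d \<in> D \<Longrightarrow> nxt (prv d) = d"
  by (auto simp: D_def nxt_def prv_def Suc_prv prv_Suc simp del: One_nat_def)

lemma arc_sides: assumes "\<tau> \<in> T" shows "{(f, k). f \<in> F \<and> k < n \<and> \<phi> f ` side n k = \<tau>} = {d \<in> A. E d = \<tau>}"
  using assms by (auto simp: A_def D_def E_def)

lemma opp_ex1: assumes "d \<in> A" shows "\<exists>!d'. d' \<in> A \<and> d' \<noteq> d \<and> E d' = E d"
proof -
  have "E d \<in> T" using assms by (simp add: A_def)
  then have "card {d' \<in> A. E d' = E d} = 2" using card_arc_sides[of "E d"] arc_sides[of "E d"] by simp
  then obtain x y where xy: "{d' \<in> A. E d' = E d} = {x, y}" "x \<noteq> y" by (auto simp: card_2_iff)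
  have "d \<in> {d' \<in> A. E d' = E d}" using assms by simp
  then have dxy: "d = x \<or> d = y" using xy by auto
  have iff: "d' \<in> A \<and> E d' = E d \<longleftrightarrow> d' = x \<or> d' = y" for d' using xy(1) by blast
  have "(d' \<in> A \<and> d' \<noteq> d \<and> E d' = E d) \<longleftrightarrow> d' = (if d = x then y else x)" for d'
    using xy(2) dxy iff[of d'] by metis
  then show ?thesis by simp
qed

lemma opp: assumes "d \<in> A" shows "opp d \<in> A" "opp d \<noteq> d" "E (opp d) = E d"
  using theI'[OF opp_ex1[OF assms]] by (auto simp: opp_def)

lemma opp_eqI: "d \<in> A \<Longrightarrow> d' \<in> A \<Longrightarrow> d' \<noteq> d \<Longrightarrow> E d' = E d \<Longrightarrow> d' = opp d"
  unfolding opp_def by (rule sym, rule the1_equality[OF opp_ex1]) simp_all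

lemma opp_opp: assumes "d \<in> A" shows "opp (opp d) = d"
proof (rule opp_eqI[symmetric])
  show "d \<noteq> opp d" using opp(2)[OF assms] by (rule not_sym)
qed (use opp[OF assms] assms in simp_all)

lemma E_image: "E ` A = T"
proof
  show "T \<subseteq> E ` A"
  proof
    fix \<tau> assume t: "\<tau> \<in> T"
    then have "{d \<in> A. E d = \<tau>} \<noteq> {}" using card_arc_sides[OF t] arc_sides[OF t] by (metis card.empty zero_neq_numeral)
    then show "\<tau> \<in> E ` A" by auto
  qed
qed (auto simp: A_def)

text \<open>A decreasing map of the interval onto itself exchanges the end points. By injectivity of
  \<open>\<phi> g\<close> on the open side, \<open>h\<close> describes the whole identification of
  the two sides.\<close>

lemma gluing: assumes d: "(f, k) \<in> A" "opp (f, k) = (g, l)"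
  obtains h where "continuous_on {0..1} h" "h 0 = 1" "h 1 = (0 :: real)"
    "\<And>s. s \<in> {0..1} \<Longrightarrow> h s \<in> {0..1} \<and> \<phi> f (side_point n k s) = \<phi> g (side_point n l (h s))"
    "\<And>s t. s \<in> {0<..<1} \<Longrightarrow> t \<in> {0<..<1} \<Longrightarrow> \<phi> f (side_point n k s) = \<phi> g (side_point n l t) \<Longrightarrow> t = h s"
proof -
  have gl: "(g, l) \<in> A" "(g, l) \<noteq> (f, k)" "E (g, l) = E (f, k)" using opp[OF d(1)] d(2) by auto
  have "opposite_sides n \<phi> f k g l"
    by (rule opposite) (use gl d(1) in \<open>auto simp: A_iff E_def\<close>)
  then obtain h :: "real \<Rightarrow> real" where hh: "continuous_on {0..1} h \<and> h ` {0..1} = {0..1} \<and>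
        (\<forall>s \<in> {0..1}. \<forall>t \<in> {0..1}. s < t \<longrightarrow> h t < h s) \<and>
        (\<forall>s \<in> {0..1}. \<phi> f (side_point n k s) = \<phi> g (side_point n l (h s)))"
    unfolding opposite_sides_def by (rule exE)
  note h = hh[THEN conjunct1] hh[THEN conjunct2, THEN conjunct1]
    hh[THEN conjunct2, THEN conjunct2, THEN conjunct1, rule_format]
    hh[THEN conjunct2, THEN conjunct2, THEN conjunct2, rule_format]
  have h01: "h s \<in> {0..1}" if "s \<in> {0..1}" for s using h(2) that by blast
  have 0: "h 0 = 1"
  proof -
    have "1 \<in> h ` {0..1}" using h(2) by simp
    then obtain s where s: "s \<in> {0..1}" "h s = 1" by (metis imageE)
    show ?thesis using h(3)[of 0 s] h01[of 0] s by (cases "s = 0") auto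
  qed
  have 1: "h 1 = 0"
  proof -
    have "0 \<in> h ` {0..1}" using h(2) by simp
    then obtain s where s: "s \<in> {0..1}" "h s = 0" by (metis imageE)
    show ?thesis using h(3)[of s 1] h01[of 1] s by (cases "s = 1") auto
  qed
  show thesis
  proof (rule that[OF h(1) 0 1])
    show "h s \<in> {0..1} \<and> \<phi> f (side_point n k s) = \<phi> g (side_point n l (h s))" if "s \<in> {0..1}" for s
      using h01[OF that] h(4)[OF that] by simp
    show "t = h s" if st: "s \<in> {0<..<1}" "t \<in> {0<..<1}" "\<phi> f (side_point n k s) = \<phi> g (side_point n l t)" for s t
    proof -
      have "h s \<in> {0<..<1}" using h(3)[of 0 s] h(3)[of s 1] 0 1 st(1) by auto
      then have "side_point n l t \<in> open_side n l" "side_point n l (h s) \<in> open_side n l"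
        using side_point_image(2)[OF n, of l] st(2) by blast+
      moreover have "\<phi> g (side_point n l t) = \<phi> g (side_point n l (h s))" using h(4)[of s] st by auto
      ultimately have "side_point n l t = side_point n l (h s)"
        using inj_open_side[of g l] gl(1) by (auto simp: A_iff inj_on_def)
      then show ?thesis using side_point_inj[OF n] by blast
    qed
  qed
qed

text \<open>Glued sides run in opposite directions, so the start of \<open>d\<close> is the end of
  \<open>opp d\<close>, which is the start of the side after it.\<close>

lemma pt_rot: assumes "d \<in> A" shows "pt (nxt (opp d)) = pt d"
proof -
  obtain f k where d: "d = (f, k)" by (cases d)
  obtain g l where o: "opp d = (g, l)" by (cases "opp d")
  obtain h :: "real \<Rightarrow> real" where "h 0 = 1" "\<phi> f (side_point n k 0) = \<phi> g (side_point n l (h 0))"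
    using gluing[of f k g l] assms o d by (metis atLeastAtMost_iff order_refl zero_le_one)
  then show ?thesis using n unfolding d o[unfolded d]
    by (simp add: pt_def nxt_def side_point_ends[OF n] corner_mod)
qed

lemma image_ngon: "f \<in> F \<Longrightarrow> \<phi> f ` ngon n \<subseteq> topspace P"
  using continuous_map_image_subset_topspace[OF cont] by auto

text \<open>The images of the polygons form a closed set that contains all points off the boundary,
  and these are dense.\<close>

lemma covered: "topspace P = (\<Union>f\<in>F. \<phi> f ` ngon n)"
proof
  let ?X = "\<Union>f\<in>F. \<phi> f ` ngon n"
  have closed: "closedin P ?X"
    using finite_F closedin_image compact_ngon[OF n] by (intro closedin_Union) auto
  have inner: "x \<in> ?X" if x: "x \<in> topspace P" "x \<notin> surface_boundary P" for x
  proof (cases "x \<in> \<Union>T")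
    case True
    then obtain \<tau> where t: "\<tau> \<in> T" "x \<in> \<tau>" by (rule UnionE)
    then have "\<tau> \<in> E ` A" by (simp only: E_image)
    then obtain f k where fk: "(f, k) \<in> A" "\<tau> = E (f, k)" by (elim imageE) (metis surj_pair)
    then have "x \<in> \<phi> f ` ngon n" using t(2) side_subset[OF n, of k] by (auto simp: E_def)
    then show ?thesis using fk(1) by (auto simp: A_iff)
  next
    case False
    then have "x \<in> \<Union>(connected_components_of (subtopology P (topspace P - surface_boundary P - \<Union>T)))"
      unfolding Union_connected_components_of using x by simp
    then obtain C where C: "x \<in> C" "C \<in> connected_components_of (subtopology P (topspace P - surface_boundary P - \<Union>T))"
      by (rule UnionE)
    then have "C \<in> (\<lambda>f. \<phi> f ` interior (ngon n)) ` F" using components by (simp add: bij_betw_def)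
    then obtain f where "f \<in> F" "x \<in> \<phi> f ` interior (ngon n)" using C(1) by auto
    then show ?thesis using interior_subset by blast
  qed
  show "topspace P \<subseteq> ?X"
  proof (rule ccontr)
    assume "\<not> topspace P \<subseteq> ?X"
    then obtain x where x: "x \<in> topspace P" "x \<notin> ?X" by blast
    then have "x \<in> surface_boundary P" "x \<in> topspace P - ?X" using inner by blast+
    moreover have "openin P (topspace P - ?X)" using closed by (simp add: closedin_def)
    ultimately have "\<exists>q \<in> topspace P - ?X. q \<notin> surface_boundary P"
      using interior_points_nearby[OF surface] by simp
    then obtain q where "q \<in> topspace P - ?X" "q \<notin> surface_boundary P" by (rule bexE)
    then show False using inner by blast
  qed
  show "?X \<subseteq> topspace P" using image_ngon by auto
qed

text \<open>Arbitrarily close to \<open>p\<close> there are boundary points outside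
  \<open>M\<close>, and they lie on sides that are not arcs. The union of these finitely many closed
  sides is closed, so it contains \<open>p\<close>.\<close>

lemma fan_boundary': assumes p: "p \<in> M"
  obtains d where "d \<in> D" "pt d = p" "d \<notin> A \<or> prv d \<notin> A"
proof -
  let ?Z = "\<Union>(f, k)\<in>D - A. \<phi> f ` side n k"
  have fin: "finite D" using finite_F by (simp add: D_def)
  have "closedin P ?Z"
    using fin closedin_image side_subset[OF n] by (intro closedin_Union) (auto simp: D_iff side_def)
  then have op: "openin P (topspace P - ?Z)" by (simp add: closedin_def)
  have "p \<in> ?Z"
  proof (rule ccontr)
    assume "p \<notin> ?Z"
    then have pZ: "p \<in> topspace P - ?Z" using p M_boundary boundary_subset by auto
    have "p \<in> surface_boundary P" using p M_boundary by auto
    from boundary_points_nearby[OF surface this op pZ finite_M]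
    obtain q where q: "q \<in> topspace P - ?Z" "q \<in> surface_boundary P" "q \<notin> M" by (elim bexE conjE)
    then obtain f z where f: "f \<in> F" "z \<in> ngon n" "q = \<phi> f z" using covered by auto
    from f(2) show False
    proof (cases rule: ngon_cases[OF n, consumes 1])
      case 1 then show False using interior_image[OF f(1)] q f by auto
    next
      case (3 k) then show False using corner_M[OF f(1)] q f by auto
    next
      case (2 k)
      have "(f, k) \<in> A"
      proof (rule ccontr)
        assume "(f, k) \<notin> A"
        then have "q \<in> ?Z" using 2 f open_side_subset[OF n, of k]
          by (intro UN_I[of "(f, k)"]) (auto simp: D_iff)
        then show False using q(1) by blast
      qed
      then show False using arc_side(2)[of f k z] 2 q f by auto
    qed
  qed
  then obtain f k where f: "(f, k) \<in> D" "(f, k) \<notin> A" "p \<in> \<phi> f ` side n k" by auto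
  then obtain z where z: "z \<in> side n k" "p = \<phi> f z" by auto
  then consider "z = corner n k" | "z = corner n (Suc k)" | "z \<in> open_side n k" using side_split[OF n] by auto
  then show thesis
  proof cases
    case 1 then show thesis using that[of "(f, k)"] f z by (simp add: pt_def)
  next
    case 2
    then show thesis using that[of "nxt (f, k)"] f z prv_nxt[OF f(1)] nxt_D(1)[OF f(1)] n
      by (simp add: pt_def nxt_def corner_mod)
  next
    case 3 then show thesis using open_side_M[of f k] f z p by (auto simp: D_iff)
  qed
qed

subsection \<open>Sectors at the corners\<close>

definition sector :: "real \<Rightarrow> 'f \<times> nat \<Rightarrow> 'p set" where
  "sector \<rho> = (\<lambda>(f, k). \<phi> f ` (ngon n \<inter> cball (corner n k) \<rho>))"

text \<open>The other sides together with the far parts of the two sides at the corner form a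
  compact set that misses the corner, so it has a positive distance from it.\<close>

lemma near_corner: assumes k: "k < n" and \<eta>: "0 < \<eta>" "\<eta> < 1"
  shows "\<forall>\<^sub>F \<rho> in at_right 0. ngon n \<inter> cball (corner n k) \<rho> \<subseteq>
    insert (corner n k) (interior (ngon n) \<union> side_point n k ` {0<..<\<eta>} \<union> side_point n ((k + n - 1) mod n) ` {1 - \<eta><..<1})"
proof -
  define k' where "k' = (k + n - 1) mod n"
  have k': "k' < n" "Suc k' mod n = k" using n k Suc_prv by (auto simp: k'_def)
  let ?C = "(\<Union>j\<in>{..<n} - {k, k'}. side n j) \<union> side_point n k ` {\<eta>..1} \<union> side_point n k' ` {0..1 - \<eta>}"
  have cont_sp: "continuous_on X (side_point n j)" for X j
    unfolding side_point_def linepath_def by (intro continuous_intros)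
  have comp: "compact ?C"
    by (intro compact_Un compact_UN compact_continuous_image cont_sp) (auto simp: side_def)
  have nC: "corner n k \<notin> ?C"
  proof -
    have "corner n k \<notin> side n j" if "j < n" "j \<noteq> k" "j \<noteq> k'" for j
      using corner_side_iff[OF n k that(1)] that prv_Suc[OF that(1)] k' by (auto simp: k'_def)
    moreover have "corner n k \<notin> side_point n k ` {\<eta>..1}"
      using side_point_ends(1)[OF n, of k] side_point_inj[OF n, of k 0] \<eta> by (metis atLeastAtMost_iff imageE leD)
    moreover have "corner n k \<notin> side_point n k' ` {0..1 - \<eta>}"
    proof -
      have "corner n k = side_point n k' 1" using side_point_ends(2)[OF n, of k'] k' corner_mod[of n "Suc k'"] n by simp
      show ?thesis
      proof
        assume "corner n k \<in> side_point n k' ` {0..1 - \<eta>}"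
        then obtain x where x: "x \<in> {0..1 - \<eta>}" "corner n k = side_point n k' x" by (elim imageE)
        then have "x = 1" using \<open>corner n k = side_point n k' 1\<close> side_point_inj[OF n, of k' x 1] by metis
        then show False using x(1) \<eta> by simp
      qed
    qed
    ultimately show ?thesis by auto
  qed
  from separate_point_closed[OF compact_imp_closed[OF comp] nC]
  obtain r where r: "0 < r" "\<forall>z \<in> ?C. r \<le> dist (corner n k) z" by (elim exE conjE)
  have main: "z \<in> insert (corner n k) (interior (ngon n) \<union> side_point n k ` {0<..<\<eta>} \<union> side_point n k' ` {1 - \<eta><..<1})"
    if z: "z \<in> ngon n" "z \<in> cball (corner n k) \<rho>" "\<rho> < r" for z \<rho>
  proof -
    have zC: "z \<notin> ?C"
    proof
      assume "z \<in> ?C"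
      then have "r \<le> dist (corner n k) z" by (rule bspec[OF r(2)])
      then show False using z by simp
    qed
    show ?thesis
    proof (cases "z \<in> interior (ngon n)")
      case False
      then have "z \<in> (\<Union>j<n. side n j)" using z(1) unfolding ngon_frontier[OF n, symmetric] by blast
      then obtain j where j: "j < n" "z \<in> side n j" by blast
      then have "j = k \<or> j = k'" using zC by blast
      then show ?thesis
      proof
        assume "j = k"
        then have "z \<in> side_point n k ` {0..1}" using j side_point_image(1)[OF n, of k] by simp
        then obtain t where t: "t \<in> {0..1}" "z = side_point n k t" by (elim imageE)
        have "t < \<eta>"
        proof (rule ccontr)
          assume "\<not> t < \<eta>"
          then have "z \<in> side_point n k ` {\<eta>..1}" using t by simp
          then show False using zC by blast
        qed
        then show ?thesis using t side_point_ends(1)[OF n, of k] by (cases "t = 0") auto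
      next
        assume "j = k'"
        then have "z \<in> side_point n k' ` {0..1}" using j side_point_image(1)[OF n, of k'] by simp
        then obtain t where t: "t \<in> {0..1}" "z = side_point n k' t" by (elim imageE)
        have "1 - \<eta> < t"
        proof (rule ccontr)
          assume "\<not> 1 - \<eta> < t"
          then have "z \<in> side_point n k' ` {0..1 - \<eta>}" using t by simp
          then show False using zC by blast
        qed
        moreover have "side_point n k' 1 = corner n k"
          using side_point_ends(2)[OF n, of k'] k' corner_mod[of n "Suc k'"] n by simp
        ultimately show ?thesis using t by (cases "t = 1") auto
      qed
    qed simp
  qed
  have "\<forall>\<^sub>F \<rho> in at_right 0. \<rho> < r" using r(1) eventually_at_right_less by (auto simp: eventually_at_right_field)
  then show ?thesis unfolding k'_def[symmetric] by eventually_elim (use main in blast)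
qed

text \<open>Gluing sends the beginning of a side close to the end of the other, by continuity of
  \<open>h\<close> at 0 and 1. So near the corners no beginning meets a beginning and no end meets
  an end.\<close>

lemma gluing_near: assumes d: "(f, k) \<in> A" "opp (f, k) = (g, l)"
  shows "\<exists>\<eta>. 0 < \<eta> \<and> \<eta> < 1 / 2 \<and>
    (\<forall>s t. 0 < s \<longrightarrow> s < \<eta> \<longrightarrow> 0 < t \<longrightarrow> t < \<eta> \<longrightarrow> \<phi> f (side_point n k s) \<noteq> \<phi> g (side_point n l t)) \<and>
    (\<forall>s t. 1 - \<eta> < s \<longrightarrow> s < 1 \<longrightarrow> 1 - \<eta> < t \<longrightarrow> t < 1 \<longrightarrow> \<phi> f (side_point n k s) \<noteq> \<phi> g (side_point n l t))"
proof -
  obtain h where h: "continuous_on {0..1} h" "h 0 = 1" "h 1 = (0 :: real)"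
    "\<And>s t. s \<in> {0<..<1} \<Longrightarrow> t \<in> {0<..<1} \<Longrightarrow> \<phi> f (side_point n k s) = \<phi> g (side_point n l t) \<Longrightarrow> t = h s"
    using gluing[OF d] by metis
  have cont: "\<exists>a>0. \<forall>s \<in> {0..1}. dist s x < a \<longrightarrow> dist (h s) (h x) < 1 / 2" if "x \<in> {0..1}" for x
    using h(1)[unfolded continuous_on_iff, rule_format, OF that, of "1 / 2"] by simp
  obtain a where a: "0 < a" "\<And>s. s \<in> {0..1} \<Longrightarrow> dist s 0 < a \<Longrightarrow> dist (h s) (h 0) < 1 / 2"
    using cont[of 0] by auto
  obtain b where b: "0 < b" "\<And>s. s \<in> {0..1} \<Longrightarrow> dist s 1 < b \<Longrightarrow> dist (h s) (h 1) < 1 / 2"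
    using cont[of 1] by auto
  define \<eta> where "\<eta> = min (1 / 4) (min a b)"
  have \<eta>: "0 < \<eta>" "\<eta> \<le> 1 / 4" "\<eta> \<le> a" "\<eta> \<le> b" using a b by (auto simp: \<eta>_def)
  show ?thesis
  proof (intro exI[of _ \<eta>] conjI allI impI)
    show "\<phi> f (side_point n k s) \<noteq> \<phi> g (side_point n l t)" if "0 < s" "s < \<eta>" "0 < t" "t < \<eta>" for s t
    proof
      assume "\<phi> f (side_point n k s) = \<phi> g (side_point n l t)"
      then have "t = h s" using h(4)[of s t] that \<eta> by auto
      moreover have "dist (h s) (h 0) < 1 / 2" using a(2)[of s] that \<eta> by auto
      ultimately show False using that \<eta> h(2) by (simp add: dist_real_def)
    qed
    show "\<phi> f (side_point n k s) \<noteq> \<phi> g (side_point n l t)" if "1 - \<eta> < s" "s < 1" "1 - \<eta> < t" "t < 1" for s t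
    proof
      assume "\<phi> f (side_point n k s) = \<phi> g (side_point n l t)"
      then have "t = h s" using h(4)[of s t] that \<eta> by auto
      moreover have "dist (h s) (h 1) < 1 / 2" using b(2)[of s] that \<eta> by (auto simp: dist_real_def)
      ultimately show False using that \<eta> h(3) by (simp add: dist_real_def)
    qed
  qed (use \<eta> in auto)
qed

lemma nxt_prv_pair: "k < n \<Longrightarrow> nxt (f, (k + n - 1) mod n) = (f, k)"
  using Suc_prv by (simp add: nxt_def)

text \<open>A common point other than the marked one would lie on two sides glued to each other. By
  \<open>gluing_near\<close> it is near the beginning of one and near the end of the other, so
  \<open>rot\<close> takes one corner to the other, which is excluded.\<close>

lemma sector_inter:
  assumes D: "(f, k) \<in> D" "(g, l) \<in> D" "(f, k) \<noteq> (g, l)" and pt: "pt (g, l) = pt (f, k)"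
    and rot: "(f, k) \<in> A \<Longrightarrow> (g, l) \<noteq> nxt (opp (f, k))" "(g, l) \<in> A \<Longrightarrow> (f, k) \<noteq> nxt (opp (g, l))"
  shows "\<forall>\<^sub>F \<rho> in at_right 0. sector \<rho> (f, k) \<inter> sector \<rho> (g, l) \<subseteq> {pt (f, k)}"
proof -
  have fg: "f \<in> F" "g \<in> F" "k < n" "l < n" using D by (auto simp: D_iff)
  define k' l' where "k' = (k + n - 1) mod n" and "l' = (l + n - 1) mod n"
  have kl': "k' < n" "l' < n" "nxt (f, k') = (f, k)" "nxt (g, l') = (g, l)"
    unfolding k'_def l'_def using n nxt_prv_pair[OF fg(3)] nxt_prv_pair[OF fg(4)] by simp_all
  have "\<exists>\<eta>. 0 < \<eta> \<and> \<eta> < 1 / 2 \<and> ((f, k) \<in> A \<and> opp (f, k) = (g, l) \<longrightarrow>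
    (\<forall>s t. 0 < s \<longrightarrow> s < \<eta> \<longrightarrow> 0 < t \<longrightarrow> t < \<eta> \<longrightarrow> \<phi> f (side_point n k s) \<noteq> \<phi> g (side_point n l t)))"
  proof (cases "(f, k) \<in> A \<and> opp (f, k) = (g, l)")
    case True
    show ?thesis by (rule ex_forward[OF gluing_near[OF True[THEN conjunct1] True[THEN conjunct2]]]) simp
  next
    case False then show ?thesis by (intro exI[of _ "1 / 4"]) auto
  qed
  then obtain \<eta>1 where \<eta>1: "0 < \<eta>1" "\<eta>1 < 1 / 2" "\<And>s t. (f, k) \<in> A \<Longrightarrow> opp (f, k) = (g, l) \<Longrightarrow>
    0 < s \<Longrightarrow> s < \<eta>1 \<Longrightarrow> 0 < t \<Longrightarrow> t < \<eta>1 \<Longrightarrow> \<phi> f (side_point n k s) \<noteq> \<phi> g (side_point n l t)" by auto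
  have "\<exists>\<eta>. 0 < \<eta> \<and> \<eta> < 1 / 2 \<and> ((f, k') \<in> A \<and> opp (f, k') = (g, l') \<longrightarrow>
    (\<forall>s t. 1 - \<eta> < s \<longrightarrow> s < 1 \<longrightarrow> 1 - \<eta> < t \<longrightarrow> t < 1 \<longrightarrow> \<phi> f (side_point n k' s) \<noteq> \<phi> g (side_point n l' t)))"
  proof (cases "(f, k') \<in> A \<and> opp (f, k') = (g, l')")
    case True
    show ?thesis by (rule ex_forward[OF gluing_near[OF True[THEN conjunct1] True[THEN conjunct2]]]) simp
  next
    case False then show ?thesis by (intro exI[of _ "1 / 4"]) auto
  qed
  then obtain \<eta>2 where \<eta>2: "0 < \<eta>2" "\<eta>2 < 1 / 2" "\<And>s t. (f, k') \<in> A \<Longrightarrow> opp (f, k') = (g, l') \<Longrightarrow>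
    1 - \<eta>2 < s \<Longrightarrow> s < 1 \<Longrightarrow> 1 - \<eta>2 < t \<Longrightarrow> t < 1 \<Longrightarrow> \<phi> f (side_point n k' s) \<noteq> \<phi> g (side_point n l' t)" by auto
  define \<eta> where "\<eta> = min \<eta>1 \<eta>2"
  have \<eta>: "0 < \<eta>" "\<eta> < 1" "\<eta> \<le> \<eta>1" "\<eta> \<le> \<eta>2" using \<eta>1 \<eta>2 by (auto simp: \<eta>_def)
  have sp: "side_point n j t \<in> open_side n j" if "0 < t" "t < 1" for j t
    using side_point_image(2)[OF n, of j] that by (metis greaterThanLessThan_iff imageI)
  \<comment> \<open>For two corners of the same polygon a radius below half their distance keeps the
    sectors disjoint before gluing.\<close>
  define r where "r = (if f = g then dist (corner n k) (corner n l) / 2 else 1)"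
  have "0 < r" using D(3) corner_inj[OF n fg(3,4)] by (auto simp: r_def)
  then have ev: "\<forall>\<^sub>F \<rho> in at_right 0. \<rho> < r" using eventually_at_right_less by (auto simp: eventually_at_right_field)
  show ?thesis
    using near_corner[OF fg(3) \<eta>(1,2), folded k'_def] near_corner[OF fg(4) \<eta>(1,2), folded l'_def] ev
  proof eventually_elim
    case (elim \<rho>)
    show ?case
    proof
      fix x assume "x \<in> sector \<rho> (f, k) \<inter> sector \<rho> (g, l)"
      then obtain y z where y: "y \<in> ngon n \<inter> cball (corner n k) \<rho>" "x = \<phi> f y"
        and z: "z \<in> ngon n \<inter> cball (corner n l) \<rho>" "x = \<phi> g z" by (auto simp: sector_def)
      have eq: "\<phi> f y = \<phi> g z" using y z by simp
      have far: "y \<noteq> z" if "f = g"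
      proof
        assume "y = z"
        then have "dist (corner n k) (corner n l) \<le> \<rho> + \<rho>"
          using y(1) z(1) dist_triangle[of "corner n k" "corner n l" y] by (auto simp: dist_commute)
        then show False using elim(3) that by (simp add: r_def)
      qed
      show "x \<in> {pt (f, k)}"
      proof (rule ccontr)
        assume "x \<notin> {pt (f, k)}"
        then have "y \<noteq> corner n k" "z \<noteq> corner n l" using y z pt by (auto simp: pt_def)
        then have ycases: "y \<in> interior (ngon n) \<union> side_point n k ` {0<..<\<eta>} \<union> side_point n k' ` {1 - \<eta><..<1}"
          and zcases: "z \<in> interior (ngon n) \<union> side_point n l ` {0<..<\<eta>} \<union> side_point n l' ` {1 - \<eta><..<1}"
          using subsetD[OF elim(1) y(1)] subsetD[OF elim(2) z(1)] by (auto simp only: insert_iff)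
        have zi: "z \<notin> interior (ngon n)" using interior_inj[of g f z y] fg eq far y(1) by auto
        have side: "\<exists>j. j < n \<and> z \<in> open_side n j \<and> (f, i) \<in> A \<and> (g, j) = opp (f, i)"
          if i: "i < n" "y \<in> open_side n i" for i
        proof -
          have "(f, i) \<in> D" "z \<in> ngon n" using fg i z(1) by (auto simp: D_iff)
          then show ?thesis
            using open_side_cases[of f i y g z] i(2) fg(2) eq far opp_eqI[of "(f, i)"] by (metis Pair_inject)
        qed
        have same: "j = i" if "z \<in> open_side n j" "z \<in> open_side n i" "j < n" "i < n" for i j
          using that open_side_disjoint[OF n, of j i] open_side_subset[OF n, of i] by blast
        consider "y \<in> interior (ngon n)" | s where "0 < s" "s < \<eta>" "y = side_point n k s"
          | s where "1 - \<eta> < s" "s < 1" "y = side_point n k' s" using ycases by auto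
        then show False
        proof cases
          case 1
          then show False using interior_inj[of f g y z] fg eq far z(1) by auto
        next
          case (2 s)
          then obtain j where j: "j < n" "z \<in> open_side n j" "(f, k) \<in> A" "(g, j) = opp (f, k)"
            using side[of k] sp[of s k] \<eta> fg by auto
          consider t where "0 < t" "t < \<eta>" "z = side_point n l t"
            | t where "1 - \<eta> < t" "t < 1" "z = side_point n l' t" using zcases zi by auto
          then show False
          proof cases
            case (1 t)
            then have "j = l" using same[of j l] j sp[of t l] \<eta> fg by auto
            then show False using \<eta>1(3)[of s t] j 1 2 \<eta> eq by auto
          next
            case (2 t)
            then have "j = l'" using same[of j l'] j sp[of t l'] \<eta> kl' by auto
            then show False using rot(1) j kl'(4) by auto
          qed
        next
          case (3 s)
          then obtain j where j: "j < n" "z \<in> open_side n j" "(f, k') \<in> A" "(g, j) = opp (f, k')"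
            using side[of k'] sp[of s k'] \<eta> kl' by auto
          consider t where "0 < t" "t < \<eta>" "z = side_point n l t"
            | t where "1 - \<eta> < t" "t < 1" "z = side_point n l' t" using zcases zi by auto
          then show False
          proof cases
            case (1 t)
            then have "j = l" using same[of j l] j sp[of t l] \<eta> fg by auto
            then have "(g, l) \<in> A" "opp (g, l) = (f, k')" using j opp(1)[of "(f, k')"] opp_opp[of "(f, k')"] by auto
            then show False using rot(2) kl'(3) by auto
          next
            case (2 t)
            then have "j = l'" using same[of j l'] j sp[of t l'] \<eta> kl' by auto
            then show False using \<eta>2(3)[of s t] j 3 2 \<eta> eq by auto
          qed
        qed
      qed
    qed
  qed
qed

text \<open>If the corners at \<open>p\<close> fell into two families not linked by
  \<open>rot\<close>, their small sectors would meet in \<open>p\<close> only. They would then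
  disconnect a punctured neighbourhood as given by \<open>boundary_punctured_nbhd\<close>.\<close>

lemma fan_connected':
  assumes G: "G \<subseteq> {d \<in> D. pt d = p}" "G \<noteq> {}"
    and rot: "\<And>d. d \<in> A \<Longrightarrow> pt d = p \<Longrightarrow> d \<in> G \<longleftrightarrow> nxt (opp d) \<in> G"
  shows "G = {d \<in> D. pt d = p}"
proof (rule ccontr)
  define G' where "G' = {d \<in> D. pt d = p} - G"
  assume "G \<noteq> {d \<in> D. pt d = p}"
  then have G': "G' \<noteq> {}" using G(1) by (auto simp: G'_def)
  have finD: "finite D" using finite_F by (simp add: D_def)
  have fin: "finite G" "finite G'" using G(1) finD by (auto simp: G'_def intro: finite_subset)
  have "\<forall>\<^sub>F \<rho> in at_right 0. sector \<rho> d \<inter> sector \<rho> d' \<subseteq> {p}" if "d \<in> G" "d' \<in> G'" for d d'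
  proof -
    obtain f k g l where fk: "d = (f, k)" "d' = (g, l)" by (metis surj_pair)
    have "d \<in> D" "pt d = p" "d' \<in> D" "pt d' = p" "d' \<notin> G" using that G(1) by (auto simp: G'_def)
    moreover from this have "d \<in> A \<Longrightarrow> d' \<noteq> nxt (opp d)" "d' \<in> A \<Longrightarrow> d \<noteq> nxt (opp d')" "d \<noteq> d'"
      using rot[of d] rot[of d'] that(1) by auto
    ultimately show ?thesis using sector_inter[of f k g l] fk by simp
  qed
  then have "\<forall>\<^sub>F \<rho> in at_right 0. \<forall>d \<in> G. \<forall>d' \<in> G'. sector \<rho> d \<inter> sector \<rho> d' \<subseteq> {p}"
    using fin by (simp add: eventually_ball_finite_distrib)
  then have "\<forall>\<^sub>F \<rho> in at_right 0. 0 < \<rho> \<and> (\<forall>d \<in> G. \<forall>d' \<in> G'. sector \<rho> d \<inter> sector \<rho> d' \<subseteq> {p})"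
    by (intro eventually_conj eventually_at_right_less)
  then obtain \<rho> :: real where \<rho>: "0 < \<rho>" "\<And>d d'. d \<in> G \<Longrightarrow> d' \<in> G' \<Longrightarrow> sector \<rho> d \<inter> sector \<rho> d' \<subseteq> {p}"
    using eventually_happens'[OF trivial_limit_at_right_real] by (metis (no_types, lifting))
  have "compact (ngon n \<inter> cball (corner n k) \<rho>)" for k
    using compact_ngon[OF n] compact_cball by (rule compact_Int)
  then have closed_sector: "closedin P (sector \<rho> d)" if "d \<in> D" for d
    using that closedin_image[of "fst d" "ngon n \<inter> cball (corner n (snd d)) \<rho>"]
    by (auto simp: sector_def D_def)
  define X X' where "X = (\<Union>d\<in>G. sector \<rho> d)" and "X' = (\<Union>d\<in>G'. sector \<rho> d)"
  have "closedin P X" "closedin P X'" unfolding X_def X'_def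
    using fin closed_sector G(1) by (auto simp: G'_def intro!: closedin_Union)
  \<comment> \<open>Every point outside \<open>Z\<close> lies in a sector of some corner at
    \<open>p\<close>, so a neighbourhood of \<open>p\<close> that misses \<open>Z\<close> is covered
    by the two families.\<close>
  define C where "C f = ngon n - (\<Union>k\<in>{k. (f, k) \<in> D \<and> pt (f, k) = p}. ball (corner n k) \<rho>)" for f
  define Z where "Z = (\<Union>f\<in>F. \<phi> f ` C f)"
  have "compact (C f)" for f unfolding C_def using compact_ngon[OF n] by (intro compact_diff open_UN) auto
  then have "closedin P Z" unfolding Z_def using finite_F closedin_image
    by (intro closedin_Union) (auto simp: C_def)
  then have op: "openin P (topspace P - Z)" by (simp add: closedin_def)
  obtain d0 where d0: "d0 \<in> G" using G(2) by auto
  have pM: "p \<in> M" using d0 G(1) corner_M by (auto simp: D_def pt_def)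
  have "p \<notin> Z"
  proof
    assume "p \<in> Z"
    then obtain f z where f: "f \<in> F" "z \<in> C f" "p = \<phi> f z" by (auto simp: Z_def)
    then obtain k where "k < n" "z = corner n k" using M_corner[of f z] pM by (auto simp: C_def)
    then show False using f \<rho>(1) by (auto simp: C_def D_iff pt_def)
  qed
  moreover have p_top: "p \<in> topspace P" "p \<in> surface_boundary P" using pM M_boundary boundary_subset by auto
  ultimately obtain W where W: "openin P W" "p \<in> W" "W \<subseteq> topspace P - Z" "connectedin P (W - {p})"
    using boundary_punctured_nbhd[OF surface _ op, of p] by auto
  have cover: "W \<subseteq> X \<union> X'"
  proof
    fix x assume x: "x \<in> W"
    then obtain f z where f: "f \<in> F" "z \<in> ngon n" "x = \<phi> f z" using W(3) covered by auto
    then have "z \<notin> C f" using x W(3) by (auto simp: Z_def)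
    then obtain k where k: "(f, k) \<in> D" "pt (f, k) = p" "z \<in> ball (corner n k) \<rho>" using f(2) by (auto simp: C_def)
    then have "x \<in> sector \<rho> (f, k)" using f by (auto simp: sector_def)
    then show "x \<in> X \<union> X'" using k(1,2) by (auto simp: X_def X'_def G'_def)
  qed
  have disj: "X \<inter> X' \<subseteq> {p}"
  proof
    fix x assume "x \<in> X \<inter> X'"
    then obtain d d' where "d \<in> G" "d' \<in> G'" "x \<in> sector \<rho> d \<inter> sector \<rho> d'" by (auto simp: X_def X'_def)
    then show "x \<in> {p}" by (rule subsetD[OF \<rho>(2)])
  qed
  \<comment> \<open>Inner points of the polygon close to the corner are not mapped to
    \<open>p\<close>, so each family contains points of the punctured neighbourhood.\<close>
  have meets: "sector \<rho> d \<inter> (W - {p}) \<noteq> {}" if "d \<in> D" "pt d = p" for d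
  proof -
    obtain f k where d: "d = (f, k)" "f \<in> F" "k < n" using \<open>d \<in> D\<close> by (auto simp: D_def)
    obtain V where V: "open V" "{z \<in> ngon n. \<phi> f z \<in> W} = ngon n \<inter> V" using open_preimage[OF d(2) W(1)] .
    have "corner n k \<in> V \<inter> ball (corner n k) \<rho>" using V(2) corner_in_ngon[OF n, of k] that(2) d W(2) \<rho>(1)
      by (auto simp: pt_def)
    moreover have "corner n k \<in> closure (interior (ngon n))"
      using convex_closure_interior[OF convex_ngon[OF n]] interior_ngon_nonempty[OF n] corner_in_ngon[OF n, of k]
        closure_subset[of "ngon n"] by auto
    ultimately obtain y where y: "y \<in> interior (ngon n)" "y \<in> V" "y \<in> ball (corner n k) \<rho>"
      using closure_iff_nhds_not_empty[of "corner n k" "interior (ngon n)"] open_Int[OF V(1) open_ball[of "corner n k" \<rho>]]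
      by blast
    then have "y \<in> ngon n" using interior_subset by blast
    then have "\<phi> f y \<in> W" using V(2) y by blast
    moreover have "\<phi> f y \<noteq> p" using interior_image(2)[OF d(2) y(1)] p_top by auto
    moreover have "\<phi> f y \<in> sector \<rho> d" using y \<open>y \<in> ngon n\<close> by (auto simp: sector_def d)
    ultimately show ?thesis by blast
  qed
  obtain d1 where d1: "d1 \<in> G'" using G' by auto
  have "sector \<rho> d0 \<inter> (W - {p}) \<noteq> {}" "sector \<rho> d1 \<inter> (W - {p}) \<noteq> {}"
    using meets[of d0] meets[of d1] d0 d1 G(1) by (auto simp: G'_def)
  moreover have "sector \<rho> d0 \<subseteq> X" "sector \<rho> d1 \<subseteq> X'" using d0 d1 by (auto simp: X_def X'_def)
  ultimately have "X \<inter> (W - {p}) \<noteq> {}" "X' \<inter> (W - {p}) \<noteq> {}" by auto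
  moreover have "W - {p} \<subseteq> X \<union> X'" "X \<inter> X' \<inter> (W - {p}) = {}" using cover disj by auto
  ultimately have "\<exists>E1 E2. closedin P E1 \<and> closedin P E2 \<and> W - {p} \<subseteq> E1 \<union> E2 \<and>
      E1 \<inter> E2 \<inter> (W - {p}) = {} \<and> E1 \<inter> (W - {p}) \<noteq> {} \<and> E2 \<inter> (W - {p}) \<noteq> {}"
    using \<open>closedin P X\<close> \<open>closedin P X'\<close> by (intro exI[of _ X] exI[of _ X'] conjI)
  then show False using connectedin_closedin[THEN iffD1, OF W(4), THEN conjunct2] by (rule notE[rotated])
qed

lemma funpow_nxt: assumes "k < n" shows "(nxt ^^ i) (f, k) = (f, (k + i) mod n)"
  using assms by (induction i) (auto simp: nxt_def mod_Suc_eq)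

sublocale dart: dart_complex D A nxt prv opp E pt n
proof
  show "finite D" using finite_F by (simp add: D_def)
  show "(nxt ^^ n) d = d" if "d \<in> D" for d
    using that funpow_nxt by (auto simp: D_def)
  show "(nxt ^^ i) d \<noteq> d" if "d \<in> D" "0 < i" "i < n" for d i
    using that funpow_nxt nat_mod_neq[of "snd d" "snd d + i" n] by (auto simp: D_def)
  show "2 \<le> n" using n by simp
  show "E d = E d' \<longleftrightarrow> d' = d \<or> d' = opp d" if "d \<in> A" "d' \<in> A" for d d'
    using opp_eqI[of d d'] opp[OF that(1)] that by metis
  show "\<exists>d'\<in>D. pt d' = pt d \<and> (d' \<notin> A \<or> prv d' \<notin> A)" if "d \<in> D" for d
  proof -
    have "pt d \<in> M" using that corner_M by (auto simp: D_def pt_def)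
    then show ?thesis using fan_boundary'[of "pt d"] by metis
  qed
  show "G = {d \<in> D. pt d = p}" if "G \<subseteq> {d \<in> D. pt d = p}" "G \<noteq> {}"
    "\<And>d. d \<in> A \<Longrightarrow> pt d = p \<Longrightarrow> (d \<in> G) = (nxt (opp d) \<in> G)" for G p
    using fan_connected' that by blast
qed (use A_D nxt_D prv_nxt nxt_prv opp opp_opp pt_rot in auto)

lemma M_points: "M = pt ` D"
proof
  show "M \<subseteq> pt ` D" using fan_boundary' by blast
qed (use corner_M in \<open>auto simp: D_def pt_def\<close>)

lemma marked_points: "marked_on_arcs M T = pt ` dart.S"
proof -
  have side: "p \<in> pt ` {d \<in> D. d \<in> A \<or> prv d \<in> A}" if p: "p \<in> M" "\<tau> \<in> T" "p \<in> \<tau>" for p \<tau>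
  proof -
    have "\<tau> \<in> E ` A" using p(2) by (simp only: E_image)
    then obtain f k where fk: "(f, k) \<in> A" "\<tau> = E (f, k)" by (elim imageE) (metis surj_pair)
    then obtain z where z: "z \<in> side n k" "p = \<phi> f z" using p(3) by (auto simp: E_def)
    have "z \<notin> open_side n k" using arc_side(3)[OF fk(1)] z p(1) by auto
    then consider "p = pt (f, k)" | "p = pt (nxt (f, k))"
      using z n by (auto simp: side_split[OF n] pt_def nxt_def corner_mod)
    then show ?thesis using fk(1) A_D nxt_D(1) prv_nxt by cases (auto intro!: imageI)
  qed
  have "pt d \<in> \<Union>T" if d: "d \<in> A" for d
  proof (rule UnionI)
    show "E d \<in> T" using d by (simp add: A_def)
    show "pt d \<in> E d" using corner_in_side(1)[OF n] by (auto simp: E_def pt_def split: prod.splits)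
  qed
  moreover have "dart.S \<subseteq> A" using dart.S_starts(3) by auto
  ultimately have "pt ` dart.S \<subseteq> M \<inter> \<Union>T" using M_points A_D by blast
  then show ?thesis unfolding marked_on_arcs_def using side dart.pt_S by blast
qed

end

section \<open>Boundaries of regions of an angulated surface\<close>

context angulated
begin

text \<open>On the polygon without its arc sides nothing is identified; there
  \<open>\<phi> f\<close> can serve as a chart.\<close>

definition W :: "'f \<Rightarrow> complex set" where
  "W f = ngon n - (\<Union>k\<in>{k. (f, k) \<in> A}. side n k)"

lemma W_ngon: "W f \<subseteq> ngon n" by (auto simp: W_def)

lemma interior_W: "interior (ngon n) \<subseteq> W f"
  using open_side_boundary[OF n] interior_subset[of "ngon n"] by (auto simp: W_def A_iff)

lemma open_side_W: assumes "k < n" "(f, k) \<notin> A" shows "open_side n k \<subseteq> W f"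
proof
  fix z assume z: "z \<in> open_side n k"
  have "z \<notin> side n j" if "(f, j) \<in> A" for j
    using open_side_disjoint[OF n, of k j] assms that z by (auto simp: A_iff)
  then show "z \<in> W f" using z open_side_subset[OF n, of k] side_subset[OF n, of k] by (auto simp: W_def)
qed

lemma W_side: "z \<in> W f \<Longrightarrow> z \<in> side n k \<Longrightarrow> (f, k) \<notin> A"
  by (auto simp: W_def)

lemma W_corner: assumes "(f, k) \<in> D"
  shows "corner n k \<in> W f \<longleftrightarrow> (f, k) \<notin> A \<and> prv (f, k) \<notin> A"
proof
  have k: "k < n" using assms by (simp add: D_iff)
  have k': "corner n k \<in> side n ((k + n - 1) mod n)"
    using corner_in_side(2)[OF n, of "(k + n - 1) mod n"] Suc_prv[OF k] corner_mod[of n "Suc ((k + n - 1) mod n)"] n by simp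
  show "(f, k) \<notin> A \<and> prv (f, k) \<notin> A" if "corner n k \<in> W f"
    using W_side[OF that corner_in_side(1)[OF n]] W_side[OF that k'] by (simp add: prv_def)
  show "corner n k \<in> W f" if na: "(f, k) \<notin> A \<and> prv (f, k) \<notin> A"
  proof -
    have "corner n k \<notin> side n j" if j: "(f, j) \<in> A" for j
    proof
      assume "corner n k \<in> side n j"
      then have "k = j \<or> k = Suc j mod n" using corner_side_iff[OF n k, of j] j by (simp add: A_iff)
      then have "(f, j) = (f, k) \<or> (f, j) = prv (f, k)" using prv_Suc[of j] j by (auto simp: prv_def A_iff)
      then show False using na j by auto
    qed
    then show ?thesis using corner_in_ngon[OF n] by (auto simp: W_def)
  qed
qed

text \<open>The delicate case is that of a corner: if it lies in \<open>W f\<close>, it is between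
  two non-arcs and forms its whole fan by \<open>trivial_fan\<close>.\<close>

lemma W_inj:
  assumes f: "f \<in> F" "g \<in> F" and y: "y \<in> W f" and z: "z \<in> ngon n" and eq: "\<phi> f y = \<phi> g z"
  shows "f = g \<and> y = z"
proof -
  have "y \<in> ngon n" using y W_ngon by blast
  then show ?thesis
  proof (cases rule: ngon_cases[OF n, consumes 1])
    case 1 then show ?thesis using interior_inj[OF f _ z eq] by simp
  next
    case (2 k)
    then have "(f, k) \<notin> A" "(f, k) \<in> D" using W_side[OF y, of k] open_side_subset[OF n] f by (auto simp: D_iff)
    then show ?thesis using open_side_cases[OF _ 2(2) f(2) z eq] by (metis Pair_inject)
  next
    case (3 k)
    obtain l where l: "l < n" "z = corner n l" using corner_cases'[OF f(1,2) z, of k] eq 3 by auto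
    have D: "(f, k) \<in> D" "(g, l) \<in> D" using f 3 l by (auto simp: D_iff)
    have "(g, l) = (f, k)"
      using dart.trivial_fan[OF D(1) _ _ D(2)] W_corner[OF D(1)] y 3 eq l by (simp add: pt_def)
    then show ?thesis using 3 l by simp
  qed
qed

lemma W_not_arc: assumes "f \<in> F" "y \<in> W f" shows "\<phi> f y \<notin> \<Union>T"
proof
  assume "\<phi> f y \<in> \<Union>T"
  then obtain \<tau> where t: "\<tau> \<in> T" "\<phi> f y \<in> \<tau>" by (rule UnionE)
  then have "\<tau> \<in> E ` A" by (simp only: E_image)
  then obtain g k where gk: "(g, k) \<in> A" "\<tau> = E (g, k)" by (elim imageE) (metis surj_pair)
  then obtain z where z: "z \<in> side n k" "\<phi> f y = \<phi> g z" using t(2) by (auto simp: E_def)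
  have "g \<in> F" using gk by (simp add: A_iff)
  then have "f = g \<and> y = z" using W_inj[OF assms(1) _ assms(2) _ z(2)] z(1) side_subset[OF n] by blast
  then show False using W_side[OF assms(2)] z gk by auto
qed

lemma not_W_arc: assumes "f \<in> F" "y \<in> ngon n" "y \<notin> W f" shows "\<phi> f y \<in> \<Union>T"
proof -
  obtain k where "(f, k) \<in> A" "y \<in> side n k" using assms by (auto simp: W_def)
  then show ?thesis by (auto simp: A_iff intro!: UnionI[of "\<phi> f ` side n k"])
qed

end

text \<open>The region is obtained from the polygons by restricting them to the sets \<open>K f\<close>, which contain
  a neighbourhood of the arcs.\<close>
locale region = angulated +
  fixes K :: "'b \<Rightarrow> complex set"
  assumes compact_K: "\<And>f. f \<in> F \<Longrightarrow> compact (K f)" and K_ngon: "\<And>f. f \<in> F \<Longrightarrow> K f \<subseteq> ngon n"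
    and arcs_K: "\<And>f k. (f, k) \<in> A \<Longrightarrow> side n k \<subseteq> K f"
    and arcs_apart: "\<And>f k. (f, k) \<in> A \<Longrightarrow> side n k \<inter> closure (ngon n - K f) = {}"
begin

definition Y :: "'a set" where "Y = (\<Union>f\<in>F. \<phi> f ` K f)"
definition X :: "'a topology" where "X = subtopology P Y"

lemma Y_subset: "Y \<subseteq> topspace P"
  unfolding Y_def covered using K_ngon by blast

lemma topspace_X: "topspace X = Y" using Y_subset by (auto simp: X_def)

text \<open>The removed parts lie in the sets \<open>W f\<close>, where no point is identified with
  another one; so removing them amounts to keeping the sets \<open>K f\<close>. This form matches
  the definition of \<open>cut_surface\<close>.\<close>

lemma Y_complement: "Y = topspace P - (\<Union>f\<in>F. \<phi> f ` (ngon n - K f))"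
proof (intro equalityI subsetI DiffI)
  fix x assume x: "x \<in> Y"
  then show "x \<in> topspace P" using Y_subset by auto
  show "x \<notin> (\<Union>f\<in>F. \<phi> f ` (ngon n - K f))"
  proof
    assume "x \<in> (\<Union>f\<in>F. \<phi> f ` (ngon n - K f))"
    then obtain f y where f: "f \<in> F" "y \<in> ngon n" "y \<notin> K f" "x = \<phi> f y" by blast
    obtain g z where g: "g \<in> F" "z \<in> K g" "x = \<phi> g z" using x by (auto simp: Y_def)
    have "y \<in> W f" using f arcs_K by (auto simp: W_def)
    then have "f = g \<and> y = z" using W_inj[OF f(1) g(1), of y z] K_ngon[OF g(1)] g f by auto
    then show False using f g by auto
  qed
next
  fix x assume x: "x \<in> topspace P - (\<Union>f\<in>F. \<phi> f ` (ngon n - K f))"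
  then obtain f y where f: "f \<in> F" "y \<in> ngon n" "x = \<phi> f y" unfolding covered by blast
  then have "y \<in> K f" using x by blast
  then show "x \<in> Y" using f by (auto simp: Y_def)
qed

lemma closed_K_image: "f \<in> F \<Longrightarrow> compact C \<Longrightarrow> C \<subseteq> K f \<Longrightarrow> closedin X (\<phi> f ` C)"
proof -
  assume f: "f \<in> F" "compact C" "C \<subseteq> K f"
  have "closedin P (\<phi> f ` C)" using closedin_image[of f C] f K_ngon by blast
  moreover have "\<phi> f ` C \<subseteq> Y" using f by (auto simp: Y_def)
  ultimately show ?thesis unfolding X_def by (rule closedin_subset_topspace)
qed

text \<open>The complement in the region is a finite union of compact images: what is kept of the
  other polygons, and the arc sides of \<open>f\<close>.\<close>

lemma open_polygon: assumes f: "f \<in> F" shows "openin X (\<phi> f ` (K f \<inter> W f))"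
proof -
  let ?C = "(\<Union>g\<in>F - {f}. \<phi> g ` K g) \<union> (\<Union>k\<in>{k. (f, k) \<in> A}. \<phi> f ` side n k)"
  have "{k. (f, k) \<in> A} \<subseteq> {..<n}" by (auto simp: A_iff)
  then have fin: "finite {k. (f, k) \<in> A}" using finite_subset by blast
  have "closedin X ?C"
  proof (intro closedin_Un closedin_Union)
    show "closedin X C" if "C \<in> (\<lambda>g. \<phi> g ` K g) ` (F - {f})" for C
      using that closed_K_image compact_K by auto
    show "closedin X C" if "C \<in> (\<lambda>k. \<phi> f ` side n k) ` {k. (f, k) \<in> A}" for C
      using that closed_K_image[OF f] arcs_K by (auto simp: side_def)
  qed (use fin finite_F in auto)
  then have "openin X (topspace X - ?C)" by (simp add: closedin_def)
  moreover have "topspace X - ?C = \<phi> f ` (K f \<inter> W f)"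
  proof (intro equalityI subsetI)
    fix x assume x: "x \<in> topspace X - ?C"
    then obtain g y where g: "g \<in> F" "y \<in> K g" "x = \<phi> g y" by (auto simp: topspace_X Y_def)
    then have "g = f" using x by auto
    moreover have "y \<in> W f" using x g K_ngon[OF f] \<open>g = f\<close> by (auto simp: W_def)
    ultimately show "x \<in> \<phi> f ` (K f \<inter> W f)" using g by auto
  next
    fix x assume "x \<in> \<phi> f ` (K f \<inter> W f)"
    then obtain y where y: "y \<in> K f" "y \<in> W f" "x = \<phi> f y" by auto
    have "x \<notin> \<phi> g ` K g" if g: "g \<in> F - {f}" for g
    proof
      assume "x \<in> \<phi> g ` K g"
      then obtain z where "x = \<phi> g z" "z \<in> K g" by (rule imageE)
      moreover from this have "z \<in> ngon n" using K_ngon[of g] g by auto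
      ultimately have "f = g \<and> y = z" using g y(3) by (intro W_inj[OF f _ y(2)]) auto
      then show False using g by simp
    qed
    moreover have "x \<notin> \<phi> f ` side n k" if k: "(f, k) \<in> A" for k
    proof
      assume "x \<in> \<phi> f ` side n k"
      then obtain z where z: "x = \<phi> f z" "z \<in> side n k" by (rule imageE)
      then have "y = z" using W_inj[OF f f y(2) subsetD[OF side_subset[OF n]] trans[OF y(3)[symmetric] z(1)]] by simp
      then show False using W_side[OF y(2), of k] z(2) k by simp
    qed
    ultimately show "x \<in> topspace X - ?C" using y f by (auto simp: topspace_X Y_def)
  qed
  ultimately show ?thesis by simp
qed

text \<open>The map is closed: compact parts of \<open>K f\<close> have closed images, and
  \<open>W_inj\<close> ensures that intersecting with the image of \<open>W f\<close> adds no
  further points.\<close>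

lemma homeomorphic_polygon: assumes f: "f \<in> F"
  shows "homeomorphic_map (top_of_set (K f \<inter> W f)) (subtopology X (\<phi> f ` (K f \<inter> W f))) (\<phi> f)"
proof (rule bijective_closed_imp_homeomorphic_map)
  let ?O = "\<phi> f ` (K f \<inter> W f)"
  have KW: "K f \<inter> W f \<subseteq> ngon n" using K_ngon[OF f] by blast
  have OY: "?O \<subseteq> Y" using f by (auto simp: Y_def)
  have "continuous_map (subtopology (top_of_set (ngon n)) (K f \<inter> W f)) P (\<phi> f)"
    using cont[OF f] by (rule continuous_map_from_subtopology)
  then have "continuous_map (top_of_set (K f \<inter> W f)) P (\<phi> f)"
    using KW by (simp add: subtopology_subtopology inf_absorb2)
  then show "continuous_map (top_of_set (K f \<inter> W f)) (subtopology X ?O) (\<phi> f)"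
    using OY by (auto simp: X_def continuous_map_in_subtopology)
  show "closed_map (top_of_set (K f \<inter> W f)) (subtopology X ?O) (\<phi> f)"
    unfolding closed_map_def
  proof (intro allI impI)
    fix U assume "closedin (top_of_set (K f \<inter> W f)) U"
    then obtain C where C: "closed C" "U = K f \<inter> W f \<inter> C" by (auto simp: closedin_closed)
    have "closedin X (\<phi> f ` (K f \<inter> C))"
      using closed_K_image[OF f] compact_Int_closed[OF compact_K[OF f] C(1)] by blast
    moreover have "\<phi> f ` U = \<phi> f ` (K f \<inter> C) \<inter> ?O"
    proof (intro equalityI subsetI)
      fix x assume "x \<in> \<phi> f ` (K f \<inter> C) \<inter> ?O"
      then obtain y z where y: "y \<in> K f \<inter> W f" "x = \<phi> f y" and z: "z \<in> K f \<inter> C" "x = \<phi> f z" by auto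
      then have "y = z" using W_inj[OF f f, of y z] K_ngon[OF f] by auto
      then show "x \<in> \<phi> f ` U" using y z C by auto
    qed (use C in auto)
    ultimately show "closedin (subtopology X ?O) (\<phi> f ` U)" by (auto simp: closedin_subtopology)
  qed
  show "\<phi> f ` topspace (top_of_set (K f \<inter> W f)) = topspace (subtopology X ?O)"
    using OY by (auto simp: topspace_X)
  show "inj_on (\<phi> f) (topspace (top_of_set (K f \<inter> W f)))"
    using W_inj[OF f f] KW by (auto simp: inj_on_def)
qed

lemma boundary_polygon: assumes f: "f \<in> F" and y: "y \<in> K f" "y \<in> W f"
  shows "\<phi> f y \<in> surface_boundary X \<longleftrightarrow> y \<notin> interior (K f)"
proof -
  have "interior (K f) \<subseteq> W f" using interior_mono[OF K_ngon[OF f]] interior_W by blast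
  then have "interior (K f \<inter> W f) = interior (K f)"
    using interior_maximal[OF _ open_interior, of "K f" "W f"] by (auto simp: interior_Int)
  then show ?thesis using chart_boundary_iff[OF open_polygon[OF f] homeomorphic_polygon[OF f], of y] y by simp
qed

text \<open>By \<open>arcs_apart\<close> a point on an arc has a neighbourhood in \<open>P\<close>
  that belongs to the region, so being a boundary point means the same in \<open>X\<close> and in
  \<open>P\<close>.\<close>

lemma boundary_arc: assumes x: "x \<in> \<Union>T" shows "x \<in> Y" "x \<in> surface_boundary X \<longleftrightarrow> x \<in> M"
proof -
  obtain \<tau> where t: "\<tau> \<in> T" "x \<in> \<tau>" using x by (rule UnionE)
  then have "\<tau> \<in> E ` A" by (simp only: E_image)
  then obtain f k where fk: "(f, k) \<in> A" "\<tau> = E (f, k)" by (elim imageE) (metis surj_pair)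
  then obtain y where y: "y \<in> side n k" "x = \<phi> f y" using t(2) by (auto simp: E_def)
  have f: "f \<in> F" using fk by (simp add: A_iff)
  show xY: "x \<in> Y" using y arcs_K[OF fk(1)] f by (auto simp: Y_def)
  let ?C = "\<Union>g\<in>F. \<phi> g ` closure (ngon n - K g)"
  have cl: "closure (ngon n - K g) \<subseteq> ngon n" for g
    by (intro closure_minimal compact_imp_closed[OF compact_ngon[OF n]]) auto
  have comp: "compact (closure (ngon n - K g))" for g
    using compact_Int_closed[OF compact_ngon[OF n] closed_closure, of "ngon n - K g"] cl[of g] by (simp add: Int_absorb1)
  have "closedin P ?C" using finite_F closedin_image[OF _ comp cl] by (intro closedin_Union) auto
  then have op: "openin P (topspace P - ?C)" by (simp add: closedin_def)
  have "topspace P - ?C \<subseteq> Y"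
  proof
    fix z assume z: "z \<in> topspace P - ?C"
    have "z \<notin> \<phi> g ` (ngon n - K g)" if "g \<in> F" for g using z that closure_subset[of "ngon n - K g"] by blast
    then show "z \<in> Y" unfolding Y_complement using z by auto
  qed
  moreover have "x \<in> topspace P - ?C"
  proof
    show "x \<in> topspace P" using xY Y_subset by auto
    show "x \<notin> ?C"
    proof
      assume "x \<in> ?C"
      then obtain g z where g: "g \<in> F" "z \<in> closure (ngon n - K g)" "x = \<phi> g z" by auto
      have "z \<notin> W g" using W_not_arc[OF g(1), of z] x g(3) by auto
      then obtain l where "(g, l) \<in> A" "z \<in> side n l" using cl[of g] g(2) by (auto simp: W_def)
      then show False using arcs_apart[of g l] g(2) by auto
    qed
  qed
  ultimately have "x \<in> surface_boundary X \<longleftrightarrow> x \<in> surface_boundary P"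
    unfolding X_def by (intro boundary_local[OF op])
  then show "x \<in> surface_boundary X \<longleftrightarrow> x \<in> M" using arc_boundary(2)[OF t(1)] t(2) M_boundary by auto
qed

lemma surface_boundary_X:
  "surface_boundary X = marked_on_arcs M T \<union> (\<Union>f\<in>F. \<phi> f ` (K f \<inter> W f - interior (K f)))"
proof (intro equalityI subsetI)
  fix x assume x: "x \<in> surface_boundary X"
  then have "x \<in> Y" using topspace_X by (auto simp: surface_boundary_def)
  then obtain f y where f: "f \<in> F" "y \<in> K f" "x = \<phi> f y" by (auto simp: Y_def)
  show "x \<in> marked_on_arcs M T \<union> (\<Union>f\<in>F. \<phi> f ` (K f \<inter> W f - interior (K f)))"
  proof (cases "y \<in> W f")
    case True
    then have "y \<notin> interior (K f)" using boundary_polygon[OF f(1,2)] x f(3) by simp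
    then show ?thesis using f True by blast
  next
    case False
    have "y \<in> ngon n" using K_ngon[OF f(1)] f(2) by (rule subsetD)
    then have "x \<in> \<Union>T" using not_W_arc[OF f(1) _ False] f(3) by simp
    then show ?thesis using boundary_arc(2) x by (simp add: marked_on_arcs_def)
  qed
next
  fix x assume "x \<in> marked_on_arcs M T \<union> (\<Union>f\<in>F. \<phi> f ` (K f \<inter> W f - interior (K f)))"
  then consider "x \<in> M" "x \<in> \<Union>T" | f y where "f \<in> F" "y \<in> K f" "y \<in> W f" "y \<notin> interior (K f)" "x = \<phi> f y"
    by (auto simp: marked_on_arcs_def)
  then show "x \<in> surface_boundary X"
  proof cases
    case 1 then show ?thesis using boundary_arc(2) by simp
  next
    case 2 then show ?thesis using boundary_polygon by simp
  qed
qed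

end

text \<open>\<open>B s\<close> is the part of the frontier of \<open>K (fst s)\<close> that belongs to the run of arcs starting
  at \<open>s\<close>: the gap following this run, or the new boundary of the part cut off around it.\<close>
locale region_pieces = region +
  fixes B :: "'b \<times> nat \<Rightarrow> complex set"
  assumes compact_B: "s \<in> dart.S \<Longrightarrow> compact (B s)" and B_K: "s \<in> dart.S \<Longrightarrow> B s \<subseteq> K (fst s)"
    and connected_B: "s \<in> dart.S \<Longrightarrow> connected (B s \<inter> W (fst s))"
    and B_ne: "s \<in> dart.S \<Longrightarrow> B s \<inter> W (fst s) \<noteq> {}"
    and B_closure: "s \<in> dart.S \<Longrightarrow> B s \<subseteq> closure (B s \<inter> W (fst s))"
    and B_ends: "s \<in> dart.S \<Longrightarrow> \<phi> (fst s) ` (B s - W (fst s)) \<subseteq> pt ` dart.S"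
    and B_cover: "f \<in> F \<Longrightarrow> K f \<inter> W f - interior (K f) = (\<Union>s\<in>{s \<in> dart.S. fst s = f}. B s \<inter> W f)"
    and B_disjoint: "s \<in> dart.S \<Longrightarrow> t \<in> dart.S \<Longrightarrow> fst s = fst t \<Longrightarrow> s \<noteq> t \<Longrightarrow> B s \<inter> B t \<inter> W (fst s) = {}"
begin

definition piece :: "'b \<times> nat \<Rightarrow> 'a set" where "piece s = \<phi> (fst s) ` B s"

lemma S_F: "s \<in> dart.S \<Longrightarrow> fst s \<in> F"
  using dart.S_starts(5)[of s] by (cases s) (auto simp: D_def)

lemma piece_minus: assumes s: "s \<in> dart.S"
  shows "piece s - pt ` dart.S = \<phi> (fst s) ` (B s \<inter> W (fst s))"
proof -
  have "\<phi> (fst s) y \<notin> pt ` dart.S" if "y \<in> W (fst s)" for y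
    using W_not_arc[OF S_F[OF s] that] marked_points by (auto simp: marked_on_arcs_def)
  moreover have "y \<in> W (fst s)" if "y \<in> B s" "\<phi> (fst s) y \<notin> pt ` dart.S" for y
    using that subsetD[OF B_ends[OF s] imageI, of y] by auto
  ultimately show ?thesis unfolding piece_def by auto
qed

lemma piece_minus_ne: "s \<in> dart.S \<Longrightarrow> piece s - pt ` dart.S \<noteq> {}"
  using piece_minus B_ne by simp

lemma closedin_piece: "s \<in> dart.S \<Longrightarrow> closedin X (piece s)"
  unfolding piece_def using closed_K_image S_F compact_B B_K by blast

lemma piece_disjoint: assumes s: "s \<in> dart.S" "t \<in> dart.S" "s \<noteq> t" shows "piece s \<inter> piece t \<subseteq> pt ` dart.S"
proof
  fix x assume x: "x \<in> piece s \<inter> piece t"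
  show "x \<in> pt ` dart.S"
  proof (rule ccontr)
    assume "x \<notin> pt ` dart.S"
    then have "x \<in> piece s - pt ` dart.S" "x \<in> piece t - pt ` dart.S" using x by auto
    then obtain y z where y: "y \<in> B s" "y \<in> W (fst s)" "x = \<phi> (fst s) y" and z: "z \<in> B t" "z \<in> W (fst t)" "x = \<phi> (fst t) z"
      unfolding piece_minus[OF s(1)] piece_minus[OF s(2)] by auto
    have "fst s = fst t \<and> y = z" using W_inj[OF S_F[OF s(1)] S_F[OF s(2)] y(2), of z] z y W_ngon by auto
    then show False using B_disjoint[OF s(1,2)] s(3) y z by auto
  qed
qed

lemma inj_piece: "inj_on piece dart.S"
proof
  fix s t assume s: "s \<in> dart.S" "t \<in> dart.S" "piece s = piece t"
  show "s = t"
  proof (rule ccontr)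
    assume "s \<noteq> t"
    then show False using piece_disjoint[OF s(1,2)] s(3) piece_minus_ne[OF s(1)] by auto
  qed
qed

lemma boundary_minus: "surface_boundary X - pt ` dart.S = (\<Union>s\<in>dart.S. piece s - pt ` dart.S)"
proof -
  have eq: "(\<Union>f\<in>F. \<phi> f ` (K f \<inter> W f - interior (K f))) = (\<Union>s\<in>dart.S. piece s - pt ` dart.S)"
  proof (intro equalityI subsetI)
    fix x assume "x \<in> (\<Union>f\<in>F. \<phi> f ` (K f \<inter> W f - interior (K f)))"
    then obtain f y where "f \<in> F" "y \<in> K f \<inter> W f - interior (K f)" "x = \<phi> f y" by blast
    then obtain s where "s \<in> dart.S" "fst s = f" "y \<in> B s \<inter> W f" "x = \<phi> f y" unfolding B_cover[OF \<open>f \<in> F\<close>] by blast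
    then show "x \<in> (\<Union>s\<in>dart.S. piece s - pt ` dart.S)" using piece_minus by (intro UN_I[of s]) auto
  next
    fix x assume "x \<in> (\<Union>s\<in>dart.S. piece s - pt ` dart.S)"
    then obtain s where s: "s \<in> dart.S" "x \<in> piece s - pt ` dart.S" by blast
    then obtain y where y: "y \<in> B s \<inter> W (fst s)" "x = \<phi> (fst s) y" unfolding piece_minus[OF s(1)] by blast
    have "y \<in> K (fst s) \<inter> W (fst s) - interior (K (fst s))" unfolding B_cover[OF S_F[OF s(1)]] using s y by blast
    then show "x \<in> (\<Union>f\<in>F. \<phi> f ` (K f \<inter> W f - interior (K f)))" using y(2) S_F[OF s(1)] by blast
  qed
  show ?thesis unfolding surface_boundary_X eq marked_points by blast
qed

lemma boundary_X: assumes "pt ` dart.S \<subseteq> (\<Union>s\<in>dart.S. piece s)" shows "surface_boundary X = (\<Union>s\<in>dart.S. piece s)"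
proof -
  have "pt ` dart.S \<subseteq> surface_boundary X" unfolding surface_boundary_X marked_points by blast
  then have "surface_boundary X = (surface_boundary X - pt ` dart.S) \<union> pt ` dart.S" by auto
  also have "\<dots> = (\<Union>s\<in>dart.S. piece s - pt ` dart.S) \<union> pt ` dart.S" unfolding boundary_minus ..
  also have "\<dots> = (\<Union>s\<in>dart.S. piece s) \<union> pt ` dart.S" by auto
  also have "\<dots> = (\<Union>s\<in>dart.S. piece s)" using assms by auto
  finally show ?thesis .
qed

lemma components_minus:
  "connected_components_of (subtopology X (surface_boundary X - pt ` dart.S)) = (\<lambda>s. piece s - pt ` dart.S) ` dart.S"
proof (rule connected_components_finite_partition[OF dart.finite_S])
  fix s assume s: "s \<in> dart.S"
  have "connectedin (top_of_set (K (fst s) \<inter> W (fst s))) (B s \<inter> W (fst s))"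
    using connected_B[OF s] B_K[OF s] by (auto simp: connectedin_subtopology)
  moreover have "continuous_map (top_of_set (K (fst s) \<inter> W (fst s))) X (\<phi> (fst s))"
    using homeomorphic_imp_continuous_map[OF homeomorphic_polygon[OF S_F[OF s]]] by (simp add: continuous_map_in_subtopology)
  ultimately show "connectedin X (piece s - pt ` dart.S)"
    unfolding piece_minus[OF s] by (rule connectedin_continuous_map_image[rotated])
  show "closedin (subtopology X (surface_boundary X - pt ` dart.S)) (piece s - pt ` dart.S)"
    unfolding closedin_subtopology
  proof (intro exI conjI)
    show "closedin X (piece s)" by (rule closedin_piece[OF s])
    show "piece s - pt ` dart.S = piece s \<inter> (surface_boundary X - pt ` dart.S)"
      unfolding boundary_minus using s by blast
  qed
next
  show "(piece s - pt ` dart.S) \<inter> (piece t - pt ` dart.S) = {}" if "s \<in> dart.S" "t \<in> dart.S" "s \<noteq> t" for s t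
    using piece_disjoint[OF that] by blast
qed (use boundary_minus piece_minus_ne in auto)

text \<open>\<open>B_closure\<close> provides density inside the polygon, and the continuous map
  \<open>\<phi> (fst s)\<close> carries it over to the surface.\<close>

lemma closure_piece: assumes s: "s \<in> dart.S" shows "X closure_of (piece s - pt ` dart.S) = piece s"
proof
  show "X closure_of (piece s - pt ` dart.S) \<subseteq> piece s"
    by (rule closure_of_minimal[OF Diff_subset closedin_piece[OF s]])
  have f: "fst s \<in> F" by (rule S_F[OF s])
  have contX: "continuous_map (top_of_set (K (fst s))) X (\<phi> (fst s))"
  proof -
    have "continuous_map (subtopology (top_of_set (ngon n)) (K (fst s))) P (\<phi> (fst s))"
      using cont[OF f] by (rule continuous_map_from_subtopology)
    then have "continuous_map (top_of_set (K (fst s))) P (\<phi> (fst s))"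
      using K_ngon[OF f] by (simp add: subtopology_subtopology inf_absorb2)
    then show ?thesis using f by (auto simp: X_def Y_def continuous_map_in_subtopology)
  qed
  have "B s \<subseteq> top_of_set (K (fst s)) closure_of (B s \<inter> W (fst s))"
    using B_closure[OF s] B_K[OF s] by (auto simp: closure_of_subtopology Int_absorb1 le_infI1)
  then have "piece s \<subseteq> \<phi> (fst s) ` (top_of_set (K (fst s)) closure_of (B s \<inter> W (fst s)))"
    unfolding piece_def by (rule image_mono)
  also have "\<dots> \<subseteq> X closure_of (\<phi> (fst s) ` (B s \<inter> W (fst s)))"
    by (rule continuous_map_image_closure_subset[OF contX])
  finally show "piece s \<subseteq> X closure_of (piece s - pt ` dart.S)" unfolding piece_minus[OF s] .
qed

lemma boundary_pieces_X: assumes "marked_on_arcs M' T = pt ` dart.S"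
  shows "boundary_pieces X M' T = piece ` dart.S"
  unfolding boundary_pieces_def assms components_minus image_image using closure_piece by simp

end

section \<open>Boundary components\<close>

text \<open>In a polygon with several runs the gap after one run leads to the beginning of another,
  so this assumption may fail before the cuts. Afterwards each piece joins the end of a run to the
  beginning of the same run.\<close>

locale region_components = region_pieces +
  assumes B_end_points: "s \<in> dart.S \<Longrightarrow> \<phi> (fst s) ` (B s - W (fst s)) = {pt s, pt (nxt (dart.run_end s))}"
begin

lemma pt_piece: assumes "s \<in> dart.S" shows "pt s \<in> piece s" "pt (nxt (dart.run_end s)) \<in> piece s"
proof -
  have "{pt s, pt (nxt (dart.run_end s))} \<subseteq> piece s"
    unfolding piece_def B_end_points[OF assms, symmetric] by auto
  then show "pt s \<in> piece s" "pt (nxt (dart.run_end s)) \<in> piece s" by auto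
qed

lemma piece_Int: assumes s: "s \<in> dart.S" shows "piece s \<inter> pt ` dart.S \<subseteq> {pt s, pt (nxt (dart.run_end s))}"
proof
  fix x assume x: "x \<in> piece s \<inter> pt ` dart.S"
  then obtain y where y: "y \<in> B s" "x = \<phi> (fst s) y" by (auto simp: piece_def)
  have "y \<notin> W (fst s)"
  proof
    assume "y \<in> W (fst s)"
    then have "x \<in> piece s - pt ` dart.S" unfolding piece_minus[OF s] using y by auto
    then show False using x by auto
  qed
  then show "x \<in> {pt s, pt (nxt (dart.run_end s))}" unfolding B_end_points[OF s, symmetric] using y by auto
qed

text \<open>By \<open>pt_next_run\<close> the piece of \<open>next_run t\<close> has an end at
  \<open>pt t\<close>. Read backwards, the second end of the piece of \<open>s\<close> is the first
  end of the piece of its predecessor.\<close>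

lemma prev_run: assumes "s \<in> dart.S"
  obtains t where "t \<in> dart.S" "dart.run_orbit t = dart.run_orbit s" "pt (nxt (dart.run_end s)) = pt t"
proof -
  have "s \<in> dart.next_run ` dart.S" using dart.bij_next_run assms by (simp add: bij_betw_def)
  then obtain t where t: "s = dart.next_run t" "t \<in> dart.S" by (rule imageE)
  have "s \<in> dart.run_orbit t" unfolding dart.run_orbit_def t(1) by (rule range_eqI[of _ _ 1]) simp
  then have "dart.run_orbit s = dart.run_orbit t" by (rule dart.run_orbit_step[OF t(2)])
  moreover have "pt (nxt (dart.run_end s)) = pt t" unfolding t(1) by (rule dart.pt_next_run[OF t(2)])
  ultimately show thesis using that t(2) by simp
qed

lemma piece_point: assumes s: "s \<in> dart.S" and x: "x \<in> piece s" "x \<in> pt ` dart.S"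
  obtains t where "t \<in> dart.S" "dart.run_orbit t = dart.run_orbit s" "x = pt t"
proof -
  have "x = pt s \<or> x = pt (nxt (dart.run_end s))" using piece_Int[OF s] x by auto
  then show thesis
  proof
    assume "x = pt s" then show thesis using that s by simp
  next
    assume "x = pt (nxt (dart.run_end s))"
    then show thesis using prev_run[OF s] that by metis
  qed
qed

lemma connectedin_piece: "s \<in> dart.S \<Longrightarrow> connectedin X (piece s)"
proof -
  assume s: "s \<in> dart.S"
  have "piece s - pt ` dart.S \<in> connected_components_of (subtopology X (surface_boundary X - pt ` dart.S))"
    unfolding components_minus using s by simp
  then have "connectedin (subtopology X (surface_boundary X - pt ` dart.S)) (piece s - pt ` dart.S)"
    by (rule connectedin_connected_components_of)
  then have "connectedin X (piece s - pt ` dart.S)" by (simp add: connectedin_subtopology)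
  then have "connectedin X (X closure_of (piece s - pt ` dart.S))" by (rule connectedin_closure_of)
  then show "connectedin X (piece s)" by (simp add: closure_piece[OF s])
qed

definition circuit :: "('b \<times> nat) set \<Rightarrow> 'a set" where "circuit C = (\<Union>s\<in>C. piece s)"

text \<open>The pieces of \<open>t\<close> and of \<open>next_run t\<close> share the point
  \<open>pt t\<close>.\<close>

lemma connectedin_circuit: assumes s: "s \<in> dart.S" shows "connectedin X (circuit (dart.run_orbit s))"
proof -
  let ?f = "\<lambda>i. (dart.next_run ^^ i) s"
  have S: "?f i \<in> dart.S" for i using dart.funpow_next_run[OF s] .
  have conn: "connectedin X (\<Union>i<Suc m. piece (?f i))" for m
  proof (induction m)
    case 0 then show ?case using connectedin_piece[OF s] by simp
  next
    case (Suc m)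
    have "pt (?f m) \<in> piece (?f m)" by (rule pt_piece(1)[OF S])
    moreover have "pt (?f m) \<in> piece (?f (Suc m))"
      using pt_piece(2)[OF S[of "Suc m"]] dart.pt_next_run[OF S[of m]] by simp
    ultimately have "(\<Union>i<Suc m. piece (?f i)) \<inter> piece (?f (Suc m)) \<noteq> {}" by (auto simp: lessThan_Suc)
    then have "connectedin X ((\<Union>i<Suc m. piece (?f i)) \<union> piece (?f (Suc m)))"
      using Suc connectedin_piece[OF S] by (intro connectedin_Un)
    moreover have "(\<Union>i<Suc (Suc m). piece (?f i)) = (\<Union>i<Suc m. piece (?f i)) \<union> piece (?f (Suc m))"
      by (simp add: lessThan_Suc Un_commute)
    ultimately show ?case by simp
  qed
  note orb = permutation_orbit[OF dart.finite_S dart.bij_next_run s]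
  obtain p where p: "1 \<le> p" "bij_betw ?f {..<p} (dart.run_orbit s)"
    using orb(1,3) unfolding dart.run_orbit_def by blast
  obtain m where m: "p = Suc m" using p(1) by (cases p) auto
  have "dart.run_orbit s = ?f ` {..<Suc m}" using p(2) unfolding m by (simp add: bij_betw_def)
  then have "circuit (dart.run_orbit s) = (\<Union>i<Suc m. piece (?f i))" unfolding circuit_def by (simp only: image_image)
  then show ?thesis using conn[of m] by simp
qed

text \<open>Different pieces meet in marked points only. A marked point \<open>pt t\<close>
  determines the run \<open>t\<close> and with it an orbit, and both ends of a piece belong to the
  orbit of that piece.\<close>

lemma circuit_disjoint:
  assumes "C \<in> dart.run_orbit ` dart.S" "C' \<in> dart.run_orbit ` dart.S" "C \<noteq> C'" shows "circuit C \<inter> circuit C' = {}"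
proof (rule ccontr)
  assume "circuit C \<inter> circuit C' \<noteq> {}"
  then obtain x s t where s: "s \<in> C" "x \<in> piece s" and t: "t \<in> C'" "x \<in> piece t" by (auto simp: circuit_def)
  obtain s0 t0 where st0: "s0 \<in> dart.S" "C = dart.run_orbit s0" "t0 \<in> dart.S" "C' = dart.run_orbit t0" using assms(1,2) by auto
  have S: "s \<in> dart.S" "t \<in> dart.S"
    using dart.run_orbit_subset[OF st0(1)] dart.run_orbit_subset[OF st0(3)] st0 s t by auto
  have orb: "dart.run_orbit s = C" "dart.run_orbit t = C'"
    using dart.run_orbit_step[OF st0(1), of s] dart.run_orbit_step[OF st0(3), of t] st0 s t by simp_all
  then have "s \<noteq> t" using assms(3) by auto
  then have x: "x \<in> pt ` dart.S" using piece_disjoint[OF S] s t by auto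
  obtain s' where s': "s' \<in> dart.S" "dart.run_orbit s' = C" "x = pt s'" using piece_point[OF S(1) s(2) x] orb by metis
  obtain t' where t': "t' \<in> dart.S" "dart.run_orbit t' = C'" "x = pt t'" using piece_point[OF S(2) t(2) x] orb by metis
  have "s' = t'" using dart.inj_pt_S s' t' by (auto simp: inj_on_def)
  then show False using s' t' assms(3) by simp
qed

lemma boundary_components_X: "boundary_components X = circuit ` dart.run_orbit ` dart.S"
  unfolding boundary_components_def
proof (rule connected_components_finite_partition)
  show "finite (dart.run_orbit ` dart.S)" using dart.finite_S by simp
  show "connectedin X (circuit C)" if "C \<in> dart.run_orbit ` dart.S" for C
    using that connectedin_circuit by auto
  have eq: "surface_boundary X = (\<Union>s\<in>dart.S. piece s)" by (rule boundary_X) (use pt_piece(1) in auto)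
  show Y: "surface_boundary X = (\<Union>C\<in>dart.run_orbit ` dart.S. circuit C)"
    unfolding eq circuit_def using dart.run_orbit_self dart.run_orbit_subset by blast
  show "circuit C \<noteq> {}" if "C \<in> dart.run_orbit ` dart.S" for C
    using that dart.run_orbit_self pt_piece(1) by (force simp: circuit_def)
  show "closedin (subtopology X (surface_boundary X)) (circuit C)" if C: "C \<in> dart.run_orbit ` dart.S" for C
  proof (rule closedin_subset_topspace)
    have "C \<subseteq> dart.S" using C dart.run_orbit_subset by auto
    then show "closedin X (circuit C)" unfolding circuit_def
      using closedin_piece finite_subset[OF _ dart.finite_S] by (intro closedin_Union) auto
    show "circuit C \<subseteq> surface_boundary X" unfolding Y using C by blast
  qed
qed (rule circuit_disjoint)

lemma orbit_S: "C \<in> dart.run_orbit ` dart.S \<Longrightarrow> C \<subseteq> dart.S"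
  using dart.run_orbit_subset by auto

lemma inj_circuit: "inj_on circuit (dart.run_orbit ` dart.S)"
proof
  fix C C' assume C: "C \<in> dart.run_orbit ` dart.S" "C' \<in> dart.run_orbit ` dart.S" "circuit C = circuit C'"
  show "C = C'"
  proof (rule ccontr)
    assume "C \<noteq> C'"
    then have "circuit C = {}" using circuit_disjoint[OF C(1,2)] C(3) by auto
    moreover obtain s where "s \<in> dart.S" "s \<in> C" using C(1) dart.run_orbit_self by auto
    ultimately show False using pt_piece(1)[of s] by (auto simp: circuit_def)
  qed
qed

lemma card_circuit_points: assumes C: "C \<in> dart.run_orbit ` dart.S" shows "card (pt ` dart.S \<inter> circuit C) = card C"
proof -
  have "pt ` dart.S \<inter> circuit C = pt ` C"
  proof (intro equalityI subsetI)
    fix x assume x: "x \<in> pt ` dart.S \<inter> circuit C"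
    then obtain s where s: "s \<in> C" "x \<in> piece s" by (auto simp: circuit_def)
    have S: "s \<in> dart.S" using orbit_S[OF C] s by auto
    obtain t where t: "t \<in> dart.S" "dart.run_orbit t = dart.run_orbit s" "x = pt t" using piece_point[OF S s(2)] x by blast
    obtain s0 where s0: "s0 \<in> dart.S" "C = dart.run_orbit s0" using C by auto
    then have "dart.run_orbit s = C" using s dart.run_orbit_step[OF s0(1), of s] by simp
    then show "x \<in> pt ` C" using t dart.run_orbit_self[of t] by auto
  qed (use orbit_S[OF C] pt_piece(1) in \<open>auto simp: circuit_def\<close>)
  then show ?thesis using card_image[OF inj_on_subset[OF dart.inj_pt_S orbit_S[OF C]]] by simp
qed

lemma circuit_pieces: assumes C: "C \<in> dart.run_orbit ` dart.S" shows "{\<bb> \<in> piece ` dart.S. \<bb> \<subseteq> circuit C} = piece ` C"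
proof (intro equalityI subsetI)
  fix \<bb> assume "\<bb> \<in> {\<bb> \<in> piece ` dart.S. \<bb> \<subseteq> circuit C}"
  then obtain t where t: "t \<in> dart.S" "\<bb> = piece t" "piece t \<subseteq> circuit C" by auto
  obtain x where x: "x \<in> piece t - pt ` dart.S" using piece_minus_ne[OF t(1)] by auto
  then obtain s where s: "s \<in> C" "x \<in> piece s" using t(3) by (auto simp: circuit_def)
  then have "s = t" using piece_disjoint[of s t] t(1) x orbit_S[OF C] by auto
  then show "\<bb> \<in> piece ` C" using s t by auto
qed (use orbit_S[OF C] in \<open>auto simp: circuit_def\<close>)

text \<open>\<open>h\<close> stands for \<open>pair_indicator\<close> at a fixed argument, and
  \<open>g\<close> for the difference of \<open>m\<close> and the weight.\<close>

lemma sum_boundary_components: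
  fixes h :: "nat \<Rightarrow> int \<Rightarrow> nat" and g :: "'a set \<Rightarrow> int"
  assumes M': "marked_on_arcs M' T = pt ` dart.S"
  shows "(\<Sum>C\<in>boundary_components X. h (card (marked_on_arcs M' T \<inter> C)) (\<Sum>\<bb>\<in>{\<bb> \<in> boundary_pieces X M' T. \<bb> \<subseteq> C}. g \<bb>)) =
    (\<Sum>C\<in>dart.run_orbit ` dart.S. h (card C) (\<Sum>s\<in>C. g (piece s)))"
  unfolding boundary_components_X sum.reindex[OF inj_circuit] o_def M' boundary_pieces_X[OF M']
proof (rule sum.cong[OF refl])
  fix C assume C: "C \<in> dart.run_orbit ` dart.S"
  show "h (card (pt ` dart.S \<inter> circuit C)) (\<Sum>\<bb>\<in>{\<bb> \<in> piece ` dart.S. \<bb> \<subseteq> circuit C}. g \<bb>) = h (card C) (\<Sum>s\<in>C. g (piece s))"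
    unfolding card_circuit_points[OF C] circuit_pieces[OF C] sum.reindex[OF inj_on_subset[OF inj_piece orbit_S[OF C]]] o_def ..
qed

end

section \<open>Runs of boundary segments\<close>

text \<open>A connected set with more than one point has no isolated points.\<close>

lemma connected_dense_minus_finite:
  fixes C :: "'a::metric_space set"
  assumes "connected C" "finite F" "\<And>x. C \<noteq> {x}" shows "C \<subseteq> closure (C - F)"
proof
  fix x assume x: "x \<in> C"
  have "x islimpt C" using connected_imp_perfect[OF assms(1) x] assms(3) by blast
  moreover have "C \<subseteq> F \<union> (C - F)" by auto
  ultimately have "x islimpt F \<union> (C - F)" by (rule islimpt_subset)
  then have "x islimpt C - F" by (rule islimpt_Un_finite[OF assms(2), THEN iffD1])
  then show "x \<in> closure (C - F)" by (simp add: closure_def)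
qed

lemma connected_sides: assumes n: "3 \<le> n" shows "connected (\<Union>j\<in>{e..<e + q}. side n j)"
proof -
  have "connected (\<Union>i<q. side n (e + i))"
  proof (rule connected_Union_chain)
    show "side n (e + i) \<inter> side n (e + Suc i) \<noteq> {}" for i
      using corner_in_side(2)[OF n, of "e + i"] corner_in_side(1)[OF n, of "e + Suc i"] by auto
  qed (simp add: side_def)
  moreover have "{e..<e + q} = (+) e ` {..<q}"
    using image_add_atLeastLessThan[of e 0 q] by (simp add: lessThan_atLeast0 add.commute)
  ultimately show ?thesis by simp
qed

context angulated
begin

lemma nxt_pow: "(f, k) \<in> D \<Longrightarrow> (nxt ^^ i) (f, k) = (f, (k + i) mod n)"
  using funpow_nxt by (simp add: D_iff)

lemma run_facts: assumes s: "(f, k) \<in> dart.S"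
  shows "f \<in> F" "k < n" "0 < dart.N.len (f, k)" "dart.N.len (f, k) < n"
    "nxt (dart.run_end (f, k)) = (f, (k + dart.N.len (f, k)) mod n)"
    "i < dart.N.len (f, k) \<Longrightarrow> (f, (k + i) mod n) \<in> A"
    "(f, (k + dart.N.len (f, k)) mod n) \<in> D - A" "(f, (k + n - 1) mod n) \<in> D - A"
proof -
  note st = dart.S_starts[OF s]
  show fk: "f \<in> F" "k < n" using st(5) by (auto simp: D_iff)
  show "0 < dart.N.len (f, k)" by (rule dart.N_len_pos[OF s])
  show *: "(f, (k + i) mod n) \<in> A" if "i < dart.N.len (f, k)" for i
    using dart.N.len_stop(2)[OF st(1) that] nxt_pow[OF st(5)] by simp
  show "nxt (dart.run_end (f, k)) = (f, (k + dart.N.len (f, k)) mod n)"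
    using dart.run_end(3)[OF s] nxt_pow[OF st(5)] by (simp add: dart.N.stop_def)
  then show "(f, (k + dart.N.len (f, k)) mod n) \<in> D - A" using dart.nxt_run_end(2)[OF s] by simp
  show prv: "(f, (k + n - 1) mod n) \<in> D - A" using st(4) nxt_D(2)[OF st(5)] by (simp add: prv_def)
  show "dart.N.len (f, k) < n"
  proof (rule ccontr)
    assume "\<not> dart.N.len (f, k) < n"
    then have "(f, (k + (n - 1)) mod n) \<in> A" using n by (intro *) simp
    moreover have "k + (n - 1) = k + n - 1" using n by simp
    ultimately show False using prv by simp
  qed
qed

lemma arc_run_iff: assumes f: "f \<in> F"
  shows "arc_run n T \<phi> f k r \<longleftrightarrow> (f, k) \<in> dart.S \<and> r = dart.N.len (f, k)"
proof -
  have A: "\<phi> f ` side n j \<in> T \<longleftrightarrow> (f, j mod n) \<in> A" for j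
    using f n side_mod(1)[of n j] by (simp add: A_iff)
  show ?thesis
  proof
    assume r: "arc_run n T \<phi> f k r"
    then have k: "k < n" "0 < r" and arcs: "\<And>i. i \<in> {k..<k + r} \<Longrightarrow> (f, i mod n) \<in> A"
      and na: "(f, (k + n - 1) mod n) \<notin> A" "(f, (k + r) mod n) \<notin> A"
      by (auto simp: arc_run_def A)
    have D: "(f, k) \<in> D" using f k by (simp add: D_iff)
    have "(f, k) \<in> dart.S" unfolding dart.S_def using arcs[of k] k na(1) by (simp add: prv_def)
    moreover have "dart.N.len (f, k) = r"
    proof (rule dart.N.len_eqI)
      show "(nxt ^^ r) (f, k) \<notin> A" using na(2) nxt_pow[OF D] by simp
      show "(nxt ^^ j) (f, k) \<in> A" if "j < r" for j using arcs[of "k + j"] that nxt_pow[OF D] by simp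
    qed
    ultimately show "(f, k) \<in> dart.S \<and> r = dart.N.len (f, k)" by simp
  next
    assume s: "(f, k) \<in> dart.S \<and> r = dart.N.len (f, k)"
    note rf = run_facts[OF s[THEN conjunct1]]
    have "(f, i mod n) \<in> A" if "i \<in> {k..<k + r}" for i
    proof -
      have "(f, (k + (i - k)) mod n) \<in> A" by (rule rf(6)) (use that s in auto)
      then show ?thesis using that by simp
    qed
    then show "arc_run n T \<phi> f k r" unfolding arc_run_def A using rf s by auto
  qed
qed

text \<open>Not reduced modulo \<open>n\<close>, so that the sides of a gap have consecutive
  numbers.\<close>

definition gap_start :: "'f \<times> nat \<Rightarrow> nat" where "gap_start s = snd s + dart.N.len s"

definition gap_sides :: "'f \<times> nat \<Rightarrow> complex set" where
  "gap_sides s = (\<Union>j\<in>{gap_start s..<gap_start s + dart.gap s}. side n j)"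

lemma gap_facts: assumes s: "s \<in> dart.S"
  shows "(nxt ^^ i) (nxt (dart.run_end s)) = (fst s, (gap_start s + i) mod n)"
    "i < dart.gap s \<Longrightarrow> (fst s, (gap_start s + i) mod n) \<in> D - A"
    "(fst s, (gap_start s + dart.gap s) mod n) \<in> dart.S" "0 < dart.gap s" "dart.gap s < n"
    "(fst s, (gap_start s + n - 1) mod n) \<in> A" "prv (fst s, gap_start s mod n) \<in> A"
proof -
  obtain f k where fk: "s = (f, k)" by (cases s)
  have st: "nxt (dart.run_end s) = (f, gap_start s mod n)" using run_facts(5) s by (simp add: fk gap_start_def)
  have D: "(f, gap_start s mod n) \<in> D" using dart.nxt_run_end(2)[OF s] st by simp
  show pow: "(nxt ^^ i) (nxt (dart.run_end s)) = (fst s, (gap_start s + i) mod n)" for i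
    unfolding st nxt_pow[OF D] by (simp add: fk mod_add_left_eq)
  show in_gap: "(fst s, (gap_start s + i) mod n) \<in> D - A" if "i < dart.gap s" for i
    using dart.gap(2)[OF s that] pow by simp
  show "(fst s, (gap_start s + dart.gap s) mod n) \<in> dart.S" using dart.gap(3)[OF s] pow by simp
  show "0 < dart.gap s" by (rule dart.gap(1)[OF s])
  have "prv (f, gap_start s mod n) \<in> A" using dart.run_end(2)[OF s] prv_nxt dart.inD st[symmetric] by auto
  then show pA: "prv (fst s, gap_start s mod n) \<in> A" by (simp add: fk)
  have "(gap_start s mod n + n - 1) mod n = (gap_start s + n - 1) mod n"
  proof -
    have "gap_start s mod n + n - 1 = gap_start s mod n + (n - 1)" "gap_start s + n - 1 = gap_start s + (n - 1)" using n by auto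
    then show ?thesis by (simp add: mod_add_left_eq)
  qed
  then show A: "(fst s, (gap_start s + n - 1) mod n) \<in> A" using pA by (simp add: prv_def)
  show "dart.gap s < n"
  proof (rule ccontr)
    assume "\<not> dart.gap s < n"
    then have "(fst s, (gap_start s + (n - 1)) mod n) \<in> D - A" using n by (intro in_gap) simp
    moreover have "gap_start s + (n - 1) = gap_start s + n - 1" using n by simp
    ultimately show False using A by simp
  qed
qed

lemma corner_W: assumes "f \<in> F" shows "corner n k \<in> W f \<longleftrightarrow> (f, k mod n) \<notin> A \<and> prv (f, k mod n) \<notin> A"
  using W_corner[of f "k mod n"] assms n corner_mod[of n k] by (simp add: D_iff)

lemma gap_ends: assumes s: "s \<in> dart.S"
  shows "corner n (gap_start s) \<notin> W (fst s)" "corner n (gap_start s + dart.gap s) \<notin> W (fst s)"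
proof -
  have f: "fst s \<in> F" using gap_facts(3)[OF s] dart.S_starts(5) by (auto simp: D_iff)
  show "corner n (gap_start s) \<notin> W (fst s)" using corner_W[OF f] gap_facts(7)[OF s] by simp
  show "corner n (gap_start s + dart.gap s) \<notin> W (fst s)"
    using corner_W[OF f] dart.S_starts(3)[OF gap_facts(3)[OF s]] by simp
qed

lemma gap_sides_position: assumes s: "s \<in> dart.S" and y: "y \<in> gap_sides s"
    "y \<noteq> corner n (gap_start s + dart.gap s)"
  obtains i where "i < dart.gap s" "y = corner n (gap_start s + i) \<or> y \<in> open_side n (gap_start s + i)"
proof -
  obtain j where "j \<in> {gap_start s..<gap_start s + dart.gap s}" "y \<in> side n j" using y(1) unfolding gap_sides_def by blast
  then obtain i where i: "i < dart.gap s" "y \<in> side n (gap_start s + i)" by (metis atLeastLessThan_iff le_iff_add nat_add_left_cancel_less)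
  then consider "y = corner n (gap_start s + i)" | "y \<in> open_side n (gap_start s + i)" | "y = corner n (gap_start s + Suc i)"
    using side_split[OF n] by auto
  then show thesis
  proof cases
    case 3
    have "Suc i \<noteq> dart.gap s"
    proof
      assume e: "Suc i = dart.gap s"
      show False using y(2) 3 unfolding e by simp
    qed
    then show thesis using that[of "Suc i"] i 3 by auto
  qed (use that i in auto)
qed

lemma gap_sides_W: assumes s: "s \<in> dart.S"
  shows "gap_sides s \<inter> W (fst s) = gap_sides s - {corner n (gap_start s), corner n (gap_start s + dart.gap s)}"
proof (intro equalityI subsetI)
  fix y assume "y \<in> gap_sides s \<inter> W (fst s)"
  then show "y \<in> gap_sides s - {corner n (gap_start s), corner n (gap_start s + dart.gap s)}" using gap_ends[OF s] by auto
next
  fix y assume y: "y \<in> gap_sides s - {corner n (gap_start s), corner n (gap_start s + dart.gap s)}"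
  have f: "fst s \<in> F" using gap_facts(3)[OF s] dart.S_starts(5) by (auto simp: D_iff)
  obtain i where i: "i < dart.gap s" "y = corner n (gap_start s + i) \<or> y \<in> open_side n (gap_start s + i)"
    using gap_sides_position[OF s] y by blast
  from i(2) have "y \<in> W (fst s)"
  proof
    assume yc: "y = corner n (gap_start s + i)"
    then obtain i' where i': "i = Suc i'" using y by (cases i) auto
    have "prv (fst s, (gap_start s + i) mod n) = (fst s, (gap_start s + i') mod n)"
      using prv_nxt[of "(fst s, (gap_start s + i') mod n)"] gap_facts(2)[OF s, of i'] i i' by (simp add: nxt_def mod_Suc_eq)
    then show ?thesis unfolding yc corner_W[OF f] using gap_facts(2)[OF s, of i'] gap_facts(2)[OF s, of i] i i' by simp
  next
    assume "y \<in> open_side n (gap_start s + i)"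
    moreover have "open_side n ((gap_start s + i) mod n) \<subseteq> W (fst s)"
      using gap_facts(2)[OF s i(1)] n by (intro open_side_W) auto
    ultimately show ?thesis using side_mod(2)[of n "gap_start s + i"] n by auto
  qed
  then show "y \<in> gap_sides s \<inter> W (fst s)" using y by auto
qed

lemma gap_sides_disjoint: assumes s: "s \<in> dart.S" "t \<in> dart.S" "fst s = fst t" "s \<noteq> t"
  shows "gap_sides s \<inter> gap_sides t \<inter> W (fst s) = {}"
proof (rule ccontr)
  assume "gap_sides s \<inter> gap_sides t \<inter> W (fst s) \<noteq> {}"
  then obtain y where y: "y \<in> gap_sides s" "y \<in> gap_sides t" "y \<in> W (fst s)" by blast
  have "y \<noteq> corner n (gap_start s + dart.gap s)" "y \<noteq> corner n (gap_start t + dart.gap t)"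
    using y(3) gap_ends(2)[OF s(1)] gap_ends(2)[OF s(2)] s(3) by auto
  then obtain i j where i: "i < dart.gap s" "y = corner n (gap_start s + i) \<or> y \<in> open_side n (gap_start s + i)"
    and j: "j < dart.gap t" "y = corner n (gap_start t + j) \<or> y \<in> open_side n (gap_start t + j)"
    using gap_sides_position[OF s(1) y(1)] gap_sides_position[OF s(2) y(2)] by metis
  define a b where "a = (gap_start s + i) mod n" and "b = (gap_start t + j) mod n"
  have ab: "a < n" "b < n" using n by (auto simp: a_def b_def)
  have ya: "y = corner n a \<or> y \<in> open_side n a" and yb: "y = corner n b \<or> y \<in> open_side n b"
    using i(2) j(2) n by (auto simp: a_def b_def corner_mod side_mod)
  have "a = b"
  proof (rule ccontr)
    assume ne: "a \<noteq> b"
    then show False using ya yb corner_inj[OF n ab] corner_notin_open_side[OF n, of a b] corner_notin_open_side[OF n, of b a]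
        open_side_disjoint[OF n ab ne] open_side_subset[OF n, of b] by blast
  qed
  then have "(nxt ^^ i) (nxt (dart.run_end s)) = (nxt ^^ j) (nxt (dart.run_end t))"
    using gap_facts(1)[OF s(1)] gap_facts(1)[OF s(2)] s(3) by (simp add: a_def b_def)
  then show False using dart.gap_unique[OF s(1,2) i(1) j(1)] s(4) by simp
qed

lemma gap_sides_ends: assumes s: "s \<in> dart.S"
  shows "gap_sides s - W (fst s) = {corner n (gap_start s), corner n (gap_start s + dart.gap s)}"
proof -
  obtain q where q: "dart.gap s = Suc q" using gap_facts(4)[OF s] by (cases "dart.gap s") auto
  have "corner n (gap_start s) \<in> gap_sides s"
    unfolding gap_sides_def by (rule UN_I[of "gap_start s"]) (simp_all add: q corner_in_side(1)[OF n])
  moreover have "corner n (Suc (gap_start s + q)) \<in> gap_sides s"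
    unfolding gap_sides_def by (rule UN_I[of "gap_start s + q"]) (simp_all add: q corner_in_side(2)[OF n])
  moreover have "Suc (gap_start s + q) = gap_start s + dart.gap s" by (simp add: q)
  ultimately have "corner n (gap_start s) \<in> gap_sides s" "corner n (gap_start s + dart.gap s) \<in> gap_sides s" by simp_all
  then show ?thesis using gap_sides_W[OF s] gap_ends[OF s] by auto
qed

lemma gap_sides_props: assumes s: "s \<in> dart.S"
  shows "compact (gap_sides s)" "gap_sides s \<subseteq> ngon n" "connected (gap_sides s \<inter> W (fst s))"
    "gap_sides s \<inter> W (fst s) \<noteq> {}" "gap_sides s \<subseteq> closure (gap_sides s \<inter> W (fst s))"
proof -
  show "compact (gap_sides s)" unfolding gap_sides_def by (intro compact_UN) (auto simp: side_def)
  show "gap_sides s \<subseteq> ngon n" unfolding gap_sides_def using side_subset[OF n] by auto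
  show "connected (gap_sides s \<inter> W (fst s))"
    unfolding gap_sides_W[OF s] unfolding gap_sides_def by (rule connected_sides_minus_ends[OF n gap_facts(5)[OF s]])
  have ne: "corner n (gap_start s) \<noteq> corner n (gap_start s + dart.gap s)"
    using corner_neq[OF n, of "gap_start s" "gap_start s + dart.gap s"] gap_facts(4,5)[OF s] by simp
  have conn: "connected (gap_sides s)" unfolding gap_sides_def by (rule connected_sides[OF n])
  have "corner n (gap_start s) \<in> gap_sides s" "corner n (gap_start s + dart.gap s) \<in> gap_sides s"
    using gap_sides_ends[OF s] by blast+
  then have "gap_sides s \<noteq> {x}" for x using ne by auto
  then show cl: "gap_sides s \<subseteq> closure (gap_sides s \<inter> W (fst s))"
    unfolding gap_sides_W[OF s] by (intro connected_dense_minus_finite[OF conn]) auto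
  have "gap_sides s \<noteq> {}" using gap_sides_ends[OF s] by auto
  then show "gap_sides s \<inter> W (fst s) \<noteq> {}" using cl by auto
qed

end

section \<open>Removing the boundary bridges\<close>

lemma segment_params:
  assumes "3 \<le> n"
  shows "s < t \<Longrightarrow> t < 1 \<Longrightarrow> side_point n j t \<in> open_segment (side_point n j s) (corner n (Suc j))"
    "0 < s \<Longrightarrow> s < t \<Longrightarrow> side_point n j s \<in> open_segment (corner n j) (side_point n j t)"
proof -
  define c d where "c = corner n j" and "d = corner n (Suc j) - corner n j"
  have sp: "side_point n j x = c + x *\<^sub>R d" for x
    by (simp add: side_point_def linepath_def c_def d_def algebra_simps)
  have cd: "d \<noteq> 0" "corner n (Suc j) = c + d" using corner_neq_Suc[OF assms, of j] by (auto simp: c_def d_def)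
  show "side_point n j t \<in> open_segment (side_point n j s) (corner n (Suc j))" if st: "s < t" "t < 1"
  proof -
    define u where "u = (t - s) / (1 - s)"
    have u: "0 < u" "u < 1" "s + u * (1 - s) = t" using st by (simp_all add: u_def)
    have "(1 - u) *\<^sub>R (c + s *\<^sub>R d) + u *\<^sub>R (c + d) = c + (s + u * (1 - s)) *\<^sub>R d" by (simp add: algebra_simps)
    then have "side_point n j t = (1 - u) *\<^sub>R side_point n j s + u *\<^sub>R corner n (Suc j)" unfolding sp cd(2) u(3) by simp
    moreover have "side_point n j s \<noteq> corner n (Suc j)"
      using st side_point_inj[OF assms, of j s 1] side_point_ends(2)[OF assms, of j] by simp
    ultimately show ?thesis unfolding in_segment using u by blast
  qed
  show "side_point n j s \<in> open_segment (corner n j) (side_point n j t)" if st: "0 < s" "s < t"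
  proof -
    have u: "0 < s / t" "s / t < 1" "s / t * t = s" using st by simp_all
    have "(1 - s / t) *\<^sub>R c + (s / t) *\<^sub>R (c + t *\<^sub>R d) = c + (s / t * t) *\<^sub>R d" by (simp add: algebra_simps)
    then have "side_point n j s = (1 - s / t) *\<^sub>R corner n j + (s / t) *\<^sub>R side_point n j t"
      unfolding sp u(3) by (simp add: c_def)
    moreover have "corner n j \<noteq> side_point n j t"
      using st side_point_inj[OF assms, of j 0 t] side_point_ends(1)[OF assms, of j] by simp
    ultimately show ?thesis unfolding in_segment using u by blast
  qed
qed

text \<open>The other sets are closed, finite in number and disjoint from \<open>K i\<close>, so
  they can be taken away from a neighbourhood of a point of \<open>K i\<close>.\<close>

lemma interior_Union_disjoint:
  fixes K :: "'i \<Rightarrow> 'a::topological_space set"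
  assumes "finite J" "\<And>j. j \<in> J \<Longrightarrow> closed (K j)" "i \<in> J" "\<And>j. j \<in> J \<Longrightarrow> j \<noteq> i \<Longrightarrow> K i \<inter> K j = {}"
  shows "interior (\<Union>j\<in>J. K j) \<inter> K i = interior (K i)"
proof
  have "interior (K i) \<subseteq> interior (\<Union>j\<in>J. K j)" by (rule interior_mono) (use assms(3) in blast)
  then show "interior (K i) \<subseteq> interior (\<Union>j\<in>J. K j) \<inter> K i" using interior_subset[of "K i"] by auto
  let ?O = "interior (\<Union>j\<in>J. K j) - (\<Union>j\<in>J - {i}. K j)"
  have "closed (\<Union>j\<in>J - {i}. K j)" using assms(1,2) by (intro closed_UN) auto
  then have "open ?O" by (rule open_Diff[OF open_interior])
  moreover have "?O \<subseteq> K i" using interior_subset[of "\<Union>j\<in>J. K j"] by auto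
  ultimately have "?O \<subseteq> interior (K i)" by (intro interior_maximal)
  moreover have "interior (\<Union>j\<in>J. K j) \<inter> K i \<subseteq> ?O" using assms(4) by blast
  ultimately show "interior (\<Union>j\<in>J. K j) \<inter> K i \<subseteq> interior (K i)" by (rule order_trans[rotated])
qed

locale angulated_arcs = angulated +
  assumes component_arc: "\<forall>C \<in> connected_components_of P. \<exists>\<tau> \<in> T. \<tau> \<subseteq> C"
begin

sublocale full: region n P M T F \<phi> "\<lambda>_. ngon n"
  using compact_ngon[OF n] side_subset[OF n] by unfold_locales auto

lemma full_X: "full.X = P"
proof -
  have "full.Y = topspace P" unfolding full.Y_def covered ..
  then show ?thesis unfolding full.X_def by simp
qed

text \<open>Without arcs nothing on the polygon is identified with other points, so its image is
  open. Being also closed and connected, it would be a whole component of \<open>P\<close>, and each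
  component contains an arc by assumption.\<close>

lemma polygon_has_arc: assumes f: "f \<in> F" shows "\<exists>k. (f, k) \<in> A"
proof (rule ccontr)
  assume no: "\<nexists>k. (f, k) \<in> A"
  then have W: "W f = ngon n" by (auto simp: W_def)
  let ?C = "\<phi> f ` ngon n"
  have op: "openin P ?C" using full.open_polygon[OF f] by (simp add: W full_X)
  have cl: "closedin P ?C" by (rule closedin_image[OF f compact_ngon[OF n] order_refl])
  have "connectedin (top_of_set (ngon n)) (ngon n)"
    using convex_connected[OF convex_ngon[OF n]] by (simp add: connectedin_subtopology)
  then have "connectedin P ?C" by (rule connectedin_continuous_map_image[OF cont[OF f]])
  moreover have ne: "\<phi> f 0 \<in> ?C" using interior_ngon_nonempty[OF n] interior_subset by blast
  then have "P \<noteq> trivial_topology" using openin_subset[OF op] by auto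
  ultimately obtain C where C: "C \<in> connected_components_of P" "?C \<subseteq> C"
    using exists_connected_component_of_superset by blast
  have "C \<subseteq> ?C \<or> disjnt C ?C"
    by (rule connectedin_clopen_cases[OF connectedin_connected_components_of[OF C(1)] cl op])
  then have "C \<subseteq> ?C" using C(2) ne by (auto simp: disjnt_iff)
  moreover obtain \<tau> where t: "\<tau> \<in> T" "\<tau> \<subseteq> C" using component_arc C(1) by blast
  moreover have "\<tau> \<noteq> {}"
  proof -
    have "\<tau> \<in> E ` A" using t(1) by (simp only: E_image)
    then obtain g k where "\<tau> = E (g, k)" by (elim imageE) (metis surj_pair)
    then show ?thesis using corner_in_side(1)[OF n, of k] by (auto simp: E_def)
  qed
  ultimately obtain y where "y \<in> ngon n" "\<phi> f y \<in> \<tau>" by blast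
  then show False using W_not_arc[OF f, of y] W t(1) by auto
qed

lemma gap_sides_cover: assumes f: "f \<in> F"
  shows "ngon n \<inter> W f - interior (ngon n) = (\<Union>s\<in>{s \<in> dart.S. fst s = f}. gap_sides s \<inter> W f)"
proof (intro equalityI subsetI)
  fix y assume y: "y \<in> ngon n \<inter> W f - interior (ngon n)"
  then have "y \<in> (\<Union>j<n. side n j)" unfolding ngon_frontier[OF n, symmetric] by blast
  then obtain j where j: "j < n" "y \<in> side n j" by blast
  have na: "(f, j) \<notin> A" using W_side[of y f j] y j by auto
  obtain k where k: "(f, k) \<in> A" using polygon_has_arc[OF f] by blast
  then have kn: "k < n" "(f, k) \<in> D" using dart.inD by (auto simp: A_iff)
  define t where "t = j + n - k"
  have "(nxt ^^ t) (f, k) = (f, j)" unfolding nxt_pow[OF kn(2)] using kn j by (simp add: t_def)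
  then obtain s i where s: "s \<in> dart.S" "i < dart.gap s" "(f, j) = (fst s, (gap_start s + i) mod n)"
    using dart.gap_cover[OF k, of t] na gap_facts(1) by auto
  then have "y \<in> side n (gap_start s + i)" using j(2) side_mod(1)[of n "gap_start s + i"] n by simp
  then have "y \<in> gap_sides s" unfolding gap_sides_def by (rule UN_I[rotated]) (use s(2) in simp)
  show "y \<in> (\<Union>s\<in>{s \<in> dart.S. fst s = f}. gap_sides s \<inter> W f)"
    by (rule UN_I[of s]) (use s y \<open>y \<in> gap_sides s\<close> in auto)
next
  fix y assume "y \<in> (\<Union>s\<in>{s \<in> dart.S. fst s = f}. gap_sides s \<inter> W f)"
  then obtain s where s: "s \<in> dart.S" "y \<in> gap_sides s" "y \<in> W f" by blast
  then obtain j where j: "y \<in> side n j" unfolding gap_sides_def by blast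
  then have "y \<in> side n (j mod n)" using side_mod(1)[of n j] n by simp
  then have "y \<notin> interior (ngon n)" using open_side_boundary[OF n, of "j mod n"] n by auto
  then show "y \<in> ngon n \<inter> W f - interior (ngon n)" using s W_ngon by blast
qed

lemma run_F: "s \<in> dart.S \<Longrightarrow> fst s \<in> F"
  using run_facts(1)[of "fst s" "snd s"] by simp

lemma gap_end_points: assumes s: "s \<in> dart.S"
  shows "\<phi> (fst s) (corner n (gap_start s)) = pt (nxt (dart.run_end s))"
    "\<phi> (fst s) (corner n (gap_start s + dart.gap s)) = pt (fst s, (gap_start s + dart.gap s) mod n)"
  using gap_facts(1)[OF s, of 0] n by (simp_all add: pt_def corner_mod)

lemma gap_start_marked: assumes s: "s \<in> dart.S" shows "pt (nxt (dart.run_end s)) \<in> pt ` dart.S"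
proof -
  have "nxt (dart.run_end s) \<in> {d \<in> D. d \<in> A \<or> prv d \<in> A}"
    using dart.nxt_run_end[OF s] by (auto simp: dart.G_starts)
  then show ?thesis unfolding dart.pt_S by (rule imageI)
qed

text \<open>With nothing removed the construction describes the pieces of \<open>P\<close> itself,
  and these decide which polygons are degenerate.\<close>

sublocale full: region_pieces n P M T F \<phi> "\<lambda>_. ngon n" gap_sides
proof
  fix s assume s: "s \<in> dart.S"
  note g = gap_sides_props[OF s]
  show "compact (gap_sides s)" "gap_sides s \<subseteq> ngon n" "connected (gap_sides s \<inter> W (fst s))"
    "gap_sides s \<inter> W (fst s) \<noteq> {}" "gap_sides s \<subseteq> closure (gap_sides s \<inter> W (fst s))" using g by auto
  show "\<phi> (fst s) ` (gap_sides s - W (fst s)) \<subseteq> pt ` dart.S"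
    unfolding gap_sides_ends[OF s] using gap_end_points[OF s] gap_start_marked[OF s] gap_facts(3)[OF s] by auto
qed (rule gap_sides_cover gap_sides_disjoint; assumption)+

abbreviation "degenerate \<equiv> degenerate_polygons n P M T F \<phi>"

lemma pieces_P: "boundary_pieces P M T = full.piece ` dart.S"
  using full.boundary_pieces_X[of M] marked_points by (simp add: full_X)

lemma piece_in_polygon: assumes s: "s \<in> dart.S" and f: "f \<in> F" shows "full.piece s \<subseteq> \<phi> f ` ngon n \<longleftrightarrow> fst s = f"
proof
  assume sub: "full.piece s \<subseteq> \<phi> f ` ngon n"
  obtain x where x: "x \<in> full.piece s - pt ` dart.S" using full.piece_minus_ne[OF s] by auto
  then obtain y where y: "y \<in> W (fst s)" "x = \<phi> (fst s) y" unfolding full.piece_minus[OF s] by auto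
  obtain z where "z \<in> ngon n" "x = \<phi> f z" using x sub by auto
  then show "fst s = f" using W_inj[OF run_F[OF s] f y(1), of z] y(2) by simp
next
  assume "fst s = f"
  then show "full.piece s \<subseteq> \<phi> f ` ngon n" unfolding full.piece_def using gap_sides_props(2)[OF s] by auto
qed

lemma degenerate_iff: assumes f: "f \<in> F"
  shows "f \<in> degenerate \<longleftrightarrow> 1 < card {s \<in> dart.S. fst s = f}"
proof -
  have "{\<bb> \<in> boundary_pieces P M T. \<bb> \<subseteq> \<phi> f ` ngon n} = full.piece ` {s \<in> dart.S. fst s = f}"
    unfolding pieces_P using piece_in_polygon[OF _ f] by blast
  moreover have "inj_on full.piece {s \<in> dart.S. fst s = f}"
    by (rule inj_on_subset[OF full.inj_piece]) auto
  ultimately show ?thesis using f by (simp add: degenerate_polygons_def card_image)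
qed

lemma single_run: assumes "s \<in> dart.S" "t \<in> dart.S" "fst s = fst t" "fst s \<notin> degenerate" shows "s = t"
proof (rule ccontr)
  assume "s \<noteq> t"
  then have "card {s, t} = 2" by simp
  moreover have "card {s, t} \<le> card {u \<in> dart.S. fst u = fst s}"
    using assms dart.finite_S by (intro card_mono) auto
  ultimately show False using degenerate_iff[OF run_F[OF assms(1)]] assms(4) by simp
qed

text \<open>The gap after the only run of a polygon leads back to its beginning. So run and gap
  together have a positive multiple of \<open>n\<close> sides; both being shorter than
  \<open>n\<close>, it is \<open>n\<close> itself.\<close>

lemma single_gap: assumes s: "s \<in> dart.S" "fst s \<notin> degenerate"
  shows "(fst s, (gap_start s + dart.gap s) mod n) = s" "dart.N.len s + dart.gap s = n"
proof -
  show eq: "(fst s, (gap_start s + dart.gap s) mod n) = s"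
    using single_run[OF gap_facts(3)[OF s(1)] s(1)] s(2) by simp
  have k: "snd s < n" using run_facts(2)[of "fst s" "snd s"] s by simp
  have len: "dart.N.len s < n" using run_facts(4)[of "fst s" "snd s"] s by simp
  have m: "(snd s + (dart.N.len s + dart.gap s)) mod n = snd s"
    using arg_cong[OF eq, of snd] by (simp add: gap_start_def add.assoc)
  have pos: "0 < dart.N.len s + dart.gap s" using gap_facts(4)[OF s(1)] by simp
  have "n dvd dart.N.len s + dart.gap s"
    using m mod_eq_dvd_iff_nat[of "snd s" "snd s + (dart.N.len s + dart.gap s)" n] k by simp
  then obtain c where c: "dart.N.len s + dart.gap s = n * c" by (rule dvdE)
  moreover have "dart.N.len s + dart.gap s < n * 2" using len gap_facts(5)[OF s(1)] by simp
  ultimately have "c < 2" "0 < c" using pos n by auto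
  then show "dart.N.len s + dart.gap s = n" using c by (simp add: less_2_cases_iff)
qed

text \<open>The counterpart of \<open>gap_cover\<close>, starting from a side that is not an
  arc.\<close>

lemma run_cover:
  assumes d: "d \<in> D" "d \<notin> A"
  shows "(nxt ^^ t) d \<notin> A \<or> (\<exists>s \<in> dart.S. \<exists>i < dart.N.len s. (nxt ^^ t) d = (nxt ^^ i) s)"
proof (induction t)
  case (Suc t)
  have D: "(nxt ^^ t) d \<in> D" by (rule dart.funpow_nxt_in[OF d(1)])
  show ?case
  proof (cases "(nxt ^^ Suc t) d \<in> A")
    case True
    from Suc show ?thesis
    proof
      assume "(nxt ^^ t) d \<notin> A"
      then have s: "(nxt ^^ Suc t) d \<in> dart.S" unfolding dart.S_def using True prv_nxt[OF D] by simp
      moreover have "(nxt ^^ Suc t) d = (nxt ^^ 0) ((nxt ^^ Suc t) d)" by simp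
      ultimately show ?thesis using dart.N_len_pos[OF s] by blast
    next
      assume "\<exists>s \<in> dart.S. \<exists>i < dart.N.len s. (nxt ^^ t) d = (nxt ^^ i) s"
      then obtain s i where s: "s \<in> dart.S" "i < dart.N.len s" "(nxt ^^ t) d = (nxt ^^ i) s" by auto
      then have e: "(nxt ^^ Suc t) d = (nxt ^^ Suc i) s" by simp
      have "Suc i \<noteq> dart.N.len s"
      proof
        assume "Suc i = dart.N.len s"
        then have "(nxt ^^ Suc t) d = dart.N.stop s" unfolding e dart.N.stop_def by simp
        then show False using True dart.N.len_stop(1)[OF dart.S_starts(1)[OF s(1)]] by simp
      qed
      then have "Suc i < dart.N.len s" using s(2) by simp
      then show ?thesis using s(1) e by blast
    qed
  qed simp
qed (use d in simp)

lemma arc_in_run: assumes a: "(f, j) \<in> A" and d: "(f, k) \<in> D" "(f, k) \<notin> A"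
  obtains s i where "s \<in> dart.S" "fst s = f" "i < dart.N.len s" "j = (snd s + i) mod n"
proof -
  have jk: "j < n" "k < n" using a d by (auto simp: A_iff D_iff)
  have "(nxt ^^ (j + n - k)) (f, k) = (f, j)" unfolding nxt_pow[OF d(1)] using jk by simp
  then obtain s i where s: "s \<in> dart.S" "i < dart.N.len s" "(f, j) = (nxt ^^ i) s"
    using run_cover[OF d, of "j + n - k"] a by auto
  moreover have "(nxt ^^ i) s = (fst s, (snd s + i) mod n)"
    using nxt_pow[of "fst s" "snd s" i] dart.S_starts(5)[OF s(1)] by simp
  ultimately show thesis using that[of s i] by simp
qed

end

locale bridge_cut = angulated_arcs +
  fixes lo hi :: "'b \<Rightarrow> nat \<Rightarrow> real" and N :: "'b \<Rightarrow> nat \<Rightarrow> complex set"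
  assumes cuts: "bridge_cuts n P M T F \<phi> lo hi N"
begin

definition before :: "'b \<times> nat \<Rightarrow> complex" where "before s = cut_before n hi (fst s) (snd s)"
definition after :: "'b \<times> nat \<Rightarrow> complex" where "after s = cut_after n lo (fst s) (snd s) (dart.N.len s)"

definition cut :: "'b \<times> nat \<Rightarrow> complex set" where
  "cut s = convex hull (corner n ` {snd s..snd s + dart.N.len s} \<union> {before s, after s})"

definition new_side :: "'b \<times> nat \<Rightarrow> complex set" where
  "new_side s = cut_boundary n (snd s) (dart.N.len s) (before s) (after s)"

lemma cut_eq: "cut s = cut_polygon n lo hi (fst s) (snd s) (dart.N.len s)"
  unfolding cut_def cut_polygon_def before_def after_def ..

section \<open>The piece cut off around one run of a degenerate polygon\<close>

context
  fixes s assumes s: "s \<in> dart.S" and deg: "fst s \<in> degenerate"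
begin

lemma params: assumes "k < n" shows "0 < lo (fst s) k" "lo (fst s) k < hi (fst s) k" "hi (fst s) k < 1"
  using cuts deg assms by (auto simp: bridge_cuts_def)

lemma added_points: "finite (N (fst s) (snd s))" "N (fst s) (snd s) \<subseteq> open_segment (before s) (after s)"
  "dart.N.len s + 2 + (card (N (fst s) (snd s)) + 1) = n"
proof -
  have "arc_run n T \<phi> (fst s) (snd s) (dart.N.len s)" using arc_run_iff[OF run_F[OF s]] s by simp
  then show "finite (N (fst s) (snd s))" "N (fst s) (snd s) \<subseteq> open_segment (before s) (after s)"
    "dart.N.len s + 2 + (card (N (fst s) (snd s)) + 1) = n"
    using cuts deg unfolding bridge_cuts_def before_def after_def by blast+
qed

lemma run_pos: "0 < dart.N.len s" using run_facts(3)[of "fst s" "snd s"] s by simp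

lemma run_bound: "dart.N.len s + 2 \<le> n" using added_points(3) by simp

lemma snd_bound: "snd s < n" using run_facts(2)[of "fst s" "snd s"] s by simp

lemma before_open_side: "before s \<in> open_side n (snd s + n - 1)"
  and after_open_side: "after s \<in> open_side n (snd s + dart.N.len s)"
proof -
  have "0 < hi (fst s) k" "lo (fst s) k < 1" if "k < n" for k using params[OF that] by linarith+
  then show "before s \<in> open_side n (snd s + n - 1)" "after s \<in> open_side n (snd s + dart.N.len s)"
    using params n unfolding before_def after_def cut_before_def cut_after_def side_point_image(2)[OF n, symmetric]
    by (intro imageI; simp)+
qed

lemmas cut_facts = cut_subset[OF n run_pos run_bound before_open_side after_open_side, folded cut_def]
  compact_cut[OF n run_pos run_bound before_open_side after_open_side, folded cut_def]
  cut_side_subset[OF n run_pos run_bound before_open_side after_open_side, folded cut_def]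
  cut_side_apart[OF n run_pos run_bound before_open_side after_open_side, folded cut_def]
  cut_frontier[OF n run_pos run_bound before_open_side after_open_side, folded cut_def new_side_def]
  cut_boundary_open[OF n run_pos run_bound before_open_side after_open_side, folded new_side_def]
  connected_cut_boundary[OF n run_pos run_bound before_open_side after_open_side, folded new_side_def]

lemma new_side_eq: "new_side s = closed_segment (corner n (snd s + dart.N.len s)) (after s) \<union>
    closed_segment (after s) (before s) \<union> closed_segment (before s) (corner n (snd s))"
  unfolding new_side_def cut_boundary_def[OF n run_pos run_bound before_open_side after_open_side] ..

lemma new_side_cut: "new_side s \<subseteq> cut s" using cut_facts(5) by blast

text \<open>Away from its two end points the new boundary runs inside the sides that flank the run
  and through the interior of the polygon, so it meets no arc.\<close>

lemma new_side_W: "new_side s \<inter> W (fst s) = new_side s - {corner n (snd s), corner n (snd s + dart.N.len s)}"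
proof -
  have a: "open_side n (snd s + n - 1) \<subseteq> W (fst s)"
    using open_side_W[of "(snd s + n - 1) mod n" "fst s"] run_facts(8)[of "fst s" "snd s"] s n by (simp add: side_mod)
  have b: "open_side n (snd s + dart.N.len s) \<subseteq> W (fst s)"
    using open_side_W[of "(snd s + dart.N.len s) mod n" "fst s"] run_facts(7)[of "fst s" "snd s"] s n by (simp add: side_mod)
  have "corner n (snd s) \<notin> W (fst s)"
    using corner_W[OF run_F[OF s], of "snd s"] s snd_bound by (simp add: dart.S_def)
  then show ?thesis using a b interior_W[of "fst s"] cut_facts(6) gap_ends(1)[OF s] unfolding gap_start_def by blast
qed

lemma new_side_ends: "new_side s - W (fst s) = {corner n (snd s), corner n (snd s + dart.N.len s)}"
proof -
  have "{corner n (snd s), corner n (snd s + dart.N.len s)} \<subseteq> new_side s" unfolding new_side_eq by simp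
  then show ?thesis using new_side_W by blast
qed

lemma new_side_closure: "new_side s \<subseteq> closure (new_side s \<inter> W (fst s))"
  unfolding new_side_W
proof (rule connected_dense_minus_finite)
  show "connected (new_side s)" unfolding new_side_eq
    by (intro connected_Un connected_segment) auto
  have "corner n (snd s) \<in> new_side s" "corner n (snd s + dart.N.len s) \<in> new_side s" unfolding new_side_eq by simp_all
  then show "new_side s \<noteq> {x}" for x
    using cut_ends_neq[OF n run_pos run_bound before_open_side after_open_side] by auto
qed simp

lemma new_side_ne: "new_side s \<inter> W (fst s) \<noteq> {}"
proof
  assume "new_side s \<inter> W (fst s) = {}"
  then have "new_side s = {}" using new_side_closure by simp
  then show False unfolding new_side_eq by simp
qed

end

text \<open>At least one side separates two runs. If it is a single one, one chord ends on it at
  \<open>lo\<close> and the other at \<open>hi\<close>, and \<open>lo < hi\<close> keeps the pieces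
  apart.\<close>

lemma cuts_disjoint_less:
  assumes s: "s \<in> dart.S" "t \<in> dart.S" "fst s = fst t" "fst s \<in> degenerate" "snd s < snd t"
  shows "cut s \<inter> cut t = {}"
proof -
  obtain f k k' where st: "s = (f, k)" "t = (f, k')" using s(3) by (metis prod.collapse)
  let ?r = "dart.N.len s" and ?r' = "dart.N.len t"
  note rs = run_facts[OF s(1)[unfolded st(1)], folded st(1)]
  note rt = run_facts[OF s(2)[unfolded st(2)], folded st(2)]
  have deg': "fst t \<in> degenerate" using s(3,4) by simp
  have kk: "k < k'" using s(5) st by simp
  have m: "(k' + n - 1) mod n = k' - 1"
  proof -
    have "k' + n - 1 = (k' - 1) + n" using kk by simp
    then have "(k' + n - 1) mod n = (k' - 1 + n) mod n" by (rule arg_cong)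
    also have "\<dots> = k' - 1" unfolding mod_add_self2 by (rule mod_less) (use rt(2) in linarith)
    finally show ?thesis .
  qed
  \<comment> \<open>Otherwise the side before \<open>k'\<close> would belong to the run at
    \<open>k\<close> and thus be an arc.\<close>
  have k1: "k + ?r < k'"
  proof (rule ccontr)
    assume "\<not> k + ?r < k'"
    then have "k' - 1 - k < ?r" "k + (k' - 1 - k) = k' - 1" using kk rs(3) by linarith+
    then have "(f, k' - 1) \<in> A" using rs(6)[of "k' - 1 - k"] rt(2) by simp
    then show False using rt(8) m by simp
  qed
  have k2: "k' + ?r' < k + n"
  proof (rule ccontr)
    assume "\<not> k' + ?r' < k + n"
    then have "k + n - 1 - k' < ?r'" "k' + (k + n - 1 - k') = k + n - 1" using rt(2,3) by linarith+
    then have "(f, (k + n - 1) mod n) \<in> A" using rt(6)[of "k + n - 1 - k'"] by simp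
    then show False using rs(8) by simp
  qed
  have "cut s \<inter> convex hull (corner n ` {k'..k' + ?r'} \<union> {before t, after t}) = {}"
    unfolding cut_def st(1) snd_conv unfolding st(1)[symmetric]
  proof (rule cut_disjoint[OF n])
    show "0 < ?r" "?r + 2 \<le> n" by (rule run_pos[OF s(1,4)] run_bound[OF s(1,4)])+
    show "before s \<in> open_side n (k + n - 1)" "after s \<in> open_side n (k + ?r)"
      using before_open_side[OF s(1,4)] after_open_side[OF s(1,4)] by (simp_all add: st(1))
    show "before t \<in> open_side n (k' - 1)"
      using before_open_side[OF s(2) deg'] side_mod(2)[of n "k' + n - 1"] m n by (simp add: st(2))
    show "after t \<in> open_side n (k' + ?r')" using after_open_side[OF s(2) deg'] by (simp add: st(2))
    have bt: "before t = side_point n (k' - 1) (hi f (k' - 1))"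
      using side_mod(3)[of n "k' + n - 1"] m n by (simp add: before_def cut_before_def st(2))
    have at: "after s = side_point n (k + ?r) (lo f ((k + ?r) mod n))" by (simp add: after_def cut_after_def st(1))
    show "before t \<in> open_segment (after s) (corner n k')" if e: "k' = Suc (k + ?r)"
    proof -
      have "k' - 1 < n" "k + ?r = k' - 1" using rt(2) e by linarith+
      then show ?thesis
        using segment_params(1)[OF n, of "lo f (k' - 1)" "hi f (k' - 1)" "k' - 1"] params[OF s(1,4), of "k' - 1"] kk
        unfolding bt at by (simp add: st(1))
    qed
    show "after t \<in> open_segment (corner n (k' + ?r')) (before s)" if e: "Suc (k' + ?r') = k + n"
    proof -
      have e': "k' + ?r' = k + n - 1" using e by simp
      have "(k + n - 1) mod n < n" using n by simp
      from params[OF s(1,4) this] show ?thesis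
        using segment_params(2)[OF n, of "lo f ((k + n - 1) mod n)" "hi f ((k + n - 1) mod n)" "k + n - 1"] e'
        unfolding after_def cut_after_def before_def cut_before_def by (simp add: st)
    qed
  qed (rule k1 k2)+
  moreover have "snd t = k'" by (simp add: st(2))
  ultimately show ?thesis by (simp only: cut_def[of t])
qed

lemma cuts_disjoint:
  assumes s: "s \<in> dart.S" "t \<in> dart.S" "fst s = fst t" "fst s \<in> degenerate" "s \<noteq> t"
  shows "cut s \<inter> cut t = {}"
proof -
  have "snd s \<noteq> snd t" using s(3,5) prod_eq_iff by blast
  then consider "snd s < snd t" | "snd t < snd s" by linarith
  then show ?thesis
  proof cases
    case 1 then show ?thesis by (rule cuts_disjoint_less[OF s(1-4)])
  next
    case 2
    have "cut t \<inter> cut s = {}" by (rule cuts_disjoint_less[OF s(2,1) s(3)[symmetric] _ 2]) (use s in simp)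
    then show ?thesis by blast
  qed
qed

section \<open>The region left after all cuts\<close>

definition K :: "'b \<Rightarrow> complex set" where
  "K f = (if f \<in> degenerate then \<Union>s\<in>{s \<in> dart.S. fst s = f}. cut s else ngon n)"

definition B :: "'b \<times> nat \<Rightarrow> complex set" where
  "B s = (if fst s \<in> degenerate then new_side s else gap_sides s)"

lemma runs_finite: "finite {s \<in> dart.S. fst s = f}" using dart.finite_S by simp

lemma run_of_degenerate: assumes "f \<in> degenerate" obtains s where "s \<in> dart.S" "fst s = f"
proof -
  have "f \<in> F" using assms by (simp add: degenerate_polygons_def)
  then have "1 < card {s \<in> dart.S. fst s = f}" using degenerate_iff[of f] assms by simp
  then have "{s \<in> dart.S. fst s = f} \<noteq> {}" by (metis card.empty not_less_zero)
  then show thesis using that by blast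
qed

lemma arc_in_cut: assumes f: "f \<in> degenerate" and a: "(f, j) \<in> A"
  obtains s where "s \<in> dart.S" "fst s = f" "side n j \<subseteq> cut s" "side n j \<inter> closure (ngon n - cut s) = {}"
proof -
  obtain t where t: "t \<in> dart.S" "fst t = f" by (rule run_of_degenerate[OF f])
  have "(f, (gap_start t + 0) mod n) \<in> D - A" using gap_facts(2)[OF t(1), of 0] gap_facts(4)[OF t(1)] t by simp
  then have d: "(f, (gap_start t + 0) mod n) \<in> D" "(f, (gap_start t + 0) mod n) \<notin> A" by (simp_all only: Diff_iff not_False_eq_True)
  obtain s i where s: "s \<in> dart.S" "fst s = f" "i < dart.N.len s" "j = (snd s + i) mod n"
    using arc_in_run[OF a d] by blast
  have j: "side n j = side n (snd s + i)" using s(4) n by (simp add: side_mod)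
  have deg: "fst s \<in> degenerate" using s(2) f by simp
  show thesis
    by (rule that[OF s(1,2)]) (use cut_facts(3,4)[OF s(1) deg, of "snd s + i"] s(3) j in simp_all)
qed

sublocale cut: region n P M T F \<phi> K
proof
  fix f assume f: "f \<in> F"
  show "compact (K f)"
    using compact_UN[OF runs_finite[of f], of cut] cut_facts(2) compact_ngon[OF n] by (auto simp: K_def)
  show "K f \<subseteq> ngon n" using cut_facts(1) by (auto simp: K_def)
next
  fix f k assume a: "(f, k) \<in> A"
  show "side n k \<subseteq> K f"
  proof (cases "f \<in> degenerate")
    case True
    then show ?thesis by (rule arc_in_cut[OF _ a]) (auto simp: K_def True)
  qed (simp add: K_def side_subset[OF n])
  show "side n k \<inter> closure (ngon n - K f) = {}"
  proof (cases "f \<in> degenerate")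
    case True
    obtain s where s: "s \<in> dart.S" "fst s = f" "side n k \<inter> closure (ngon n - cut s) = {}"
      by (rule arc_in_cut[OF True a])
    have "ngon n - K f \<subseteq> ngon n - cut s" using s(1,2) True by (auto simp: K_def)
    then show ?thesis using closure_mono s(3) by blast
  qed (simp add: K_def)
qed

text \<open>The cuts in one polygon are closed and disjoint, so the interior of their union can be
  found one cut at a time. The frontier of a cut consists of arcs, which \<open>W f\<close>
  excludes, and of the new boundary.\<close>

lemma K_frontier: assumes f: "f \<in> F"
  shows "K f \<inter> W f - interior (K f) = (\<Union>s\<in>{s \<in> dart.S. fst s = f}. B s \<inter> W f)"
proof (cases "f \<in> degenerate")
  case False
  then show ?thesis using gap_sides_cover[OF f] by (auto simp: K_def B_def)
next
  case True
  let ?J = "{s \<in> dart.S. fst s = f}"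
  have Kf: "K f = (\<Union>s\<in>?J. cut s)" using True by (simp add: K_def)
  have int: "interior (K f) \<inter> cut s = interior (cut s)" if "s \<in> ?J" for s
    unfolding Kf
  proof (rule interior_Union_disjoint[OF runs_finite _ that])
    show "closed (cut t)" if "t \<in> ?J" for t
      using that True by (intro compact_imp_closed cut_facts(2)) auto
    show "cut s \<inter> cut t = {}" if "t \<in> ?J" "t \<noteq> s" for t
      using that \<open>s \<in> ?J\<close> True by (intro cuts_disjoint) auto
  qed
  have front: "(cut s - interior (cut s)) \<inter> W f = B s \<inter> W f" if s: "s \<in> ?J" for s
  proof -
    have s': "s \<in> dart.S" "fst s = f" "fst s \<in> degenerate" using s True by auto
    have "side n j \<inter> W f = {}" if j: "j \<in> {snd s..<snd s + dart.N.len s}" for j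
    proof -
      have "(f, j mod n) \<in> A" using run_facts(6)[of "fst s" "snd s" "j - snd s"] s' j by auto
      then show ?thesis using W_side[of _ f "j mod n"] side_mod(1)[of n j] n by auto
    qed
    then have "(\<Union>j\<in>{snd s..<snd s + dart.N.len s}. side n j) \<inter> W f = {}" by blast
    then show ?thesis unfolding cut_facts(5)[OF s'(1,3)] B_def if_P[OF s'(3)] by blast
  qed
  show ?thesis
  proof (intro equalityI subsetI)
    fix y assume y: "y \<in> K f \<inter> W f - interior (K f)"
    then obtain s where s: "s \<in> ?J" "y \<in> cut s" unfolding Kf by blast
    then have "y \<in> B s \<inter> W f" using int[OF s(1)] front[OF s(1)] y by blast
    then show "y \<in> (\<Union>s\<in>?J. B s \<inter> W f)" by (rule UN_I[OF s(1)])
  next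
    fix y assume "y \<in> (\<Union>s\<in>?J. B s \<inter> W f)"
    then obtain s where s: "s \<in> ?J" "y \<in> B s \<inter> W f" by (rule UN_E)
    have y: "y \<in> (cut s - interior (cut s)) \<inter> W f" unfolding front[OF s(1)] by (rule s(2))
    then show "y \<in> K f \<inter> W f - interior (K f)" using int[OF s(1)] s(1) unfolding Kf by blast
  qed
qed

lemma B_end_points: assumes s: "s \<in> dart.S"
  shows "\<phi> (fst s) ` (B s - W (fst s)) = {pt s, pt (nxt (dart.run_end s))}"
proof -
  have s': "pt s = \<phi> (fst s) (corner n (snd s))" by (simp add: pt_def split_beta)
  show ?thesis
  proof (cases "fst s \<in> degenerate")
    case True
    then show ?thesis using new_side_ends[OF s True] gap_end_points(1)[OF s] by (auto simp: B_def s' gap_start_def)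
  next
    case False
    then show ?thesis
      using gap_sides_ends[OF s] gap_end_points[OF s] single_gap(1)[OF s False] by (auto simp: B_def)
  qed
qed

sublocale cut: region_components n P M T F \<phi> K B
proof
  fix s assume s: "s \<in> dart.S"
  note g = gap_sides_props[OF s]
  note f = run_F[OF s]
  show "compact (B s)"
  proof (cases "fst s \<in> degenerate")
    case True
    then show ?thesis by (simp add: B_def new_side_eq[OF s] compact_Un)
  qed (simp add: B_def g)
  show "B s \<subseteq> K (fst s)" using new_side_cut[OF s] g(2) s by (auto simp: B_def K_def)
  show "connected (B s \<inter> W (fst s))"
    using new_side_W[OF s] cut_facts(7)[OF s] g(3) by (simp add: B_def)
  show "B s \<inter> W (fst s) \<noteq> {}" using new_side_ne[OF s] g(4) by (simp add: B_def)
  show "B s \<subseteq> closure (B s \<inter> W (fst s))" using new_side_closure[OF s] g(5) by (simp add: B_def)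
  show "\<phi> (fst s) ` (B s - W (fst s)) = {pt s, pt (nxt (dart.run_end s))}" by (rule B_end_points[OF s])
  then show "\<phi> (fst s) ` (B s - W (fst s)) \<subseteq> pt ` dart.S" using gap_start_marked[OF s] s by auto
next
  fix s t assume st: "s \<in> dart.S" "t \<in> dart.S" "fst s = fst t" "s \<noteq> t"
  show "B s \<inter> B t \<inter> W (fst s) = {}"
  proof (cases "fst s \<in> degenerate")
    case True
    then have "B s \<subseteq> cut s" "B t \<subseteq> cut t" using new_side_cut st by (auto simp: B_def)
    then show ?thesis using cuts_disjoint[OF st(1-3) True st(4)] by blast
  next
    case False
    then show ?thesis using gap_sides_disjoint[OF st] st(3) by (simp add: B_def)
  qed
qed (rule K_frontier; assumption)

lemma K_cuts: assumes "f \<in> degenerate" shows "K f = \<Union>{cut_polygon n lo hi f k r | k r. arc_run n T \<phi> f k r}"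
proof -
  have f: "f \<in> F" using assms by (simp add: degenerate_polygons_def)
  have "{cut_polygon n lo hi f k r | k r. arc_run n T \<phi> f k r} = cut ` {s \<in> dart.S. fst s = f}"
    unfolding arc_run_iff[OF f] by (force simp: cut_eq)
  then show ?thesis using assms by (simp add: K_def)
qed

lemma cut_surface_eq: "cut_surface n P M T F \<phi> lo hi = cut.X"
proof -
  have "(\<Union>f\<in>degenerate. bridge n T \<phi> lo hi f) = (\<Union>f\<in>degenerate. \<phi> f ` (ngon n - K f))"
    unfolding bridge_def using K_cuts by simp
  also have "\<dots> = (\<Union>f\<in>F. \<phi> f ` (ngon n - K f))"
  proof -
    have "degenerate \<subseteq> F" by (auto simp: degenerate_polygons_def)
    moreover have "\<phi> f ` (ngon n - K f) = {}" if "f \<in> F - degenerate" for f using that by (simp add: K_def)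
    ultimately show ?thesis by blast
  qed
  finally show ?thesis unfolding cut_surface_def cut.X_def cut.Y_complement by simp
qed

definition new_points :: "'b \<times> nat \<Rightarrow> complex set" where
  "new_points s = N (fst s) (snd s) \<union> {before s, after s}"

lemma cut_marked_eq: "cut_marked n P M T F \<phi> lo hi N =
    (M \<inter> cut.Y) \<union> (\<Union>s\<in>{s \<in> dart.S. fst s \<in> degenerate}. \<phi> (fst s) ` new_points s)"
proof -
  have 1: "\<phi> f ` \<Union>{N f k \<union> {cut_before n hi f k, cut_after n lo f k r} | k r. arc_run n T \<phi> f k r} =
      (\<Union>s\<in>{s \<in> dart.S. fst s = f}. \<phi> (fst s) ` new_points s)" if f: "f \<in> degenerate" for f
  proof -
    have f: "f \<in> F" using f by (simp add: degenerate_polygons_def)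
    have "{N f k \<union> {cut_before n hi f k, cut_after n lo f k r} | k r. arc_run n T \<phi> f k r} =
        new_points ` {s \<in> dart.S. fst s = f}"
      unfolding arc_run_iff[OF f] by (force simp: new_points_def before_def after_def)
    then show ?thesis by auto
  qed
  have "(\<Union>f\<in>degenerate. \<phi> f ` \<Union>{N f k \<union> {cut_before n hi f k, cut_after n lo f k r} | k r. arc_run n T \<phi> f k r}) =
      (\<Union>f\<in>degenerate. \<Union>s\<in>{s \<in> dart.S. fst s = f}. \<phi> (fst s) ` new_points s)"
    by (rule SUP_cong[OF refl 1])
  also have "\<dots> = (\<Union>s\<in>{s \<in> dart.S. fst s \<in> degenerate}. \<phi> (fst s) ` new_points s)" by blast
  finally show ?thesis unfolding cut_marked_def cut_surface_eq cut.topspace_X by simp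
qed

abbreviation "M' \<equiv> cut_marked n P M T F \<phi> lo hi N"

text \<open>The \<open>n\<close> sides of the polygon cut off are the arcs of the run, two short
  curves and the parts of the chord, one more than there are points in \<open>N\<close>. The new
  points are those of \<open>N\<close> and the two ends of the chord, which gives the count.\<close>

lemma new_points: assumes s: "s \<in> dart.S" "fst s \<in> degenerate"
  shows "new_points s \<subseteq> B s \<inter> W (fst s)" "card (new_points s) + dart.N.len s + 1 = n"
proof -
  note f = before_open_side[OF s] after_open_side[OF s]
  note c = cut_sides[OF n run_pos[OF s] run_bound[OF s] f]
  have int: "open_segment (before s) (after s) \<subseteq> interior (ngon n)" using chord_interior[OF n c] by blast
  have na: "x \<in> W (fst s)" if "x \<in> {before s, after s}" for x
  proof -
    have "(fst s, (snd s + n - 1) mod n) \<in> D - A" "(fst s, (snd s + dart.N.len s) mod n) \<in> D - A"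
      using run_facts(7,8)[of "fst s" "snd s"] s by simp_all
    then have "open_side n ((snd s + n - 1) mod n) \<subseteq> W (fst s)" "open_side n ((snd s + dart.N.len s) mod n) \<subseteq> W (fst s)"
      by (intro open_side_W; simp add: D_iff)+
    then show ?thesis using c(4,5) that by blast
  qed
  have "N (fst s) (snd s) \<subseteq> W (fst s)"
    using added_points(2)[OF s] int interior_W by (rule order_trans[OF order_trans])
  moreover have "N (fst s) (snd s) \<subseteq> closed_segment (after s) (before s)"
    using added_points(2)[OF s] open_closed_segment closed_segment_commute by blast
  ultimately show "new_points s \<subseteq> B s \<inter> W (fst s)"
    using na unfolding new_points_def B_def if_P[OF s(2)] new_side_eq[OF s] by auto
  have "before s \<notin> N (fst s) (snd s)" "after s \<notin> N (fst s) (snd s)"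
    using added_points(2)[OF s] by (auto simp: open_segment_def)
  moreover have "before s \<noteq> after s" using open_side_disjoint[OF n c(1-3)] c(4,5) open_side_subset[OF n] by fastforce
  ultimately have "card (new_points s) = card (N (fst s) (snd s)) + 2"
    using added_points(1)[OF s] by (simp add: new_points_def)
  then show "card (new_points s) + dart.N.len s + 1 = n" using added_points(3)[OF s] by simp
qed

lemma marked_cut: "marked_on_arcs M' T = pt ` dart.S"
proof -
  have "\<phi> (fst s) ` new_points s \<inter> \<Union>T = {}" if s: "s \<in> dart.S" "fst s \<in> degenerate" for s
    using new_points(1)[OF s] W_not_arc[OF run_F[OF s(1)]] by blast
  moreover have "M \<inter> cut.Y \<inter> \<Union>T = M \<inter> \<Union>T" using cut.boundary_arc(1) by blast
  ultimately have "M' \<inter> \<Union>T = M \<inter> \<Union>T" unfolding cut_marked_eq by blast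
  then show ?thesis using marked_points by (simp add: marked_on_arcs_def)
qed

lemma W_marked: assumes f: "f \<in> F" and y: "y \<in> W f" "\<phi> f y \<in> M'"
  obtains k where "y = corner n k" | s where "s \<in> dart.S" "fst s \<in> degenerate" "fst s = f" "y \<in> new_points s"
proof -
  from y(2) consider "\<phi> f y \<in> M"
    | s z where "s \<in> dart.S" "fst s \<in> degenerate" "z \<in> new_points s" "\<phi> f y = \<phi> (fst s) z"
    unfolding cut_marked_eq by blast
  then show thesis
  proof cases
    case 1
    then show ?thesis using M_corner[OF f subsetD[OF W_ngon y(1)]] that(1) by blast
  next
    case (2 s z)
    have "z \<in> ngon n" using new_points(1)[OF 2(1,2)] 2(3) W_ngon by blast
    then have "f = fst s \<and> y = z" by (rule W_inj[OF f run_F[OF 2(1)] y(1) _ 2(4)])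
    then show ?thesis using that(2) 2 by simp
  qed
qed

lemma inj_W: assumes f: "f \<in> F" shows "inj_on (\<phi> f) (W f)"
  by (rule inj_onI) (use W_inj[OF f f] W_ngon in blast)

text \<open>In an \<open>n\<close>-gon with one run of \<open>l\<close> arcs the other
  \<open>n - l\<close> sides form the piece and have \<open>n - l - 1\<close> inner corners; with
  \<open>n = m + 2\<close> this is the identity between weight and length of the thread. For a
  polygon cut off along a chord these corners are the new points, otherwise they are old corners
  inside the gap.\<close>

lemma weight_piece: assumes s: "s \<in> dart.S" shows "weight M' T (cut.piece s) + dart.N.len s + 1 = n"
proof -
  define f where "f = fst s"
  have f: "f \<in> F" unfolding f_def by (rule run_F[OF s])
  have "M' \<inter> cut.piece s - pt ` dart.S = M' \<inter> (cut.piece s - pt ` dart.S)" by blast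
  then have w: "M' \<inter> cut.piece s - pt ` dart.S = M' \<inter> \<phi> f ` (B s \<inter> W f)"
    unfolding cut.piece_minus[OF s] f_def .
  have card: "weight M' T (cut.piece s) = card Z" if "Z \<subseteq> W f" "M' \<inter> \<phi> f ` (B s \<inter> W f) = \<phi> f ` Z" for Z
    unfolding weight_def marked_cut w that(2) by (rule card_image[OF inj_on_subset[OF inj_W[OF f] that(1)]])
  show ?thesis
  proof (cases "f \<in> degenerate")
    case True
    note deg = True[unfolded f_def]
    have "M' \<inter> \<phi> f ` (B s \<inter> W f) = \<phi> f ` new_points s"
    proof (intro equalityI subsetI)
      fix x assume "x \<in> M' \<inter> \<phi> f ` (B s \<inter> W f)"
      then obtain y where y: "y \<in> B s" "y \<in> W f" "x = \<phi> f y" "\<phi> f y \<in> M'" by blast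
      from f y(2,4) show "x \<in> \<phi> f ` new_points s"
      proof (cases rule: W_marked)
        case (1 k)
        \<comment> \<open>An old corner cannot lie on the inner part of the new boundary, which is
          contained in the interior of the polygon and two open sides.\<close>
        have "corner n k \<notin> interior (ngon n)"
          using corner_in_side(1)[OF n, of k] side_mod(1)[of n k] open_side_boundary[OF n, of "k mod n"] n by auto
        moreover have "y \<in> new_side s \<inter> W (fst s)" using y(1,2) deg by (simp add: B_def f_def)
        then have "y \<in> new_side s - {corner n (snd s), corner n (snd s + dart.N.len s)}"
          unfolding new_side_W[OF s deg] .
        ultimately show ?thesis
          using cut_facts(6)[OF s deg] corner_notin_open_side[OF n] 1 by blast
      next
        case (2 t)
        have "y \<in> B t" using new_points(1)[OF 2(1,2)] 2(4) by blast
        then have "t = s" using cut.B_disjoint[OF 2(1) s] 2(3) y(1,2) by (auto simp: f_def)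
        then show ?thesis using 2(4) y(3) by simp
      qed
    next
      fix x assume "x \<in> \<phi> f ` new_points s"
      then show "x \<in> M' \<inter> \<phi> f ` (B s \<inter> W f)"
        using new_points(1)[OF s deg] s deg unfolding cut_marked_eq f_def by blast
    qed
    then have "weight M' T (cut.piece s) = card (new_points s)"
      using new_points(1)[OF s deg] by (intro card) (auto simp: f_def)
    then show ?thesis using new_points(2)[OF s deg] by simp
  next
    case False
    note deg = False[unfolded f_def]
    let ?c = "\<lambda>i. corner n (gap_start s + i)"
    have gn: "dart.gap s < n" by (rule gap_facts(5)[OF s])
    have B: "B s \<inter> W f = gap_sides s - {?c 0, ?c (dart.gap s)}"
      using gap_sides_W[OF s] deg by (simp add: B_def f_def)
    have cB: "?c ` {0<..<dart.gap s} \<subseteq> B s \<inter> W f"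
    proof
      fix y assume "y \<in> ?c ` {0<..<dart.gap s}"
      then obtain i where i: "0 < i" "i < dart.gap s" "y = ?c i" by auto
      have "y \<in> gap_sides s" unfolding gap_sides_def
        by (rule UN_I[of "gap_start s + i"]) (use i corner_in_side(1)[OF n] in auto)
      moreover have "y \<noteq> ?c 0" "y \<noteq> ?c (dart.gap s)"
        using corner_neq[OF n, of "gap_start s" "gap_start s + i"] corner_neq[OF n, of "gap_start s + i" "gap_start s + dart.gap s"] i gn
        by auto
      ultimately show "y \<in> B s \<inter> W f" unfolding B by blast
    qed
    have "M' \<inter> \<phi> f ` (B s \<inter> W f) = \<phi> f ` ?c ` {0<..<dart.gap s}"
    proof (intro equalityI subsetI)
      fix x assume "x \<in> M' \<inter> \<phi> f ` (B s \<inter> W f)"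
      then obtain y where y: "y \<in> B s \<inter> W f" "x = \<phi> f y" "\<phi> f y \<in> M'" by blast
      have yW: "y \<in> W f" using y(1) by simp
      from f yW y(3) show "x \<in> \<phi> f ` ?c ` {0<..<dart.gap s}"
      proof (cases rule: W_marked)
        case (1 k)
        have "y \<in> gap_sides s" "y \<noteq> ?c (dart.gap s)" "y \<noteq> ?c 0" using y(1) unfolding B by auto
        then obtain i where "i < dart.gap s" "y = ?c i \<or> y \<in> open_side n (gap_start s + i)"
          using gap_sides_position[OF s] by blast
        then have "i < dart.gap s" "y = ?c i" using corner_notin_open_side[OF n] 1 by blast+
        moreover have "0 < i" using \<open>y \<noteq> ?c 0\<close> \<open>y = ?c i\<close> by (cases i) auto
        ultimately show ?thesis using y(2) by auto
      next
        case (2 t)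
        then show ?thesis using False by simp
      qed
    next
      fix x assume "x \<in> \<phi> f ` ?c ` {0<..<dart.gap s}"
      then obtain y where y: "y \<in> ?c ` {0<..<dart.gap s}" "x = \<phi> f y" by blast
      have yB: "y \<in> B s \<inter> W f" using cB y(1) by blast
      have "x \<in> M" using y corner_M'[OF f] by auto
      moreover have "x \<in> cut.Y" unfolding cut.Y_def y(2)
        using f False yB W_ngon by (intro UN_I[OF f] imageI) (auto simp: K_def)
      ultimately show "x \<in> M' \<inter> \<phi> f ` (B s \<inter> W f)" using yB y(2) unfolding cut_marked_eq by blast
    qed
    then have "weight M' T (cut.piece s) = card (?c ` {0<..<dart.gap s})" using cB by (intro card) auto
    also have "\<dots> = dart.gap s - 1"
    proof -
      have "inj_on ?c {0<..<dart.gap s}"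
      proof (rule linorder_inj_onI)
        show "?c i \<noteq> ?c j" if "i < j" "i \<in> {0<..<dart.gap s}" "j \<in> {0<..<dart.gap s}" for i j
          using corner_neq[OF n, of "gap_start s + i" "gap_start s + j"] that gn by auto
      qed auto
      then show ?thesis by (simp add: card_image)
    qed
    finally show ?thesis using single_gap(2)[OF s deg] gap_facts(4)[OF s] by simp
  qed
qed

lemma sum_boundary_components_cut:
  fixes h :: "nat \<Rightarrow> int \<Rightarrow> nat"
  assumes m: "n = m + 2"
  shows "(\<Sum>C\<in>boundary_components (cut_surface n P M T F \<phi> lo hi). h (card (marked_on_arcs M' T \<inter> C))
      (\<Sum>\<bb>\<in>{\<bb> \<in> boundary_pieces (cut_surface n P M T F \<phi> lo hi) M' T. \<bb> \<subseteq> C}. int m - int (weight M' T \<bb>))) =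
    (\<Sum>C\<in>dart.run_orbit ` dart.S. h (card C) (\<Sum>s\<in>C. int (dart.N.len s - 1)))"
proof -
  have g: "(\<Sum>s\<in>C. int m - int (weight M' T (cut.piece s))) = (\<Sum>s\<in>C. int (dart.N.len s - 1))"
    if C: "C \<in> dart.run_orbit ` dart.S" for C
  proof (rule sum.cong[OF refl])
    fix s assume "s \<in> C"
    then have s: "s \<in> dart.S" using cut.orbit_S[OF C] by blast
    have "0 < dart.N.len s" using run_facts(3)[of "fst s" "snd s"] s by simp
    then show "int m - int (weight M' T (cut.piece s)) = int (dart.N.len s - 1)"
      using weight_piece[OF s] m by linarith
  qed
  show ?thesis unfolding cut_surface_eq cut.sum_boundary_components[OF marked_cut]
    by (rule sum.cong[OF refl]) (simp only: g)
qed

end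

section \<open>Relation cycles and the value of the AG-invariant\<close>

context dart_quiver
begin

definition face_cycle :: "'a \<Rightarrow> 'a list" where "face_cycle d = map (\<lambda>i. (nxt ^^ i) d) [0..<n]"

text \<open>The internal polygons as sets of darts, since in this abstract setting a polygon is an
  orbit of \<open>nxt\<close>.\<close>

definition arc_faces :: "'a set set" where
  "arc_faces = {range (\<lambda>i. (nxt ^^ i) d) | d. d \<in> D \<and> (\<forall>i. (nxt ^^ i) d \<in> A)}"

lemma length_face_cycle: "length (face_cycle d) = n" by (simp add: face_cycle_def)

lemma nth_face_cycle: "i < n \<Longrightarrow> face_cycle d ! i = (nxt ^^ i) d" by (simp add: face_cycle_def)

lemma inj_face_cycle: "inj face_cycle"
  by (rule injI) (use nth_face_cycle[of 0] n_ge in \<open>metis funpow_0 less_le_trans pos2\<close>)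

lemma nxt_mod: assumes "d \<in> D" shows "(nxt ^^ (i mod n)) d = (nxt ^^ i) d"
  using funpow_mod_eq[OF nxt_period[OF assms]] .

lemma rotate_face_cycle: assumes "d \<in> D" shows "rotate i (face_cycle d) = face_cycle ((nxt ^^ i) d)"
proof (rule nth_equalityI)
  fix j assume "j < length (rotate i (face_cycle d))"
  then have j: "j < n" by (simp add: length_face_cycle)
  have "rotate i (face_cycle d) ! j = (nxt ^^ ((i + j) mod n)) d"
    using j n_ge by (simp add: nth_rotate length_face_cycle nth_face_cycle)
  also have "\<dots> = (nxt ^^ j) ((nxt ^^ i) d)" unfolding nxt_mod[OF assms] add.commute[of i j] funpow_add by simp
  finally show "rotate i (face_cycle d) ! j = face_cycle ((nxt ^^ i) d) ! j" using j by (simp add: nth_face_cycle)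
qed (simp add: length_face_cycle)

text \<open>A cycle of relations stays on one polygon. A return after fewer than \<open>n\<close>
  steps contradicts \<open>nxt_no_period\<close>, and more than \<open>n\<close> steps would repeat
  an arrow.\<close>

lemma relation_cycle_iff: "relation_cycle Q I c \<longleftrightarrow> (\<exists>d \<in> D. (\<forall>i. (nxt ^^ i) d \<in> A) \<and> c = face_cycle d)"
proof
  assume c: "relation_cycle Q I c"
  then have ne: "c \<noteq> []" and arcs: "set c \<subseteq> arcs Q" and dist: "distinct c"
    and succ: "\<And>i. Suc i < length c \<Longrightarrow> c ! Suc i = nxt (c ! i)" and close: "hd c = nxt (last c)"
    by (auto simp: relation_cycle_def forbidden_path_def in_relation_iff successively_conv_nth)
  define d where "d = hd c"
  have nth: "c ! i = (nxt ^^ i) d" if "i < length c" for i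
    using that ne succ by (induction i) (auto simp: d_def hd_conv_nth)
  have inA: "(nxt ^^ i) d \<in> A" if "i < length c" for i
    using nth[OF that] nth_mem[OF that] arcs by (auto simp: Q_simps)
  have d: "d \<in> D" using inA[of 0] ne inD by simp
  have period: "(nxt ^^ length c) d = d"
  proof -
    obtain l where l: "length c = Suc l" using ne by (cases c) auto
    then have "last c = (nxt ^^ l) d" using nth[of l] ne by (simp add: last_conv_nth)
    then show ?thesis using close l by (simp add: d_def)
  qed
  have "\<not> length c < n" using nxt_no_period[OF d, of "length c"] period ne by auto
  moreover have "\<not> n < length c"
  proof
    assume "n < length c"
    then have "c ! n = c ! 0" using nth[of n] nth[of 0] nxt_period[OF d] ne by simp
    then show False using dist \<open>n < length c\<close> n_ge ne nth_eq_iff_index_eq[of c n 0] by simp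
  qed
  ultimately have len: "length c = n" by simp
  have "c = face_cycle d" by (rule nth_equalityI) (use len nth in \<open>simp_all add: length_face_cycle nth_face_cycle\<close>)
  moreover have "(nxt ^^ i) d \<in> A" for i using inA[of "i mod n"] nxt_mod[OF d, of i] len n_ge by simp
  ultimately show "\<exists>d \<in> D. (\<forall>i. (nxt ^^ i) d \<in> A) \<and> c = face_cycle d" using d by blast
next
  assume "\<exists>d \<in> D. (\<forall>i. (nxt ^^ i) d \<in> A) \<and> c = face_cycle d"
  then obtain d where d: "d \<in> D" "\<And>i. (nxt ^^ i) d \<in> A" "c = face_cycle d" by blast
  have len: "length c = n" "c \<noteq> []" using d(3) n_ge by (auto simp: length_face_cycle face_cycle_def)
  have arcs: "(nxt ^^ i) d \<in> arcs Q" for i using d(2)[of i] d(2)[of "Suc i"] by (simp add: Q_simps)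
  have "(nxt ^^ i) d \<noteq> (nxt ^^ j) d" if "i < j" "j < n" for i j
  proof
    assume e: "(nxt ^^ i) d = (nxt ^^ j) d"
    have "(nxt ^^ (j - i)) ((nxt ^^ i) d) = (nxt ^^ (j - i + i)) d" by (simp only: funpow_add o_apply)
    also have "\<dots> = (nxt ^^ i) d" using that e by simp
    finally have "(nxt ^^ (j - i)) ((nxt ^^ i) d) = (nxt ^^ i) d" .
    then show False using nxt_no_period[OF funpow_nxt_in[OF d(1)], of "j - i" i] that by simp
  qed
  then have "distinct c" unfolding d(3) face_cycle_def distinct_map
    by (auto intro!: linorder_inj_onI)
  moreover have "successively (in_relation Q I) c"
    unfolding successively_conv_nth in_relation_iff using arcs arcs[of "Suc _"] by (auto simp: d(3) length_face_cycle nth_face_cycle)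
  moreover have "in_relation Q I (last c) (hd c)"
  proof -
    obtain l where l: "n = Suc l" using n_ge by (cases n) auto
    then have "last c = (nxt ^^ l) d" using len d(3) nth_face_cycle[of l d] by (simp add: last_conv_nth)
    moreover have "hd c = d" using len d(3) n_ge by (simp add: hd_conv_nth nth_face_cycle)
    moreover have "nxt ((nxt ^^ l) d) = d" using nxt_period[OF d(1)] l by simp
    ultimately show ?thesis unfolding in_relation_iff using arcs[of l] arcs[of 0] by simp
  qed
  moreover have "set c \<subseteq> arcs Q" using arcs by (auto simp: d(3) face_cycle_def)
  ultimately show "relation_cycle Q I c" using len(2) by (simp add: relation_cycle_def forbidden_path_def)
qed

text \<open>Rotating a cycle means starting at another side of the polygon, so the rotation classes
  correspond to the polygons themselves.\<close>

lemma card_relation_cycles: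
  "card {range (\<lambda>i. rotate i c) | c. relation_cycle Q I c \<and> length c = q} = (if q = n then card arc_faces else 0)"
proof (cases "q = n")
  case True
  have eq: "range (\<lambda>i. rotate i (face_cycle d)) = face_cycle ` range (\<lambda>i. (nxt ^^ i) d)" if "d \<in> D" for d
    unfolding image_image rotate_face_cycle[OF that] ..
  have "{range (\<lambda>i. rotate i c) | c. relation_cycle Q I c \<and> length c = q} =
      {range (\<lambda>i. rotate i (face_cycle d)) | d. d \<in> D \<and> (\<forall>i. (nxt ^^ i) d \<in> A)}"
    unfolding relation_cycle_iff using True length_face_cycle by blast
  also have "\<dots> = {face_cycle ` range (\<lambda>i. (nxt ^^ i) d) | d. d \<in> D \<and> (\<forall>i. (nxt ^^ i) d \<in> A)}"
  proof (intro Collect_cong ex_cong1)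
    fix x d
    show "(x = range (\<lambda>i. rotate i (face_cycle d)) \<and> d \<in> D \<and> (\<forall>i. (nxt ^^ i) d \<in> A)) =
      (x = face_cycle ` range (\<lambda>i. (nxt ^^ i) d) \<and> d \<in> D \<and> (\<forall>i. (nxt ^^ i) d \<in> A))"
      by (cases "d \<in> D") (simp_all only: eq simp_thms)
  qed
  also have "\<dots> = (`) face_cycle ` arc_faces" unfolding arc_faces_def by blast
  finally show ?thesis
    using True card_image[OF inj_on_subset[OF inj_on_image[of face_cycle UNIV]], of arc_faces] inj_face_cycle
    by (simp add: card_image inj_on_image inj_on_def inj_image_eq_iff)
next
  case False
  then have empty: "{range (\<lambda>i. rotate i c) | c. relation_cycle Q I c \<and> length c = q} = {}"
    unfolding relation_cycle_iff using length_face_cycle by blast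
  show ?thesis unfolding empty using False by simp
qed

lemma AG_invariant_eq:
  "AG_invariant Q I \<sigma> \<epsilon> = (\<lambda>x. card arc_faces * pair_indicator 0 (int n) x +
     (\<Sum>C\<in>run_orbit ` S. pair_indicator (card C) (\<Sum>s\<in>C. int (N.len s - 1)) x))"
proof
  fix x :: "nat \<times> nat"
  obtain a b where x: "x = (a, b)" by (cases x)
  have fin: "finite (run_orbit ` S)" using finite_S by simp
  have "(\<Sum>C\<in>run_orbit ` S. pair_indicator (card C) (\<Sum>s\<in>C. int (N.len s - 1)) (a, b)) =
      (\<Sum>C\<in>run_orbit ` S. if card C = a \<and> (\<Sum>s\<in>C. N.len s - 1) = b then 1 else 0)"
  proof (rule sum.cong[OF refl])
    fix C
    have "(\<Sum>s\<in>C. int (N.len s - 1)) = int (\<Sum>s\<in>C. N.len s - 1)" by simp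
    then show "pair_indicator (card C) (\<Sum>s\<in>C. int (N.len s - 1)) (a, b) =
        (if card C = a \<and> (\<Sum>s\<in>C. N.len s - 1) = b then 1 else 0)"
      by (simp only: pair_indicator_def prod.case of_nat_eq_iff eq_commute[of a] eq_commute[of b])
  qed
  also have "\<dots> = card {C \<in> run_orbit ` S. card C = a \<and> (\<Sum>s\<in>C. N.len s - 1) = b}"
    by (subst sum.inter_filter[OF fin, symmetric]) simp
  finally have 1: "(\<Sum>C\<in>run_orbit ` S. pair_indicator (card C) (\<Sum>s\<in>C. int (N.len s - 1)) (a, b)) =
      card {C \<in> run_orbit ` S. card C = a \<and> (\<Sum>s\<in>C. N.len s - 1) = b}" .
  have 2: "(if a = 0 then if b = n then card arc_faces else 0 else 0) = card arc_faces * pair_indicator 0 (int n) (a, b)"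
    by (simp add: pair_indicator_def)
  show "AG_invariant Q I \<sigma> \<epsilon> x = card arc_faces * pair_indicator 0 (int n) x +
     (\<Sum>C\<in>run_orbit ` S. pair_indicator (card C) (\<Sum>s\<in>C. int (N.len s - 1)) x)"
    unfolding AG_invariant_def x prod.case card_AG_threads card_relation_cycles 1 2 by (rule add.commute)
qed

end

context angulated
begin

lemma quiver_eq: "angulation_quiver n T F \<phi> =
    \<lparr>verts = E ` A, arcs = {d \<in> A. nxt d \<in> A}, tail = E, head = (\<lambda>d. E (nxt d))\<rparr>"
proof -
  have n0: "0 < n" using n by simp
  have nE: "\<phi> f ` side n (Suc k) = E (nxt (f, k))" for f k using side_mod(1)[OF n0, of "Suc k"] by (simp add: E_def nxt_def)
  have "{(f, k). f \<in> F \<and> k < n \<and> \<phi> f ` side n k \<in> T \<and> \<phi> f ` side n (Suc k) \<in> T} = {d \<in> A. nxt d \<in> A}"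
    unfolding nE using n0 by (auto simp: A_iff nxt_def E_def)
  moreover have "(\<lambda>(f, k). \<phi> f ` side n k) = E" by (auto simp: E_def)
  moreover have "(\<lambda>(f, k). \<phi> f ` side n (Suc k)) = (\<lambda>d. E (nxt d))" unfolding nE by auto
  ultimately show ?thesis unfolding angulation_quiver_def by (simp only: E_image)
qed

lemma path_in_angulation_ideal:
  assumes p: "(u, p) \<in> qpaths (angulation_quiver n T F \<phi>)"
  shows "(path_elem (u, p) :: _ \<Rightarrow> 'k::field) \<in> angulation_ideal n T F \<phi> \<longleftrightarrow>
    \<not> successively (\<lambda>\<alpha> \<beta>. \<beta> \<noteq> nxt \<alpha>) p"
proof -
  let ?Q = "angulation_quiver n T F \<phi>"
  have wf: "wf_digraph ?Q" unfolding quiver_eq by unfold_locales auto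
  have r: "head ?Q \<alpha> = tail ?Q \<beta>" if "\<beta> = nxt \<alpha>" for \<alpha> \<beta> unfolding quiver_eq by (simp add: that)
  have "(\<exists>f k. \<alpha> = (f, k) \<and> \<beta> = (f, Suc k mod n)) \<longleftrightarrow> \<beta> = nxt \<alpha>" for \<alpha> \<beta> :: "'f \<times> nat"
    by (cases \<alpha>) (simp add: nxt_def)
  then have I: "angulation_ideal n T F \<phi> = (generated_ideal ?Q
    {path_elem (tail ?Q \<alpha>, [\<alpha>, \<beta>]) | \<alpha> \<beta>. \<alpha> \<in> arcs ?Q \<and> \<beta> \<in> arcs ?Q \<and> \<beta> = nxt \<alpha>} :: (_ \<Rightarrow> 'k) set)"
    unfolding angulation_ideal_def Let_def by simp
  show ?thesis unfolding I by (rule wf_digraph.path_elem_in_generated_ideal[OF wf r p])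
qed

lemma card_internal_polygons:
  "card {range (\<lambda>i. (nxt ^^ i) d) | d. d \<in> D \<and> (\<forall>i. (nxt ^^ i) d \<in> A)} = card (internal_polygons n T F \<phi>)"
proof -
  have n0: "0 < n" using n by simp
  have orbit: "range (\<lambda>i. (nxt ^^ i) (f, k)) = {f} \<times> {..<n}" if k: "k < n" for f k
  proof (intro equalityI subsetI)
    fix d assume "d \<in> range (\<lambda>i. (nxt ^^ i) (f, k))"
    then show "d \<in> {f} \<times> {..<n}" using n0 by (auto simp: funpow_nxt[OF k])
  next
    fix d assume "d \<in> {f} \<times> {..<n}"
    then obtain j where j: "d = (f, j)" "j < n" by auto
    then have "d = (nxt ^^ (j + n - k)) (f, k)" using k by (simp add: funpow_nxt[OF k])
    then show "d \<in> range (\<lambda>i. (nxt ^^ i) (f, k))" by (rule range_eqI)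
  qed
  have "(\<forall>i. (nxt ^^ i) (f, k) \<in> A) \<longleftrightarrow> f \<in> internal_polygons n T F \<phi>" if "k < n" for f k
  proof -
    have "(\<forall>i. (nxt ^^ i) (f, k) \<in> A) \<longleftrightarrow> range (\<lambda>i. (nxt ^^ i) (f, k)) \<subseteq> A" by blast
    also have "\<dots> \<longleftrightarrow> f \<in> internal_polygons n T F \<phi>"
      unfolding orbit[OF that] using n0 by (auto simp: A_iff internal_polygons_def)
    finally show ?thesis .
  qed
  then have "{range (\<lambda>i. (nxt ^^ i) d) | d. d \<in> D \<and> (\<forall>i. (nxt ^^ i) d \<in> A)} =
      {{f} \<times> {..<n} | f k. f \<in> F \<and> k < n \<and> f \<in> internal_polygons n T F \<phi>}"
    using orbit by (auto simp: D_def) (metis lessThan_iff orbit)+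
  also have "\<dots> = (\<lambda>f. {f} \<times> {..<n}) ` internal_polygons n T F \<phi>"
    using n0 by (auto simp: internal_polygons_def)
  finally have "card {range (\<lambda>i. (nxt ^^ i) d) | d. d \<in> D \<and> (\<forall>i. (nxt ^^ i) d \<in> A)} =
      card ((\<lambda>f. {f} \<times> {..<n}) ` internal_polygons n T F \<phi>)" by simp
  also have "\<dots> = card (internal_polygons n T F \<phi>)"
    by (rule card_image) (use n0 in \<open>auto simp: inj_on_def times_eq_iff\<close>)
  finally show ?thesis .
qed

end

theorem theorem30:
  fixes m :: nat
    and P P' :: "'p topology"
    and M M' :: "'p set"
    and T :: "'p set set"
    and F :: "'f set"
    and \<phi> :: "'f \<Rightarrow> complex \<Rightarrow> 'p"
    and lo hi :: "'f \<Rightarrow> nat \<Rightarrow> real"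
    and N :: "'f \<Rightarrow> nat \<Rightarrow> complex set"
    and Q :: "('p set, 'f \<times> nat) pre_digraph"
    and I :: "(('p set, 'f \<times> nat) qpath \<Rightarrow> 'k::alg_closed_field) set"
    and \<sigma> \<epsilon> :: "'f \<times> nat \<Rightarrow> int"
  assumes "1 \<le> m"
    and "angulation (m + 2) P M T F \<phi>"
    and "\<forall>C \<in> connected_components_of P. \<exists>\<tau> \<in> T. \<tau> \<subseteq> C"
    and "bridge_cuts (m + 2) P M T F \<phi> lo hi N"
    and "P' = cut_surface (m + 2) P M T F \<phi> lo hi"
    and "M' = cut_marked (m + 2) P M T F \<phi> lo hi N"
    and "Q = angulation_quiver (m + 2) T F \<phi>"
    and "I = angulation_ideal (m + 2) T F \<phi>"
    and "sign_functions Q I \<sigma> \<epsilon>"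
  shows "AG_invariant Q I \<sigma> \<epsilon> = (\<lambda>x.
    card (internal_polygons (m + 2) T F \<phi>) * pair_indicator 0 (int (m + 2)) x +
    (\<Sum>C \<in> boundary_components P'.
       pair_indicator
         (card (marked_on_arcs M' T \<inter> C))
         (\<Sum>\<bb> \<in> {\<bb> \<in> boundary_pieces P' M' T. \<bb> \<subseteq> C}. int m - int (weight M' T \<bb>))
         x))"
proof -
  interpret bridge_cut "m + 2" P M T F \<phi> lo hi N
    by unfold_locales (use assms(1-4) in auto)
  interpret dq: dart_quiver D A nxt prv opp E pt "m + 2" Q I \<sigma> \<epsilon>
  proof
    show "Q = \<lparr>verts = E ` A, arcs = {d \<in> A. nxt d \<in> A}, tail = E, head = (\<lambda>d. E (nxt d))\<rparr>"
      unfolding assms(7) by (rule quiver_eq)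
    show "path_elem (u, p) \<in> I \<longleftrightarrow> \<not> successively (\<lambda>\<alpha> \<beta>. \<beta> \<noteq> nxt \<alpha>) p" if "(u, p) \<in> qpaths Q" for u p
      unfolding assms(8) by (rule path_in_angulation_ideal) (use that assms(7) in simp)
  qed (rule assms(9))
  show ?thesis
    unfolding dq.AG_invariant_eq dq.arc_faces_def card_internal_polygons assms(5,6)
    by (rule ext) (simp only: sum_boundary_components_cut[OF refl, of "\<lambda>a b. pair_indicator a b _"])
qed

end
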